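(* Let $\mathfrak g$ be a finitary Lie algebra which is a union of reductive subalgebras. Then there exist Lie algebras $\mathfrak g_i$, each isomorphic to $\mathfrak{gl}_\infty$, $\mathfrak{so}_\infty$, $\mathfrak{sp}_\infty$, or a finite-dimensional simple Lie algebra, and an injective homomorphism $\varphi:\mathfrak g\hookrightarrow\mathfrak z(\mathfrak g)\oplus\bigoplus_i\mathfrak g_i$ such that $\varphi|_{\mathfrak z(\mathfrak g)}=\mathrm{id}$ (onto the summand $\mathfrak z(\mathfrak g)$) and $\varphi([\mathfrak g,\mathfrak g])=\bigoplus_i[\mathfrak g_i,\mathfrak g_i]$.
   Context: Ground field $\mathbb C$; Lie algebras of at most countable dimension. A locally finite Lie algebra is finitary if it admits a faithful representation with a basis in which all its elements act by finite matrices (equivalently, it embeds into $\mathfrak{gl}_\infty$). A Lie algebra is a union of reductive subalgebras if it is the union of nested finite-dimensional reductive Lie subalgebras $\mathfrak g_1\subset\mathfrak g_2\subset\cdots$. $\mathfrak z(\mathfrak g)$ is the center. $\mathfrak{gl}_\infty=\mathfrak{gl}(V,V_* )$ is the Lie algebra of $V\otimes V_*$ for countable-dimensional $V,V_*$ with nondegenerate pairing, product $(v\otimes w)(v'\otimes w')=\langle v',w\rangle v\otimes w'$; $\mathfrak{so}_\infty=\bigwedge^2V\subset\mathfrak{gl}(V,V)$ for a nondegenerate symmetric form on $V$; $\mathfrak{sp}_\infty=\mathrm{Sym}^2V\subset\mathfrak{gl}(V,V)$ for a nondegenerate antisymmetric form. *)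

theory Defs
  imports Complex_Main "HOL-Library.Countable_Set"
begin

record 'a lie_alg =
  lcarrier :: "'a set"
  lzero :: 'a
  ladd :: "'a \<Rightarrow> 'a \<Rightarrow> 'a"
  lsmult :: "complex \<Rightarrow> 'a \<Rightarrow> 'a"
  lbr :: "'a \<Rightarrow> 'a \<Rightarrow> 'a"

definition lie_algebra :: "('a, 'b) lie_alg_scheme \<Rightarrow> bool" where
  "lie_algebra L \<longleftrightarrow>
     (let C = lcarrier L; z = lzero L; ad = ladd L; sm = lsmult L; b = lbr L in
       z \<in> C \<and>
       (\<forall>x\<in>C. \<forall>y\<in>C. ad x y \<in> C) \<and>
       (\<forall>c. \<forall>x\<in>C. sm c x \<in> C) \<and>
       (\<forall>x\<in>C. \<forall>y\<in>C. b x y \<in> C) \<and>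
       (\<forall>x\<in>C. \<forall>y\<in>C. \<forall>w\<in>C. ad (ad x y) w = ad x (ad y w)) \<and>
       (\<forall>x\<in>C. \<forall>y\<in>C. ad x y = ad y x) \<and>
       (\<forall>x\<in>C. ad z x = x) \<and>
       (\<forall>x\<in>C. \<exists>y\<in>C. ad x y = z) \<and>
       (\<forall>c. \<forall>x\<in>C. \<forall>y\<in>C. sm c (ad x y) = ad (sm c x) (sm c y)) \<and>
       (\<forall>c d. \<forall>x\<in>C. sm (c + d) x = ad (sm c x) (sm d x)) \<and>
       (\<forall>c d. \<forall>x\<in>C. sm c (sm d x) = sm (c * d) x) \<and>
       (\<forall>x\<in>C. sm 1 x = x) \<and>
       (\<forall>x\<in>C. \<forall>y\<in>C. \<forall>w\<in>C. b (ad x y) w = ad (b x w) (b y w)) \<and>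
       (\<forall>x\<in>C. \<forall>y\<in>C. \<forall>w\<in>C. b x (ad y w) = ad (b x y) (b x w)) \<and>
       (\<forall>c. \<forall>x\<in>C. \<forall>y\<in>C. b (sm c x) y = sm c (b x y)) \<and>
       (\<forall>c. \<forall>x\<in>C. \<forall>y\<in>C. b x (sm c y) = sm c (b x y)) \<and>
       (\<forall>x\<in>C. b x x = z) \<and>
       (\<forall>x\<in>C. \<forall>y\<in>C. \<forall>w\<in>C.
          ad (b x (b y w)) (ad (b y (b w x)) (b w (b x y))) = z))"

primrec lsum :: "('a, 'b) lie_alg_scheme \<Rightarrow> (nat \<Rightarrow> 'a) \<Rightarrow> nat \<Rightarrow> 'a" where
  "lsum L v 0 = lzero L"
| "lsum L v (Suc n) = ladd L (lsum L v n) (v n)"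

definition lspan :: "('a, 'b) lie_alg_scheme \<Rightarrow> 'a set \<Rightarrow> 'a set" where
  "lspan L S = {lsum L (\<lambda>i. lsmult L (c i) (v i)) n | c v n. \<forall>i<n. v i \<in> S}"

definition fin_dim :: "('a, 'b) lie_alg_scheme \<Rightarrow> bool" where
  "fin_dim L \<longleftrightarrow> (\<exists>S. finite S \<and> S \<subseteq> lcarrier L \<and> lspan L S = lcarrier L)"

definition countable_dim :: "('a, 'b) lie_alg_scheme \<Rightarrow> bool" where
  "countable_dim L \<longleftrightarrow> (\<exists>S. countable S \<and> S \<subseteq> lcarrier L \<and> lspan L S = lcarrier L)"

definition lsubspace :: "('a, 'b) lie_alg_scheme \<Rightarrow> 'a set \<Rightarrow> bool" where
  "lsubspace L U \<longleftrightarrow> U \<subseteq> lcarrier L \<and> lzero L \<in> U \<and>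
     (\<forall>x\<in>U. \<forall>y\<in>U. ladd L x y \<in> U) \<and> (\<forall>c. \<forall>x\<in>U. lsmult L c x \<in> U)"

definition subalgebra :: "('a, 'b) lie_alg_scheme \<Rightarrow> 'a set \<Rightarrow> bool" where
  "subalgebra L U \<longleftrightarrow> lsubspace L U \<and> (\<forall>x\<in>U. \<forall>y\<in>U. lbr L x y \<in> U)"

definition lideal :: "('a, 'b) lie_alg_scheme \<Rightarrow> 'a set \<Rightarrow> bool" where
  "lideal L I \<longleftrightarrow> lsubspace L I \<and> (\<forall>x\<in>lcarrier L. \<forall>y\<in>I. lbr L x y \<in> I)"

definition lrestrict :: "'a lie_alg \<Rightarrow> 'a set \<Rightarrow> 'a lie_alg" where
  "lrestrict L U = L\<lparr>lcarrier := U\<rparr>"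

definition center :: "('a, 'b) lie_alg_scheme \<Rightarrow> 'a set" where
  "center L = {z \<in> lcarrier L. \<forall>x\<in>lcarrier L. lbr L z x = lzero L}"

definition derived :: "('a, 'b) lie_alg_scheme \<Rightarrow> 'a set" where
  "derived L = lspan L {lbr L x y | x y. x \<in> lcarrier L \<and> y \<in> lcarrier L}"

definition simple_lie :: "('a, 'b) lie_alg_scheme \<Rightarrow> bool" where
  "simple_lie L \<longleftrightarrow> lie_algebra L \<and>
     (\<exists>x\<in>lcarrier L. \<exists>y\<in>lcarrier L. lbr L x y \<noteq> lzero L) \<and>
     (\<forall>I. lideal L I \<longrightarrow> I = {lzero L} \<or> I = lcarrier L)"

text \<open>Reductive: finite-dimensional with completely reducible adjoint representation,
i.e. every ad-invariant subspace (= ideal) has an ad-invariant complement.\<close>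
definition reductive :: "('a, 'b) lie_alg_scheme \<Rightarrow> bool" where
  "reductive L \<longleftrightarrow> lie_algebra L \<and> fin_dim L \<and>
     (\<forall>I. lideal L I \<longrightarrow>
        (\<exists>J. lideal L J \<and> I \<inter> J = {lzero L} \<and>
             (\<forall>x\<in>lcarrier L. \<exists>a\<in>I. \<exists>b\<in>J. x = ladd L a b)))"

definition lie_hom :: "('a, 'b) lie_alg_scheme \<Rightarrow> ('c, 'd) lie_alg_scheme \<Rightarrow> ('a \<Rightarrow> 'c) \<Rightarrow> bool" where
  "lie_hom L M f \<longleftrightarrow>
     (\<forall>x\<in>lcarrier L. f x \<in> lcarrier M) \<and>
     (\<forall>x\<in>lcarrier L. \<forall>y\<in>lcarrier L. f (ladd L x y) = ladd M (f x) (f y)) \<and>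
     (\<forall>c. \<forall>x\<in>lcarrier L. f (lsmult L c x) = lsmult M c (f x)) \<and>
     (\<forall>x\<in>lcarrier L. \<forall>y\<in>lcarrier L. f (lbr L x y) = lbr M (f x) (f y))"

definition lie_iso :: "('a, 'b) lie_alg_scheme \<Rightarrow> ('c, 'd) lie_alg_scheme \<Rightarrow> bool" where
  "lie_iso L M \<longleftrightarrow> (\<exists>f. lie_hom L M f \<and> bij_betw f (lcarrier L) (lcarrier M))"

text \<open>gl(V,V_*) = V \<otimes> V_*, written in a pair of dual bases (e_i), (e_i^*), i \<in> nat
 (such dual bases exist for countable-dimensional nondegenerate pairings):
 finitely supported nat \<times> nat matrices, e_i \<otimes> e_j^* being the matrix unit E_ij.\<close>

definition mmul :: "(nat \<Rightarrow> nat \<Rightarrow> complex) \<Rightarrow> (nat \<Rightarrow> nat \<Rightarrow> complex) \<Rightarrow> nat \<Rightarrow> nat \<Rightarrow> complex" where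
  "mmul A B i j = (\<Sum>k\<in>{k. A i k \<noteq> 0}. A i k * B k j)"

definition gl_inf :: "(nat \<Rightarrow> nat \<Rightarrow> complex) lie_alg" where
  "gl_inf = \<lparr> lcarrier = {A. finite {(i, j). A i j \<noteq> 0}},
              lzero = (\<lambda>i j. 0),
              ladd = (\<lambda>A B i j. A i j + B i j),
              lsmult = (\<lambda>c A i j. c * A i j),
              lbr = (\<lambda>A B i j. mmul A B i j - mmul B A i j) \<rparr>"

text \<open>so_infty = \<Lambda>^2 V for a nondegenerate symmetric form; in an orthonormal basis
 (exists in countable dimension over the complex numbers), e_i \<and> e_j = E_ij - E_ji,
 i.e. the finitary antisymmetric matrices.\<close>
definition so_inf :: "(nat \<Rightarrow> nat \<Rightarrow> complex) lie_alg" where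
  "so_inf = gl_inf\<lparr> lcarrier := {A \<in> lcarrier gl_inf. \<forall>i j. A j i = - A i j} \<rparr>"

text \<open>sp_infty = Sym^2 V for a nondegenerate antisymmetric form \<omega>; in a symplectic basis
 with \<omega>(e_{2k}, e_{2k+1}) = 1 this is the set of finitary matrices A with
 \<omega>(A e_i, e_j) + \<omega>(e_i, A e_j) = 0 for all i, j.\<close>
definition partner :: "nat \<Rightarrow> nat" where
  "partner i = (if even i then i + 1 else i - 1)"

definition omega :: "nat \<Rightarrow> nat \<Rightarrow> complex" where
  "omega i j = (if even i \<and> j = i + 1 then 1 else if odd i \<and> j + 1 = i then -1 else 0)"

definition sp_inf :: "(nat \<Rightarrow> nat \<Rightarrow> complex) lie_alg" where
  "sp_inf = gl_inf\<lparr> lcarrier := {A \<in> lcarrier gl_inf.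
      \<forall>i j. A (partner j) i * omega (partner j) j + omega i (partner i) * A (partner i) j = 0} \<rparr>"

definition finitary :: "'a lie_alg \<Rightarrow> bool" where
  "finitary L \<longleftrightarrow> (\<exists>f. lie_hom L gl_inf f \<and> inj_on f (lcarrier L))"

definition union_of_reductive :: "'a lie_alg \<Rightarrow> bool" where
  "union_of_reductive L \<longleftrightarrow>
     (\<exists>S :: nat \<Rightarrow> 'a set.
        (\<forall>n. subalgebra L (S n) \<and> reductive (lrestrict L (S n)) \<and> S n \<subseteq> S (Suc n)) \<and>
        (\<Union>n. S n) = lcarrier L)"

definition dsum :: "'a lie_alg \<Rightarrow> nat set \<Rightarrow> (nat \<Rightarrow> 'm lie_alg) \<Rightarrow> ('a \<times> (nat \<Rightarrow> 'm)) lie_alg" where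
  "dsum Z I G = \<lparr>
     lcarrier = {(z, f). z \<in> lcarrier Z \<and> (\<forall>i\<in>I. f i \<in> lcarrier (G i)) \<and>
                         (\<forall>i. i \<notin> I \<longrightarrow> f i = lzero (G i)) \<and> finite {i. f i \<noteq> lzero (G i)}},
     lzero = (lzero Z, \<lambda>i. lzero (G i)),
     ladd = (\<lambda>p q. (ladd Z (fst p) (fst q), \<lambda>i. ladd (G i) (snd p i) (snd q i))),
     lsmult = (\<lambda>c p. (lsmult Z c (fst p), \<lambda>i. lsmult (G i) c (snd p i))),
     lbr = (\<lambda>p q. (lbr Z (fst p) (fst q), \<lambda>i. lbr (G i) (snd p i) (snd q i))) \<rparr>"

end

theory Submission
  imports Defs "HOL-Computational_Algebra.Computational_Algebra"
begin

text \<open>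
  A finitary algebra is realised by finitely supported matrices, as an increasing union \<open>L\<close> of
  reductive algebras \<open>A n\<close>. A matrix of size \<open>n\<close> acts nontrivially on a number of pairwise commuting
  simple algebras that is bounded in terms of \<open>n\<close>. Hence a simple ideal of \<open>A m\<close> meets boundedly many
  simple ideals of \<open>A k\<close> for all \<open>k \<ge> m\<close>, and where this number is minimal in the long run the ideal
  of \<open>L\<close> it generates is simple. Every nonzero ideal inside \<open>[L, L]\<close> contains such a simple ideal, so
  an element commuting with all of them is central, and each element acts on finitely many of them.

  It remains to find, for a simple ideal \<open>S\<close>, a homomorphism from \<open>L\<close> to one of the listed algebras
  which maps \<open>S\<close> onto the derived algebra and whose kernel is the centralizer of \<open>S\<close>. If \<open>S\<close> has
  finite dimension, project along the centralizer. Otherwise some section of the natural module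
  of \<open>L\<close> is irreducible and faithful for \<open>S\<close>; dual bases for it and for a space of functionals again
  give finitely supported matrices, and \<open>S\<close> generates all of them as an associative algebra. Now
  compare a word \<open>s\<^sub>1 \<dots> s\<^sub>k\<close> with \<open>(-1)\<^sup>k s\<^sub>k \<dots> s\<^sub>1\<close>. If these are independent of each other, \<open>S\<close> contains
  all \<open>E i j\<close> with \<open>i \<noteq> j\<close>; if one determines the other, this defines an involution, hence a bilinear
  form, and \<open>S\<close> consists of all skew elements.
\<close>

section \<open>The ring of finitely supported matrices\<close>

text \<open>The inclusions of \<open>A n\<close> in \<open>A (Suc n)\<close> are arbitrary: a simple
  ideal may sit diagonally in several simple ideals of the next stage. Hence the type of the limit
  is not read off from finite stages; even the choice between the linear and the orthogonal or
  symplectic case is made inside the infinite-dimensional algebra.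

  Words and signed reversals come from iterated brackets. If \<open>y\<close> in \<open>S\<close>
  vanishes on a large upper left block, bracketing it successively with \<open>s_1, ..., s_k\<close>
  gives \<open>y * T + T' * y\<close> with \<open>T\<close> the word and \<open>T'\<close> its
  signed reversal, since the mixed terms vanish. Such \<open>y\<close> form a subspace of finite
  codimension in \<open>S\<close>. The wanted elements are then reached by contradiction: were one
  missing, certain products would vanish for all such \<open>y\<close>, and
  \<open>exp (t ad s)\<close> would turn this into an equation between formal power series, a ring
  without zero divisors.

  In the linear case \<open>S\<close> becomes the algebra of trace-zero matrices, while the image of
  \<open>L\<close> may be anything between it and \<open>gl_inf\<close>. This is why only derived
  algebras are hit exactly.\<close>

typedef fmat = "{A :: nat \<Rightarrow> nat \<Rightarrow> complex. finite {(i, j). A i j \<noteq> 0}}"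
  morphisms ent Fmat
  by (rule exI[of _ "\<lambda>i j. 0"]) simp

lemma finite_ent: "finite {(i, j). ent A i j \<noteq> 0}"
  using ent[of A] by simp

lemma ent_Fmat: "finite {(i, j). f i j \<noteq> 0} \<Longrightarrow> ent (Fmat f) = f"
  by (simp add: Fmat_inverse)

lemma fmat_eqI: "(\<And>i j. ent A i j = ent B i j) \<Longrightarrow> A = B"
  by (metis ent_inject ext)

definition bnd :: "nat \<Rightarrow> fmat \<Rightarrow> bool" where
  "bnd n A \<longleftrightarrow> (\<forall>i j. ent A i j \<noteq> 0 \<longrightarrow> i < n \<and> j < n)"

lemma bnd_mono: "bnd n A \<Longrightarrow> n \<le> m \<Longrightarrow> bnd m A"
  unfolding bnd_def by (meson less_le_trans)

lemma bnd_ex: "\<exists>n. bnd n A"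
proof -
  have f: "finite (fst ` {(i, j). ent A i j \<noteq> 0} \<union> snd ` {(i, j). ent A i j \<noteq> 0})"
    using finite_ent[of A] by simp
  then obtain n where n: "\<forall>x \<in> fst ` {(i, j). ent A i j \<noteq> 0} \<union> snd ` {(i, j). ent A i j \<noteq> 0}. x < n"
    using finite_nat_set_iff_bounded by blast
  have "i < n \<and> j < n" if "ent A i j \<noteq> 0" for i j
    using n that by (force simp: image_iff)
  thus ?thesis unfolding bnd_def by blast
qed

lemma bnd_ex2: "\<exists>n. bnd n A \<and> bnd n B"
  by (meson bnd_ex bnd_mono nat_le_linear)

lemma bnd_finite: "finite X \<Longrightarrow> \<exists>n. \<forall>A\<in>X. bnd n A"
proof (induction X rule: finite_induct)
  case (insert x F)
  then obtain n m where "\<forall>A\<in>F. bnd n A" "bnd m x" using bnd_ex by blast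
  hence "\<forall>A\<in>insert x F. bnd (max n m) A" by (auto intro: bnd_mono)
  thus ?case by blast
qed simp

lemma finite_supp_bound:
  assumes "\<And>i j. f i j \<noteq> (0::complex) \<Longrightarrow> i < n \<and> j < (m::nat)"
  shows "finite {(i::nat, j). f i j \<noteq> 0}"
  by (rule finite_subset[of _ "{..<n} \<times> {..<m}"]) (use assms in auto)

text \<open>Not a ring with one: the identity matrix is not finitely supported. Hence powers of a
  matrix appear below only as iterated multiplication operators, and generated algebras have no
  unit.\<close>

instantiation fmat :: ring
begin

definition "0 = Fmat (\<lambda>i j. 0)"
definition "A + B = Fmat (\<lambda>i j. ent A i j + ent B i j)"
definition "A - B = Fmat (\<lambda>i j. ent A i j - ent B i j)"
definition "- A = Fmat (\<lambda>i j. - ent A i j)"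
definition "A * B = Fmat (mmul (ent A) (ent B))"

lemma ent_zero [simp]: "ent 0 i j = 0"
  unfolding zero_fmat_def by (subst ent_Fmat) auto

lemma ent_add [simp]: "ent (A + B) i j = ent A i j + ent B i j"
proof -
  have "finite {(i, j). ent A i j + ent B i j \<noteq> 0}"
    by (rule finite_subset[OF _ finite_UnI[OF finite_ent[of A] finite_ent[of B]]]) auto
  thus ?thesis unfolding plus_fmat_def by (subst ent_Fmat) auto
qed

lemma ent_diff [simp]: "ent (A - B) i j = ent A i j - ent B i j"
proof -
  have "finite {(i, j). ent A i j - ent B i j \<noteq> 0}"
    by (rule finite_subset[OF _ finite_UnI[OF finite_ent[of A] finite_ent[of B]]]) auto
  thus ?thesis unfolding minus_fmat_def by (subst ent_Fmat) auto
qed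

lemma ent_uminus [simp]: "ent (- A) i j = - ent A i j"
proof -
  have "finite {(i, j). - ent A i j \<noteq> 0}" using finite_ent[of A] by simp
  thus ?thesis unfolding uminus_fmat_def by (subst ent_Fmat) auto
qed

lemma mmul_bound:
  assumes "bnd n A"
  shows "mmul (ent A) (ent B) i j = (\<Sum>k<n. ent A i k * ent B k j)"
  unfolding mmul_def
  by (rule sum.mono_neutral_left) (use assms in \<open>auto simp: bnd_def\<close>)

lemma ent_times: "ent (A * B) = mmul (ent A) (ent B)"
proof -
  obtain n where n: "bnd n A" "bnd n B" using bnd_ex2 by blast
  have "i < n \<and> j < n" if "mmul (ent A) (ent B) i j \<noteq> 0" for i j
  proof -
    have "(\<Sum>k<n. ent A i k * ent B k j) \<noteq> 0" using that mmul_bound[OF n(1)] by simp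
    then obtain k where "ent A i k * ent B k j \<noteq> 0" by (meson sum.not_neutral_contains_not_neutral)
    thus ?thesis using n by (auto simp: bnd_def)
  qed
  hence "finite {(i, j). mmul (ent A) (ent B) i j \<noteq> 0}" by (rule finite_supp_bound)
  thus ?thesis unfolding times_fmat_def by (rule ent_Fmat)
qed

lemma ent_times_bound: "bnd n A \<Longrightarrow> ent (A * B) i j = (\<Sum>k<n. ent A i k * ent B k j)"
  by (simp add: ent_times mmul_bound)

lemma ent_times_bound2: "bnd n B \<Longrightarrow> ent (A * B) i j = (\<Sum>k<n. ent A i k * ent B k j)"
proof -
  assume n: "bnd n B"
  obtain m where m: "bnd m A" "n \<le> m" by (metis bnd_ex bnd_mono nat_le_linear)
  have "(\<Sum>k<m. ent A i k * ent B k j) = (\<Sum>k<n. ent A i k * ent B k j)"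
    by (rule sum.mono_neutral_right) (use n m in \<open>force simp: bnd_def\<close>)+
  thus ?thesis using ent_times_bound[OF m(1)] by simp
qed

lemma bnd_times: "bnd n A \<Longrightarrow> bnd n B \<Longrightarrow> bnd n (A * B)"
proof -
  assume n: "bnd n A" "bnd n B"
  show "bnd n (A * B)" unfolding bnd_def
  proof (intro allI impI)
    fix i j assume "ent (A * B) i j \<noteq> 0"
    hence "(\<Sum>k<n. ent A i k * ent B k j) \<noteq> 0" by (simp add: ent_times_bound[OF n(1)])
    then obtain k where "ent A i k * ent B k j \<noteq> 0" by (meson sum.not_neutral_contains_not_neutral)
    thus "i < n \<and> j < n" using n by (auto simp: bnd_def)
  qed
qed

instance
proof
  fix A B C :: fmat
  show "A + B + C = A + (B + C)" by (rule fmat_eqI) simp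
  show "A + B = B + A" by (rule fmat_eqI) simp
  show "0 + A = A" by (rule fmat_eqI) simp
  show "- A + A = 0" by (rule fmat_eqI) simp
  show "A - B = A + - B" by (rule fmat_eqI) simp
  obtain n where n: "bnd n A" "bnd n B" using bnd_ex2 by blast
  obtain p where p: "bnd p (A + B)" "n \<le> p" by (metis bnd_ex bnd_mono nat_le_linear)
  have np: "bnd p A" "bnd p B" using n p bnd_mono by auto
  show "(A + B) * C = A * C + B * C"
    by (rule fmat_eqI) (simp add: ent_times_bound[OF p(1)] ent_times_bound[OF np(1)]
        ent_times_bound[OF np(2)] distrib_right sum.distrib)
  show "A * (B + C) = A * B + A * C"
    by (rule fmat_eqI) (simp add: ent_times_bound[OF n(1)] distrib_left sum.distrib)
  show "A * B * C = A * (B * C)"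
    by (rule fmat_eqI)
      (simp add: ent_times_bound[OF bnd_times[OF n]] ent_times_bound[OF n(1)] ent_times_bound[OF n(2)]
        sum_distrib_left sum_distrib_right mult.assoc, rule sum.swap)
qed

end

lemma ent_sum [simp]: "ent (sum f X) i j = (\<Sum>x\<in>X. ent (f x) i j)"
  by (induction X rule: infinite_finite_induct) auto

definition scaleM :: "complex \<Rightarrow> fmat \<Rightarrow> fmat" (infixr "*\<^sub>m" 75) where
  "c *\<^sub>m A = Fmat (\<lambda>i j. c * ent A i j)"

lemma ent_scaleM [simp]: "ent (c *\<^sub>m A) i j = c * ent A i j"
proof -
  have "finite {(i, j). c * ent A i j \<noteq> 0}"
    by (rule finite_subset[OF _ finite_ent[of A]]) auto
  thus ?thesis unfolding scaleM_def by (subst ent_Fmat) auto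
qed

interpretation fm: vector_space scaleM
  by unfold_locales (rule fmat_eqI, simp add: algebra_simps)+

interpretation fmm: vector_space_pair scaleM scaleM
  by unfold_locales

lemma scaleM_mult_left [simp]: "(c *\<^sub>m A) * B = c *\<^sub>m (A * B)"
proof (rule fmat_eqI)
  fix i j
  obtain n where n: "bnd n B" using bnd_ex by blast
  show "ent ((c *\<^sub>m A) * B) i j = ent (c *\<^sub>m (A * B)) i j"
    by (simp add: ent_times_bound2[OF n] sum_distrib_left mult.assoc)
qed

lemma scaleM_mult_right [simp]: "A * (c *\<^sub>m B) = c *\<^sub>m (A * B)"
proof (rule fmat_eqI)
  fix i j
  obtain n where n: "bnd n A" using bnd_ex by blast
  show "ent (A * (c *\<^sub>m B)) i j = ent (c *\<^sub>m (A * B)) i j"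
    by (simp add: ent_times_bound[OF n] sum_distrib_left mult_ac)
qed

lemma bnd_add: "bnd n A \<Longrightarrow> bnd n B \<Longrightarrow> bnd n (A + B)"
  unfolding bnd_def by (metis add_0 ent_add)

lemma bnd_scale: "bnd n A \<Longrightarrow> bnd n (c *\<^sub>m A)"
  by (auto simp: bnd_def)

lemma bnd_zero: "bnd n 0"
  by (auto simp: bnd_def)

lemma subspace_bnd: "fm.subspace {A. bnd n A}"
  by (rule fm.subspaceI) (auto simp: bnd_add bnd_scale bnd_zero)

subsection \<open>Matrix units\<close>

definition E :: "nat \<Rightarrow> nat \<Rightarrow> fmat" where
  "E i j = Fmat (\<lambda>a b. if a = i \<and> b = j then 1 else 0)"

lemma ent_E [simp]: "ent (E i j) a b = (if a = i \<and> b = j then 1 else 0)"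
proof -
  have "finite {(a, b). (if a = i \<and> b = j then 1 else (0::complex)) \<noteq> 0}"
    by (rule finite_subset[of _ "{(i, j)}"]) (auto split: if_splits)
  thus ?thesis unfolding E_def by (subst ent_Fmat) auto
qed

lemma bnd_E: "i < n \<Longrightarrow> j < n \<Longrightarrow> bnd n (E i j)"
  by (auto simp: bnd_def split: if_splits)

lemma E_nonzero [simp]: "E i j \<noteq> 0"
  by (metis ent_E ent_zero zero_neq_one)

lemma sum_unit_left:
  "(\<Sum>k<Suc (max i j). (if a = i \<and> k = j then 1 else 0) * (f k :: complex)) = (if a = i then f j else 0)"
proof -
  have "(\<Sum>k<Suc (max i j). (if a = i \<and> k = j then 1 else 0) * f k)
      = (\<Sum>k<Suc (max i j). if k = j then (if a = i then f j else 0) else 0)"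
    by (rule sum.cong) auto
  thus ?thesis by (simp add: sum.delta less_Suc_eq_le del: sum.lessThan_Suc)
qed

lemma sum_unit_right:
  "(\<Sum>k<Suc (max i j). (f k :: complex) * (if k = i \<and> b = j then 1 else 0)) = (if b = j then f i else 0)"
proof -
  have "(\<Sum>k<Suc (max i j). f k * (if k = i \<and> b = j then 1 else 0))
      = (\<Sum>k<Suc (max i j). if k = i then (if b = j then f i else 0) else 0)"
    by (rule sum.cong) auto
  thus ?thesis by (simp add: sum.delta less_Suc_eq_le del: sum.lessThan_Suc)
qed

lemma ent_E_mult [simp]: "ent (E i j * A) a b = (if a = i then ent A j b else 0)"
proof -
  have "bnd (Suc (max i j)) (E i j)" by (rule bnd_E) auto
  thus ?thesis
    by (subst ent_times_bound, assumption)
      (simp only: ent_E sum_unit_left)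
qed

lemma ent_mult_E [simp]: "ent (A * E i j) a b = (if b = j then ent A a i else 0)"
proof -
  have "bnd (Suc (max i j)) (E i j)" by (rule bnd_E) auto
  thus ?thesis
    by (subst ent_times_bound2, assumption)
      (simp only: ent_E sum_unit_right)
qed

lemma E_mult_E: "E i j * E k l = (if j = k then E i l else 0)"
  by (rule fmat_eqI) auto

lemma E_mult_E_same [simp]: "E i j * E j l = E i l"
  by (simp add: E_mult_E)

lemma E_sandwich: "E i j * A * E k l = ent A j k *\<^sub>m E i l"
  by (rule fmat_eqI) auto

lemma E_sandwich': "E i j * (A * E k l) = ent A j k *\<^sub>m E i l"
  using E_sandwich by (simp add: mult.assoc)

lemma fmat_decomp: "bnd n A \<Longrightarrow> A = (\<Sum>i<n. \<Sum>j<n. ent A i j *\<^sub>m E i j)"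
proof (rule fmat_eqI)
  fix a b assume n: "bnd n A"
  have "(\<Sum>j<n. ent A i j * (if a = i \<and> b = j then 1 else 0))
      = (if i = a then ent A a b else 0)" for i
  proof -
    have "(\<Sum>j<n. ent A i j * (if a = i \<and> b = j then 1 else 0))
        = (\<Sum>j<n. if j = b then (if i = a then ent A a b else 0) else 0)"
      by (rule sum.cong) auto
    thus ?thesis using n by (auto simp: bnd_def)
  qed
  hence "(\<Sum>i<n. \<Sum>j<n. ent A i j * (if a = i \<and> b = j then 1 else 0)) = ent A a b"
    using n by (auto simp: bnd_def)
  thus "ent A a b = ent (\<Sum>i<n. \<Sum>j<n. ent A i j *\<^sub>m E i j) a b" by simp
qed

lemma span_E: "A \<in> fm.span (range (\<lambda>(i, j). E i j))"
proof -
  obtain n where n: "bnd n A" using bnd_ex by blast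
  show ?thesis
    by (subst fmat_decomp[OF n])
      (intro fm.span_sum fm.span_scale fm.span_base, auto)
qed

lemma span_E_bnd: "bnd n A \<Longrightarrow> A \<in> fm.span ((\<lambda>(i, j). E i j) ` ({..<n} \<times> {..<n}))"
  by (subst fmat_decomp[of n], assumption)
    (intro fm.span_sum fm.span_scale fm.span_base, auto)

lemma finite_dim_bnd: "\<exists>B. finite B \<and> {A. bnd n A} \<subseteq> fm.span B"
  using span_E_bnd by (intro exI[of _ "(\<lambda>(i, j). E i j) ` ({..<n} \<times> {..<n})"]) auto

lemma fmat_nonzero_ex: "A \<noteq> 0 \<Longrightarrow> \<exists>i j. ent A i j \<noteq> 0"
  by (metis ent_zero fmat_eqI)

text \<open>The counterpart of \<open>bnd n\<close>: the upper left block is zero. Between two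
  matrices of size \<open>n\<close> such a matrix disappears, which kills the mixed terms of
  iterated brackets.\<close>

definition corner :: "nat \<Rightarrow> fmat \<Rightarrow> bool" where
  "corner n A \<longleftrightarrow> (\<forall>i<n. \<forall>j<n. ent A i j = 0)"

lemma corner_mono: "corner m A \<Longrightarrow> n \<le> m \<Longrightarrow> corner n A"
  unfolding corner_def by auto

lemma corner_sandwich: "bnd n T \<Longrightarrow> bnd n T' \<Longrightarrow> corner n y \<Longrightarrow> T * y * T' = 0"
proof (rule fmat_eqI)
  fix i j assume a: "bnd n T" "bnd n T'" "corner n y"
  have "ent (T * y * T') i j = (\<Sum>l<n. (\<Sum>k<n. ent T i k * ent y k l) * ent T' l j)"
    by (simp add: ent_times_bound2[OF a(2)] ent_times_bound[OF a(1)])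
  also have "\<dots> = 0" using a(3) by (simp add: corner_def)
  finally show "ent (T * y * T') i j = ent 0 i j" by simp
qed

section \<open>Commutators and Lie subalgebras of matrices\<close>

definition lb :: "fmat \<Rightarrow> fmat \<Rightarrow> fmat" where
  "lb A B = A * B - B * A"

lemma lb_simps:
  "lb (A + B) C = lb A C + lb B C" "lb A (B + C) = lb A B + lb A C"
  "lb (A - B) C = lb A C - lb B C" "lb A (B - C) = lb A B - lb A C"
  "lb (- A) B = - lb A B" "lb A (- B) = - lb A B"
  "lb (c *\<^sub>m A) B = c *\<^sub>m lb A B" "lb A (c *\<^sub>m B) = c *\<^sub>m lb A B"
  "lb 0 A = 0" "lb A 0 = 0" "lb A A = 0"
  by (simp_all add: lb_def algebra_simps fm.scale_right_diff_distrib)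

lemma lb_minus_commute: "lb A B = - lb B A"
  by (simp add: lb_def)

lemma lb_jacobi: "lb (lb A B) C = lb A (lb B C) - lb B (lb A C)"
  by (simp add: lb_def algebra_simps)

lemma lb_sum_right: "lb B (sum f X) = (\<Sum>x\<in>X. lb B (f x))"
  by (simp add: lb_def sum_distrib_left sum_distrib_right sum_subtractf)

definition lie_sub :: "fmat set \<Rightarrow> bool" where
  "lie_sub S \<longleftrightarrow> fm.subspace S \<and> (\<forall>x\<in>S. \<forall>y\<in>S. lb x y \<in> S)"

lemma scaleM_uminus: "- A = (-1) *\<^sub>m A"
  by (rule fmat_eqI) simp

lemma scaleM_sum_left: "sum f X *\<^sub>m A = (\<Sum>x\<in>X. f x *\<^sub>m A)"
  by (rule fmat_eqI) (simp add: sum_distrib_right)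

section \<open>Linear algebra\<close>

abbreviation flinear :: "(fmat \<Rightarrow> fmat) \<Rightarrow> bool" where
  "flinear f \<equiv> Vector_Spaces.linear scaleM scaleM f"

lemma flinearI:
  assumes "\<And>x y. f (x + y) = f x + f y" "\<And>c x. f (c *\<^sub>m x) = c *\<^sub>m f x"
  shows "flinear f"
  unfolding Vector_Spaces.linear_iff using assms fm.vector_space_axioms by blast

lemma finite_basis_of_subset:
  assumes "finite B" "X \<subseteq> fm.span B"
  shows "\<exists>C. finite C \<and> C \<subseteq> X \<and> X \<subseteq> fm.span C \<and> fm.independent C"
proof -
  obtain C where C: "C \<subseteq> X" "fm.independent C" "X \<subseteq> fm.span C"
    using fm.maximal_independent_subset[of X] by blast
  moreover have "finite C"
    using fm.independent_span_bound[OF assms(1) C(2)] C(1) assms(2) by blast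
  ultimately show ?thesis by blast
qed

lemma finite_basis_bnd:
  assumes "\<And>x. x \<in> X \<Longrightarrow> bnd n x"
  shows "\<exists>C. finite C \<and> C \<subseteq> X \<and> X \<subseteq> fm.span C \<and> fm.independent C"
proof -
  obtain B where "finite B" "{A. bnd n A} \<subseteq> fm.span B" using finite_dim_bnd by blast
  thus ?thesis using finite_basis_of_subset[of B X] assms by blast
qed

lemma span_bnd:
  assumes "\<And>x. x \<in> X \<Longrightarrow> bnd n x" "y \<in> fm.span X"
  shows "bnd n y"
proof -
  have "fm.span X \<subseteq> {A. bnd n A}"
    by (rule fm.span_minimal) (use assms(1) subspace_bnd in auto)
  thus ?thesis using assms(2) by blast
qed

text \<open>Rank-nullity without dimensions: \<open>F\<close> lifts a finite spanning set of the
  image, so the kernel has finite codimension in \<open>S\<close>.\<close>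

lemma preimage_finite:
  assumes f: "flinear f" and S: "fm.subspace S" and B: "finite B" "f ` S \<subseteq> fm.span B"
  shows "\<exists>F. finite F \<and> F \<subseteq> S \<and> (\<forall>s\<in>S. \<exists>t\<in>fm.span F. f (s - t) = 0)"
proof -
  obtain C where C: "finite C" "C \<subseteq> f ` S" "f ` S \<subseteq> fm.span C"
    using finite_basis_of_subset[OF B] by blast
  obtain F where F: "finite F" "F \<subseteq> S" "f ` F = C"
    using finite_subset_image[OF C(1,2)] by metis
  have "\<exists>t\<in>fm.span F. f (s - t) = 0" if "s \<in> S" for s
  proof -
    have "f s \<in> fm.span (f ` F)" using that C(3) F(3) by blast
    then obtain t where "t \<in> fm.span F" "f s = f t"
      using fmm.linear_span_image[OF f] by blast
    thus ?thesis using fmm.linear_diff[OF f] by auto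
  qed
  thus ?thesis using F by blast
qed

definition cornerp :: "nat \<Rightarrow> fmat \<Rightarrow> fmat" where
  "cornerp n A = (\<Sum>i<n. \<Sum>j<n. ent A i j *\<^sub>m E i j)"

lemma ent_cornerp: "ent (cornerp n A) a b = (if a < n \<and> b < n then ent A a b else 0)"
proof -
  have "(\<Sum>j<n. ent A i j * (if a = i \<and> b = j then 1 else 0))
      = (if i = a then (if b < n then ent A a b else 0) else 0)" for i
  proof -
    have "(\<Sum>j<n. ent A i j * (if a = i \<and> b = j then 1 else 0))
        = (\<Sum>j<n. if j = b then (if i = a then ent A a b else 0) else 0)"
      by (rule sum.cong) auto
    thus ?thesis by auto
  qed
  thus ?thesis unfolding cornerp_def by auto
qed

lemma bnd_cornerp: "bnd n (cornerp n A)"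
  by (auto simp: bnd_def ent_cornerp split: if_splits)

lemma cornerp_0_iff: "cornerp n A = 0 \<longleftrightarrow> corner n A"
proof
  assume "cornerp n A = 0"
  hence "\<And>i j. ent (cornerp n A) i j = 0" by simp
  thus "corner n A" unfolding corner_def ent_cornerp by metis
next
  assume "corner n A"
  thus "cornerp n A = 0" by (intro fmat_eqI) (auto simp: ent_cornerp corner_def)
qed

lemma linear_cornerp: "flinear (cornerp n)"
  by (rule flinearI; rule fmat_eqI) (auto simp: ent_cornerp)

text \<open>Cutting out the upper left block is a linear map of finite rank. It lets statements
  about elements with zero corner pass to all of \<open>S\<close>, up to a correction
  \<open>t\<close> whose size is bounded independently of \<open>s\<close>.\<close>

lemma corner_codim:
  assumes "fm.subspace S"
  shows "\<exists>F. finite F \<and> F \<subseteq> S \<and> (\<forall>s\<in>S. \<exists>t\<in>fm.span F. corner n (s - t))"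
proof -
  obtain B where "finite B" "{A. bnd n A} \<subseteq> fm.span B" using finite_dim_bnd by blast
  hence "cornerp n ` S \<subseteq> fm.span B" using bnd_cornerp by blast
  from preimage_finite[OF linear_cornerp assms \<open>finite B\<close> this] show ?thesis
    by (simp add: cornerp_0_iff)
qed

section \<open>Pairs of words and the corner lemma\<close>

inductive_set alg :: "fmat set \<Rightarrow> fmat set" for S where
  base: "s \<in> S \<Longrightarrow> s \<in> alg S"
| add: "x \<in> alg S \<Longrightarrow> y \<in> alg S \<Longrightarrow> x + y \<in> alg S"
| scale: "x \<in> alg S \<Longrightarrow> c *\<^sub>m x \<in> alg S"
| mult: "x \<in> alg S \<Longrightarrow> y \<in> alg S \<Longrightarrow> x * y \<in> alg S"

text \<open>\<open>(T, T')\<close> is a pair when some expression in elements of \<open>S\<close> evaluates to \<open>T\<close> and its image under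
  the anti-automorphism \<open>s \<mapsto> -s\<close> of the enveloping algebra evaluates to \<open>T'\<close>.\<close>

inductive_set pairs :: "fmat set \<Rightarrow> (fmat \<times> fmat) set" for S where
  base: "s \<in> S \<Longrightarrow> (s, - s) \<in> pairs S"
| add: "(x, x') \<in> pairs S \<Longrightarrow> (y, y') \<in> pairs S \<Longrightarrow> (x + y, x' + y') \<in> pairs S"
| scale: "(x, x') \<in> pairs S \<Longrightarrow> (c *\<^sub>m x, c *\<^sub>m x') \<in> pairs S"
| mult: "(x, x') \<in> pairs S \<Longrightarrow> (y, y') \<in> pairs S \<Longrightarrow> (x * y, y' * x') \<in> pairs S"

lemma pairs_diff: "(x, x') \<in> pairs S \<Longrightarrow> (y, y') \<in> pairs S \<Longrightarrow> (x - y, x' - y') \<in> pairs S"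
  using pairs.add[of x x' S "(-1) *\<^sub>m y" "(-1) *\<^sub>m y'"] pairs.scale[of y y' S "-1"]
  by (simp add: scaleM_uminus[symmetric])

lemma pairs_ex: "T \<in> alg S \<Longrightarrow> \<exists>T'. (T, T') \<in> pairs S"
  by (induction rule: alg.induct) (blast intro: pairs.intros)+

text \<open>Signed reversal is an involution: swapping \<open>(s, - s)\<close> gives the generator
  belonging to \<open>- s\<close>, and the product rule is symmetric under the swap.\<close>

lemma pairs_swap:
  assumes S: "fm.subspace S" and "(T, T') \<in> pairs S"
  shows "(T', T) \<in> pairs S"
  using assms(2)
proof (induction rule: pairs.induct)
  case (base s)
  hence "- s \<in> S" using fm.subspace_neg[OF S] by blast
  thus ?case using pairs.base[of "- s"] by simp
qed (blast intro: pairs.intros)+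

lemma corner_mult:
  assumes "bnd n T" "corner n y"
  shows "i < n \<Longrightarrow> ent (y * T) i j = 0" "j < n \<Longrightarrow> ent (T * y) i j = 0"
  using assms by (simp_all add: ent_times_bound[OF assms(1)] ent_times_bound2[OF assms(1)] corner_def)

text \<open>In an iterated bracket of \<open>y\<close>, all terms with factors on both sides of \<open>y\<close> vanish once the zero
  corner of \<open>y\<close> is large enough.\<close>

lemma corner_lemma:
  assumes S: "lie_sub S" and "(T, T') \<in> pairs S"
  shows "\<exists>n. \<forall>y\<in>S. corner n y \<longrightarrow> y * T + T' * y \<in> S"
  using assms(2)
proof (induction rule: pairs.induct)
  case (base s)
  have "y * s + - s * y \<in> S" if "y \<in> S" for y
    using S that base by (auto simp: lie_sub_def lb_def)
  thus ?case by blast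
next
  case (add x x' y y')
  then obtain n m where nm: "\<forall>z\<in>S. corner n z \<longrightarrow> z * x + x' * z \<in> S"
    "\<forall>z\<in>S. corner m z \<longrightarrow> z * y + y' * z \<in> S" by blast
  have "z * (x + y) + (x' + y') * z \<in> S" if z: "z \<in> S" "corner (max n m) z" for z
  proof -
    have "(z * x + x' * z) + (z * y + y' * z) \<in> S"
      using z nm corner_mono[of _ z] S fm.subspace_add unfolding lie_sub_def
      by (metis max.cobounded1 max.cobounded2)
    thus ?thesis by (simp add: algebra_simps)
  qed
  thus ?case by blast
next
  case (scale x x' c)
  then obtain n where n: "\<forall>z\<in>S. corner n z \<longrightarrow> z * x + x' * z \<in> S" by blast
  have "z * (c *\<^sub>m x) + (c *\<^sub>m x') * z \<in> S" if z: "z \<in> S" "corner n z" for z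
  proof -
    have "c *\<^sub>m (z * x + x' * z) \<in> S" using n z S fm.subspace_scale unfolding lie_sub_def by blast
    thus ?thesis by (simp add: fm.scale_right_distrib)
  qed
  thus ?case by blast
next
  case (mult x x' y y')
  then obtain n m where nm: "\<forall>z\<in>S. corner n z \<longrightarrow> z * x + x' * z \<in> S"
    "\<forall>z\<in>S. corner m z \<longrightarrow> z * y + y' * z \<in> S" by blast
  obtain b where b: "\<forall>A\<in>{x, x', y, y'}. bnd b A" using bnd_finite[of "{x, x', y, y'}"] by auto
  \<comment> \<open>Besides the two corners from the induction hypotheses, the size \<open>b\<close>
    of the factors is needed: it keeps the corner of \<open>w\<close> zero and kills the two mixed
    terms.\<close>
  define N where "N = max b (max n m)"
  have bN: "bnd N x" "bnd N x'" "bnd N y" "bnd N y'" using b bnd_mono unfolding N_def by auto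
  have "z * (x * y) + (y' * x') * z \<in> S" if z: "z \<in> S" "corner N z" for z
  proof -
    define w where "w = z * x + x' * z"
    have w: "w \<in> S" using nm(1) z corner_mono[of N z n] unfolding w_def N_def by auto
    have "corner N w" unfolding corner_def w_def
      using corner_mult[OF bN(1) z(2)] corner_mult[OF bN(2) z(2)] by simp
    hence "w * y + y' * w \<in> S" using nm(2) w corner_mono[of N w m] unfolding N_def by auto
    moreover have "x' * z * y = 0" "y' * z * x = 0"
      using corner_sandwich bN z(2) by blast+
    ultimately show ?thesis unfolding w_def by (simp add: algebra_simps)
  qed
  thus ?case by blast
qed

text \<open>The first components of pairs \<open>(T, 0)\<close> form a two-sided ideal of
  \<open>alg S\<close>, and the ring of all finitely supported matrices is simple: sandwiching
  \<open>T0\<close> between matrix units already yields every \<open>E k l\<close>.\<close>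

lemma pairs_dichotomy:
  assumes S: "fm.subspace S" and A: "alg S = UNIV" and T0: "(T0, 0) \<in> pairs S" "T0 \<noteq> 0"
  shows "(T, 0) \<in> pairs S" "(0, T) \<in> pairs S"
proof -
  obtain i j where ij: "ent T0 i j \<noteq> 0" using fmat_nonzero_ex[OF T0(2)] by blast
  have E: "(E k l, 0) \<in> pairs S" for k l
  proof -
    obtain X Y where XY: "(E k i, X) \<in> pairs S" "(E j l, Y) \<in> pairs S"
      using pairs_ex A by (metis UNIV_I)
    have "((E k i * T0) * E j l, Y * (0 * X)) \<in> pairs S"
      using XY T0(1) by (intro pairs.mult)
    hence "(ent T0 i j *\<^sub>m E k l, 0) \<in> pairs S" by (simp add: E_sandwich)
    from pairs.scale[OF this, of "1 / ent T0 i j"] show ?thesis using ij by simp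
  qed
  have 0: "(0, 0) \<in> pairs S" using pairs.scale[OF T0(1), of 0] by simp
  have sum: "(sum f X, 0) \<in> pairs S" if "\<And>x. x \<in> X \<Longrightarrow> (f x, 0) \<in> pairs S" for f and X :: "nat set"
    using that
  proof (induction X rule: infinite_finite_induct)
    case (insert x F)
    thus ?case using pairs.add[of "f x" 0 S "sum f F" 0] by auto
  qed (auto simp: 0)
  have *: "(T, 0) \<in> pairs S" for T
  proof -
    obtain n where n: "bnd n T" using bnd_ex by blast
    have "(c *\<^sub>m E i j, 0) \<in> pairs S" for c i j using pairs.scale[OF E, of c] by simp
    hence "((\<Sum>i<n. \<Sum>j<n. ent T i j *\<^sub>m E i j), 0) \<in> pairs S" by (intro sum)
    thus ?thesis using fmat_decomp[OF n] by simp
  qed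
  show "(T, 0) \<in> pairs S" by (rule *)
  show "(0, T) \<in> pairs S" using pairs_swap[OF S *] .
qed

section \<open>Exponentials of inner derivations\<close>

abbreviation pl :: "fmat \<Rightarrow> nat \<Rightarrow> fmat \<Rightarrow> fmat" where
  "pl s p \<equiv> ((\<lambda>x. s * x) ^^ p)"

lemma pl_mult: "pl s p (x * y) = pl s p x * y"
  by (induction p) (simp_all add: mult.assoc)

text \<open>If \<open>z p q\<close> behaves like \<open>s\<^sup>p a \<otimes> s\<^sup>q b\<close>, then the coefficient of \<open>t\<^sup>m\<close> in
  \<open>exp (t ad s)\<close> applied to \<open>z 0 0\<close> lies in the Lie algebra.\<close>

lemma exp_coeff_mem:
  assumes S: "lie_sub S" and s: "s \<in> S" and z0: "z 0 0 \<in> S"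
    and z: "\<And>p q. lb s (z p q) = z (Suc p) q + z p (Suc q)"
  shows "(\<Sum>p\<le>m. (1 / (fact p * fact (m - p))) *\<^sub>m z p (m - p)) \<in> S"
proof (induction m)
  case 0
  show ?case using z0 by simp
next
  case (Suc m)
  define c :: "nat \<Rightarrow> nat \<Rightarrow> complex" where "c p q = 1 / (fact p * fact q)" for p q
  have c1: "of_nat (Suc p) * c (Suc p) q = c p q" for p q
    unfolding c_def fact_Suc by (simp del: of_nat_Suc)
  have c2: "of_nat (Suc q) * c p (Suc q) = c p q" for p q
    unfolding c_def fact_Suc by (simp del: of_nat_Suc)
  define Y where "Y m = (\<Sum>p\<le>m. c p (m - p) *\<^sub>m z p (m - p))" for m
  \<comment> \<open>The recursion \<open>(m + 1) Y (m + 1) = [s, Y m]\<close> of the exponential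
    series: \<open>Suc m\<close> is split as \<open>p + (Suc m - p)\<close>, and each summand
    cancels a factor of one factorial.\<close>
  have "of_nat (Suc m) *\<^sub>m Y (Suc m)
      = (\<Sum>p\<le>Suc m. (of_nat p * c p (Suc m - p)) *\<^sub>m z p (Suc m - p))
      + (\<Sum>p\<le>Suc m. (of_nat (Suc m - p) * c p (Suc m - p)) *\<^sub>m z p (Suc m - p))"
  proof -
    have "of_nat (Suc m) = (of_nat p :: complex) + of_nat (Suc m - p)" if "p \<le> Suc m" for p
      using that by (simp flip: of_nat_add)
    thus ?thesis unfolding Y_def fm.scale_sum_right sum.distrib[symmetric]
      by (intro sum.cong refl)
        (simp add: fm.scale_left_distrib[symmetric] distrib_right[symmetric] del: of_nat_Suc)
  qed
  also have "(\<Sum>p\<le>Suc m. (of_nat p * c p (Suc m - p)) *\<^sub>m z p (Suc m - p))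
      = (\<Sum>p\<le>m. c p (m - p) *\<^sub>m z (Suc p) (m - p))"
    by (subst sum.atMost_Suc_shift) (simp add: c1 del: of_nat_Suc)
  also have "(\<Sum>p\<le>Suc m. (of_nat (Suc m - p) * c p (Suc m - p)) *\<^sub>m z p (Suc m - p))
      = (\<Sum>p\<le>m. c p (m - p) *\<^sub>m z p (Suc (m - p)))"
  proof -
    have "(of_nat (Suc m - p) * c p (Suc m - p)) *\<^sub>m z p (Suc m - p) = c p (m - p) *\<^sub>m z p (Suc (m - p))"
      if "p \<le> m" for p
    proof -
      have "Suc m - p = Suc (m - p)" using that by simp
      thus ?thesis by (simp only: c2)
    qed
    thus ?thesis by simp
  qed
  also have "(\<Sum>p\<le>m. c p (m - p) *\<^sub>m z (Suc p) (m - p)) + (\<Sum>p\<le>m. c p (m - p) *\<^sub>m z p (Suc (m - p)))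
      = lb s (Y m)"
    unfolding Y_def by (simp add: lb_sum_right lb_simps z fm.scale_right_distrib sum.distrib)
  finally have eq: "of_nat (Suc m) *\<^sub>m Y (Suc m) = lb s (Y m)" .
  have "Y m \<in> S" using Suc unfolding Y_def c_def .
  hence "lb s (Y m) \<in> S" using S s unfolding lie_sub_def by blast
  hence "(1 / of_nat (Suc m)) *\<^sub>m (of_nat (Suc m) *\<^sub>m Y (Suc m)) \<in> S"
    using eq S fm.subspace_scale unfolding lie_sub_def by metis
  hence "Y (Suc m) \<in> S" by (simp del: of_nat_Suc)
  thus ?case unfolding Y_def c_def .
qed

text \<open>Products of exponential generating functions. With these, a family of identities indexed
  by \<open>m\<close> becomes one equation in the integral domain of formal power series.\<close>

lemma fps_exp_sum:
  "fps_nth (Abs_fps (\<lambda>p. f p / fact p) * Abs_fps (\<lambda>p. g p / fact p)) m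
    = (\<Sum>p\<le>m. (f p * g (m - p)) / (fact p * fact (m - p) :: complex))"
  unfolding fps_mult_nth by (simp add: atLeast0AtMost)

subsection \<open>Polarization\<close>

lemma foldr_diff: "foldr (*) xs (v - w) = foldr (*) xs v - foldr (*) xs (w :: fmat)"
  by (induction xs) (simp_all add: right_diff_distrib)

lemma foldr_add: "foldr (*) xs (v + w) = foldr (*) xs v + foldr (*) xs (w :: fmat)"
  by (induction xs) (simp_all add: algebra_simps)

lemma foldr_scale: "foldr (*) xs (c *\<^sub>m v) = c *\<^sub>m foldr (*) xs (v :: fmat)"
  by (induction xs) simp_all

lemma foldr_sum: "foldr (*) xs (sum f X) = (\<Sum>x\<in>X. foldr (*) xs (f x :: fmat))"
proof (induction X rule: infinite_finite_induct)
  case (insert x F)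
  thus ?case by (simp add: foldr_add)
qed (use foldr_diff[of xs 0 0] in auto)

lemma foldr_replicate: "foldr (*) (replicate p s) w = pl s p w"
  by (induction p) simp_all

text \<open>\<open>qq s x w r i\<close> is the sum of all words with \<open>i\<close> letters
  \<open>x\<close> and \<open>r - i\<close> letters \<open>s\<close>, applied to \<open>w\<close>:
  the coefficient of \<open>l ^ i\<close> in the \<open>r\<close>-th power of
  \<open>s + l x\<close>.\<close>

fun qq :: "fmat \<Rightarrow> fmat \<Rightarrow> fmat \<Rightarrow> nat \<Rightarrow> nat \<Rightarrow> fmat" where
  "qq s x w 0 0 = w"
| "qq s x w 0 (Suc i) = 0"
| "qq s x w (Suc r) 0 = s * qq s x w r 0"
| "qq s x w (Suc r) (Suc i) = s * qq s x w r (Suc i) + x * qq s x w r i"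

lemma qq_0: "qq s x w r 0 = pl s r w"
  by (induction r) simp_all

lemma qq_big: "r < i \<Longrightarrow> qq s x w r i = 0"
proof (induction r arbitrary: i)
  case 0
  thus ?case by (cases i) simp_all
next
  case (Suc r)
  thus ?case by (cases i) simp_all
qed

lemma qq_expand: "pl (s + l *\<^sub>m x) r w = (\<Sum>i\<le>r. (l ^ i) *\<^sub>m qq s x w r i)"
proof (induction r)
  case (Suc r)
  have "(\<Sum>i\<le>Suc r. (l ^ i) *\<^sub>m qq s x w (Suc r) i)
      = s * qq s x w r 0 + (\<Sum>i\<le>r. (l ^ Suc i) *\<^sub>m (s * qq s x w r (Suc i) + x * qq s x w r i))"
    by (subst sum.atMost_Suc_shift) simp
  also have "\<dots> = (s * qq s x w r 0 + (\<Sum>i\<le>r. (l ^ Suc i) *\<^sub>m (s * qq s x w r (Suc i))))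
      + (\<Sum>i\<le>r. (l ^ Suc i) *\<^sub>m (x * qq s x w r i))"
    by (simp only: fm.scale_right_distrib sum.distrib add.assoc)
  also have "s * qq s x w r 0 + (\<Sum>i\<le>r. (l ^ Suc i) *\<^sub>m (s * qq s x w r (Suc i)))
      = (\<Sum>i\<le>Suc r. (l ^ i) *\<^sub>m (s * qq s x w r i))"
    by (subst sum.atMost_Suc_shift) simp
  also have "\<dots> = (\<Sum>i\<le>r. (l ^ i) *\<^sub>m (s * qq s x w r i))"
    by (simp add: qq_big)
  finally show ?case
    using Suc by (simp add: distrib_right sum_distrib_left fm.scale_sum_right mult.commute)
qed simp

text \<open>Induction on the length. Exchanging neighbouring letters changes a word by a word one
  letter shorter, since \<open>S\<close> is closed under brackets; so \<open>f\<close> does not see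
  the order of the letters. It remains to polarize the power: \<open>f\<close> of a power of
  \<open>s + l x\<close> is a polynomial in \<open>l\<close> that vanishes identically.\<close>

lemma polarize_words:
  assumes S: "lie_sub S"
    and f: "\<And>x y. f (x + y) = f x + f y" "\<And>c x. f (c *\<^sub>m x) = (c :: complex) * f x"
    and pow: "\<And>s p. s \<in> S \<Longrightarrow> f (pl s p w) = 0"
  shows "set xs \<subseteq> S \<Longrightarrow> f (foldr (*) xs w) = 0"
proof (induction "length xs" arbitrary: xs rule: less_induct)
  case less
  define m where "m = length xs"
  have IH: "f (foldr (*) ys w) = 0" if "set ys \<subseteq> S" "length ys < m" for ys
    using less(1) that m_def by blast
  have fd: "f (x - y) = f x - f y" for x y
    using f(1)[of "x - y" y] by simp
  have f0: "f 0 = 0" using f(2)[of 0 0] by simp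
  have fsum: "f (sum g X) = (\<Sum>x\<in>X. f (g x))" for g and X :: "nat set"
    by (induction X rule: infinite_finite_induct) (auto simp: f0 f(1))
  have swap: "f (foldr (*) (xs @ a # b # ys) w) = f (foldr (*) (xs @ b # a # ys) w)"
    if "set xs \<subseteq> S" "a \<in> S" "b \<in> S" "set ys \<subseteq> S" "length xs + length ys + 2 = m" for xs a b ys
  proof -
    have "f (foldr (*) (xs @ lb a b # ys) w) = 0"
      by (rule IH) (use that S in \<open>auto simp: lie_sub_def\<close>)
    moreover have "foldr (*) (xs @ lb a b # ys) w
        = foldr (*) (xs @ a # b # ys) w - foldr (*) (xs @ b # a # ys) w"
      by (simp add: foldr_diff[symmetric] lb_def algebra_simps)
    ultimately show ?thesis by (simp add: fd)
  qed
  \<comment> \<open>The \<open>r\<close> words with exactly one letter \<open>x\<close> all have the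
    same value under \<open>f\<close>.\<close>
  have first: "f (foldr (*) ys (qq s x w r 1)) = of_nat r * f (foldr (*) (ys @ x # replicate (r - 1) s) w)"
    if "set ys \<subseteq> S" "s \<in> S" "x \<in> S" "length ys + r = m" for ys s x r
    using that(1,4)
  proof (induction r arbitrary: ys)
    case 0
    show ?case using foldr_scale[of ys 0 0] by (simp add: f0)
  next
    case (Suc r)
    show ?case
    proof (cases r)
      case 0
      thus ?thesis by simp
    next
      case (Suc r')
      have "f (foldr (*) ys (s * qq s x w r 1)) = f (foldr (*) (ys @ [s]) (qq s x w r 1))" by simp
      also have "\<dots> = of_nat r * f (foldr (*) ((ys @ [s]) @ x # replicate (r - 1) s) w)"
        by (rule Suc.IH) (use Suc.prems that in auto)
      also have "f (foldr (*) ((ys @ [s]) @ x # replicate (r - 1) s) w)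
          = f (foldr (*) (ys @ x # s # replicate (r - 1) s) w)"
      proof -
        have "set (replicate (r - 1) s) \<subseteq> S" using that(2) by auto
        thus ?thesis using swap[of ys s x "replicate (r - 1) s"] Suc.prems that(2,3) Suc by auto
      qed
      also have "s # replicate (r - 1) s = replicate r s" using Suc by simp
      finally have 1: "f (foldr (*) ys (s * qq s x w r 1)) = of_nat r * f (foldr (*) (ys @ x # replicate r s) w)" .
      have 2: "f (foldr (*) ys (x * qq s x w r 0)) = f (foldr (*) (ys @ x # replicate r s) w)"
        by (simp add: qq_0 foldr_replicate)
      have "qq s x w (Suc r) 1 = s * qq s x w r 1 + x * qq s x w r 0" by simp
      thus ?thesis by (simp add: foldr_add f(1) 1 2 distrib_right add.commute del: qq.simps One_nat_def)
    qed
  qed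
  \<comment> \<open>Arbitrary letters are introduced one at a time from the left: \<open>ys\<close>
    is the part already general, the rest is a power of one element \<open>s\<close>.\<close>
  have "f (foldr (*) (ys @ replicate (m - length ys) s) w) = 0"
    if "set ys \<subseteq> S" "s \<in> S" "length ys \<le> m" for ys s
    using that
  proof (induction ys arbitrary: s rule: rev_induct)
    case Nil
    thus ?case by (simp add: foldr_replicate pow)
  next
    case (snoc x ys)
    define r where "r = m - length ys"
    have r: "r > 0" "length ys + r = m" "m - length (ys @ [x]) = r - 1" using snoc.prems unfolding r_def by auto
    have "(\<Sum>i\<le>r. f (foldr (*) ys (qq s x w r i)) * l ^ i) = 0" for l
    proof -
      have "s + l *\<^sub>m x \<in> S" using snoc.prems S unfolding lie_sub_def
        by (auto intro: fm.subspace_add fm.subspace_scale)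
      hence "f (foldr (*) (ys @ replicate r (s + l *\<^sub>m x)) w) = 0"
        using snoc.IH[of "s + l *\<^sub>m x"] snoc.prems unfolding r_def by auto
      thus ?thesis by (simp add: foldr_replicate qq_expand foldr_sum foldr_scale fsum f(2) mult.commute)
    qed
    hence "\<forall>i\<le>r. f (foldr (*) ys (qq s x w r i)) = 0"
      using polyfun_eq_0[of "\<lambda>i. f (foldr (*) ys (qq s x w r i))" r] by blast
    hence "f (foldr (*) ys (qq s x w r 1)) = 0" using r(1) by auto
    hence "of_nat r * f (foldr (*) (ys @ x # replicate (r - 1) s) w) = 0"
      using first[of ys s x r] snoc.prems r(2) by (simp del: One_nat_def)
    thus ?case using r by simp
  qed
  \<comment> \<open>With \<open>xs\<close> as prefix the power is empty, so \<open>0\<close> serves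
    as a dummy \<open>s\<close>.\<close>
  from this[of xs 0] less(2) S show ?case unfolding m_def lie_sub_def
    by (auto simp: fm.subspace_0)
qed

text \<open>The words applied to \<open>w\<close> span a space stable under \<open>alg S\<close>, so
  vanishing on powers extends to the whole associative algebra.\<close>

lemma polarize:
  assumes S: "lie_sub S"
    and f: "\<And>x y. f (x + y) = f x + f y" "\<And>c x. f (c *\<^sub>m x) = (c :: complex) * f x"
    and pow: "\<And>s p. s \<in> S \<Longrightarrow> f (pl s p w) = 0"
    and T: "T \<in> alg S"
  shows "f (T * w) = 0"
proof -
  define X where "X = fm.span {foldr (*) xs w |xs. set xs \<subseteq> S}"
  have f0: "f 0 = 0" using f(2)[of 0 0] by simp
  have "T * x \<in> X" if "x \<in> X" for x
    using T that
  proof (induction arbitrary: x rule: alg.induct)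
    case (base s)
    from base(2) show ?case unfolding X_def
    proof (induction rule: fm.span_induct_alt)
      case base
      show ?case by (simp add: fm.span_zero)
    next
      case (step c y z)
      then obtain xs where xs: "y = foldr (*) xs w" "set xs \<subseteq> S" by blast
      have "s * y \<in> fm.span {foldr (*) xs w |xs. set xs \<subseteq> S}"
        by (rule fm.span_base) (use xs base in \<open>auto intro!: exI[of _ "s # xs"]\<close>)
      thus ?case using step by (simp add: distrib_left fm.span_add fm.span_scale)
    qed
  next
    case (add T T')
    thus ?case unfolding X_def by (simp add: distrib_right fm.span_add)
  next
    case (scale T c)
    thus ?case unfolding X_def by (simp add: fm.span_scale)
  qed (simp add: mult.assoc)
  moreover have "w \<in> X" unfolding X_def by (rule fm.span_base) (auto intro!: exI[of _ "[]"])
  ultimately have "T * w \<in> X" by blast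
  thus ?thesis unfolding X_def
  proof (induction rule: fm.span_induct_alt)
    case (step c y z)
    thus ?case using polarize_words[OF S f pow] by (auto simp: f)
  qed (rule f0)
qed

section \<open>Irreducible algebras without an invariant form\<close>

text \<open>\<open>E k 0\<close> represents the basis vector \<open>e_k\<close> as a column. Finite
  codimension alone would give some nonzero \<open>y\<close> with zero corner; the arguments below
  need one that does not kill a given vector.\<close>

definition deep :: "fmat set \<Rightarrow> bool" where
  "deep S \<longleftrightarrow> (\<forall>n k. \<exists>y\<in>S. corner n y \<and> y * E k 0 \<noteq> 0)"

abbreviation pr :: "fmat \<Rightarrow> nat \<Rightarrow> fmat \<Rightarrow> fmat" where
  "pr s q \<equiv> ((\<lambda>x. x * s) ^^ q)"

lemma pr_mult: "pr s q (x * y) = x * pr s q y"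
  by (induction q) (simp_all add: mult.assoc)

lemma pr_pl: "pr s q x * y = x * pl s q y"
  by (induction q arbitrary: y) (simp_all add: mult.assoc funpow_swap1 pl_mult)

text \<open>The sums are the coefficients of \<open>A(t) A(-t)\<close> for the exponential
  generating function \<open>A\<close> of \<open>a\<close>, and power series have no zero
  divisors.\<close>

lemma fps_exp_neg_zero:
  fixes a :: "nat \<Rightarrow> complex"
  assumes "\<And>m. (\<Sum>p\<le>m. (a p * ((-1) ^ (m - p) * a (m - p))) / (fact p * fact (m - p))) = 0"
  shows "a p = 0"
proof -
  define A where "A = Abs_fps (\<lambda>p. a p / fact p)"
  define B where "B = Abs_fps (\<lambda>p. ((-1) ^ p * a p) / fact p)"
  have "A * B = 0"
    by (rule fps_ext) (simp add: A_def B_def fps_exp_sum[of a "\<lambda>p. (-1) ^ p * a p"] assms)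
  hence "A = 0 \<or> B = 0" by simp
  hence "fps_nth A p = 0 \<or> fps_nth B p = 0" by auto
  thus ?thesis by (auto simp: A_def B_def)
qed

lemma lie_sub_diff: "lie_sub S \<Longrightarrow> x \<in> S \<Longrightarrow> y \<in> S \<Longrightarrow> x - y \<in> S"
  and lie_sub_add: "lie_sub S \<Longrightarrow> x \<in> S \<Longrightarrow> y \<in> S \<Longrightarrow> x + y \<in> S"
  and lie_sub_scale: "lie_sub S \<Longrightarrow> x \<in> S \<Longrightarrow> c *\<^sub>m x \<in> S"
  and lie_sub_lb: "lie_sub S \<Longrightarrow> x \<in> S \<Longrightarrow> y \<in> S \<Longrightarrow> lb x y \<in> S"
  and lie_sub_0: "lie_sub S \<Longrightarrow> 0 \<in> S"
  by (auto simp: lie_sub_def fm.subspace_diff fm.subspace_add fm.subspace_scale fm.subspace_0)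

lemma scale_mem_cancel:
  assumes "lie_sub S" "c *\<^sub>m x \<in> S" "c \<noteq> 0"
  shows "x \<in> S"
  using lie_sub_scale[OF assms(1,2), of "1 / c"] assms(3) by simp

text \<open>For \<open>y\<close>, \<open>y'\<close> in \<open>S\<close> with zero corner,
  \<open>y * E 0 j\<close> and \<open>E i j * y'\<close> lie in \<open>S\<close>, and their bracket
  is a multiple of \<open>E i j\<close> because \<open>i \<noteq> j\<close>. If \<open>E i j\<close>
  were missing, the factor, entry \<open>(j, 0)\<close> of \<open>y' * y\<close>, would always
  vanish. From this, entry \<open>(j, 0)\<close> of \<open>T * y\<close> is shown to vanish for all
  \<open>T\<close>, hence column \<open>0\<close> of \<open>y\<close>, against the choice of
  \<open>y\<close>.\<close>

theorem no_form:
  assumes S: "lie_sub S" and A: "alg S = UNIV" and deep: "deep S"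
    and all: "\<And>T. (T, 0) \<in> pairs S" "\<And>T. (0, T) \<in> pairs S"
    and ij: "i \<noteq> j"
  shows "E i j \<in> S"
proof (rule ccontr)
  assume nE: "E i j \<notin> S"
  obtain n1 where n1: "\<And>y. y \<in> S \<Longrightarrow> corner n1 y \<Longrightarrow> y * E 0 j \<in> S"
    using corner_lemma[OF S all(1)[of "E 0 j"]] by auto
  obtain n2 where n2: "\<And>y. y \<in> S \<Longrightarrow> corner n2 y \<Longrightarrow> E i j * y \<in> S"
    using corner_lemma[OF S all(2)[of "E i j"]] by auto
  define n where "n = max n1 n2"
  have orth: "ent (y' * y) j 0 = 0" if y: "y \<in> S" "y' \<in> S" "corner n y" "corner n y'" for y y'
  proof (rule ccontr)
    assume c: "ent (y' * y) j 0 \<noteq> 0"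
    have "y * E 0 j \<in> S" "E i j * y' \<in> S"
      using y n1 n2 corner_mono unfolding n_def by (metis max.cobounded1 max.cobounded2)+
    hence "lb (E i j * y') (y * E 0 j) \<in> S" by (rule lie_sub_lb[OF S, rotated])
    moreover have "(y * E 0 j) * (E i j * y') = y * (E 0 j * E i j) * y'" by (simp only: mult.assoc)
    moreover have "(E i j * y') * (y * E 0 j) = E i j * (y' * y) * E 0 j" by (simp only: mult.assoc)
    ultimately have "ent (y' * y) j 0 *\<^sub>m E i j \<in> S"
      using ij by (simp add: lb_def E_mult_E E_sandwich)
    thus False using scale_mem_cancel[OF S] c nE by blast
  qed
  obtain F where F: "finite F" "F \<subseteq> S" "\<forall>s\<in>S. \<exists>t\<in>fm.span F. corner n (s - t)"
    using corner_codim[of S n] S unfolding lie_sub_def by auto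
  obtain N0 where N0: "\<forall>A\<in>F. bnd N0 A" using bnd_finite[OF F(1)] by blast
  \<comment> \<open>Large enough for the corrections \<open>t\<close>, and positive, so that column
    \<open>0\<close> of \<open>t * y\<close> vanishes.\<close>
  define N where "N = max N0 (max n (Suc j))"
  obtain y where y: "y \<in> S" "corner N y" "y * E 0 0 \<noteq> 0" using deep unfolding deep_def by blast
  have yn: "corner n y" using corner_mono[OF y(2)] unfolding N_def by simp
  have sy: "ent (s * y) j 0 = 0" if s: "s \<in> S" for s
  proof -
    obtain t where t: "t \<in> fm.span F" "corner n (s - t)" using F(3) s by blast
    have "bnd N t"
      by (rule span_bnd[OF _ t(1)]) (use N0 bnd_mono in \<open>auto simp: N_def\<close>)
    hence "ent (t * y) j 0 = 0" using corner_mult(2)[OF _ y(2)] unfolding N_def by auto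
    moreover have "t \<in> S" using t(1) fm.span_minimal[OF F(2)] S unfolding lie_sub_def by auto
    hence "ent ((s - t) * y) j 0 = 0" using orth[OF y(1) _ yn t(2)] lie_sub_diff[OF S s] by blast
    ultimately show ?thesis by (simp add: left_diff_distrib)
  qed
  \<comment> \<open>A rank-one element of \<open>S\<close>. As \<open>W x W\<close> is
    \<open>W\<close> times the entry \<open>(j, 0)\<close> of \<open>x * y\<close>, the fact
    \<open>sy\<close> says that \<open>W s W = 0\<close> for all \<open>s\<close> in
    \<open>S\<close>.\<close>
  define W where "W = y * E 0 j"
  have W: "W \<in> S" using n1 y(1) corner_mono[OF yn] unfolding W_def n_def by simp
  have WxW: "W * (x * W) = ent (x * y) j 0 *\<^sub>m W" for x
  proof -
    have "W * (x * W) = y * (E 0 j * (x * y) * E 0 j)" unfolding W_def by (simp only: mult.assoc)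
    also have "\<dots> = ent (x * y) j 0 *\<^sub>m W" unfolding W_def E_sandwich by simp
    finally show ?thesis .
  qed
  have Wn: "W \<noteq> 0"
  proof
    assume "W = 0"
    hence "W * E j 0 = 0" by simp
    thus False using y(3) unfolding W_def by (simp add: mult.assoc)
  qed
  have pow: "ent (pl s p y) j 0 = 0" if s: "s \<in> S" for s p
  proof -
    define a where "a p = ent (pl s p y) j 0" for p
    \<comment> \<open>Terms of \<open>exp (t s) W exp (- t s)\<close>, whose coefficients lie in
      \<open>S\<close>. Hence the series vanishes between two factors \<open>W\<close>, where it
      equals \<open>a(t) a(-t) W\<close>.\<close>
    define z where "z p q = ((-1) ^ q) *\<^sub>m pr s q (pl s p W)" for p q :: nat
    have aW: "W * pl s p W = a p *\<^sub>m W" for p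
    proof (cases p)
      case 0
      have "W * W = y * (E 0 j * y * E 0 j)" unfolding W_def by (simp only: mult.assoc)
      thus ?thesis using 0 unfolding E_sandwich by (simp add: a_def W_def)
    next
      case (Suc p')
      have "pl s p W = pl s p y * E 0 j" unfolding W_def by (simp only: pl_mult)
      hence "W * pl s p W = y * (E 0 j * pl s p y * E 0 j)" unfolding W_def by (simp only: mult.assoc)
      thus ?thesis unfolding E_sandwich by (simp add: a_def W_def)
    qed
    have zz: "lb s (z p q) = z (Suc p) q + z p (Suc q)" for p q
    proof -
      have "s * pr s q (pl s p W) = pr s q (pl s (Suc p) W)" by (simp add: pr_mult)
      thus ?thesis unfolding z_def lb_def by simp
    qed
    have "z 0 0 \<in> S" using W by (simp add: z_def)
    note Y = exp_coeff_mem[OF S s this zz]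
    have "(\<Sum>p\<le>m. (a p * ((-1) ^ (m - p) * a (m - p))) / (fact p * fact (m - p))) = 0" for m
    proof -
      define Y where "Y = (\<Sum>p\<le>m. (1 / (fact p * fact (m - p))) *\<^sub>m z p (m - p))"
      have "Y \<in> S" using Y unfolding Y_def .
      hence "W * (Y * W) = 0" using WxW sy by simp
      moreover have "W * (z p q * W) = (a p * ((-1) ^ q * a q)) *\<^sub>m W" for p q
      proof -
        have "W * (pr s q (pl s p W) * W) = (W * pl s p W) * pl s q W"
          by (simp only: pr_pl mult.assoc)
        also have "\<dots> = (a p * a q) *\<^sub>m W" by (simp add: aW mult.commute)
        finally show ?thesis unfolding z_def by (simp add: mult_ac)
      qed
      hence "W * (Y * W) = (\<Sum>p\<le>m. ((a p * ((-1) ^ (m - p) * a (m - p))) / (fact p * fact (m - p))) *\<^sub>m W)"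
        unfolding Y_def by (simp add: sum_distrib_left sum_distrib_right)
      ultimately have "(\<Sum>p\<le>m. (a p * ((-1) ^ (m - p) * a (m - p))) / (fact p * fact (m - p))) *\<^sub>m W = 0"
        by (simp add: scaleM_sum_left)
      thus ?thesis using Wn by (simp only: fm.scale_eq_0_iff) simp
    qed
    from fps_exp_neg_zero[OF this, of p] show ?thesis unfolding a_def .
  qed
  have "ent (T * y) j 0 = 0" for T
    by (rule polarize[of S "\<lambda>x. ent x j 0" y]) (simp_all add: S A pow)
  \<comment> \<open>\<open>E j a\<close> moves entry \<open>(a, 0)\<close> of \<open>y\<close> to
    position \<open>(j, 0)\<close>.\<close>
  from this[of "E j _"] have "ent y a 0 = 0" for a by simp
  hence "y * E 0 0 = 0" by (intro fmat_eqI) auto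
  thus False using y(3) by blast
qed

section \<open>Irreducible algebras with an invariant form\<close>

text \<open>An involution, later recognised as taking adjoints with respect to a bilinear form on
  columns.\<close>

locale star =
  fixes st :: "fmat \<Rightarrow> fmat"
  assumes st_add: "st (x + y) = st x + st y"
    and st_scale: "st (c *\<^sub>m x) = c *\<^sub>m st x"
    and st_mult: "st (x * y) = st y * st x"
    and st_st: "st (st x) = x"
begin

lemma st_0: "st 0 = 0"
  using st_scale[of 0 0] by simp

lemma st_diff: "st (x - y) = st x - st y"
  using st_add[of "x - y" y] by (simp add: algebra_simps)

lemma st_sum: "st (sum f X) = (\<Sum>x\<in>X. st (f x))"
  by (induction X rule: infinite_finite_induct) (auto simp: st_0 st_add)

lemma st_eq_0: "st x = 0 \<Longrightarrow> x = 0"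
  using st_st st_0 by metis

text \<open>\<open>st (E 0 0)\<close> is an idempotent of rank one; \<open>C\<close> and \<open>C'\<close> connect it with \<open>E 0 0\<close>, and
  \<open>st C = \<kappa> C\<close> makes the sign of the form appear.\<close>

definition "R = st (E 0 0)"

text \<open>\<open>E 0 0\<close> and \<open>R\<close> are idempotents of rank one, so
  \<open>R X R\<close> is always a multiple of \<open>R\<close>, and products through a nonzero
  entry \<open>(l, k)\<close> of \<open>R\<close> yield mutually inverse \<open>C\<close> and
  \<open>C'\<close> between them. Both \<open>C\<close> and \<open>st C\<close> lie on the line of
  all \<open>E 0 0 X R\<close>, so they are proportional, and \<open>st (st C) = C\<close> makes the
  square of the factor \<open>1\<close>.\<close>

lemma form_ex:
  "\<exists>k C C'. E 0 0 * C = C \<and> C * R = C \<and> R * C' = C' \<and> C' * E 0 0 = C' \<and> C * C' = E 0 0 \<and> C' * C = R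
     \<and> st C = k *\<^sub>m C \<and> k * k = 1"
proof -
  have RR: "R * R = R" unfolding R_def by (simp flip: st_mult)
  have "R \<noteq> 0" unfolding R_def using st_eq_0 E_nonzero by blast
  then obtain l k where lk: "ent R l k \<noteq> 0" using fmat_nonzero_ex by blast
  have RXR: "\<exists>c. R * X * R = c *\<^sub>m R" for X
  proof -
    have "R * X * R = st (E 0 0 * st X * E 0 0)" by (simp add: st_mult st_st R_def mult.assoc)
    thus ?thesis unfolding E_sandwich st_scale R_def by blast
  qed
  obtain c where c: "R * E k l * R = c *\<^sub>m R" using RXR by blast
  have "ent R l k * ent R l k = c * ent R l k"
  proof -
    \<comment> \<open>The scalar in \<open>R * E k l * R = c R\<close> is found by comparing entry
      \<open>(l, k)\<close>.\<close>
    have "E l l * (R * E k l * R) * E k k = (E l l * R * E k l) * (R * E k k)" by (simp only: mult.assoc)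
    also have "\<dots> = (ent R l k *\<^sub>m E l l) * (R * E k k)" by (simp only: E_sandwich)
    also have "\<dots> = (ent R l k * ent R l k) *\<^sub>m E l k" by (simp add: E_sandwich')
    finally have "E l l * (c *\<^sub>m R) * E k k = (ent R l k * ent R l k) *\<^sub>m E l k" using c by simp
    hence "(c * ent R l k) *\<^sub>m E l k = (ent R l k * ent R l k) *\<^sub>m E l k"
      by (simp add: E_sandwich)
    thus ?thesis by auto
  qed
  hence c': "c = ent R l k" using lk by simp
  define C where "C = E 0 l * R"
  define C' where "C' = (1 / ent R l k) *\<^sub>m (R * E k 0)"
  have 1: "E 0 0 * C = C" "C * R = C" "R * C' = C'" "C' * E 0 0 = C'"
    unfolding C_def C'_def by (simp_all add: mult.assoc RR) (simp_all add: mult.assoc[symmetric] RR)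
  have "C * C' = (1 / ent R l k) *\<^sub>m (E 0 l * (R * R) * E k 0)"
    unfolding C_def C'_def by (simp add: mult.assoc)
  hence 2: "C * C' = E 0 0" unfolding RR E_sandwich using lk by simp
  have "C' * C = (1 / ent R l k) *\<^sub>m (R * (E k 0 * E 0 l) * R)"
    unfolding C_def C'_def by (simp only: scaleM_mult_left scaleM_mult_right mult.assoc)
  hence 3: "C' * C = R" using c c' lk by simp
  have "st C = E 0 0 * (st C * R)"
  proof -
    have "st C = st (E 0 0 * C * R)" using 1 by simp
    also have "\<dots> = E 0 0 * (st C * R)" by (simp add: st_mult R_def st_st)
    finally show ?thesis .
  qed
  also have "\<dots> = E 0 0 * (st C * C') * E 0 0 * C"
    using 1 3 by (simp add: mult.assoc)
  also have "\<dots> = ent (st C * C') 0 0 *\<^sub>m C" unfolding E_sandwich using 1 by simp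
  finally have 4: "st C = ent (st C * C') 0 0 *\<^sub>m C" .
  define \<kappa> where "\<kappa> = ent (st C * C') 0 0"
  have "C = st (st C)" by (simp add: st_st)
  also have "\<dots> = (\<kappa> * \<kappa>) *\<^sub>m C"
    using 4 by (simp add: st_scale \<kappa>_def[symmetric])
  finally have "1 *\<^sub>m C = (\<kappa> * \<kappa>) *\<^sub>m C" by simp
  moreover have "C \<noteq> 0" using 2 by auto
  ultimately have "\<kappa> * \<kappa> = 1" using fm.scale_right_imp_eq by metis
  thus ?thesis using 1 2 3 4 unfolding \<kappa>_def by blast
qed

definition \<kappa> :: complex where
  "\<kappa> = (SOME k. \<exists>C C'. E 0 0 * C = C \<and> C * R = C \<and> R * C' = C' \<and> C' * E 0 0 = C'
     \<and> C * C' = E 0 0 \<and> C' * C = R \<and> st C = k *\<^sub>m C \<and> k * k = 1)"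

definition C :: fmat where
  "C = (SOME C. \<exists>C'. E 0 0 * C = C \<and> C * R = C \<and> R * C' = C' \<and> C' * E 0 0 = C'
     \<and> C * C' = E 0 0 \<and> C' * C = R \<and> st C = \<kappa> *\<^sub>m C \<and> \<kappa> * \<kappa> = 1)"

lemma C_ex: "\<exists>C'. E 0 0 * C = C \<and> C * R = C \<and> R * C' = C' \<and> C' * E 0 0 = C'
     \<and> C * C' = E 0 0 \<and> C' * C = R \<and> st C = \<kappa> *\<^sub>m C \<and> \<kappa> * \<kappa> = 1"
  unfolding C_def by (rule someI_ex) (use someI_ex[OF form_ex] in \<open>unfold \<kappa>_def\<close>)

lemma C_props: "E 0 0 * C = C" "C * R = C" "st C = \<kappa> *\<^sub>m C" "\<kappa> * \<kappa> = 1"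
  using C_ex by blast+

text \<open>The row vector representing the functional \<open>B u\<close>: for a column
  \<open>u\<close> the matrix \<open>st u\<close> starts with \<open>R\<close>, and \<open>C\<close>
  carries it to row \<open>0\<close>.\<close>

definition dag :: "fmat \<Rightarrow> fmat" where "dag u = C * st u"

definition B :: "fmat \<Rightarrow> fmat \<Rightarrow> complex" where "B u v = ent (dag u * v) 0 0"

abbreviation vec :: "fmat \<Rightarrow> bool" where "vec u \<equiv> u * E 0 0 = u"

lemma dag_row: "E 0 0 * dag u = dag u"
  unfolding dag_def using C_props(1) by (simp add: mult.assoc[symmetric])

lemma dag_mult: "vec v \<Longrightarrow> dag u * v = B u v *\<^sub>m E 0 0"
proof -
  assume v: "vec v"
  have "dag u * v = E 0 0 * (dag u * v) * E 0 0"
    using v dag_row by (metis mult.assoc)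
  thus ?thesis unfolding E_sandwich B_def .
qed

lemma dag_add: "dag (u + v) = dag u + dag v"
  and dag_scale: "dag (c *\<^sub>m u) = c *\<^sub>m dag u"
  and dag_act: "dag (T * u) = dag u * st T"
  unfolding dag_def by (simp_all add: st_add st_scale st_mult distrib_left mult.assoc)

lemma B_lin: "B (u + v) w = B u w + B v w" "B w (u + v) = B w u + B w v"
  "B (c *\<^sub>m u) w = c * B u w" "B w (c *\<^sub>m u) = c * B w u"
  unfolding B_def by (simp_all add: dag_add dag_scale distrib_left distrib_right)

lemma B_adj: "B (T * u) v = B u (st T * v)"
  unfolding B_def dag_act by (simp add: mult.assoc)

lemma st_rank1: "st (u * dag v) = \<kappa> *\<^sub>m (v * dag u)"
proof -
  have "st (u * (C * st v)) = v * (\<kappa> *\<^sub>m C) * st u"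
    by (simp add: st_mult st_st C_props(3) mult.assoc)
  thus ?thesis unfolding dag_def by (simp add: mult.assoc)
qed

text \<open>Apply \<open>st\<close> to the rank-one identity \<open>dag_mult\<close> and use that
  \<open>st C\<close> is \<open>\<kappa>\<close> times \<open>C\<close>; so \<open>\<kappa>\<close>
  is the sign of the form.\<close>

lemma B_sym: assumes "vec u" "vec v" shows "B u v = \<kappa> * B v u"
proof -
  have "R * st v = st v" using assms(2) unfolding R_def by (simp flip: st_mult)
  have "st (dag u * v) = B u v *\<^sub>m R" using dag_mult[OF assms(2)] by (simp add: st_scale R_def)
  hence "C * st (dag u * v) = B u v *\<^sub>m C" by (simp add: C_props(2))
  moreover have "C * st (dag u * v) = (\<kappa> * B v u) *\<^sub>m C"
  proof -
    have "C * st (dag u * v) = \<kappa> *\<^sub>m ((dag v * u) * C)"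
      unfolding dag_def by (simp add: st_mult st_st C_props(3) mult.assoc)
    also have "\<dots> = (\<kappa> * B v u) *\<^sub>m C" using dag_mult[OF assms(1)] C_props(1) by simp
    finally show ?thesis .
  qed
  moreover have "C \<noteq> 0" using C_ex by (metis E_nonzero mult_zero_left)
  ultimately show ?thesis using fm.scale_right_imp_eq by metis
qed

lemma dag_inj: assumes "vec u" "dag u = 0" shows "u = 0"
proof -
  obtain C' where C': "C' * C = R" using C_ex by blast
  have "R * st u = st u" using assms(1) unfolding R_def by (simp flip: st_mult)
  hence "st u = C' * dag u" unfolding dag_def using C' by (simp add: mult.assoc[symmetric])
  thus ?thesis using assms(2) st_eq_0 by simp
qed

lemma dag_surj: assumes "E 0 0 * f = f" shows "\<exists>u. vec u \<and> dag u = f"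
proof -
  obtain C' where C': "R * C' = C'" "C * C' = E 0 0" using C_ex by blast
  define u where "u = st (C' * f)"
  have "dag u = f" unfolding dag_def u_def st_st using C'(2) assms by (simp add: mult.assoc[symmetric])
  moreover have "st (u * E 0 0) = st u"
    unfolding st_mult R_def[symmetric] using C'(1) by (simp add: u_def st_st mult.assoc[symmetric])
  hence "vec u" using st_st by metis
  ultimately show ?thesis by blast
qed

lemma \<kappa>_cases: "\<kappa> = 1 \<or> \<kappa> = -1"
  using C_props(4) by (metis square_eq_1_iff)

text \<open>The skew element built from two vectors: \<open>u \<and> v\<close> for a symmetric form,
  the symmetric product \<open>u v\<close> for an antisymmetric one.\<close>

definition wdg :: "fmat \<Rightarrow> fmat \<Rightarrow> fmat" where
  "wdg u v = u * dag v - \<kappa> *\<^sub>m (v * dag u)"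

lemma wdg_lin: "wdg (u + v) w = wdg u w + wdg v w" "wdg w (u + v) = wdg w u + wdg w v"
  "wdg (u - v) w = wdg u w - wdg v w" "wdg w (u - v) = wdg w u - wdg w v"
  "wdg (c *\<^sub>m u) w = c *\<^sub>m wdg u w" "wdg w (c *\<^sub>m u) = c *\<^sub>m wdg w u"
proof -
  have d: "dag (u - v) = dag u - dag v" unfolding dag_def by (simp add: st_diff right_diff_distrib)
  show "wdg (u - v) w = wdg u w - wdg v w" "wdg w (u - v) = wdg w u - wdg w v"
    unfolding wdg_def d
    by (simp_all add: left_diff_distrib right_diff_distrib fm.scale_right_diff_distrib)
qed (simp_all add: wdg_def dag_add dag_scale algebra_simps fm.scale_right_diff_distrib fm.scale_right_distrib)

lemma wdg_swap: "wdg v u = (- \<kappa>) *\<^sub>m wdg u v"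
  unfolding wdg_def using C_props(4) by (simp add: fm.scale_right_diff_distrib)

lemma st_wdg: "st (wdg u v) = - wdg u v"
  unfolding wdg_def using C_props(4) by (simp add: st_diff st_scale st_rank1)

lemma wdg_act: "vec c \<Longrightarrow> wdg a b * c = B b c *\<^sub>m a - (\<kappa> * B a c) *\<^sub>m b" if "vec a" "vec b"
  unfolding wdg_def using that by (simp add: left_diff_distrib mult.assoc dag_mult)

lemma lb_wdg: assumes "st s = - s" shows "lb s (wdg a b) = wdg (s * a) b + wdg a (s * b)"
  unfolding wdg_def lb_def using assms
  by (simp add: dag_act algebra_simps fm.scale_right_diff_distrib)

end

text \<open>In generating functions the hypothesis reads \<open>A B_ij = k H_j F_i\<close>. The
  right side is a matrix of rank at most one, so \<open>A^2 det B = 0\<close> for the two by two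
  matrix \<open>B\<close>; its determinant has constant term \<open>1\<close>, hence
  \<open>A = 0\<close>.\<close>

lemma fps_det_zero:
  fixes a :: "nat \<Rightarrow> complex" and b :: "nat \<Rightarrow> nat \<Rightarrow> nat \<Rightarrow> complex"
  assumes eq: "\<And>i j m. i < 2 \<Longrightarrow> j < 2 \<Longrightarrow>
      (\<Sum>p\<le>m. (a p * b i j (m - p) - k * (h j p * e i (m - p))) / (fact p * fact (m - p))) = 0"
    and b0: "\<And>i j. i < 2 \<Longrightarrow> j < 2 \<Longrightarrow> b i j 0 = (if i = j then 1 else 0)"
  shows "a p = 0"
proof -
  define A where "A = Abs_fps (\<lambda>p. a p / fact p)"
  define B where "B i j = Abs_fps (\<lambda>p. b i j p / fact p)" for i j
  define H where "H j = Abs_fps (\<lambda>p. h j p / fact p)" for j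
  define F where "F i = Abs_fps (\<lambda>p. e i p / fact p)" for i
  have AB: "A * B i j = fps_const k * (H j * F i)" if "i < 2" "j < 2" for i j
  proof (rule fps_ext)
    fix m
    have "fps_nth (A * B i j) m - fps_nth (fps_const k * (H j * F i)) m
        = (\<Sum>p\<le>m. (a p * b i j (m - p) - k * (h j p * e i (m - p))) / (fact p * fact (m - p)))"
      unfolding A_def B_def H_def F_def
      by (simp add: fps_exp_sum sum_distrib_left diff_divide_distrib sum_subtractf)
    thus "fps_nth (A * B i j) m = fps_nth (fps_const k * (H j * F i)) m" using eq[OF that] by simp
  qed
  have "A * A * (B 0 0 * B 1 1 - B 0 1 * B 1 0)
      = (A * B 0 0) * (A * B 1 1) - (A * B 0 1) * (A * B 1 0)" by (simp add: algebra_simps)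
  also have "\<dots> = 0" by (simp add: AB algebra_simps)
  finally have "A * A * (B 0 0 * B 1 1 - B 0 1 * B 1 0) = 0" .
  moreover have "fps_nth (B 0 0 * B 1 1 - B 0 1 * B 1 0) 0 = 1"
    using b0 unfolding B_def by simp
  hence "B 0 0 * B 1 1 - B 0 1 * B 1 0 \<noteq> 0" by (metis fps_zero_nth zero_neq_one)
  ultimately have "A = 0" by simp
  hence "fps_nth A p = 0" by simp
  thus ?thesis unfolding A_def by simp
qed

context star
begin

text \<open>The bracket of \<open>wdg w v\<close> and \<open>wdg w' v'\<close> contains the wanted
  term with a factor \<open>B w w'\<close>, terms known to lie in \<open>S\<close>, and the unwanted
  \<open>wdg w' w\<close> with factor \<open>B v v'\<close>. Exchanging \<open>w\<close> and
  \<open>w'\<close> and adding with weight \<open>\<kappa>\<close> doubles the wanted term and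
  cancels the unwanted one.\<close>

lemma form_step:
  assumes S: "lie_sub S" and v: "vec v" "vec v'" "vec w" "vec w'"
    and m: "wdg w v \<in> S" "wdg w v' \<in> S" "wdg w' v \<in> S" "wdg w' v' \<in> S" and nB: "B w w' \<noteq> 0"
  shows "wdg v v' \<in> S"
proof -
  have X: "(- \<kappa> * B x y) *\<^sub>m wdg v v' + B v v' *\<^sub>m wdg y x \<in> S"
    if "vec x" "vec y" "wdg x v \<in> S" "wdg x v' \<in> S" "wdg y v \<in> S" "wdg y v' \<in> S" for x y
  proof -
    have 1: "lb (wdg x v) (wdg y v') \<in> S" by (rule lie_sub_lb[OF S]) (use that in auto)
    have "lb (wdg x v) (wdg y v') = wdg (wdg x v * y) v' + wdg y (wdg x v * v')"
      by (rule lb_wdg[OF st_wdg])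
    also have "\<dots> = (B v y *\<^sub>m wdg x v' - (\<kappa> * B x y) *\<^sub>m wdg v v')
        + (B v v' *\<^sub>m wdg y x - (\<kappa> * B x v') *\<^sub>m wdg y v)"
      by (simp only: wdg_act[OF that(1) v(1) that(2)] wdg_act[OF that(1) v(1) v(2)] wdg_lin)
    finally have 2: "lb (wdg x v) (wdg y v') = (B v y *\<^sub>m wdg x v' - (\<kappa> * B x y) *\<^sub>m wdg v v')
        + (B v v' *\<^sub>m wdg y x - (\<kappa> * B x v') *\<^sub>m wdg y v)" .
    have "lb (wdg x v) (wdg y v') - B v y *\<^sub>m wdg x v' + (\<kappa> * B x v') *\<^sub>m wdg y v \<in> S"
      using S that 1 by (intro lie_sub_add lie_sub_diff lie_sub_scale)
    thus ?thesis unfolding 2 by (simp add: algebra_simps)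
  qed
  have "((- \<kappa> * B w w') *\<^sub>m wdg v v' + B v v' *\<^sub>m wdg w' w)
      + \<kappa> *\<^sub>m ((- \<kappa> * B w' w) *\<^sub>m wdg v v' + B v v' *\<^sub>m wdg w w') \<in> S"
    by (rule lie_sub_add[OF S X lie_sub_scale[OF S X]]) (use v m in auto)
  moreover have "\<kappa> *\<^sub>m ((- \<kappa> * B w' w) *\<^sub>m wdg v v' + B v v' *\<^sub>m wdg w w')
      = (- \<kappa> * B w w') *\<^sub>m wdg v v' - B v v' *\<^sub>m wdg w' w"
  proof -
    have "B w w' = \<kappa> * B w' w" using B_sym v by blast
    hence h1: "\<kappa> *\<^sub>m ((- \<kappa> * B w' w) *\<^sub>m wdg v v') = (- \<kappa> * B w w') *\<^sub>m wdg v v'"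
      by (simp add: mult_ac)
    have h2: "\<kappa> *\<^sub>m (B v v' *\<^sub>m wdg w w') = - (B v v' *\<^sub>m wdg w' w)"
      using C_props(4) by (subst wdg_swap[of w w']) (simp add: mult_ac)
    show ?thesis unfolding fm.scale_right_distrib h1 h2 by simp
  qed
  ultimately have "(- \<kappa> * B w w') *\<^sub>m wdg v v' + (- \<kappa> * B w w') *\<^sub>m wdg v v' \<in> S"
    by simp
  hence "(- 2 * \<kappa> * B w w') *\<^sub>m wdg v v' \<in> S"
    unfolding fm.scale_left_distrib[symmetric] by (simp add: mult.assoc)
  moreover have "- 2 * \<kappa> * B w w' \<noteq> 0" using nB \<kappa>_cases by auto
  ultimately show ?thesis using scale_mem_cancel[OF S] by blast
qed

lemma wdg_coeff: assumes "vec a" "vec b" "vec d"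
  shows "ent (dag w * (wdg a b * d)) 0 0 = B b d * B w a - \<kappa> * (B a d * B w b)"
  unfolding wdg_act[OF assms] by (simp add: right_diff_distrib B_def[symmetric])

text \<open>Follows the pattern of \<open>no_form\<close>: if \<open>wdg v v'\<close> is missing,
  \<open>form_step\<close> forces \<open>B\<close> to vanish between many vectors
  \<open>y e_j\<close>. The rank-one element is replaced by \<open>wdg w x\<close>, whose two terms
  mix; testing with two vectors \<open>x 0\<close>, \<open>x 1\<close> and two columns
  \<open>e_0\<close>, \<open>e_1\<close> separates them by a determinant. The outcome
  \<open>B w (T * w) = 0\<close> for all \<open>T\<close> contradicts
  \<open>w \<noteq> 0\<close>.\<close>

theorem form_wdg:
  assumes S: "lie_sub S" and A: "alg S = UNIV" and deep: "deep S"
    and skew: "\<And>s. s \<in> S \<Longrightarrow> st s = - s"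
    and K: "\<And>T. \<exists>n. \<forall>y\<in>S. corner n y \<longrightarrow> y * T + st T * y \<in> S"
    and v: "vec v" "vec v'"
  shows "wdg v v' \<in> S"
proof (rule ccontr)
  assume nS: "wdg v v' \<notin> S"
  \<comment> \<open>For \<open>T = u * dag x\<close>, of rank at most one, \<open>K\<close> produces
    \<open>wdg (y * u) x\<close>.\<close>
  have K': "\<exists>n. \<forall>y\<in>S. corner n y \<longrightarrow> wdg (y * u) x \<in> S" for u x
  proof -
    have "y * (u * dag x) + st (u * dag x) * y = wdg (y * u) x" if "y \<in> S" for y
      unfolding wdg_def st_rank1 dag_act using skew[OF that] by (simp add: mult.assoc)
    thus ?thesis using K[of "u * dag x"] by auto
  qed
  have vE: "vec (E i 0)" for i by simp
  \<comment> \<open>Vectors dual to the standard ones: \<open>B (x i) (E j 0)\<close> is the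
    Kronecker delta, which gives the determinant in \<open>fps_det_zero\<close> its constant term
    \<open>1\<close>.\<close>
  have "\<exists>u. vec u \<and> dag u = E 0 i" for i by (rule dag_surj) simp
  then obtain x where x: "\<And>i. vec (x i)" "\<And>i. dag (x i) = E 0 i" by metis
  have "\<exists>n. \<forall>y\<in>S. corner n y \<longrightarrow>
      (\<forall>i<2. wdg (y * E i 0) v \<in> S \<and> wdg (y * E i 0) v' \<in> S \<and> wdg (y * E 0 0) (x i) \<in> S)"
  proof -
    have "\<forall>i. \<exists>n. \<forall>y\<in>S. corner n y \<longrightarrow> wdg (y * E i 0) v \<in> S" using K' by blast
    from choice[OF this] obtain n where
      n: "\<forall>i. \<forall>y\<in>S. corner (n i) y \<longrightarrow> wdg (y * E i 0) v \<in> S" by blast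
    have "\<forall>i. \<exists>n. \<forall>y\<in>S. corner n y \<longrightarrow> wdg (y * E i 0) v' \<in> S" using K' by blast
    from choice[OF this] obtain m where
      m: "\<forall>i. \<forall>y\<in>S. corner (m i) y \<longrightarrow> wdg (y * E i 0) v' \<in> S" by blast
    have "\<forall>i. \<exists>n. \<forall>y\<in>S. corner n y \<longrightarrow> wdg (y * E 0 0) (x i) \<in> S" using K' by blast
    from choice[OF this] obtain k where
      k: "\<forall>i. \<forall>y\<in>S. corner (k i) y \<longrightarrow> wdg (y * E 0 0) (x i) \<in> S" by blast
    define N where "N = n 0 + n 1 + m 0 + m 1 + k 0 + (k 1 :: nat)"
    have "n i \<le> N" "m i \<le> N" "k i \<le> N" if "i < 2" for i
    proof -
      have "i = 0 \<or> i = 1" using that by auto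
      thus "n i \<le> N" "m i \<le> N" "k i \<le> N" unfolding N_def by auto
    qed
    thus ?thesis using n m k corner_mono by (intro exI[of _ N]) blast
  qed
  then obtain n where n: "\<And>y i. y \<in> S \<Longrightarrow> corner n y \<Longrightarrow> i < 2 \<Longrightarrow>
      wdg (y * E i 0) v \<in> S \<and> wdg (y * E i 0) v' \<in> S \<and> wdg (y * E 0 0) (x i) \<in> S" by blast
  have vm: "vec (y * E i 0)" for y i by (simp add: mult.assoc)
  have orth: "B (y * E 0 0) (y' * E j 0) = 0"
    if "y \<in> S" "y' \<in> S" "corner n y" "corner n y'" "j < 2" for y y' j
    using form_step[OF S v vm vm, of y 0 y' j] n[OF that(1,3), of 0] n[OF that(2,4,5)] nS by auto
  obtain F where F: "finite F" "F \<subseteq> S" "\<forall>s\<in>S. \<exists>t\<in>fm.span F. corner n (s - t)"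
    using corner_codim[of S n] S unfolding lie_sub_def by auto
  obtain N0 where N0: "\<forall>A\<in>insert (dag (E 0 0)) F. bnd N0 A"
    using bnd_finite[of "insert (dag (E 0 0)) F"] F(1) by blast
  \<comment> \<open>The size of \<open>dag (E 0 0)\<close> is included, so that
    \<open>dag (E 0 0) * y * t\<close> is a sandwich with \<open>y\<close> in the middle.\<close>
  define N where "N = max N0 (max n 2)"
  obtain y where y: "y \<in> S" "corner N y" "y * E 0 0 \<noteq> 0" using deep unfolding deep_def by blast
  have yn: "corner n y" using corner_mono[OF y(2)] unfolding N_def by simp
  define w where "w = y * E 0 0"
  have w: "vec w" unfolding w_def by (simp add: mult.assoc)
  have sw: "B w (s * E j 0) = 0" if s: "s \<in> S" "j < 2" for s j
  proof -
    obtain t where t: "t \<in> fm.span F" "corner n (s - t)" using F(3) s by blast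
    have bN: "bnd N t"
      by (rule span_bnd[OF _ t(1)]) (use N0 bnd_mono in \<open>auto simp: N_def\<close>)
    have "B w (t * E j 0) = - ent ((dag (E 0 0) * y * t) * E j 0) 0 0"
      unfolding w_def B_adj skew[OF y(1)] by (simp add: B_def mult.assoc)
    also have "dag (E 0 0) * y * t = 0"
      by (rule corner_sandwich[OF _ bN y(2)]) (use N0 bnd_mono in \<open>auto simp: N_def\<close>)
    finally have 1: "B w (t * E j 0) = 0" by simp
    have "t \<in> S" using t(1) fm.span_minimal[OF F(2)] S unfolding lie_sub_def by auto
    hence 2: "B w ((s - t) * E j 0) = 0"
      using orth[OF y(1) _ yn t(2) s(2)] lie_sub_diff[OF S s(1)] unfolding w_def by blast
    have "s * E j 0 = (s - t) * E j 0 + t * E j 0" by (simp add: left_diff_distrib)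
    thus ?thesis using 1 2 B_lin(2) by simp
  qed
  have wx: "wdg w (x i) \<in> S" if "i < 2" for i using n[OF y(1) yn that] unfolding w_def by blast
  have pow: "ent (dag w * pl s p w) 0 0 = 0" if s: "s \<in> S" for s p
  proof -
    define a where "a p = B w (pl s p w)" for p
    define b where "b i j q = B (pl s q (x i)) (E j 0)" for i j q :: nat
    define h where "h j p = B (pl s p w) (E j 0)" for j p :: nat
    define e where "e i q = B w (pl s q (x i))" for i q :: nat
    have vp: "vec (pl s p u)" if "vec u" for p u using that by (metis pl_mult)
    have "a p = 0"
    proof (rule fps_det_zero[where b = b and h = h and e = e and k = \<kappa>])
      fix i j m :: nat assume ij: "i < 2" "j < 2"
      define z where "z p q = wdg (pl s p w) (pl s q (x i))" for p q
      have "z 0 0 \<in> S" using wx[OF ij(1)] by (simp add: z_def)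
      moreover have "lb s (z p q) = z (Suc p) q + z p (Suc q)" for p q
        unfolding z_def lb_wdg[OF skew[OF s]] by simp
      ultimately have "(\<Sum>p\<le>m. (1 / (fact p * fact (m - p))) *\<^sub>m z p (m - p)) \<in> S"
        using exp_coeff_mem[OF S s, of z] by blast
      from sw[OF this ij(2)]
      have "(\<Sum>p\<le>m. (1 / (fact p * fact (m - p))) * ent (dag w * (z p (m - p) * E j 0)) 0 0) = 0"
        unfolding B_def by (simp add: sum_distrib_left sum_distrib_right mult.assoc)
      moreover have "ent (dag w * (z p q * E j 0)) 0 0 = a p * b i j q - \<kappa> * (h j p * e i q)" for p q
        unfolding z_def a_def b_def h_def e_def
        using wdg_coeff[OF vp[OF w] vp[OF x(1)[of i]] vE] by (simp add: mult_ac)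
      ultimately show "(\<Sum>p\<le>m. (a p * b i j (m - p) - \<kappa> * (h j p * e i (m - p))) / (fact p * fact (m - p))) = 0"
        by simp
    next
      fix i j :: nat
      show "b i j 0 = (if i = j then 1 else 0)" unfolding b_def B_def using x(2)[of i] by auto
    qed
    thus ?thesis unfolding a_def B_def .
  qed
  have pT: "ent (dag w * (T * w)) 0 0 = 0" for T
    by (rule polarize[of S "\<lambda>u. ent (dag w * u) 0 0" w]) (simp_all add: S A pow distrib_left)
  have "dag w \<noteq> 0" using dag_inj[OF w] y(3) unfolding w_def by blast
  then obtain i c where ic: "ent (dag w) i c \<noteq> 0" using fmat_nonzero_ex by blast
  hence i0: "i = 0" using dag_row[of w] ent_E_mult[of 0 0 "dag w" i c] by (auto split: if_splits)
  obtain d j where dj: "ent w d j \<noteq> 0" using fmat_nonzero_ex y(3) unfolding w_def by blast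
  hence j0: "j = 0" using w ent_mult_E[of w 0 0 d j] by (auto split: if_splits)
  \<comment> \<open>A matrix unit placed between nonzero entries of \<open>dag w\<close> and
    \<open>w\<close> gives a nonzero value of \<open>B w (T * w)\<close>.\<close>
  have "dag w * (E c d * w) = E 0 0 * (dag w * E c d * w) * E 0 0"
    using dag_row w by (metis mult.assoc)
  also have "\<dots> = (E 0 0 * dag w * E c d) * (w * E 0 0)" by (simp only: mult.assoc)
  also have "\<dots> = (ent (dag w) 0 c *\<^sub>m E 0 d) * (w * E 0 0)" by (simp only: E_sandwich)
  finally have "dag w * (E c d * w) = (ent (dag w) 0 c * ent w d 0) *\<^sub>m E 0 0"
    by (simp add: E_sandwich')
  thus False using pT[of "E c d"] ic dj i0 j0 by simp
qed

text \<open>\<open>E i j - st (E i j)\<close> is \<open>wdg (E i 0) u\<close> for the vector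
  \<open>u\<close> with \<open>dag u = E 0 j\<close>, and a skew \<open>T\<close> is half of
  \<open>T - st T\<close>.\<close>

corollary form_main:
  assumes S: "lie_sub S" and A: "alg S = UNIV" and deep: "deep S"
    and skew: "\<And>s. s \<in> S \<Longrightarrow> st s = - s"
    and K: "\<And>T. \<exists>n. \<forall>y\<in>S. corner n y \<longrightarrow> y * T + st T * y \<in> S"
    and T: "st T = - T"
  shows "T \<in> S"
proof -
  have EE: "E i j - st (E i j) \<in> S" for i j
  proof -
    obtain u where u: "vec u" "dag u = E 0 j" using dag_surj[of "E 0 j"] by auto
    have "wdg (E i 0) u \<in> S" by (rule form_wdg[OF S A deep skew K]) (use u in auto)
    moreover have "E i j = E i 0 * dag u" using u by simp
    hence "wdg (E i 0) u = E i j - st (E i j)" unfolding wdg_def using st_rank1[of "E i 0" u] by simp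
    ultimately show ?thesis by simp
  qed
  obtain n where n: "bnd n T" using bnd_ex by blast
  have "T - st T = (\<Sum>i<n. \<Sum>j<n. ent T i j *\<^sub>m (E i j - st (E i j)))"
  proof -
    have "st T = (\<Sum>i<n. \<Sum>j<n. ent T i j *\<^sub>m st (E i j))"
      by (subst fmat_decomp[OF n]) (simp add: st_sum st_scale)
    moreover have "T = (\<Sum>i<n. \<Sum>j<n. ent T i j *\<^sub>m E i j)" by (rule fmat_decomp[OF n])
    ultimately show ?thesis by (simp add: fm.scale_right_diff_distrib sum_subtractf)
  qed
  also have "\<dots> \<in> S"
    using S EE unfolding lie_sub_def by (intro fm.subspace_sum fm.subspace_scale) auto
  finally have "2 *\<^sub>m T \<in> S"
    using T fm.scale_left_distrib[of 1 1 T] by simp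
  thus ?thesis using scale_mem_cancel[OF S] by fastforce
qed

end

text \<open>If no nonzero \<open>T0\<close> is paired with \<open>0\<close>, the second component of
  a pair is determined by the first; it exists for every matrix as \<open>alg S\<close> is
  everything. So \<open>pairs S\<close> is the graph of a map, and the closure rules of
  \<open>pairs\<close> turn into the axioms of \<open>star\<close>.\<close>

theorem irreducible_cases:
  assumes S: "lie_sub S" and A: "alg S = UNIV" and deep: "deep S"
  shows "(\<forall>i j. i \<noteq> j \<longrightarrow> E i j \<in> S) \<or> (\<exists>st. star st \<and> S = {T. st T = - T})"
proof (cases "\<exists>T0. T0 \<noteq> 0 \<and> (T0, 0) \<in> pairs S")
  case True
  then obtain T0 where T0: "T0 \<noteq> 0" "(T0, 0) \<in> pairs S" by blast
  have sub: "fm.subspace S" using S unfolding lie_sub_def by blast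
  have "E i j \<in> S" if "i \<noteq> j" for i j
    by (rule no_form[OF S A deep _ _ that]) (use pairs_dichotomy[OF sub A T0(2,1)] in auto)
  thus ?thesis by blast
next
  case False
  have sub: "fm.subspace S" using S unfolding lie_sub_def by blast
  have uniq: "T1 = T2" if "(T, T1) \<in> pairs S" "(T, T2) \<in> pairs S" for T T1 T2
  proof -
    have "(0, T1 - T2) \<in> pairs S" using pairs_diff[OF that] by simp
    hence "(T1 - T2, 0) \<in> pairs S" by (rule pairs_swap[OF sub])
    hence "T1 - T2 = 0" using False by blast
    thus ?thesis by simp
  qed
  define st where "st T = (SOME T'. (T, T') \<in> pairs S)" for T
  have st: "(T, st T) \<in> pairs S" for T
    unfolding st_def by (rule someI_ex) (use pairs_ex[of T S] A in simp)
  have "star st"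
  proof
    show "st (x + y) = st x + st y" for x y by (rule uniq[OF st pairs.add[OF st st]])
    show "st (c *\<^sub>m x) = c *\<^sub>m st x" for c x by (rule uniq[OF st pairs.scale[OF st]])
    show "st (x * y) = st y * st x" for x y by (rule uniq[OF st pairs.mult[OF st st]])
    show "st (st x) = x" for x by (rule uniq[OF st pairs_swap[OF sub st]])
  qed
  moreover have skew: "st s = - s" if "s \<in> S" for s by (rule uniq[OF st pairs.base[OF that]])
  moreover have "T \<in> S" if "st T = - T" for T
    by (rule star.form_main[OF \<open>star st\<close> S A deep skew corner_lemma[OF S st] that])
  ultimately show ?thesis by blast
qed

section \<open>Density\<close>

definition fd :: "fmat set \<Rightarrow> bool" where
  "fd X \<longleftrightarrow> (\<exists>B. finite B \<and> X \<subseteq> fm.span B)"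

lemma fd_subset: "fd Y \<Longrightarrow> X \<subseteq> Y \<Longrightarrow> fd X"
  unfolding fd_def by blast

lemma fd_bnd: "(\<And>x. x \<in> X \<Longrightarrow> bnd n x) \<Longrightarrow> fd X"
  unfolding fd_def using finite_dim_bnd[of n] by blast

lemma fd_imp_bnd: "fd X \<Longrightarrow> \<exists>n. \<forall>x\<in>X. bnd n x"
proof -
  assume "fd X"
  then obtain B where B: "finite B" "X \<subseteq> fm.span B" unfolding fd_def by blast
  obtain n where "\<forall>x\<in>B. bnd n x" using bnd_finite[OF B(1)] by blast
  thus ?thesis using span_bnd[of B n] B(2) by blast
qed

lemma fd_image: "fd X \<Longrightarrow> flinear f \<Longrightarrow> fd (f ` X)"
proof -
  assume X: "fd X" and f: "flinear f"
  then obtain B where B: "finite B" "X \<subseteq> fm.span B" unfolding fd_def by blast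
  have "f ` X \<subseteq> fm.span (f ` B)" using B(2) fmm.linear_span_image[OF f] by blast
  thus ?thesis unfolding fd_def using B(1) by blast
qed

lemma fd_span: "fd X \<Longrightarrow> fd (fm.span X)"
  unfolding fd_def by (metis fm.span_minimal fm.subspace_span)

text \<open>Stands in for the quotient by \<open>U\<close>: working modulo \<open>U\<close> means
  applying \<open>p\<close>.\<close>

lemma kernel_ex:
  assumes "fm.subspace U"
  shows "\<exists>p. flinear p \<and> (\<forall>x. p x = 0 \<longleftrightarrow> x \<in> U)"
proof -
  obtain B where B: "B \<subseteq> U" "fm.independent B" "U \<subseteq> fm.span B"
    using fm.maximal_independent_subset[of U] by blast
  obtain B' where B': "B \<subseteq> B'" "fm.independent B'" "UNIV \<subseteq> fm.span B'"
    by (rule fm.maximal_independent_subset_extend[OF subset_UNIV B(2)])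
  define p where "p = fmm.construct B' (\<lambda>b. if b \<in> B then 0 else b)"
  have p: "flinear p" unfolding p_def by (rule fmm.linear_construct[OF B'(2)])
  have pb: "p b = (if b \<in> B then 0 else b)" if "b \<in> B'" for b
    unfolding p_def using fmm.construct_basis[OF B'(2) that] .
  have 1: "x - p x \<in> U" for x
  proof -
    have "x \<in> fm.span B'" using B'(3) by blast
    thus ?thesis
    proof (induction rule: fm.span_induct_alt)
      case base
      show ?case using fmm.linear_0[OF p] fm.subspace_0[OF assms] by simp
    next
      case (step c x y)
      have "x - p x \<in> U" using pb[OF step(1)] B(1) fm.subspace_0[OF assms] by auto
      hence "c *\<^sub>m (x - p x) + (y - p y) \<in> U"
        using step(2) assms by (intro fm.subspace_add fm.subspace_scale) auto
      thus ?case
        by (simp add: fmm.linear_add[OF p] fmm.linear_scale[OF p] fm.scale_right_diff_distrib algebra_simps)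
    qed
  qed
  have "p x = 0" if "x \<in> U" for x
  proof -
    have "x \<in> fm.span B" using that B(3) by blast
    thus ?thesis
    proof (induction rule: fm.span_induct_alt)
      case base
      show ?case using fmm.linear_0[OF p] .
    next
      case (step c x y)
      thus ?case using pb[of x] B'(1) by (auto simp: fmm.linear_add[OF p] fmm.linear_scale[OF p])
    qed
  qed
  moreover have "x \<in> U" if "p x = 0" for x using 1[of x] that by simp
  ultimately show ?thesis using p by blast
qed

subsection \<open>Eigenvectors\<close>

text \<open>The polynomial \<open>p\<close> evaluated at the operator \<open>f\<close> and applied
  to \<open>z\<close>, by Horner's scheme.\<close>

definition pap :: "(fmat \<Rightarrow> fmat) \<Rightarrow> complex poly \<Rightarrow> fmat \<Rightarrow> fmat" where
  "pap f p z = fold_coeffs (\<lambda>a y. a *\<^sub>m z + f y) p 0"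

context
  fixes f :: "fmat \<Rightarrow> fmat"
  assumes f: "flinear f"
begin

lemma f_lin: "f 0 = 0" "f (x + y) = f x + f y" "f (c *\<^sub>m x) = c *\<^sub>m f x"
  using fmm.linear_0[OF f] fmm.linear_add[OF f] fmm.linear_scale[OF f] by auto

lemma pap_0 [simp]: "pap f 0 z = 0"
  by (simp add: pap_def)

lemma pap_pCons: "pap f (pCons a p) z = a *\<^sub>m z + f (pap f p z)"
  by (cases "pCons a p = 0") (auto simp: pap_def f_lin)

lemma pap_add: "pap f (p + q) z = pap f p z + pap f q z"
proof (induction p arbitrary: q)
  case (pCons a p)
  show ?case
  proof (cases q)
    case (pCons b q')
    thus ?thesis using pCons.IH[of q'] by (simp add: pap_pCons f_lin fm.scale_left_distrib)
  qed
qed simp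

lemma pap_smult: "pap f (smult c p) z = c *\<^sub>m pap f p z"
  by (induction p) (simp_all add: pap_pCons f_lin fm.scale_right_distrib)

lemma pap_monom: "pap f (monom 1 n) z = (f ^^ n) z"
  by (induction n) (simp_all add: monom_0 monom_Suc pap_pCons f_lin)

lemma pap_factor: "pap f ([:- l, 1:] * q) z = f (pap f q z) - l *\<^sub>m pap f q z"
proof -
  have "[:- l, 1:] * q = smult (- l) q + pCons 0 q" by simp
  thus ?thesis by (simp only: pap_add pap_smult pap_pCons) simp
qed

lemma pap_mem: "fm.subspace X \<Longrightarrow> f ` X \<subseteq> X \<Longrightarrow> z \<in> X \<Longrightarrow> pap f p z \<in> X"
  by (induction p) (auto simp: pap_pCons fm.subspace_0 intro!: fm.subspace_add fm.subspace_scale)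

text \<open>In finite dimension some iterate of \<open>x\<close> under \<open>f\<close> depends
  linearly on the earlier ones.\<close>

lemma annihilating_poly:
  assumes X: "fm.subspace X" "f ` X \<subseteq> X" "fd X" and x: "x \<in> X"
  shows "\<exists>p. p \<noteq> 0 \<and> pap f p x = 0"
proof -
  define v where "v i = (f ^^ i) x" for i
  have vX: "v i \<in> X" for i using x X(2) unfolding v_def by (induction i) auto
  obtain B where B: "finite B" "X \<subseteq> fm.span B" using X(3) unfolding fd_def by blast
  have "\<exists>n. v n \<in> fm.span (v ` {..<n})"
  proof (rule ccontr)
    assume no: "\<nexists>n. v n \<in> fm.span (v ` {..<n})"
    have "fm.independent (v ` {..<m}) \<and> card (v ` {..<m}) = m" for m
    proof (induction m)
      case 0
      show ?case by (simp add: fm.independent_empty)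
    next
      case (Suc m)
      have n: "v m \<notin> fm.span (v ` {..<m})" using no by blast
      hence v: "v m \<notin> v ` {..<m}" using fm.span_base[of "v m" "v ` {..<m}"] by metis
      have "v ` {..<Suc m} = insert (v m) (v ` {..<m})" by (auto simp: lessThan_Suc)
      thus ?case using Suc v fm.independent_insertI[OF n] by simp
    qed
    moreover have "v ` {..<Suc (card B)} \<subseteq> fm.span B" using vX B(2) by blast
    ultimately have "Suc (card B) \<le> card B" using fm.independent_span_bound[OF B(1)] by metis
    thus False by simp
  qed
  then obtain n where n: "v n \<in> fm.span (v ` {..<n})" by blast
  have "\<exists>q. (\<forall>i\<ge>n. coeff q i = 0) \<and> pap f q x = y" if "y \<in> fm.span (v ` {..<n})" for y
    using that
  proof (induction rule: fm.span_induct_alt)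
    case base
    show ?case by (intro exI[of _ 0]) simp
  next
    case (step c w y)
    obtain i where i: "i < n" "w = v i" using step(1) by blast
    obtain q where q: "\<forall>i\<ge>n. coeff q i = 0" "pap f q x = y" using step(2) by blast
    have "pap f (smult c (monom 1 i) + q) x = c *\<^sub>m w + y"
      by (simp add: pap_add pap_smult pap_monom i v_def q)
    moreover have "\<forall>k\<ge>n. coeff (smult c (monom 1 i) + q) k = 0" using i q by auto
    ultimately show ?case by blast
  qed
  then obtain q where q: "\<forall>i\<ge>n. coeff q i = 0" "pap f q x = v n" using n by blast
  have "pap f (monom 1 n + smult (-1) q) x = 0"
    unfolding pap_add pap_smult pap_monom q(2) v_def by (simp add: scaleM_uminus[symmetric])
  moreover have "coeff (monom 1 n + smult (-1) q) n \<noteq> 0" using q(1) by simp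
  hence "monom 1 n + smult (-1) q \<noteq> 0" by fastforce
  ultimately show ?thesis by blast
qed

text \<open>Choose a polynomial of least degree annihilating some nonzero vector of
  \<open>X\<close>. After a linear factor is split off, the cofactor no longer annihilates that
  vector but sends it to an eigenvector.\<close>

lemma eigenvector_ex:
  assumes X: "fm.subspace X" "f ` X \<subseteq> X" "fd X" and x: "x \<in> X" "x \<noteq> 0"
  shows "\<exists>l z. z \<in> X \<and> z \<noteq> 0 \<and> f z = l *\<^sub>m z"
proof -
  define P where "P d \<longleftrightarrow> (\<exists>p z. degree p = d \<and> p \<noteq> 0 \<and> z \<in> X \<and> z \<noteq> 0 \<and> pap f p z = 0)" for d
  have "\<exists>d. P d" using annihilating_poly[OF X x(1)] x unfolding P_def by blast
  then obtain d where d: "P d" "\<And>e. e < d \<Longrightarrow> \<not> P e" using exists_least_iff[of P] by blast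
  obtain p z where p: "degree p = d" "p \<noteq> 0" "z \<in> X" "z \<noteq> 0" "pap f p z = 0"
    using d(1) unfolding P_def by blast
  have "d \<noteq> 0"
  proof
    assume "d = 0"
    then obtain a where a: "p = [:a:]" using p(1) degree_eq_zeroE by blast
    thus False using p by (simp add: pap_pCons f_lin)
  qed
  hence "\<not> constant (poly p)" using p(1) constant_degree[of p] by simp
  then obtain l where "poly p l = 0" using fundamental_theorem_of_algebra by blast
  then obtain q where q: "p = [:- l, 1:] * q" using poly_eq_0_iff_dvd by (metis dvdE)
  have q0: "q \<noteq> 0" using q p(2) by auto
  have "degree p = degree [:- l, 1:] + degree q" unfolding q using q0 by (intro degree_mult_eq) auto
  hence "degree q < d" using p(1) by simp
  hence "pap f q z \<noteq> 0" using d(2) p q0 unfolding P_def by blast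
  moreover have "pap f q z \<in> X" using pap_mem[OF X(1,2) p(3)] .
  moreover have "f (pap f q z) = l *\<^sub>m pap f q z" using p(5) unfolding q pap_factor by simp
  ultimately show ?thesis by blast
qed

end

subsection \<open>Burnside's theorem for finitary matrices\<close>

text \<open>Column and row vectors are the matrices supported in column \<open>0\<close> and in row \<open>0\<close>, so that all
  products are products of matrices.\<close>

definition Vc :: "fmat set" where "Vc = {u. u * E 0 0 = u}"

definition Vr :: "fmat set" where "Vr = {u. E 0 0 * u = u}"

lemma subspace_Vc: "fm.subspace Vc"
  unfolding Vc_def by (rule fm.subspaceI) (simp_all add: distrib_right)

lemma subspace_Vr: "fm.subspace Vr"
  unfolding Vr_def by (rule fm.subspaceI) (simp_all add: distrib_left)

lemma Vc_mult: "u \<in> Vc \<Longrightarrow> T * u \<in> Vc"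
  by (simp add: Vc_def mult.assoc)

lemma Vr_mult: "u \<in> Vr \<Longrightarrow> u * T \<in> Vr"
  by (simp add: Vr_def mult.assoc[symmetric])

lemma E_Vc [simp]: "E i 0 \<in> Vc" and E_Vr [simp]: "E 0 i \<in> Vr"
  by (simp_all add: Vc_def Vr_def)

lemma Vc_ent: "u \<in> Vc \<Longrightarrow> j \<noteq> 0 \<Longrightarrow> ent u i j = 0"
  unfolding Vc_def using ent_mult_E[of u 0 0 i j] by simp

lemma Vr_ent: "u \<in> Vr \<Longrightarrow> i \<noteq> 0 \<Longrightarrow> ent u i j = 0"
  unfolding Vr_def using ent_E_mult[of 0 0 u i j] by simp

lemma Vr_Vc: "f \<in> Vr \<Longrightarrow> u \<in> Vc \<Longrightarrow> f * u = ent (f * u) 0 0 *\<^sub>m E 0 0"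
proof -
  assume "f \<in> Vr" "u \<in> Vc"
  hence "E 0 0 * f = f" "u * E 0 0 = u" by (simp_all add: Vr_def Vc_def)
  moreover have "E 0 0 * (f * u) * E 0 0 = (E 0 0 * f) * (u * E 0 0)" by (simp only: mult.assoc)
  ultimately show ?thesis unfolding E_sandwich by simp
qed

lemma Vc_bnd: "u \<in> Vc \<Longrightarrow> (\<And>i. i \<ge> n \<Longrightarrow> ent u i 0 = 0) \<Longrightarrow> 0 < n \<Longrightarrow> bnd n u"
  unfolding bnd_def using Vc_ent by (metis not_le_imp_less)

lemma Vc_sum:
  assumes "u \<in> Vc" "bnd n u" shows "u = (\<Sum>i<n. ent u i 0 *\<^sub>m E i 0)"
proof (rule fmat_eqI)
  fix a b :: nat
  have "(\<Sum>i<n. ent u i 0 * (if a = i \<and> b = 0 then 1 else 0))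
      = (\<Sum>i<n. if i = a then (if b = 0 then ent u a 0 else 0) else 0)"
    by (rule sum.cong) auto
  also have "\<dots> = ent u a b" using assms(2) Vc_ent[OF assms(1), of b a] by (auto simp: bnd_def)
  finally show "ent u a b = ent (\<Sum>i<n. ent u i 0 *\<^sub>m E i 0) a b" by simp
qed

lemma Vr_sum:
  assumes "u \<in> Vr" "bnd n u" shows "u = (\<Sum>i<n. ent u 0 i *\<^sub>m E 0 i)"
proof (rule fmat_eqI)
  fix a b :: nat
  have "(\<Sum>i<n. ent u 0 i * (if a = 0 \<and> b = i then 1 else 0))
      = (\<Sum>i<n. if i = b then (if a = 0 then ent u 0 b else 0) else 0)"
    by (rule sum.cong) auto
  also have "\<dots> = ent u a b" using assms(2) Vr_ent[OF assms(1), of a b] by (auto simp: bnd_def)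
  finally show "ent u a b = ent (\<Sum>i<n. ent u 0 i *\<^sub>m E 0 i) a b" by simp
qed

lemma not_fd_Vc: "\<not> fd Vc"
proof
  assume "fd Vc"
  then obtain n where "\<forall>x\<in>Vc. bnd n x" using fd_imp_bnd by blast
  hence "bnd n (E n 0)" by simp
  thus False by (auto simp: bnd_def split: if_splits)
qed

lemma subspace_alg: "fm.subspace S \<Longrightarrow> fm.subspace (alg S)"
  by (rule fm.subspaceI) (auto intro: alg.intros fm.subspace_0)

lemma linear_mult_left: "flinear (\<lambda>x. a * x)"
  by (rule flinearI) (simp_all add: distrib_left)

lemma linear_mult_right: "flinear (\<lambda>x. x * a)"
  by (rule flinearI) (simp_all add: distrib_right)

lemma col_eqI: "(\<And>j. A * E j 0 = B * E j 0) \<Longrightarrow> A = B"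
proof (rule fmat_eqI)
  fix i j assume "\<And>j. A * E j 0 = B * E j 0"
  hence "ent (A * E j 0) i 0 = ent (B * E j 0) i 0" by simp
  thus "ent A i j = ent B i j" by simp
qed

definition irr :: "fmat set \<Rightarrow> bool" where
  "irr S \<longleftrightarrow> (\<forall>X. fm.subspace X \<longrightarrow> X \<subseteq> Vc \<longrightarrow> (\<forall>s\<in>S. \<forall>x\<in>X. s * x \<in> X) \<longrightarrow> X = {0} \<or> X = Vc)"

text \<open>\<open>alg S z\<close> is a submodule of the columns. Were it zero, \<open>S\<close>
  would kill \<open>z\<close> and the line of \<open>z\<close> would be a submodule, impossible
  since the columns have infinite dimension.\<close>

lemma alg_transitive:
  assumes S: "fm.subspace S" and irr: "irr S" and z: "z \<in> Vc" "z \<noteq> 0" and u: "u \<in> Vc"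
  shows "\<exists>T\<in>alg S. T * z = u"
proof -
  define X where "X = (\<lambda>T. T * z) ` alg S"
  have sX: "fm.subspace X" unfolding X_def
    by (rule fmm.linear_subspace_image[OF linear_mult_right subspace_alg[OF S]])
  have "X \<subseteq> Vc" using z(1) Vc_mult unfolding X_def by blast
  moreover have "s * x \<in> X" if sx: "s \<in> S" "x \<in> X" for s x
  proof -
    obtain T where "T \<in> alg S" "x = T * z" using sx(2) unfolding X_def by blast
    hence "s * T \<in> alg S" "s * x = (s * T) * z" using sx(1) by (auto intro: alg.intros simp: mult.assoc)
    thus ?thesis unfolding X_def by blast
  qed
  ultimately have "X = {0} \<or> X = Vc" using irr sX unfolding irr_def by blast
  moreover have "X \<noteq> {0}"
  proof
    assume X0: "X = {0}"
    have sz: "s * z = 0" if "s \<in> S" for s using X0 alg.base[OF that] unfolding X_def by auto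
    have "s * x \<in> fm.span {z}" if "s \<in> S" "x \<in> fm.span {z}" for s x
      using that sz by (auto simp: fm.span_singleton fm.span_zero)
    moreover have "fm.span {z} \<subseteq> Vc" using z(1) fm.span_minimal[OF _ subspace_Vc] by blast
    ultimately have "fm.span {z} = {0} \<or> fm.span {z} = Vc"
      using irr fm.subspace_span unfolding irr_def by blast
    moreover have "z \<in> fm.span {z}" by (simp add: fm.span_base)
    ultimately have "fm.span {z} = Vc" using z(2) by auto
    thus False using not_fd_Vc unfolding fd_def by (metis finite.emptyI finite_insert order_refl)
  qed
  ultimately have "u \<in> X" using u by blast
  thus ?thesis unfolding X_def by blast
qed

lemma bnd_mult_Vc: "bnd n T \<Longrightarrow> u \<in> Vc \<Longrightarrow> bnd (Suc n) (T * u)"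
proof (rule Vc_bnd)
  assume n: "bnd n T" and u: "u \<in> Vc"
  show "T * u \<in> Vc" by (rule Vc_mult[OF u])
  show "ent (T * u) i 0 = 0" if "i \<ge> Suc n" for i
  proof -
    have "ent T i x = 0" for x using n that unfolding bnd_def by (meson Suc_leD leD)
    thus ?thesis by (simp add: ent_times_bound[OF n])
  qed
qed simp

text \<open>Burnside's argument: take \<open>T \<noteq> 0\<close> in \<open>alg S\<close> of least
  rank. If its image were more than the line of \<open>p\<close>, some \<open>D\<close> in
  \<open>alg S\<close> would give \<open>T D\<close> an eigenvalue \<open>l\<close> on that image
  with \<open>T D T - l T\<close> nonzero and of smaller rank.\<close>

lemma rank_one_ex:
  assumes S: "fm.subspace S" and irr: "irr S"
  shows "\<exists>T\<in>alg S. \<exists>p\<in>Vc. \<exists>f\<in>Vr. T = p * f \<and> p \<noteq> 0 \<and> f \<noteq> 0"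
proof -
  define I where "I T = (\<lambda>u. T * u) ` Vc" for T
  have sI: "fm.subspace (I T)" for T
    unfolding I_def by (rule fmm.linear_subspace_image[OF linear_mult_left subspace_Vc])
  have fI: "fd (I T)" for T
  proof -
    obtain n where "bnd n T" using bnd_ex by blast
    thus ?thesis unfolding I_def by (intro fd_bnd[of _ "Suc n"]) (auto intro: bnd_mult_Vc)
  qed
  have "\<exists>d. \<exists>T\<in>alg S. T \<noteq> 0 \<and> fm.dim (I T) = d"
  proof -
    obtain T where "T \<in> alg S" "T * E 0 0 = E 0 0"
      using alg_transitive[OF S irr E_Vc[of 0] E_nonzero E_Vc[of 0]] by blast
    moreover from this have "T \<noteq> 0" by auto
    ultimately show ?thesis by blast
  qed
  then obtain d where d: "\<exists>T\<in>alg S. T \<noteq> 0 \<and> fm.dim (I T) = d"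
    "\<And>e. e < d \<Longrightarrow> \<not> (\<exists>T\<in>alg S. T \<noteq> 0 \<and> fm.dim (I T) = e)"
    using exists_least_iff[of "\<lambda>d. \<exists>T\<in>alg S. T \<noteq> 0 \<and> fm.dim (I T) = d"] by blast
  obtain T where T: "T \<in> alg S" "T \<noteq> 0" "fm.dim (I T) = d" using d(1) by blast
  obtain j where j: "T * E j 0 \<noteq> 0" using col_eqI[of T 0] T(2) by auto
  define p where "p = T * E j 0"
  have pV: "p \<in> Vc" unfolding p_def by (rule Vc_mult) simp
  have "T * u \<in> fm.span {p}" if u: "u \<in> Vc" for u
  proof (rule ccontr)
    assume nu: "T * u \<notin> fm.span {p}"
    obtain D where D: "D \<in> alg S" "D * p = u"
      using alg_transitive[OF S irr pV _ u] j unfolding p_def by blast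
    define g where "g x = T * (D * x)" for x
    have g: "flinear g" unfolding g_def by (rule flinearI) (simp_all add: distrib_left)
    have "g ` I T \<subseteq> I T" unfolding g_def I_def using Vc_mult by blast
    moreover have pI: "p \<in> I T" unfolding I_def p_def using E_Vc by blast
    ultimately obtain l z where z: "z \<in> I T" "z \<noteq> 0" "g z = l *\<^sub>m z"
      using eigenvector_ex[OF g sI _ fI] j unfolding p_def by blast
    define T' where "T' = T * D * T - l *\<^sub>m T"
    have T': "T' \<in> alg S" unfolding T'_def
      by (rule fm.subspace_diff[OF subspace_alg[OF S]]) (use T D in \<open>auto intro: alg.intros\<close>)
    have "T' * E j 0 = T * u - l *\<^sub>m p" unfolding T'_def using D(2) by (simp add: left_diff_distrib mult.assoc p_def)
    moreover have "T * u \<noteq> l *\<^sub>m p" using nu by (auto simp: fm.span_singleton)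
    ultimately have T'0: "T' \<noteq> 0" by auto
    define g' where "g' x = g x - l *\<^sub>m x" for x
    have g': "flinear g'" unfolding g'_def
      by (rule flinearI) (simp_all add: fmm.linear_add[OF g] fmm.linear_scale[OF g] fm.scale_right_diff_distrib fm.scale_right_distrib mult.commute)
    have I': "I T' \<subseteq> g' ` I T" unfolding I_def g'_def g_def T'_def
      by (auto simp: left_diff_distrib mult.assoc)
    \<comment> \<open>The eigenvector starts a basis of the image; \<open>g'\<close> kills it, so
      the image of \<open>T'\<close> is spanned by the values of \<open>g'\<close> on the other
      basis vectors.\<close>
    have "fm.independent {z}" using z(2) by simp
    then obtain B where B: "{z} \<subseteq> B" "B \<subseteq> I T" "fm.independent B" "I T \<subseteq> fm.span B"
      using fm.maximal_independent_subset_extend[of "{z}" "I T"] z(1) by auto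
    obtain B0 where "finite B0" "I T \<subseteq> fm.span B0" using fI unfolding fd_def by blast
    hence fB: "finite B" using fm.independent_span_bound[of B0 B] B by blast
    have cB: "card B = d" using fm.basis_card_eq_dim[OF B(2,4,3)] T(3) by simp
    have "g' ` I T \<subseteq> fm.span (g' ` B)" using B(4) fmm.linear_span_image[OF g'] by blast
    also have "g' ` B \<subseteq> insert 0 (g' ` (B - {z}))" using z(3) unfolding g'_def by auto
    hence "fm.span (g' ` B) \<subseteq> fm.span (g' ` (B - {z}))"
      using fm.span_mono[of "g' ` B" "insert 0 (g' ` (B - {z}))"] by simp
    finally have "I T' \<subseteq> fm.span (g' ` (B - {z}))" using I' by blast
    hence "fm.dim (I T') \<le> card (g' ` (B - {z}))" by (rule fm.dim_le_card) (use fB in simp)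
    also have "\<dots> \<le> card (B - {z})" by (rule card_image_le) (use fB in simp)
    also have "\<dots> < card B" using B(1) fB by (intro psubset_card_mono) auto
    finally have "fm.dim (I T') < d" using cB by simp
    thus False using d(2) T' T'0 by blast
  qed
  hence "T * E i 0 \<in> fm.span {p}" for i by simp
  hence c: "\<exists>c. T * E i 0 = c *\<^sub>m p" for i unfolding fm.span_singleton by blast
  obtain a b where "ent p a b \<noteq> 0" using fmat_nonzero_ex j unfolding p_def by blast
  hence a: "ent p a 0 \<noteq> 0" using Vc_ent[OF pV] by (cases "b = 0") auto
  \<comment> \<open>\<open>T\<close> maps every column to a multiple of \<open>p\<close>; reading
    off row \<open>a\<close>, where \<open>p\<close> is nonzero, recovers the factor.\<close>
  define f where "f = (1 / ent p a 0) *\<^sub>m (E 0 a * T)"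
  have pE: "E 0 a * p = ent p a 0 *\<^sub>m E 0 0"
    using pV E_sandwich[of 0 a p 0 0] by (simp add: Vc_def mult.assoc)
  have "T * E i 0 = (p * f) * E i 0" for i
  proof -
    obtain c where c: "T * E i 0 = c *\<^sub>m p" using c by blast
    have "(p * f) * E i 0 = (1 / ent p a 0) *\<^sub>m (p * (E 0 a * (T * E i 0)))"
      unfolding f_def by (simp add: mult.assoc)
    also have "\<dots> = c *\<^sub>m (p * E 0 0)" unfolding c using a by (simp add: pE)
    finally show ?thesis using c pV by (simp add: Vc_def)
  qed
  hence Tpf: "T = p * f" by (rule col_eqI)
  moreover have "f \<in> Vr" unfolding f_def Vr_def by (simp add: mult.assoc[symmetric])
  moreover have "f \<noteq> 0" using Tpf T(2) by auto
  moreover have "p \<noteq> 0" using j unfolding p_def .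
  ultimately show ?thesis using T(1) pV by blast
qed

text \<open>Irreducibility on columns leaves the functionals open: the rows occurring in
  \<open>alg S\<close> might form a proper, still separating subspace of \<open>Vr\<close>. This
  condition excludes that.\<close>

definition rowfull :: "fmat set \<Rightarrow> bool" where
  "rowfull S \<longleftrightarrow> Vr \<subseteq> fm.span {f * s |f s. f \<in> Vr \<and> s \<in> S}"

text \<open>The rank-one element \<open>p f\<close> gives all \<open>X p f Y\<close>. Here
  \<open>X p\<close> is arbitrary by transitivity, so everything depends on the rows
  \<open>F = f (alg S)\<close>. They separate columns, hence take arbitrary prescribed entries on
  finitely many positions; as \<open>s\<close> sees only finitely many, every
  \<open>E 0 j * s\<close> lies in \<open>F\<close>, and \<open>rowfull\<close> gives all
  rows.\<close>

theorem alg_UNIV: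
  assumes S: "fm.subspace S" and irr: "irr S" and rf: "rowfull S"
  shows "alg S = UNIV"
proof -
  obtain p f where pf: "p * f \<in> alg S" "p \<in> Vc" "f \<in> Vr" "p \<noteq> 0" "f \<noteq> 0"
    using rank_one_ex[OF S irr] by blast
  have sA: "fm.subspace (alg S)" by (rule subspace_alg[OF S])
  define F where "F = (\<lambda>Y. f * Y) ` alg S"
  have sF: "fm.subspace F" unfolding F_def by (rule fmm.linear_subspace_image[OF linear_mult_left sA])
  have sep: "z = 0" if z: "z \<in> Vc" "\<And>g. g \<in> F \<Longrightarrow> g * z = 0" for z
  proof (rule ccontr)
    assume z0: "z \<noteq> 0"
    have "f * u = 0" if u: "u \<in> Vc" for u
    proof -
      obtain Y where "Y \<in> alg S" "Y * z = u" using alg_transitive[OF S irr z(1) z0 u] by blast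
      thus ?thesis using z(2)[of "f * Y"] unfolding F_def by (auto simp: mult.assoc)
    qed
    hence "f * E j 0 = 0 * E j 0" for j by simp
    hence "f = 0" by (rule col_eqI)
    thus False using pf(5) by blast
  qed
  have Fs: "g * s \<in> F" if gs: "g \<in> F" "s \<in> S" for g s
  proof -
    obtain Y where "Y \<in> alg S" "g = f * Y" using gs(1) unfolding F_def by blast
    hence "Y * s \<in> alg S" "g * s = f * (Y * s)" using gs(2) by (auto intro: alg.intros simp: mult.assoc)
    thus ?thesis unfolding F_def by blast
  qed
  have Es: "E 0 j * s \<in> F" if s: "s \<in> S" for j s
  proof -
    obtain n where n: "bnd n s" using bnd_ex by blast
    \<comment> \<open>The identity on the first \<open>n\<close> positions, enough to act as a left
      unit for \<open>s\<close>.\<close>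
    define P where "P = (\<Sum>i<n. E i i)"
    have entP: "ent P a b = (if a = b \<and> a < n then 1 else 0)" for a b
    proof -
      have "ent P a b = (\<Sum>i<n. if i = a then (if a = b then 1 else 0) else 0)"
        unfolding P_def ent_sum by (rule sum.cong) auto
      thus ?thesis by auto
    qed
    have bP: "bnd n P" by (auto simp: bnd_def entP split: if_splits)
    have Ps: "P * s = s"
    proof (rule fmat_eqI)
      fix a b
      have "ent (P * s) a b = (\<Sum>k<n. if k = a then ent s a b else 0)"
        unfolding ent_times_bound[OF bP] by (rule sum.cong) (auto simp: entP)
      thus "ent (P * s) a b = ent s a b" using n by (auto simp: bnd_def)
    qed
    show ?thesis
    proof (cases "j < n")
      case False
      hence "E 0 j * s = 0" using n by (intro fmat_eqI) (auto simp: bnd_def)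
      thus ?thesis using fm.subspace_0[OF sF] by simp
    next
      case True
      define X where "X = (\<lambda>g. g * P) ` F"
      have sX: "fm.subspace X" unfolding X_def by (rule fmm.linear_subspace_image[OF linear_mult_right sF])
      have "E 0 j \<in> X"
      proof (rule ccontr)
        assume nX: "E 0 j \<notin> X"
        obtain q where q: "flinear q" "\<And>x. q x = 0 \<longleftrightarrow> x \<in> X" using kernel_ex[OF sX] by blast
        have "q (E 0 j) \<noteq> 0" using q(2) nX by blast
        then obtain a b where ab: "ent (q (E 0 j)) a b \<noteq> 0" using fmat_nonzero_ex by blast
        define l where "l x = ent (q x) a b" for x
        \<comment> \<open>If \<open>E 0 j\<close> is no truncated row of \<open>F\<close>, a linear
          functional \<open>l\<close> vanishes on all truncated rows but not on it. Its values on
          the unit rows are the entries of a column killed by \<open>F\<close>.\<close>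
        define z where "z = (\<Sum>i<n. l (E 0 i) *\<^sub>m E i 0)"
        have "z \<in> Vc" unfolding z_def by (intro fm.subspace_sum[OF subspace_Vc] fm.subspace_scale[OF subspace_Vc] E_Vc)
        moreover have "g * z = 0" if g: "g \<in> F" for g
        proof -
          have gV: "g \<in> Vr" using g pf(3) Vr_mult unfolding F_def by blast
          have gP: "g * P = (\<Sum>i<n. ent g 0 i *\<^sub>m E 0 i)"
          proof (rule fmat_eqI)
            fix c d :: nat
            have "ent (g * P) c d = (\<Sum>k<n. if k = d then ent g c d else 0)"
              unfolding ent_times_bound2[OF bP] by (rule sum.cong) (auto simp: entP)
            moreover have "(\<Sum>i<n. ent g 0 i * (if c = 0 \<and> d = i then 1 else 0))
                = (\<Sum>k<n. if k = d then ent g c d else 0)"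
              by (rule sum.cong) (use Vr_ent[OF gV] in auto)
            ultimately show "ent (g * P) c d = ent (\<Sum>i<n. ent g 0 i *\<^sub>m E 0 i) c d" by simp
          qed
          have "q (g * P) = 0" using q(2) g unfolding X_def by blast
          hence "ent (q (\<Sum>i<n. ent g 0 i *\<^sub>m E 0 i)) a b = 0" using gP by simp
          hence 0: "(\<Sum>i<n. ent g 0 i * l (E 0 i)) = 0"
            unfolding l_def by (simp add: fmm.linear_sum[OF q(1)] fmm.linear_scale[OF q(1)])
          have "g * E i 0 = ent g 0 i *\<^sub>m E 0 0" for i
            using gV E_sandwich[of 0 0 g i 0] by (simp add: Vr_def mult.assoc[symmetric])
          hence "g * z = (\<Sum>i<n. (ent g 0 i * l (E 0 i)) *\<^sub>m E 0 0)"
            unfolding z_def by (simp add: sum_distrib_left mult.commute)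
          also have "\<dots> = 0" using 0 by (simp flip: scaleM_sum_left)
          finally show ?thesis .
        qed
        ultimately have "z = 0" by (rule sep)
        hence "ent z j 0 = 0" by simp
        moreover have "ent z j 0 = (\<Sum>i<n. if i = j then l (E 0 j) else 0)"
          unfolding z_def ent_sum by (rule sum.cong) auto
        ultimately show False using ab True unfolding l_def by simp
      qed
      then obtain g where g: "g \<in> F" "E 0 j = g * P" unfolding X_def by blast
      have "E 0 j * s = g * s" unfolding g(2) mult.assoc Ps ..
      thus ?thesis using Fs[OF g(1) s] by simp
    qed
  qed
  have "g * s \<in> F" if g: "g \<in> Vr" "s \<in> S" for g s
  proof -
    obtain n where "bnd n g" using bnd_ex by blast
    hence "g * s = (\<Sum>i<n. ent g 0 i *\<^sub>m (E 0 i * s))"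
      by (subst Vr_sum[OF g(1)]) (auto simp: sum_distrib_right)
    also have "\<dots> \<in> F" using Es[OF g(2)] by (intro fm.subspace_sum[OF sF] fm.subspace_scale[OF sF])
    finally show ?thesis .
  qed
  hence "fm.span {f * s |f s. f \<in> Vr \<and> s \<in> S} \<subseteq> F" by (intro fm.span_minimal[OF _ sF]) blast
  hence VF: "Vr \<subseteq> F" using rf unfolding rowfull_def by blast
  have EA: "E i k \<in> alg S" for i k
  proof -
    obtain X where X: "X \<in> alg S" "X * p = E i 0" using alg_transitive[OF S irr pf(2,4) E_Vc] by blast
    obtain Y where Y: "Y \<in> alg S" "f * Y = E 0 k" using VF E_Vr[of k] unfolding F_def by (metis imageE subsetD)
    have "X * (p * f) * Y = (X * p) * (f * Y)" by (simp only: mult.assoc)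
    also have "\<dots> = E i k" unfolding X(2) Y(2) by simp
    finally show ?thesis using alg.mult[OF alg.mult[OF X(1) pf(1)] Y(1)] by simp
  qed
  have "T \<in> alg S" for T
  proof -
    obtain n where n: "bnd n T" using bnd_ex by blast
    show ?thesis by (subst fmat_decomp[OF n]) (intro fm.subspace_sum[OF sA] fm.subspace_scale[OF sA] EA)
  qed
  thus ?thesis by blast
qed

section \<open>Locally finite algebras\<close>

definition locally_fd :: "fmat set \<Rightarrow> bool" where
  "locally_fd S \<longleftrightarrow> (\<forall>F. finite F \<longrightarrow> F \<subseteq> S \<longrightarrow> (\<exists>K. lie_sub K \<and> K \<subseteq> S \<and> F \<subseteq> K \<and> fd K))"

text \<open>If \<open>S u\<close> had finite dimension, it would equal \<open>K u\<close> for a finite-dimensional subalgebra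
  \<open>K\<close>, and the finite-dimensional \<open>K\<close>-module generated by \<open>u\<close> would be \<open>S\<close>-stable.\<close>

lemma not_fd_orbit:
  assumes S: "lie_sub S" and irr: "irr S" and loc: "locally_fd S" and u: "u \<in> Vc" "u \<noteq> 0"
  shows "\<not> fd ((\<lambda>s. s * u) ` S)"
proof
  assume fdu: "fd ((\<lambda>s. s * u) ` S)"
  have sS: "fm.subspace S" using S unfolding lie_sub_def by blast
  obtain B where B: "finite B" "(\<lambda>s. s * u) ` S \<subseteq> fm.span B" using fdu unfolding fd_def by blast
  obtain F where F: "finite F" "F \<subseteq> S" "\<forall>s\<in>S. \<exists>t\<in>fm.span F. (s - t) * u = 0"
    using preimage_finite[OF linear_mult_right sS B] by blast
  obtain K where K: "lie_sub K" "K \<subseteq> S" "F \<subseteq> K" "fd K" using loc F(1,2) unfolding locally_fd_def by blast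
  have Ku: "\<exists>k\<in>K. s * u = k * u" if s: "s \<in> S" for s
  proof -
    obtain t where t: "t \<in> fm.span F" "(s - t) * u = 0" using F(3) s by blast
    have "t \<in> K" using t(1) fm.span_minimal[OF K(3)] K(1) unfolding lie_sub_def by blast
    thus ?thesis using t(2) by (auto simp: left_diff_distrib)
  qed
  define X where "X = fm.span {foldr (*) xs u |xs. set xs \<subseteq> K}"
  have sX: "fm.subspace X" unfolding X_def by (rule fm.subspace_span)
  have wX: "foldr (*) xs u \<in> X" if "set xs \<subseteq> K" for xs
    unfolding X_def by (rule fm.span_base) (use that in blast)
  have XVc: "X \<subseteq> Vc" unfolding X_def
  proof (rule fm.span_minimal[OF _ subspace_Vc])
    have "foldr (*) xs u \<in> Vc" for xs by (induction xs) (use u(1) Vc_mult in auto)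
    thus "{foldr (*) xs u |xs. set xs \<subseteq> K} \<subseteq> Vc" by blast
  qed
  have KX: "k * x \<in> X" if "k \<in> K" "x \<in> X" for k x
    using that(2) unfolding X_def
  proof (induction rule: fm.span_induct_alt)
    case base
    show ?case by (simp add: fm.span_zero)
  next
    case (step c x y)
    then obtain xs where "x = foldr (*) xs u" "set xs \<subseteq> K" by blast
    hence "k * x \<in> X" using wX[of "k # xs"] that(1) by simp
    thus ?case using step(2) unfolding X_def by (simp add: distrib_left fm.span_add fm.span_scale)
  qed
  \<comment> \<open>Moving \<open>s\<close> past the first letter \<open>k\<close> costs
    \<open>lb s k\<close>, which is again in \<open>S\<close>; hence the induction runs over all
    \<open>s\<close> at once.\<close>
  have SW: "s * foldr (*) xs u \<in> X" if "set xs \<subseteq> K" "s \<in> S" for xs s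
    using that
  proof (induction xs arbitrary: s)
    case Nil
    then obtain k where "k \<in> K" "s * u = k * u" using Ku by blast
    thus ?case using wX[of "[k]"] by simp
  next
    case (Cons k xs)
    define v where "v = foldr (*) xs u"
    have "s * (k * v) = k * (s * v) + lb s k * v" by (simp add: lb_def left_diff_distrib mult.assoc)
    moreover have "k * (s * v) \<in> X" using Cons v_def KX by simp
    moreover have "lb s k \<in> S" using Cons.prems K(2) lie_sub_lb[OF S] by auto
    hence "lb s k * v \<in> X" using Cons v_def by simp
    ultimately show ?case using fm.subspace_add[OF sX] unfolding v_def by simp
  qed
  have "s * x \<in> X" if "s \<in> S" "x \<in> X" for s x
    using that(2) unfolding X_def
  proof (induction rule: fm.span_induct_alt)
    case base
    show ?case by (simp add: fm.span_zero)
  next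
    case (step c x y)
    hence "s * x \<in> X" using SW[OF _ that(1)] by blast
    thus ?case using step(2) unfolding X_def by (simp add: distrib_left fm.span_add fm.span_scale)
  qed
  hence "X = {0} \<or> X = Vc" using irr sX XVc unfolding irr_def by blast
  moreover have "u \<in> X" using wX[of "[]"] by simp
  ultimately have "X = Vc" using u(2) by blast
  moreover have "fd X" unfolding X_def
  proof (rule fd_span)
    obtain n where n: "\<forall>k\<in>K. bnd n k" using fd_imp_bnd[OF K(4)] by blast
    obtain m where m: "bnd m u" "n \<le> m" by (metis bnd_ex bnd_mono nat_le_linear)
    have "bnd m (foldr (*) xs u)" if "set xs \<subseteq> K" for xs
      using that by (induction xs) (use n m bnd_mono in \<open>auto intro!: bnd_times\<close>)
    thus "fd {foldr (*) xs u |xs. set xs \<subseteq> K}" by (intro fd_bnd[of _ m]) blast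
  qed
  ultimately show False using not_fd_Vc by simp
qed

text \<open>Otherwise every element with zero \<open>n\<close>-corner kills \<open>e_k\<close>, and
  since these have finite codimension the orbit \<open>S e_k\<close> would have finite
  dimension.\<close>

lemma deepI:
  assumes S: "lie_sub S" and irr: "irr S" and loc: "locally_fd S"
  shows "deep S"
  unfolding deep_def
proof (intro allI, rule ccontr)
  fix n k assume no: "\<not> (\<exists>y\<in>S. corner n y \<and> y * E k 0 \<noteq> 0)"
  have sS: "fm.subspace S" using S unfolding lie_sub_def by blast
  obtain F where F: "finite F" "F \<subseteq> S" "\<forall>s\<in>S. \<exists>t\<in>fm.span F. corner n (s - t)"
    using corner_codim[OF sS, of n] by auto
  have "s * E k 0 \<in> fm.span ((\<lambda>s. s * E k 0) ` F)" if s: "s \<in> S" for s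
  proof -
    obtain t where t: "t \<in> fm.span F" "corner n (s - t)" using F(3) s by blast
    have "t \<in> S" using t(1) fm.span_minimal[OF F(2) sS] by blast
    hence "(s - t) * E k 0 = 0" using no t(2) fm.subspace_diff[OF sS s] by blast
    hence "s * E k 0 = t * E k 0" by (simp add: left_diff_distrib)
    thus ?thesis using t(1) fmm.linear_span_image[OF linear_mult_right] by blast
  qed
  hence "fd ((\<lambda>s. s * E k 0) ` S)" unfolding fd_def using F(1) by blast
  thus False using not_fd_orbit[OF S irr loc, of "E k 0"] by simp
qed

theorem irreducible_locally_fd_cases:
  assumes S: "lie_sub S" and "irr S" "rowfull S" "locally_fd S"
  shows "(\<forall>i j. i \<noteq> j \<longrightarrow> E i j \<in> S) \<or> (\<exists>st. star st \<and> S = {T. st T = - T})"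
  using irreducible_cases[OF S alg_UNIV deepI] assms unfolding lie_sub_def by blast

section \<open>Dual bases\<close>

text \<open>An infinite sequence as the union of finite lists, each extending the last: stage
  \<open>k\<close> secures requirement \<open>Q k\<close>, and \<open>grow\<close> makes the length
  unbounded.\<close>

lemma seq_build:
  fixes P :: "'b list \<Rightarrow> bool" and Q :: "nat \<Rightarrow> 'b list \<Rightarrow> bool"
  assumes P0: "P []"
    and step: "\<And>xs k. P xs \<Longrightarrow> \<exists>ys. P (xs @ ys) \<and> Q k (xs @ ys)"
    and grow: "\<And>xs. P xs \<Longrightarrow> \<exists>ys. ys \<noteq> [] \<and> P (xs @ ys)"
  shows "\<exists>s. (\<forall>k. \<exists>n. P (map s [0..<n]) \<and> Q k (map s [0..<n])) \<and> (\<forall>m. \<exists>n\<ge>m. P (map s [0..<n]))"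
proof -
  have "\<exists>L. \<forall>n. P (L n) \<and> (\<exists>ys. ys \<noteq> [] \<and> L (Suc n) = L n @ ys \<and> Q n (L (Suc n)))"
  proof (rule dependent_nat_choice[of "\<lambda>n. P" "\<lambda>n x y. \<exists>ys. ys \<noteq> [] \<and> y = x @ ys \<and> Q n y"])
    show "\<exists>x. P x" using P0 by blast
  next
    fix xs n assume "P xs"
    then obtain ys where ys: "ys \<noteq> []" "P (xs @ ys)" using grow by blast
    then obtain zs where "P ((xs @ ys) @ zs)" "Q n ((xs @ ys) @ zs)" using step by blast
    thus "\<exists>y. P y \<and> (\<exists>ys. ys \<noteq> [] \<and> y = xs @ ys \<and> Q n y)"
      using ys(1) by (intro exI[of _ "xs @ ys @ zs"]) auto
  qed
  then obtain L where L: "\<And>n. P (L n)" "\<And>n. \<exists>ys. ys \<noteq> [] \<and> L (Suc n) = L n @ ys \<and> Q n (L (Suc n))" by blast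
  have pre: "\<exists>zs. L (n + d) = L n @ zs" for n d
  proof (induction d)
    case (Suc d)
    thus ?case using L(2)[of "n + d"] by auto
  qed simp
  have len: "n \<le> length (L n)" for n
  proof (induction n)
    case (Suc n)
    obtain ys where "ys \<noteq> []" "L (Suc n) = L n @ ys" using L(2) by blast
    thus ?case using Suc by (cases ys) auto
  qed simp
  define s where "s i = L (Suc i) ! i" for i
  have s: "s i = L n ! i" if "i < length (L n)" for i n
  proof -
    have i: "i < length (L (Suc i))" using len[of "Suc i"] by simp
    show ?thesis
    proof (cases "n \<le> Suc i")
      case True
      then obtain zs where "L (Suc i) = L n @ zs" using pre[of n "Suc i - n"] by auto
      thus ?thesis using that unfolding s_def by (simp add: nth_append)
    next
      case False
      then obtain zs where "L n = L (Suc i) @ zs" using pre[of "Suc i" "n - Suc i"] by auto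
      thus ?thesis using i unfolding s_def by (simp add: nth_append)
    qed
  qed
  have sL: "map s [0..<length (L n)] = L n" for n
    by (rule nth_equalityI) (auto simp: s)
  show ?thesis
  proof (intro exI[of _ s] conjI allI)
    fix k
    show "\<exists>n. P (map s [0..<n]) \<and> Q k (map s [0..<n])"
      using sL[of "Suc k"] L(1)[of "Suc k"] L(2)[of k] by (intro exI[of _ "length (L (Suc k))"]) auto
  next
    fix m
    show "\<exists>n\<ge>m. P (map s [0..<n])"
      using sL[of m] L(1)[of m] len[of m] by (intro exI[of _ "length (L m)"]) auto
  qed
qed

section \<open>Finite biorthogonal systems of vectors and functionals\<close>

definition bp :: "fmat \<Rightarrow> fmat \<Rightarrow> complex" where "bp f u = ent (f * u) 0 0"

lemma bp_lin: "bp (f + g) u = bp f u + bp g u" "bp f (u + v) = bp f u + bp f v"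
  "bp (f - g) u = bp f u - bp g u" "bp f (u - v) = bp f u - bp f v"
  "bp (c *\<^sub>m f) u = c * bp f u" "bp f (c *\<^sub>m u) = c * bp f u" "bp 0 u = 0" "bp f 0 = 0"
  unfolding bp_def by (simp_all add: distrib_left distrib_right left_diff_distrib right_diff_distrib)

lemma bp_sum: "bp f (sum g X) = (\<Sum>x\<in>X. bp f (g x))" "bp (sum g X) u = (\<Sum>x\<in>X. bp (g x) u)"
  unfolding bp_def by (simp_all add: sum_distrib_left sum_distrib_right)

lemma bp_sum_list: "bp f (sum_list xs) = (\<Sum>x\<leftarrow>xs. bp f x)" "bp (sum_list xs) u = (\<Sum>x\<leftarrow>xs. bp x u)"
  by (induction xs) (auto simp: bp_lin)

lemma bp_move: "bp (f * T) u = bp f (T * u)"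
  unfolding bp_def by (simp add: mult.assoc)

lemma sum_list_single:
  fixes c :: "'c \<Rightarrow> complex"
  assumes "i < length xs" "\<And>j. j < length xs \<Longrightarrow> j \<noteq> i \<Longrightarrow> c (xs ! j) = 0"
  shows "(\<Sum>x\<leftarrow>xs. c x) = c (xs ! i)"
proof -
  have "(\<Sum>x\<leftarrow>xs. c x) = (\<Sum>j = 0..<length xs. c (xs ! j))"
    by (simp add: sum_list_sum_nth)
  also have "\<dots> = (\<Sum>j\<in>{i}. c (xs ! j))"
    by (rule sum.mono_neutral_right) (use assms in auto)
  finally show ?thesis by simp
qed

lemma subspace_sum_list: "fm.subspace M \<Longrightarrow> (\<And>x. x \<in> set xs \<Longrightarrow> x \<in> M) \<Longrightarrow> sum_list xs \<in> M"
  by (induction xs) (auto simp: fm.subspace_0 fm.subspace_add)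

definition biorth :: "fmat set \<Rightarrow> fmat set \<Rightarrow> (fmat \<times> fmat) list \<Rightarrow> bool" where
  "biorth M F xs \<longleftrightarrow> (\<forall>x\<in>set xs. fst x \<in> M \<and> snd x \<in> F)
    \<and> (\<forall>i<length xs. \<forall>j<length xs. bp (snd (xs ! i)) (fst (xs ! j)) = (if i = j then 1 else 0))"

text \<open>The pairing of \<open>g\<close> and \<open>u\<close> as the system \<open>xs\<close>
  computes it; the expansion is exact when it agrees with \<open>bp g u\<close>.\<close>

definition bexp :: "(fmat \<times> fmat) list \<Rightarrow> fmat \<Rightarrow> fmat \<Rightarrow> complex" where
  "bexp xs g u = (\<Sum>x\<leftarrow>xs. bp g (fst x) * bp (snd x) u)"

lemma bexp_fst: "biorth M F xs \<Longrightarrow> i < length xs \<Longrightarrow> bexp xs g (fst (xs ! i)) = bp g (fst (xs ! i))"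
  unfolding bexp_def by (subst sum_list_single[of i]) (auto simp: biorth_def)

lemma bexp_snd: "biorth M F xs \<Longrightarrow> i < length xs \<Longrightarrow> bexp xs (snd (xs ! i)) u = bp (snd (xs ! i)) u"
  unfolding bexp_def by (subst sum_list_single[of i]) (auto simp: biorth_def)

lemma biorth_snoc:
  assumes "biorth M F xs" "u \<in> M" "g \<in> F" "bp g u = 1"
    "\<And>x. x \<in> set xs \<Longrightarrow> bp (snd x) u = 0" "\<And>x. x \<in> set xs \<Longrightarrow> bp g (fst x) = 0"
  shows "biorth M F (xs @ [(u, g)])"
  using assms unfolding biorth_def by (auto simp: nth_append less_Suc_eq)

text \<open>Gram-Schmidt on both sides at once. The residues \<open>u'\<close> and \<open>g'\<close>
  pair to the defect \<open>bp g u - bexp xs g u\<close>, which is nonzero; adding them, one divided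
  by the defect, makes the expansions of \<open>u\<close> and of \<open>g\<close> exact
  together.\<close>

lemma biorth_extend:
  assumes M: "fm.subspace M" and F: "fm.subspace F" and P: "biorth M F xs"
    and u: "u \<in> M" and g: "g \<in> F" and ne: "bp g u \<noteq> bexp xs g u"
  shows "\<exists>ys. ys \<noteq> [] \<and> biorth M F (xs @ ys) \<and> (\<forall>h\<in>F. bp h u = bexp (xs @ ys) h u)
    \<and> (\<forall>v\<in>M. bp g v = bexp (xs @ ys) g v)"
proof -
  define u' where "u' = u - (\<Sum>x\<leftarrow>xs. bp (snd x) u *\<^sub>m fst x)"
  define g' where "g' = g - (\<Sum>x\<leftarrow>xs. bp g (fst x) *\<^sub>m snd x)"
  have bu: "bp h u' = bp h u - bexp xs h u" for h
    unfolding u'_def bexp_def by (simp add: bp_lin bp_sum_list o_def mult.commute)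
  have bg: "bp g' v = bp g v - bexp xs g v" for v
    unfolding g'_def bexp_def by (simp add: bp_lin bp_sum_list o_def)
  have u'M: "u' \<in> M" unfolding u'_def using P
    by (intro fm.subspace_diff[OF M u] subspace_sum_list[OF M]) (auto simp: biorth_def intro!: fm.subspace_scale[OF M])
  have g'F: "g' \<in> F" unfolding g'_def using P
    by (intro fm.subspace_diff[OF F g] subspace_sum_list[OF F]) (auto simp: biorth_def intro!: fm.subspace_scale[OF F])
  have ou: "bp (snd x) u' = 0" if "x \<in> set xs" for x
    using that bexp_snd[OF P] unfolding bu by (metis in_set_conv_nth right_minus_eq)
  have og: "bp g' (fst x) = 0" if "x \<in> set xs" for x
    using that bexp_fst[OF P] unfolding bg by (metis in_set_conv_nth right_minus_eq)
  define c where "c = bp g u - bexp xs g u"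
  have c: "c \<noteq> 0" using ne unfolding c_def by simp
  have e0: "bexp xs g' v = 0" for v unfolding bexp_def using og by (simp add: sum_list_0 cong: map_cong)
  have e1: "bexp xs h u' = 0" for h unfolding bexp_def using ou by (simp add: sum_list_0 cong: map_cong)
  have gu': "bp g' u' = c" unfolding bu e0 bg c_def by simp
  have gu: "bp g' u = c" unfolding bg c_def by simp
  have "bp g u' = c" unfolding bu c_def by simp
  define y where "y = (u', (1 / c) *\<^sub>m g')"
  have P': "biorth M F (xs @ [y])" unfolding y_def
    by (rule biorth_snoc[OF P u'M fm.subspace_scale[OF F g'F]])
      (use c ou og gu' in \<open>auto simp: bp_lin\<close>)
  have 1: "bp h u = bexp (xs @ [y]) h u" for h
    using c gu unfolding bexp_def y_def by (simp add: bp_lin) (simp add: bu bexp_def)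
  have 2: "bp g v = bexp (xs @ [y]) g v" for v
    using c \<open>bp g u' = c\<close> unfolding bexp_def y_def by (simp add: bp_lin) (simp add: bg bexp_def)
  show ?thesis using P' 1 2 by (intro exI[of _ "[y]"]) auto
qed

text \<open>Vectors and functionals are treated alternately. The pairing need not be nondegenerate;
  its radicals are invisible to the conclusion.\<close>

theorem dual_bases:
  fixes u g :: "nat \<Rightarrow> fmat"
  assumes M: "fm.subspace M" and F: "fm.subspace F"
    and u: "\<And>k. u k \<in> M" "M \<subseteq> fm.span (range u)"
    and g: "\<And>k. g k \<in> F" "F \<subseteq> fm.span (range g)"
    and inf: "\<And>xs. biorth M F xs \<Longrightarrow> \<exists>v\<in>M. \<exists>h\<in>F. bp h v \<noteq> bexp xs h v"
  shows "\<exists>(w :: nat \<Rightarrow> fmat) f. (\<forall>i. w i \<in> M \<and> f i \<in> F) \<and> (\<forall>i j. bp (f i) (w j) = (if i = j then 1 else 0))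
    \<and> (\<forall>v\<in>M. \<exists>n. \<forall>h\<in>F. bp h v = (\<Sum>k<n. bp h (w k) * bp (f k) v))
    \<and> (\<forall>h\<in>F. \<exists>n. \<forall>v\<in>M. bp h v = (\<Sum>k<n. bp h (w k) * bp (f k) v))"
proof -
  define Q where "Q k xs \<longleftrightarrow> (if even k then (\<forall>h\<in>F. bp h (u (k div 2)) = bexp xs h (u (k div 2)))
    else (\<forall>v\<in>M. bp (g (k div 2)) v = bexp xs (g (k div 2)) v))" for k xs
  have "\<exists>ys. biorth M F (xs @ ys) \<and> Q k (xs @ ys)" if P: "biorth M F xs" for xs k
  proof (cases "Q k xs")
    case True
    thus ?thesis using P by (intro exI[of _ "[]"]) simp
  next
    case False
    show ?thesis
    proof (cases "even k")
      case True
      then obtain h where "h \<in> F" "bp h (u (k div 2)) \<noteq> bexp xs h (u (k div 2))"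
        using False unfolding Q_def by auto
      from biorth_extend[OF M F P u(1) this] show ?thesis using True unfolding Q_def by auto
    next
      case odd: False
      then obtain v where "v \<in> M" "bp (g (k div 2)) v \<noteq> bexp xs (g (k div 2)) v"
        using False unfolding Q_def by auto
      from biorth_extend[OF M F P this(1) g(1) this(2)] show ?thesis using odd unfolding Q_def by auto
    qed
  qed
  moreover have "biorth M F []" by (simp add: biorth_def)
  moreover have "\<exists>ys. ys \<noteq> [] \<and> biorth M F (xs @ ys)" if P: "biorth M F xs" for xs
    using inf[OF P] biorth_extend[OF M F P] by blast
  ultimately obtain s where s: "\<And>k. \<exists>n. biorth M F (map s [0..<n]) \<and> Q k (map s [0..<n])"
    "\<And>m. \<exists>n\<ge>m. biorth M F (map s [0..<n])"
    using seq_build[of "biorth M F" Q] by blast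
  define w where "w i = fst (s i)" for i
  define f where "f i = snd (s i)" for i
  have wf: "w i \<in> M \<and> f i \<in> F" for i
  proof -
    obtain n where "n \<ge> Suc i" "biorth M F (map s [0..<n])" using s(2) by blast
    thus ?thesis unfolding biorth_def w_def f_def by auto
  qed
  have bi: "bp (f i) (w j) = (if i = j then 1 else 0)" for i j
  proof -
    obtain n where n: "n \<ge> Suc (max i j)" "biorth M F (map s [0..<n])" using s(2) by blast
    hence "bp (snd (map s [0..<n] ! i)) (fst (map s [0..<n] ! j)) = (if i = j then 1 else 0)"
      unfolding biorth_def by simp
    thus ?thesis using n(1) unfolding w_def f_def by simp
  qed
  have be: "bexp (map s [0..<n]) h v = (\<Sum>k<n. bp h (w k) * bp (f k) v)" for n h v
    unfolding bexp_def w_def f_def by (simp add: sum_list_sum_nth atLeast0LessThan)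
  \<comment> \<open>An exact expansion stays exact under extension: it forces
    \<open>bp (f k) v = 0\<close> for the later \<open>k\<close>.\<close>
  have upM: "bp h v = (\<Sum>k<m. bp h (w k) * bp (f k) v)"
    if "\<forall>h\<in>F. bp h v = (\<Sum>k<n. bp h (w k) * bp (f k) v)" "n \<le> m" "h \<in> F" for h v n m
  proof -
    have "bp (f k) v = 0" if k: "k \<ge> n" for k
    proof -
      have "bp (f k) v = (\<Sum>l<n. bp (f k) (w l) * bp (f l) v)" using \<open>\<forall>h\<in>F. _\<close> wf by blast
      also have "\<dots> = 0" by (rule sum.neutral) (use k bi in auto)
      finally show ?thesis .
    qed
    hence "(\<Sum>k<m. bp h (w k) * bp (f k) v) = (\<Sum>k<n. bp h (w k) * bp (f k) v)"
      by (intro sum.mono_neutral_right) (use that in auto)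
    thus ?thesis using that by simp
  qed
  have upF: "bp h v = (\<Sum>k<m. bp h (w k) * bp (f k) v)"
    if "\<forall>v\<in>M. bp h v = (\<Sum>k<n. bp h (w k) * bp (f k) v)" "n \<le> m" "v \<in> M" for h v n m
  proof -
    have "bp h (w k) = 0" if k: "k \<ge> n" for k
    proof -
      have "bp h (w k) = (\<Sum>l<n. bp h (w l) * bp (f l) (w k))" using \<open>\<forall>v\<in>M. _\<close> wf by blast
      also have "\<dots> = 0" by (rule sum.neutral) (use k bi in auto)
      finally show ?thesis .
    qed
    hence "(\<Sum>k<m. bp h (w k) * bp (f k) v) = (\<Sum>k<n. bp h (w k) * bp (f k) v)"
      by (intro sum.mono_neutral_right) (use that in auto)
    thus ?thesis using that by simp
  qed
  have c1: "\<exists>n. \<forall>h\<in>F. bp h v = (\<Sum>k<n. bp h (w k) * bp (f k) v)" if "v \<in> fm.span (range u)" for v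
    using that
  proof (induction rule: fm.span_induct_alt)
    case base
    show ?case by (simp add: bp_lin)
  next
    case (step c x y)
    obtain i where i: "x = u i" using step(1) by blast
    obtain n where "Q (2 * i) (map s [0..<n])" using s(1) by blast
    hence n: "\<forall>h\<in>F. bp h x = (\<Sum>k<n. bp h (w k) * bp (f k) x)" unfolding Q_def i be by simp
    obtain m where m: "\<forall>h\<in>F. bp h y = (\<Sum>k<m. bp h (w k) * bp (f k) y)" using step(2) by blast
    have "bp h (c *\<^sub>m x + y) = (\<Sum>k<max n m. bp h (w k) * bp (f k) (c *\<^sub>m x + y))" if "h \<in> F" for h
      using upM[OF n _ that, of "max n m"] upM[OF m _ that, of "max n m"]
      by (simp add: bp_lin distrib_left sum.distrib sum_distrib_left mult.left_commute)
    thus ?case by blast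
  qed
  have c2: "\<exists>n. \<forall>v\<in>M. bp h v = (\<Sum>k<n. bp h (w k) * bp (f k) v)" if "h \<in> fm.span (range g)" for h
    using that
  proof (induction rule: fm.span_induct_alt)
    case base
    show ?case by (simp add: bp_lin)
  next
    case (step c x y)
    obtain i where i: "x = g i" using step(1) by blast
    obtain n where "Q (Suc (2 * i)) (map s [0..<n])" using s(1) by blast
    hence n: "\<forall>v\<in>M. bp x v = (\<Sum>k<n. bp x (w k) * bp (f k) v)" unfolding Q_def i be by simp
    obtain m where m: "\<forall>v\<in>M. bp y v = (\<Sum>k<m. bp y (w k) * bp (f k) v)" using step(2) by blast
    have "bp (c *\<^sub>m x + y) v = (\<Sum>k<max n m. bp (c *\<^sub>m x + y) (w k) * bp (f k) v)" if "v \<in> M" for v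
      using upF[OF n _ that, of "max n m"] upF[OF m _ that, of "max n m"]
      by (simp add: bp_lin distrib_right sum.distrib sum_distrib_left mult.assoc)
    thus ?case by blast
  qed
  show ?thesis
  proof (rule exI[of _ w], rule exI[of _ f], intro conjI)
    show "\<forall>i. w i \<in> M \<and> f i \<in> F" "\<forall>i j. bp (f i) (w j) = (if i = j then 1 else 0)"
      using wf bi by simp_all
    show "\<forall>v\<in>M. \<exists>n. \<forall>h\<in>F. bp h v = (\<Sum>k<n. bp h (w k) * bp (f k) v)"
      using c1 subsetD[OF u(2)] by simp
    show "\<forall>h\<in>F. \<exists>n. \<forall>v\<in>M. bp h v = (\<Sum>k<n. bp h (w k) * bp (f k) v)"
      using c2 subsetD[OF g(2)] by simp
  qed
qed

text \<open>The members of \<open>M\<close> of size \<open>n\<close> span a finite-dimensional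
  space, and \<open>M\<close> is the union over \<open>n\<close>.\<close>

lemma countable_spanning:
  assumes "fm.subspace M"
  shows "\<exists>u :: nat \<Rightarrow> fmat. (\<forall>k. u k \<in> M) \<and> M \<subseteq> fm.span (range u)"
proof -
  have "\<exists>C. finite C \<and> C \<subseteq> {x \<in> M. bnd n x} \<and> {x \<in> M. bnd n x} \<subseteq> fm.span C" for n
    using finite_basis_bnd[of "{x \<in> M. bnd n x}" n] by blast
  then obtain C where C: "\<And>n. finite (C n)" "\<And>n. C n \<subseteq> {x \<in> M. bnd n x}" "\<And>n. {x \<in> M. bnd n x} \<subseteq> fm.span (C n)"
    by metis
  define X where "X = insert 0 (\<Union>n. C n)"
  have "countable X" unfolding X_def using C(1) by (simp add: countable_finite)
  moreover have "X \<noteq> {}" unfolding X_def by simp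
  ultimately have rX: "range (from_nat_into X) = X" by (rule range_from_nat_into[rotated])
  have "X \<subseteq> M" unfolding X_def using C(2) fm.subspace_0[OF assms] by blast
  moreover have "M \<subseteq> fm.span X"
  proof
    fix x assume "x \<in> M"
    moreover obtain n where "bnd n x" using bnd_ex by blast
    ultimately have "x \<in> fm.span (C n)" using C(3) by blast
    thus "x \<in> fm.span X" using fm.span_mono[of "C n" X] unfolding X_def by blast
  qed
  ultimately show ?thesis using rX by (intro exI[of _ "from_nat_into X"]) (auto intro: from_nat_into)
qed

subsection \<open>Matrices in dual bases\<close>

locale dbasis =
  fixes M F :: "fmat set" and w f :: "nat \<Rightarrow> fmat"
  assumes sM: "fm.subspace M" and sF: "fm.subspace F" and MV: "M \<subseteq> Vc" and FV: "F \<subseteq> Vr"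
    and wM: "w i \<in> M" and fF: "f i \<in> F"
    and bi: "bp (f i) (w j) = (if i = j then 1 else 0)"
    and cM: "v \<in> M \<Longrightarrow> \<exists>n. \<forall>h\<in>F. bp h v = (\<Sum>k<n. bp h (w k) * bp (f k) v)"
    and cF: "h \<in> F \<Longrightarrow> \<exists>n. \<forall>v\<in>M. bp h v = (\<Sum>k<n. bp h (w k) * bp (f k) v)"
begin

lemma f_van: "v \<in> M \<Longrightarrow> \<exists>n. \<forall>k\<ge>n. bp (f k) v = 0"
proof -
  assume "v \<in> M"
  then obtain n where n: "\<forall>h\<in>F. bp h v = (\<Sum>k<n. bp h (w k) * bp (f k) v)" using cM by blast
  have "bp (f k) v = 0" if k: "k \<ge> n" for k
  proof -
    have "bp (f k) v = (\<Sum>l<n. bp (f k) (w l) * bp (f l) v)" using n fF by blast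
    also have "\<dots> = 0" by (rule sum.neutral) (use k bi in auto)
    finally show ?thesis .
  qed
  thus ?thesis by blast
qed

lemma w_van: "h \<in> F \<Longrightarrow> \<exists>n. \<forall>k\<ge>n. bp h (w k) = 0"
proof -
  assume "h \<in> F"
  then obtain n where n: "\<forall>v\<in>M. bp h v = (\<Sum>k<n. bp h (w k) * bp (f k) v)" using cF by blast
  have "bp h (w k) = 0" if k: "k \<ge> n" for k
  proof -
    have "bp h (w k) = (\<Sum>l<n. bp h (w l) * bp (f l) (w k))" using n wM by blast
    also have "\<dots> = 0" by (rule sum.neutral) (use k bi in auto)
    finally show ?thesis .
  qed
  thus ?thesis by blast
qed

lemma expand:
  assumes "h \<in> F" "v \<in> M" "\<forall>k\<ge>n. bp (f k) v = 0 \<or> bp h (w k) = 0"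
  shows "bp h v = (\<Sum>k<n. bp h (w k) * bp (f k) v)"
proof -
  obtain m where m: "\<forall>h\<in>F. bp h v = (\<Sum>k<m. bp h (w k) * bp (f k) v)" using cM[OF assms(2)] by blast
  have z: "bp (f k) v = 0" if k: "k \<ge> m" for k
  proof -
    have "bp (f k) v = (\<Sum>l<m. bp (f k) (w l) * bp (f l) v)" using m fF by blast
    also have "\<dots> = 0" by (rule sum.neutral) (use k bi in auto)
    finally show ?thesis .
  qed
  have "(\<Sum>k<max n m. bp h (w k) * bp (f k) v) = (\<Sum>k<n. bp h (w k) * bp (f k) v)"
    by (rule sum.mono_neutral_right) (use assms(3) in auto)
  moreover have "(\<Sum>k<max n m. bp h (w k) * bp (f k) v) = (\<Sum>k<m. bp h (w k) * bp (f k) v)"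
    by (rule sum.mono_neutral_right) (use z in auto)
  ultimately show ?thesis using m assms(1) by simp
qed

definition pres :: "fmat \<Rightarrow> bool" where
  "pres T \<longleftrightarrow> (\<forall>v\<in>M. T * v \<in> M) \<and> (\<forall>h\<in>F. h * T \<in> F)"

definition rep :: "fmat \<Rightarrow> fmat" where
  "rep T = Fmat (\<lambda>i j. bp (f i) (T * w j))"

text \<open>Finite support has to be proved on both sides: \<open>T\<close> has finite rank, so the
  vectors \<open>T * v\<close> span a finite-dimensional part of \<open>M\<close>, on which almost
  all \<open>f k\<close> vanish; dually for the functionals \<open>h * T\<close> and the
  \<open>w k\<close>.\<close>

lemma ent_rep: assumes "pres T" shows "ent (rep T) i j = bp (f i) (T * w j)"
proof -
  obtain n where n: "bnd n T" using bnd_ex by blast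
  have "\<exists>m. \<forall>v\<in>M. \<forall>k\<ge>m. bp (f k) (T * v) = 0"
  proof -
    have "bnd (Suc n) x" if "x \<in> (\<lambda>v. T * v) ` M" for x using that bnd_mult_Vc[OF n] MV by blast
    then obtain C where C: "finite C" "C \<subseteq> (\<lambda>v. T * v) ` M" "(\<lambda>v. T * v) ` M \<subseteq> fm.span C"
      using finite_basis_bnd[of "(\<lambda>v. T * v) ` M" "Suc n"] by blast
    have CM: "C \<subseteq> M" using C(2) assms unfolding pres_def by blast
    have "\<forall>c\<in>C. \<exists>m. \<forall>k\<ge>m. bp (f k) c = 0" using f_van CM by blast
    then obtain m where m: "\<forall>c\<in>C. \<forall>k\<ge>m c. bp (f k) c = 0" by metis
    define m0 where "m0 = Max (insert 0 (m ` C))"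
    have m0: "m c \<le> m0" if "c \<in> C" for c unfolding m0_def using that C(1) by (intro Max_ge) auto
    have "bp (f k) x = 0" if "k \<ge> m0" "x \<in> fm.span C" for k x
      using that(2)
    proof (induction rule: fm.span_induct_alt)
      case (step c x y)
      hence "bp (f k) x = 0" using m m0[of x] that(1) by (meson order_trans)
      thus ?case using step by (simp add: bp_lin)
    qed (simp add: bp_lin)
    thus ?thesis using C(3) by blast
  qed
  then obtain m where m: "\<forall>v\<in>M. \<forall>k\<ge>m. bp (f k) (T * v) = 0" by blast
  have "\<exists>m. \<forall>h\<in>F. \<forall>k\<ge>m. bp (h * T) (w k) = 0"
  proof -
    have "bnd (Suc n) x" if xF: "x \<in> (\<lambda>h. h * T) ` F" for x
    proof -
      obtain h where h: "h \<in> Vr" "x = h * T" using xF FV by blast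
      have "ent h i j = 0" if "i \<noteq> 0" for i j using Vr_ent[OF h(1) that] .
      moreover have "ent T i j = 0" if "j \<ge> n" for i j using n that unfolding bnd_def by (meson leD)
      ultimately have "ent x i j = 0" if "i \<noteq> 0 \<or> j \<ge> n" for i j
        using that unfolding h(2) by (auto simp: ent_times_bound2[OF n])
      thus ?thesis unfolding bnd_def by (metis Suc_leD not_less_eq_eq not_le zero_less_Suc)
    qed
    then obtain C where C: "finite C" "C \<subseteq> (\<lambda>h. h * T) ` F" "(\<lambda>h. h * T) ` F \<subseteq> fm.span C"
      using finite_basis_bnd[of "(\<lambda>h. h * T) ` F" "Suc n"] by blast
    have CF: "C \<subseteq> F" using C(2) assms unfolding pres_def by blast
    have "\<forall>c\<in>C. \<exists>m. \<forall>k\<ge>m. bp c (w k) = 0" using w_van CF by blast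
    then obtain m where m: "\<forall>c\<in>C. \<forall>k\<ge>m c. bp c (w k) = 0" by metis
    define m0 where "m0 = Max (insert 0 (m ` C))"
    have m0: "m c \<le> m0" if "c \<in> C" for c unfolding m0_def using that C(1) by (intro Max_ge) auto
    have "bp x (w k) = 0" if "k \<ge> m0" "x \<in> fm.span C" for k x
      using that(2)
    proof (induction rule: fm.span_induct_alt)
      case (step c x y)
      hence "bp x (w k) = 0" using m m0[of x] that(1) by (meson order_trans)
      thus ?case using step by (simp add: bp_lin)
    qed (simp add: bp_lin)
    thus ?thesis using C(3) by blast
  qed
  then obtain m' where m': "\<forall>h\<in>F. \<forall>k\<ge>m'. bp (h * T) (w k) = 0" by blast
  have "finite {(i, j). bp (f i) (T * w j) \<noteq> 0}"
  proof (rule finite_supp_bound)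
    fix i j assume nz: "bp (f i) (T * w j) \<noteq> 0"
    hence "i < m" using m wM by (meson not_le)
    moreover have "j < m'" using m' fF nz by (metis bp_move not_le)
    ultimately show "i < m \<and> j < m'" by blast
  qed
  thus ?thesis unfolding rep_def by (simp add: ent_Fmat)
qed

lemma pres_add: "pres S \<Longrightarrow> pres T \<Longrightarrow> pres (S + T)"
  and pres_scale: "pres T \<Longrightarrow> pres (c *\<^sub>m T)"
  and pres_mult: "pres S \<Longrightarrow> pres T \<Longrightarrow> pres (S * T)"
  unfolding pres_def using fm.subspace_add[OF sM] fm.subspace_add[OF sF] fm.subspace_scale[OF sM]
    fm.subspace_scale[OF sF]
  by (auto simp: distrib_left distrib_right mult.assoc) (simp add: mult.assoc[symmetric])

lemma rep_add: "pres S \<Longrightarrow> pres T \<Longrightarrow> rep (S + T) = rep S + rep T"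
  and rep_scale: "pres T \<Longrightarrow> rep (c *\<^sub>m T) = c *\<^sub>m rep T"
  by (rule fmat_eqI, simp add: ent_rep pres_add pres_scale bp_lin distrib_right)+

text \<open>Insert the expansion in dual bases between \<open>f i * S\<close> and
  \<open>T * w j\<close>; it is finite because \<open>rep S\<close> is.\<close>

lemma rep_mult: assumes "pres S" "pres T" shows "rep (S * T) = rep S * rep T"
proof (rule fmat_eqI)
  fix i j
  obtain n where n: "bnd n (rep S)" using bnd_ex by blast
  have "bp (f i * S) (w k) = 0" if "k \<ge> n" for k
  proof -
    have "ent (rep S) i k = 0" using n that unfolding bnd_def by (meson leD)
    thus ?thesis unfolding ent_rep[OF assms(1)] bp_move .
  qed
  hence "bp (f i * S) (T * w j) = (\<Sum>k<n. bp (f i * S) (w k) * bp (f k) (T * w j))"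
    using assms fF wM unfolding pres_def by (intro expand) auto
  thus "ent (rep (S * T)) i j = ent (rep S * rep T) i j"
    by (simp add: ent_rep assms pres_mult ent_times_bound[OF n] bp_move mult.assoc)
qed

lemma rep_diff: "pres S \<Longrightarrow> pres T \<Longrightarrow> rep (S - T) = rep S - rep T"
  using rep_add[of S "- T"] pres_scale[of T "-1"] rep_scale[of T "-1"] by simp

lemma rep_lb: "pres S \<Longrightarrow> pres T \<Longrightarrow> rep (lb S T) = lb (rep S) (rep T)"
  unfolding lb_def by (simp add: rep_diff rep_mult pres_mult)

lemma rep_eq_0:
  assumes "pres T" "rep T = 0" "h \<in> F" "v \<in> M"
  shows "bp h (T * v) = 0"
proof -
  have z: "bp (f i) (T * w j) = 0" for i j using ent_rep[OF assms(1)] assms(2) by simp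
  have "bp (f i * T) v = 0" for i
  proof -
    obtain n where "\<forall>h\<in>F. bp h v = (\<Sum>k<n. bp h (w k) * bp (f k) v)" using cM[OF assms(4)] by blast
    hence "bp (f i * T) v = (\<Sum>k<n. bp (f i * T) (w k) * bp (f k) v)"
      using assms(1) fF unfolding pres_def by blast
    thus ?thesis by (simp add: bp_move z)
  qed
  moreover obtain n where "\<forall>v\<in>M. bp h v = (\<Sum>k<n. bp h (w k) * bp (f k) v)" using cF[OF assms(3)] by blast
  hence "bp h (T * v) = (\<Sum>k<n. bp h (w k) * bp (f k) (T * v))"
    using assms(1,4) unfolding pres_def by blast
  ultimately show ?thesis by (simp add: bp_move)
qed

end

section \<open>Orthonormal and symplectic bases\<close>

lemma lcarrier_gl_inf: "lcarrier gl_inf = range ent"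
proof -
  have "A \<in> range ent" if "finite {(i, j). A i j \<noteq> 0}" for A :: "nat \<Rightarrow> nat \<Rightarrow> complex"
    using ent_Fmat[OF that] by (metis rangeI)
  thus ?thesis by (auto simp: gl_inf_def finite_ent)
qed

lemma mem_so_inf: "A \<in> lcarrier so_inf \<longleftrightarrow> A \<in> range ent \<and> (\<forall>i j. A j i = - A i j)"
  unfolding so_inf_def lcarrier_gl_inf by simp

lemma mem_sp_inf: "A \<in> lcarrier sp_inf \<longleftrightarrow> A \<in> range ent
    \<and> (\<forall>i j. A (partner j) i * omega (partner j) j + omega i (partner i) * A (partner i) j = 0)"
  unfolding sp_inf_def lcarrier_gl_inf by simp

lemma Vc_span: "(\<And>k. E k 0 \<in> fm.span X) \<Longrightarrow> Vc \<subseteq> fm.span X"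
proof
  fix u assume X: "\<And>k. E k 0 \<in> fm.span X" and u: "u \<in> Vc"
  obtain n where "bnd n u" using bnd_ex by blast
  from Vc_sum[OF u this] show "u \<in> fm.span X"
    by (metis (no_types, lifting) X fm.span_scale fm.span_sum)
qed

lemma E_notin_span: "finite X \<Longrightarrow> \<exists>n. E n 0 \<notin> fm.span X"
  using Vc_span[of X] not_fd_Vc unfolding fd_def by blast

context star
begin

lemma B_bp: "B u v = bp (dag u) v"
  by (simp add: B_def bp_def)

lemma Vc_vec: "u \<in> Vc \<longleftrightarrow> vec u"
  by (simp add: Vc_def)

lemma dag_Vr: "dag u \<in> Vr"
  by (simp add: Vr_def dag_row)

lemma B_0: "B 0 v = 0" "B u 0 = 0"
  using B_lin(3)[of 0 0 v] B_lin(4)[of u 0 0] by simp_all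

lemma B_diff: "B (u - v) x = B u x - B v x" "B x (u - v) = B x u - B x v"
  using B_lin(1)[of "u - v" v x] B_lin(2)[of x "u - v" v] by simp_all

lemma B_sum_list: "B x (sum_list xs) = (\<Sum>y\<leftarrow>xs. B x y)"
  by (induction xs) (auto simp: B_0 B_lin)

lemma B_nondeg: assumes "vec u" "u \<noteq> 0" shows "\<exists>v. vec v \<and> B u v = 1"
proof -
  have "dag u \<noteq> 0" using dag_inj assms by blast
  then obtain i j where ij: "ent (dag u) i j \<noteq> 0" using fmat_nonzero_ex by blast
  hence "i = 0" using Vr_ent[OF dag_Vr] by blast
  define v where "v = (1 / ent (dag u) 0 j) *\<^sub>m E j 0"
  have "vec v" unfolding v_def by simp
  moreover have "B u v = 1" using ij \<open>i = 0\<close> unfolding v_def B_def by simp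
  ultimately show ?thesis by blast
qed

lemma vec_subspace: "vec 0" "vec u \<Longrightarrow> vec v \<Longrightarrow> vec (u + v)" "vec u \<Longrightarrow> vec v \<Longrightarrow> vec (u - v)"
  "vec u \<Longrightarrow> vec (c *\<^sub>m u)"
  by (simp_all add: distrib_right left_diff_distrib)

lemma vec_sum_list: "(\<And>x. x \<in> set xs \<Longrightarrow> vec x) \<Longrightarrow> vec (sum_list xs)"
  by (induction xs) (auto simp: distrib_right)

text \<open>\<open>w'\<close> is the basis dual to \<open>w\<close> under the form. Since every row
  is some \<open>dag u\<close>, the assumption \<open>fin\<close> makes the coordinates of
  functionals finite in number.\<close>

lemma form_dbasis:
  assumes w: "\<And>i. vec (w i)" "\<And>i. vec (w' i)"
    and bi: "\<And>i j. B (w' i) (w j) = (if i = j then 1 else 0)"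
    and fin: "\<And>j. \<exists>n. \<forall>k\<ge>n. B (w j) (w k) = 0"
    and span: "Vc \<subseteq> fm.span (range w)"
  shows "dbasis Vc Vr w (\<lambda>i. dag (w' i))"
proof -
  have ex: "\<exists>n. \<forall>m\<ge>n. \<forall>h. bp h v = (\<Sum>k<m. bp h (w k) * B (w' k) v)" if "v \<in> Vc" for v
    using subsetD[OF span that]
  proof (induction rule: fm.span_induct_alt)
    case base
    show ?case by (simp add: bp_lin B_0)
  next
    case (step c x y)
    obtain i where i: "x = w i" using step(1) by blast
    obtain n where n: "\<forall>m\<ge>n. \<forall>h. bp h y = (\<Sum>k<m. bp h (w k) * B (w' k) y)" using step(2) by blast
    have x: "bp h x = (\<Sum>k<m. bp h (w k) * B (w' k) x)" if "m \<ge> Suc i" for h m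
    proof -
      have "(\<Sum>k<m. bp h (w k) * B (w' k) x) = (\<Sum>k<m. if k = i then bp h (w i) else 0)"
        by (rule sum.cong) (auto simp: i bi)
      thus ?thesis using that by (simp add: i)
    qed
    have "bp h (c *\<^sub>m x + y) = (\<Sum>k<m. bp h (w k) * B (w' k) (c *\<^sub>m x + y))"
      if "m \<ge> max n (Suc i)" for h m
    proof -
      have "bp h y = (\<Sum>k<m. bp h (w k) * B (w' k) y)" using n that by simp
      moreover have "bp h x = (\<Sum>k<m. bp h (w k) * B (w' k) x)" using x that by simp
      ultimately show ?thesis
        by (simp add: bp_lin B_lin distrib_left sum.distrib sum_distrib_left mult.left_commute)
    qed
    thus ?case by blast
  qed
  have van: "\<exists>n. \<forall>k\<ge>n. B u (w k) = 0" if "u \<in> Vc" for u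
    using subsetD[OF span that]
  proof (induction rule: fm.span_induct_alt)
    case base
    show ?case by (simp add: B_0)
  next
    case (step c x y)
    obtain n m where "\<forall>k\<ge>n. B x (w k) = 0" "\<forall>k\<ge>m. B y (w k) = 0" using step fin by blast
    hence "\<forall>k\<ge>max n m. B (c *\<^sub>m x + y) (w k) = 0" by (simp add: B_lin)
    thus ?case by blast
  qed
  show ?thesis
  proof
    show "fm.subspace Vc" "fm.subspace Vr" by (rule subspace_Vc, rule subspace_Vr)
    show "Vc \<subseteq> Vc" "Vr \<subseteq> Vr" by auto
    show "w i \<in> Vc" "dag (w' i) \<in> Vr" for i by (simp_all add: Vc_vec w dag_Vr)
    show "bp (dag (w' i)) (w j) = (if i = j then 1 else 0)" for i j using bi unfolding B_bp .
    show "\<exists>n. \<forall>h\<in>Vr. bp h v = (\<Sum>k<n. bp h (w k) * bp (dag (w' k)) v)" if "v \<in> Vc" for v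
      using ex[OF that] unfolding B_bp by blast
  next
    fix h assume "h \<in> Vr"
    then obtain u where u: "vec u" "dag u = h" using dag_surj unfolding Vr_def by blast
    obtain n where n: "\<forall>k\<ge>n. B u (w k) = 0" using van u(1) Vc_vec by blast
    have "bp h v = (\<Sum>k<n. bp h (w k) * bp (dag (w' k)) v)" if v: "v \<in> Vc" for v
    proof -
      obtain m where m: "\<forall>l\<ge>m. \<forall>h. bp h v = (\<Sum>k<l. bp h (w k) * B (w' k) v)" using ex[OF v] by blast
      have "bp h v = (\<Sum>k<max m n. bp h (w k) * B (w' k) v)" using m by simp
      also have "\<dots> = (\<Sum>k<n. bp h (w k) * B (w' k) v)"
        by (rule sum.mono_neutral_right) (use n u(2) in \<open>auto simp: B_bp\<close>)
      finally show ?thesis unfolding B_bp .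
    qed
    thus "\<exists>n. \<forall>v\<in>Vc. bp h v = (\<Sum>k<n. bp h (w k) * bp (dag (w' k)) v)" by blast
  qed
qed

text \<open>A change of basis is an automorphism of the matrix ring. The last clause rewrites
  skewness as a condition on the numbers \<open>B (w i) (T * w j)\<close>, ready to be compared with
  the equations defining \<open>so_inf\<close> and \<open>sp_inf\<close>.\<close>

lemma form_rep:
  assumes w: "\<And>i. vec (w i)" "\<And>i. vec (w' i)"
    and bi: "\<And>i j. B (w' i) (w j) = (if i = j then 1 else 0)"
    and fin: "\<And>j. \<exists>n. \<forall>k\<ge>n. B (w j) (w k) = 0"
    and span: "Vc \<subseteq> fm.span (range w)"
  shows "\<exists>r. flinear r \<and> (\<forall>x y. r (x * y) = r x * r y) \<and> inj r \<and> surj r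
    \<and> (\<forall>T i j. ent (r T) i j = B (w' i) (T * w j))
    \<and> (\<forall>T. st T = - T \<longleftrightarrow> (\<forall>i j. B (w i) (T * w j) = - \<kappa> * B (w j) (T * w i)))"
proof -
  interpret b: dbasis Vc Vr w "\<lambda>i. dag (w' i)" by (rule form_dbasis[OF assms])
  have p: "b.pres T" for T unfolding b.pres_def using Vc_mult Vr_mult by blast
  have lin: "flinear b.rep" by (rule flinearI) (simp_all add: b.rep_add b.rep_scale p)
  have bpE: "bp (E 0 i) (T * E j 0) = ent T i j" for T i j unfolding bp_def by simp
  have "inj b.rep"
  proof (rule injI)
    fix x y assume "b.rep x = b.rep y"
    hence "b.rep (x - y) = 0" by (simp add: b.rep_diff p)
    hence "bp (E 0 i) ((x - y) * E j 0) = 0" for i j using b.rep_eq_0[OF p] by simp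
    thus "x = y" unfolding bpE by (intro fmat_eqI) simp
  qed
  moreover have "surj b.rep"
  proof (rule surjI)
    fix A
    \<comment> \<open>The preimage of \<open>A\<close> is the operator with entries \<open>A\<close>
      in the bases \<open>w\<close> and \<open>w'\<close>; \<open>SOME\<close> picks a size bound,
      since \<open>surjI\<close> asks for a function of \<open>A\<close>.\<close>
    show "b.rep (\<Sum>i<(SOME n. bnd n A). \<Sum>j<(SOME n. bnd n A). ent A i j *\<^sub>m (w i * dag (w' j))) = A"
    proof (rule fmat_eqI)
      fix a c
      define n where "n = (SOME n. bnd n A)"
      have n: "bnd n A" unfolding n_def by (rule someI_ex[OF bnd_ex])
      have wd: "bp (dag (w' a)) (w i * dag (w' j) * w c) = (if i = a \<and> j = c then 1 else 0)" for i j
      proof -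
        have "w i * dag (w' j) * w c = w i * (B (w' j) (w c) *\<^sub>m E 0 0)"
          using dag_mult[OF w(1)] by (simp add: mult.assoc)
        also have "\<dots> = B (w' j) (w c) *\<^sub>m w i" using w(1) by simp
        finally show ?thesis by (simp add: bp_lin B_bp[symmetric] bi)
      qed
      have "ent (b.rep (\<Sum>i<n. \<Sum>j<n. ent A i j *\<^sub>m (w i * dag (w' j)))) a c
          = (\<Sum>i<n. \<Sum>j<n. ent A i j * (if i = a \<and> j = c then 1 else 0))"
        by (simp only: b.ent_rep[OF p] sum_distrib_right bp_sum scaleM_mult_left bp_lin wd)
      also have "\<dots> = (\<Sum>i<n. if i = a then ent A a c else 0)"
      proof (rule sum.cong[OF refl])
        fix i
        have "(\<Sum>j<n. ent A i j * (if i = a \<and> j = c then 1 else 0))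
            = (\<Sum>j<n. if j = c then (if i = a then ent A a c else 0) else 0)"
          by (rule sum.cong) auto
        thus "(\<Sum>j<n. ent A i j * (if i = a \<and> j = c then 1 else 0)) = (if i = a then ent A a c else 0)"
          using n by (auto simp: bnd_def)
      qed
      also have "\<dots> = ent A a c" using n by (auto simp: bnd_def)
      finally show "ent (b.rep (\<Sum>i<(SOME n. bnd n A). \<Sum>j<(SOME n. bnd n A). ent A i j *\<^sub>m (w i * dag (w' j)))) a c
        = ent A a c" unfolding n_def .
    qed
  qed
  moreover have "st T = - T \<longleftrightarrow> (\<forall>i j. B (w i) (T * w j) = - \<kappa> * B (w j) (T * w i))" for T
  proof -
    have adj: "B (w i) (st T * w j) = \<kappa> * B (w j) (T * w i)" for i j
    proof -
      have "B (w i) (st T * w j) = B (T * w i) (w j)" by (simp add: B_adj)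
      also have "\<dots> = \<kappa> * B (w j) (T * w i)" by (rule B_sym) (use w in \<open>simp_all add: mult.assoc\<close>)
      finally show ?thesis .
    qed
    have z: "X = 0" if X: "\<And>i j. B (w i) (X * w j) = 0" for X
    proof -
      have 1: "B u (X * w j) = 0" if "u \<in> Vc" for u j
        using subsetD[OF span that] by (induction rule: fm.span_induct_alt) (auto simp: B_0 B_lin X)
      have 2: "B u (X * v) = 0" if u: "u \<in> Vc" and v: "v \<in> Vc" for u v
        using subsetD[OF span v]
        by (induction rule: fm.span_induct_alt) (auto simp: B_0 B_lin 1[OF u] distrib_left)
      have "ent X i j = 0" for i j
      proof -
        obtain u where "vec u" "dag u = E 0 i" using dag_surj[of "E 0 i"] by auto
        thus ?thesis using 2[of u "E j 0"] bpE unfolding B_bp Vc_vec by simp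
      qed
      thus ?thesis by (intro fmat_eqI) simp
    qed
    have "st T = - T \<longleftrightarrow> st T + T = 0" by (simp add: eq_neg_iff_add_eq_0)
    also have "\<dots> \<longleftrightarrow> (\<forall>i j. B (w i) ((st T + T) * w j) = 0)" using z B_0 by auto
    also have "\<dots> \<longleftrightarrow> (\<forall>i j. B (w i) (T * w j) = - \<kappa> * B (w j) (T * w i))"
      by (simp add: distrib_right B_lin adj eq_neg_iff_add_eq_0 add.commute)
    finally show ?thesis .
  qed
  ultimately show ?thesis using lin b.rep_mult[OF p p] b.ent_rep[OF p] unfolding B_bp
    by (intro exI[of _ b.rep]) blast
qed

section \<open>Orthonormal bases for a symmetric form\<close>

definition onl :: "fmat list \<Rightarrow> bool" where
  "onl xs \<longleftrightarrow> (\<forall>x\<in>set xs. vec x) \<and> (\<forall>i<length xs. \<forall>j<length xs. B (xs ! i) (xs ! j) = (if i = j then 1 else 0))"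

lemma onl_proj:
  assumes P: "onl xs" and u: "vec u"
  shows "\<exists>u'. vec u' \<and> (\<forall>x\<in>set xs. B x u' = 0) \<and> u - u' \<in> fm.span (set xs)"
proof -
  define p where "p = (\<Sum>y\<leftarrow>xs. B y u *\<^sub>m y)"
  have "B x (u - p) = 0" if "x \<in> set xs" for x
  proof -
    obtain i where i: "i < length xs" "x = xs ! i" using \<open>x \<in> set xs\<close> by (metis in_set_conv_nth)
    have "B x p = (\<Sum>y\<leftarrow>xs. B y u * B x y)" unfolding p_def by (simp add: B_sum_list o_def B_lin)
    also have "\<dots> = B (xs ! i) u * B x (xs ! i)"
      by (rule sum_list_single) (use P i in \<open>auto simp: onl_def\<close>)
    also have "\<dots> = B x u" using P i unfolding onl_def by simp
    finally show ?thesis by (simp add: B_diff)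
  qed
  moreover have "vec (u - p)" unfolding p_def
    by (intro vec_subspace u vec_sum_list) (use P in \<open>auto simp: onl_def\<close>)
  moreover have "p \<in> fm.span (set xs)" unfolding p_def
    by (intro subspace_sum_list[OF fm.subspace_span]) (auto intro: fm.span_scale fm.span_base)
  ultimately show ?thesis by (intro exI[of _ "u - p"]) simp
qed

lemma onl_snoc:
  assumes k: "\<kappa> = 1" and P: "onl xs" and u: "vec u" "\<And>x. x \<in> set xs \<Longrightarrow> B x u = 0" "B u u \<noteq> 0"
  shows "\<exists>c. c \<noteq> 0 \<and> onl (xs @ [c *\<^sub>m u])"
proof -
  define c where "c = 1 / csqrt (B u u)"
  have c: "c \<noteq> 0" "c * c * B u u = 1" unfolding c_def using u(3)
    by (simp_all add: power2_eq_square[symmetric] field_simps)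
  have "B u x = 0" if "x \<in> set xs" for x
    using B_sym[OF u(1), of x] P that u(2) unfolding onl_def by simp
  hence "onl (xs @ [c *\<^sub>m u])"
    using P u c(2) unfolding onl_def by (auto simp: nth_append less_Suc_eq B_lin mult.assoc)
  thus ?thesis using c(1) by blast
qed

lemma onl_extend1:
  assumes k: "\<kappa> = 1" and P: "onl xs" and u: "vec u" "\<And>x. x \<in> set xs \<Longrightarrow> B x u = 0" "B u u \<noteq> 0"
  shows "\<exists>y. onl (xs @ [y]) \<and> u \<in> fm.span {y} \<and> y \<in> fm.span {u}"
proof -
  obtain c where c: "c \<noteq> 0" "onl (xs @ [c *\<^sub>m u])" using onl_snoc[OF assms] by blast
  have "(1 / c) *\<^sub>m (c *\<^sub>m u) \<in> fm.span {c *\<^sub>m u}" by (intro fm.span_scale fm.span_base) simp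
  hence "u \<in> fm.span {c *\<^sub>m u}" using c(1) by simp
  moreover have "c *\<^sub>m u \<in> fm.span {u}" by (intro fm.span_scale fm.span_base) simp
  ultimately show ?thesis using c(2) by blast
qed

text \<open>Gram-Schmidt may leave a residue \<open>u'\<close> that is isotropic but not zero.
  Nondegeneracy then provides \<open>v\<close> with \<open>B u' v = 1\<close>, orthogonal to
  \<open>xs\<close>; in the plane of \<open>u'\<close> and \<open>v\<close> two orthogonal
  non-isotropic vectors with \<open>u'\<close> in their span are found, and both are added.\<close>

lemma onl_extend:
  assumes k: "\<kappa> = 1" and P: "onl xs" and u: "vec u"
  shows "\<exists>ys. onl (xs @ ys) \<and> u \<in> fm.span (set (xs @ ys))"
proof -
  have up: "u \<in> fm.span (set (xs @ ys))" if "u - u' \<in> fm.span (set xs)" "u' \<in> fm.span (set (xs @ ys))" for u' ys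
  proof -
    have "u - u' \<in> fm.span (set (xs @ ys))" using that(1) fm.span_mono[of "set xs" "set (xs @ ys)"] by auto
    from fm.span_add[OF this that(2)] show ?thesis by simp
  qed
  obtain u' where u': "vec u'" "\<forall>x\<in>set xs. B x u' = 0" "u - u' \<in> fm.span (set xs)"
    using onl_proj[OF P u] by blast
  show ?thesis
  proof (cases "B u' u' = 0")
    case False
    then obtain y where y: "onl (xs @ [y])" "u' \<in> fm.span {y}" using onl_extend1[OF k P u'(1)] u'(2) by blast
    have "u' \<in> fm.span (set (xs @ [y]))" using y(2) fm.span_mono[of "{y}" "set (xs @ [y])"] by auto
    thus ?thesis using y(1) up[OF u'(3)] by blast
  next
    case iso: True
    show ?thesis
    proof (cases "u' = 0")
      case True
      thus ?thesis using P u'(3) by (intro exI[of _ "[]"]) simp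
    next
      case False
      then obtain v0 where v0: "vec v0" "B u' v0 = 1" using B_nondeg u'(1) by blast
      obtain v where v: "vec v" "\<forall>x\<in>set xs. B x v = 0" "v0 - v \<in> fm.span (set xs)"
        using onl_proj[OF P v0(1)] by blast
      have "B u' z = 0" if "z \<in> fm.span (set xs)" for z
        using that
      proof (induction rule: fm.span_induct_alt)
        case (step c x y)
        hence "B u' x = 0" using B_sym[OF u'(1), of x] P u'(2) unfolding onl_def by simp
        thus ?case using step by (simp add: B_lin)
      qed (simp add: B_0)
      hence "B u' (v0 - v) = 0" using v(3) by blast
      hence uv: "B u' v = 1" using v0(2) by (simp add: B_diff)
      hence vu: "B v u' = 1" using B_sym[OF v(1) u'(1)] k by simp
      \<comment> \<open>If \<open>v\<close> is isotropic too, then \<open>u' + v\<close> has square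
        \<open>2\<close>; in either case \<open>B z u' = 1\<close>.\<close>
      define z where "z = (if B v v = 0 then u' + v else v)"
      have z: "vec z" "\<And>x. x \<in> set xs \<Longrightarrow> B x z = 0" "B z z \<noteq> 0" "B z u' = 1"
        unfolding z_def using u'(1,2) v(1,2) uv vu iso by (auto simp: B_lin distrib_right)
      obtain a where a: "onl (xs @ [a])" "z \<in> fm.span {a}" "a \<in> fm.span {z}" using onl_extend1[OF k P z(1-3)] by blast
      obtain t where t: "z = t *\<^sub>m a" using a(2) by (auto simp: fm.span_singleton)
      have au: "t * B a u' = 1" using z(4) unfolding t by (simp add: B_lin)
      have va: "vec a" using a(1) unfolding onl_def by simp
      have aa: "B a a = 1" using a(1) unfolding onl_def by (force simp: nth_append)
      define u2 where "u2 = u' - B a u' *\<^sub>m a"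
      have ua: "B u' a = B a u'" using B_sym[OF u'(1) va] k by simp
      have xa: "B x a = 0" if "x \<in> set xs" for x
      proof -
        have "B x z = 0" using z(2) that by blast
        moreover have "t \<noteq> 0" using au by auto
        ultimately show ?thesis unfolding t by (simp add: B_lin)
      qed
      have "vec u2" unfolding u2_def by (intro vec_subspace u'(1) va)
      moreover have "B x u2 = 0" if "x \<in> set (xs @ [a])" for x
        using that u'(2) xa aa unfolding u2_def by (auto simp: B_lin B_diff)
      \<comment> \<open>Because \<open>u'\<close> is isotropic, \<open>B a a = 1\<close> and
        \<open>B a u'\<close> is nonzero, the residue \<open>u2\<close> cannot be isotropic.\<close>
      moreover have "B u2 u2 = - (B a u' * B a u')"
        unfolding u2_def using iso aa ua by (simp add: B_diff B_lin)
      hence "B u2 u2 \<noteq> 0" using au by auto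
      ultimately obtain b where b: "onl ((xs @ [a]) @ [b])" "u2 \<in> fm.span {b}"
        using onl_extend1[OF k a(1)] by blast
      have "u2 \<in> fm.span (set (xs @ [a, b]))" using b(2) fm.span_mono[of "{b}" "set (xs @ [a, b])"] by auto
      moreover have "B a u' *\<^sub>m a \<in> fm.span (set (xs @ [a, b]))" by (intro fm.span_scale fm.span_base) simp
      ultimately have "u2 + B a u' *\<^sub>m a \<in> fm.span (set (xs @ [a, b]))" by (rule fm.span_add)
      hence "u' \<in> fm.span (set (xs @ [a, b]))" unfolding u2_def by simp
      hence "u \<in> fm.span (set (xs @ [a, b]))" by (rule up[OF u'(3)])
      moreover have "onl (xs @ [a, b])" using b(1) by simp
      ultimately show ?thesis by blast
    qed
  qed
qed

lemma orthonormal_basis: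
  assumes k: "\<kappa> = 1"
  shows "\<exists>w :: nat \<Rightarrow> fmat. (\<forall>i. vec (w i)) \<and> (\<forall>i j. B (w i) (w j) = (if i = j then 1 else 0)) \<and> Vc \<subseteq> fm.span (range w)"
proof -
  have step: "\<exists>ys. onl (xs @ ys) \<and> E k 0 \<in> fm.span (set (xs @ ys))" if "onl xs" for xs k
    using onl_extend[OF k that] by simp
  have "\<exists>ys. ys \<noteq> [] \<and> onl (xs @ ys)" if P: "onl xs" for xs
  proof -
    obtain n where "E n 0 \<notin> fm.span (set xs)" using E_notin_span by blast
    moreover obtain ys where "onl (xs @ ys)" "E n 0 \<in> fm.span (set (xs @ ys))" using step[OF P] by blast
    ultimately show ?thesis by (intro exI[of _ ys]) auto
  qed
  then obtain s where s: "\<And>k. \<exists>n. onl (map s [0..<n]) \<and> E k 0 \<in> fm.span (set (map s [0..<n]))"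
    "\<And>m. \<exists>n\<ge>m. onl (map s [0..<n])"
    using seq_build[of onl "\<lambda>k xs. E k 0 \<in> fm.span (set xs)"] step by (auto simp: onl_def)
  have "vec (s i) \<and> B (s i) (s j) = (if i = j then 1 else 0)" for i j
  proof -
    obtain n where n: "n \<ge> Suc (max i j)" "onl (map s [0..<n])" using s(2) by blast
    hence "B (map s [0..<n] ! i) (map s [0..<n] ! j) = (if i = j then 1 else 0)" "vec (map s [0..<n] ! i)"
      unfolding onl_def by auto
    thus ?thesis using n(1) by simp
  qed
  moreover have "Vc \<subseteq> fm.span (range s)"
  proof (rule Vc_span)
    fix k
    obtain n where "E k 0 \<in> fm.span (set (map s [0..<n]))" using s(1) by blast
    moreover have "set (map s [0..<n]) \<subseteq> range s" by auto
    ultimately show "E k 0 \<in> fm.span (range s)" using fm.span_mono by blast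
  qed
  ultimately show ?thesis by blast
qed

section \<open>Hyperbolic pairs and symplectic bases for an antisymmetric form\<close>

definition spl :: "(fmat \<times> fmat) list \<Rightarrow> bool" where
  "spl xs \<longleftrightarrow> (\<forall>x\<in>set xs. vec (fst x) \<and> vec (snd x))
    \<and> (\<forall>i<length xs. \<forall>j<length xs. B (fst (xs ! i)) (snd (xs ! j)) = (if i = j then 1 else 0)
        \<and> B (fst (xs ! i)) (fst (xs ! j)) = 0 \<and> B (snd (xs ! i)) (snd (xs ! j)) = 0)"

definition spset :: "(fmat \<times> fmat) list \<Rightarrow> fmat set" where
  "spset xs = fst ` set xs \<union> snd ` set xs"

lemma spl_proj:
  assumes k: "\<kappa> = -1" and P: "spl xs" and u: "vec u"
  shows "\<exists>u'. vec u' \<and> (\<forall>x\<in>set xs. B (fst x) u' = 0 \<and> B (snd x) u' = 0) \<and> u - u' \<in> fm.span (spset xs)"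
proof -
  define p where "p = (\<Sum>y\<leftarrow>xs. B (fst y) u *\<^sub>m snd y - B (snd y) u *\<^sub>m fst y)"
  have "B (fst x) (u - p) = 0 \<and> B (snd x) (u - p) = 0" if "x \<in> set xs" for x
  proof -
    obtain i where i: "i < length xs" "x = xs ! i" using \<open>x \<in> set xs\<close> by (metis in_set_conv_nth)
    have sf: "B (snd (xs ! i)) (fst (xs ! j)) = (if i = j then -1 else 0)" if "j < length xs" for j
    proof -
      have "B (snd (xs ! i)) (fst (xs ! j)) = \<kappa> * B (fst (xs ! j)) (snd (xs ! i))"
        by (rule B_sym) (use P i that in \<open>auto simp: spl_def\<close>)
      thus ?thesis using P i that k unfolding spl_def by simp
    qed
    have "B (fst x) p = (\<Sum>y\<leftarrow>xs. B (fst y) u * B (fst x) (snd y) - B (snd y) u * B (fst x) (fst y))"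
      unfolding p_def by (simp add: B_sum_list o_def B_lin B_diff)
    also have "\<dots> = B (fst (xs ! i)) u * B (fst x) (snd (xs ! i)) - B (snd (xs ! i)) u * B (fst x) (fst (xs ! i))"
      by (rule sum_list_single) (use P i in \<open>auto simp: spl_def\<close>)
    also have "\<dots> = B (fst x) u" using P i unfolding spl_def by simp
    finally have 1: "B (fst x) (u - p) = 0" by (simp add: B_diff)
    have "B (snd x) p = (\<Sum>y\<leftarrow>xs. B (fst y) u * B (snd x) (snd y) - B (snd y) u * B (snd x) (fst y))"
      unfolding p_def by (simp add: B_sum_list o_def B_lin B_diff)
    also have "\<dots> = B (fst (xs ! i)) u * B (snd x) (snd (xs ! i)) - B (snd (xs ! i)) u * B (snd x) (fst (xs ! i))"
      by (rule sum_list_single) (use P i sf in \<open>auto simp: spl_def\<close>)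
    also have "\<dots> = B (snd x) u" using P i sf[OF i(1)] unfolding spl_def by simp
    finally have "B (snd x) (u - p) = 0" by (simp add: B_diff)
    thus ?thesis using 1 by blast
  qed
  moreover have "vec (u - p)" unfolding p_def
    by (intro vec_subspace u vec_sum_list) (use P in \<open>auto simp: spl_def left_diff_distrib\<close>)
  moreover have "B (fst y) u *\<^sub>m snd y - B (snd y) u *\<^sub>m fst y \<in> fm.span (spset xs)" if "y \<in> set xs" for y
    by (intro fm.span_diff fm.span_scale fm.span_base) (use that in \<open>auto simp: spset_def\<close>)
  hence "p \<in> fm.span (spset xs)" unfolding p_def
    by (intro subspace_sum_list[OF fm.subspace_span]) auto
  ultimately show ?thesis by (intro exI[of _ "u - p"]) simp
qed

text \<open>Here every vector is isotropic, so no residue has to be normalised: a nonzero one only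
  needs a partner \<open>v\<close> with \<open>B u' v = 1\<close>, made orthogonal to
  \<open>xs\<close>.\<close>

lemma spl_extend:
  assumes k: "\<kappa> = -1" and P: "spl xs" and u: "vec u"
  shows "\<exists>ys. spl (xs @ ys) \<and> u \<in> fm.span (spset (xs @ ys))"
proof -
  obtain u' where u': "vec u'" "\<forall>x\<in>set xs. B (fst x) u' = 0 \<and> B (snd x) u' = 0" "u - u' \<in> fm.span (spset xs)"
    using spl_proj[OF k P u] by blast
  have alt: "B x x = 0" if "vec x" for x using B_sym[OF that that] k by simp
  have anti: "B y x = 0" if "vec x" "vec y" "B x y = 0" for x y using B_sym[OF that(2,1)] that(3) by simp
  show ?thesis
  proof (cases "u' = 0")
    case True
    thus ?thesis using P u'(3) by (intro exI[of _ "[]"]) simp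
  next
    case False
    then obtain v0 where v0: "vec v0" "B u' v0 = 1" using B_nondeg u'(1) by blast
    obtain v where v: "vec v" "\<forall>x\<in>set xs. B (fst x) v = 0 \<and> B (snd x) v = 0" "v0 - v \<in> fm.span (spset xs)"
      using spl_proj[OF k P v0(1)] by blast
    have "B u' z = 0" if "z \<in> fm.span (spset xs)" for z
      using that
    proof (induction rule: fm.span_induct_alt)
      case (step c x y)
      have "vec x" "B x u' = 0" using step(1) P u'(2) unfolding spset_def spl_def by auto
      hence "B u' x = 0" using anti u'(1) by blast
      thus ?case using step by (simp add: B_lin)
    qed (simp add: B_0)
    hence "B u' (v0 - v) = 0" using v(3) by blast
    hence uv: "B u' v = 1" using v0(2) by (simp add: B_diff)
    have ui: "B u' (fst x) = 0" "B u' (snd x) = 0" "B v (fst x) = 0" "B v (snd x) = 0" if "x \<in> set xs" for x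
      using that u' v P anti unfolding spl_def by auto
    have "spl (xs @ [(u', v)])"
      using P u'(1,2) v(1,2) uv alt[OF u'(1)] alt[OF v(1)] ui unfolding spl_def
      by (auto simp: nth_append less_Suc_eq)
    moreover have "u \<in> fm.span (spset (xs @ [(u', v)]))"
    proof -
      have "spset xs \<subseteq> spset (xs @ [(u', v)])" unfolding spset_def by auto
      hence "u - u' \<in> fm.span (spset (xs @ [(u', v)]))" using u'(3) fm.span_mono by blast
      moreover have "u' \<in> fm.span (spset (xs @ [(u', v)]))" unfolding spset_def by (rule fm.span_base) simp
      ultimately have "(u - u') + u' \<in> fm.span (spset (xs @ [(u', v)]))" by (rule fm.span_add)
      thus ?thesis by simp
    qed
    ultimately show ?thesis by blast
  qed
qed

lemma symplectic_basis:
  assumes k: "\<kappa> = -1"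
  shows "\<exists>w. (\<forall>i. vec (w i)) \<and> (\<forall>i j. B (w i) (w j) = omega i j) \<and> Vc \<subseteq> fm.span (range w)"
proof -
  have step: "\<exists>ys. spl (xs @ ys) \<and> E k 0 \<in> fm.span (spset (xs @ ys))" if "spl xs" for xs k
    using spl_extend[OF k that] by simp
  have "\<exists>ys. ys \<noteq> [] \<and> spl (xs @ ys)" if P: "spl xs" for xs
  proof -
    have "finite (spset xs)" unfolding spset_def by simp
    then obtain n where "E n 0 \<notin> fm.span (spset xs)" using E_notin_span by blast
    moreover obtain ys where "spl (xs @ ys)" "E n 0 \<in> fm.span (spset (xs @ ys))" using step[OF P] by blast
    ultimately show ?thesis by (intro exI[of _ ys]) auto
  qed
  then obtain s where s: "\<And>k. \<exists>n. spl (map s [0..<n]) \<and> E k 0 \<in> fm.span (spset (map s [0..<n]))"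
    "\<And>m. \<exists>n\<ge>m. spl (map s [0..<n])"
    using seq_build[of spl "\<lambda>k xs. E k 0 \<in> fm.span (spset xs)"] step by (auto simp: spl_def)
  have b: "vec (fst (s i)) \<and> vec (snd (s i)) \<and> B (fst (s i)) (snd (s j)) = (if i = j then 1 else 0)
    \<and> B (snd (s i)) (fst (s j)) = (if i = j then -1 else 0)
    \<and> B (fst (s i)) (fst (s j)) = 0 \<and> B (snd (s i)) (snd (s j)) = 0" for i j
  proof -
    obtain n where n: "n \<ge> Suc (max i j)" "spl (map s [0..<n])" using s(2) by blast
    have *: "vec (fst (s a)) \<and> vec (snd (s a)) \<and> B (fst (s a)) (snd (s c)) = (if a = c then 1 else 0)
      \<and> B (fst (s a)) (fst (s c)) = 0 \<and> B (snd (s a)) (snd (s c)) = 0" if "a < n" "c < n" for a c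
      using n(2) that unfolding spl_def by auto
    have ij: "i < n" "j < n" using n(1) by auto
    have "B (snd (s i)) (fst (s j)) = \<kappa> * B (fst (s j)) (snd (s i))"
      by (rule B_sym) (use * ij in auto)
    thus ?thesis using *[OF ij] *[OF ij(2,1)] k by auto
  qed
  \<comment> \<open>Interleaving the pairs puts partners at positions \<open>2 k\<close> and
    \<open>2 k + 1\<close>, as \<open>omega\<close> prescribes.\<close>
  define w where "w i = (if even i then fst (s (i div 2)) else snd (s (i div 2)))" for i
  have "vec (w i)" for i using b unfolding w_def by simp
  moreover have "B (w i) (w j) = omega i j" for i j
  proof -
    have 1: "i div 2 = j div 2 \<longleftrightarrow> j = i + 1" if "even i" "odd j" using that by presburger
    have 2: "i div 2 = j div 2 \<longleftrightarrow> j + 1 = i" if "odd i" "even j" using that by presburger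
    show ?thesis
    proof (cases "even i"; cases "even j")
      assume "even i" "odd j"
      thus ?thesis using b[of "i div 2" "j div 2"] 1 unfolding w_def omega_def by simp
    next
      assume "odd i" "even j"
      thus ?thesis using b[of "i div 2" "j div 2"] 2 unfolding w_def omega_def by simp
    next
      assume "even i" "even j"
      hence "j \<noteq> i + 1" by presburger
      thus ?thesis using b[of "i div 2" "j div 2"] \<open>even i\<close> \<open>even j\<close> unfolding w_def omega_def by simp
    next
      assume "odd i" "odd j"
      hence "j + 1 \<noteq> i" by presburger
      thus ?thesis using b[of "i div 2" "j div 2"] \<open>odd i\<close> \<open>odd j\<close> unfolding w_def omega_def by simp
    qed
  qed
  moreover have "Vc \<subseteq> fm.span (range w)"
  proof (rule Vc_span)
    fix k
    obtain n where "E k 0 \<in> fm.span (spset (map s [0..<n]))" using s(1) by blast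
    moreover have "spset (map s [0..<n]) \<subseteq> range w"
    proof -
      have "fst (s i) = w (2 * i)" "snd (s i) = w (Suc (2 * i))" for i unfolding w_def by auto
      thus ?thesis unfolding spset_def by auto
    qed
    ultimately show "E k 0 \<in> fm.span (range w)" using fm.span_mono by blast
  qed
  ultimately show ?thesis by blast
qed

theorem star_model:
  "\<exists>r. flinear r \<and> (\<forall>x y. r (x * y) = r x * r y) \<and> inj r
    \<and> ((\<lambda>T. ent (r T)) ` {T. st T = - T} = lcarrier so_inf
      \<or> (\<lambda>T. ent (r T)) ` {T. st T = - T} = lcarrier sp_inf)"
proof (cases "\<kappa> = 1")
  case k: True
  obtain w :: "nat \<Rightarrow> fmat" where w: "\<And>i. vec (w i)" "\<And>i j. B (w i) (w j) = (if i = j then 1 else 0)" "Vc \<subseteq> fm.span (range w)"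
    using orthonormal_basis[OF k] by blast
  have fin: "\<exists>n. \<forall>k\<ge>n. B (w j) (w k) = 0" for j using w(2) by (intro exI[of _ "Suc j"]) simp
  obtain r where r: "flinear r" "\<forall>x y. r (x * y) = r x * r y" "inj r" "surj r"
    "\<And>T i j. ent (r T) i j = B (w i) (T * w j)"
    "\<And>T. st T = - T \<longleftrightarrow> (\<forall>i j. B (w i) (T * w j) = - \<kappa> * B (w j) (T * w i))"
    using form_rep[OF w(1) w(1) w(2) fin w(3)] by blast
  have iff: "st T = - T \<longleftrightarrow> (\<forall>i j. ent (r T) j i = - ent (r T) i j)" for T
    unfolding r(6) r(5) using k by auto
  have "(\<lambda>T. ent (r T)) ` {T. st T = - T} = lcarrier so_inf"
  proof (intro equalityI subsetI)
    fix A assume A: "A \<in> lcarrier so_inf"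
    then obtain X where "A = ent X" unfolding mem_so_inf by blast
    moreover obtain T where "r T = X" using r(4) by (metis surjD)
    ultimately have T: "A = ent (r T)" by simp
    hence "\<forall>i j. ent (r T) j i = - ent (r T) i j" using A unfolding mem_so_inf by blast
    hence "st T = - T" using iff by blast
    thus "A \<in> (\<lambda>T. ent (r T)) ` {T. st T = - T}" using T by blast
  next
    fix A assume "A \<in> (\<lambda>T. ent (r T)) ` {T. st T = - T}"
    then obtain T where "A = ent (r T)" "st T = - T" by blast
    thus "A \<in> lcarrier so_inf" using iff unfolding mem_so_inf by blast
  qed
  thus ?thesis using r(1-3) by blast
next
  case False
  hence k: "\<kappa> = -1" using \<kappa>_cases by blast
  obtain w where w: "\<And>i. vec (w i)" "\<And>i j. B (w i) (w j) = omega i j" "Vc \<subseteq> fm.span (range w)"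
    using symplectic_basis[OF k] by blast
  define \<sigma> :: "nat \<Rightarrow> complex" where "\<sigma> i = (if even i then 1 else -1)" for i
  have pp: "partner (partner i) = i" for i unfolding partner_def by auto
  have \<sigma>p: "\<sigma> (partner i) = - \<sigma> i" for i unfolding \<sigma>_def partner_def by auto
  have \<sigma>2: "\<sigma> i * \<sigma> i = 1" for i unfolding \<sigma>_def by simp
  have om: "omega i j = (if j = partner i then \<sigma> i else 0)" for i j
    unfolding omega_def \<sigma>_def partner_def by (auto elim: oddE)
  \<comment> \<open>The dual basis: \<open>B (w (partner i)) (w i)\<close> is
    \<open>- \<sigma> i\<close>, and \<open>\<sigma> i\<close> is its own inverse.\<close>
  define w' where "w' i = (- \<sigma> i) *\<^sub>m w (partner i)" for i
  have w': "vec (w' i)" for i unfolding w'_def using w(1) by simp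
  have bi: "B (w' i) (w j) = (if i = j then 1 else 0)" for i j
    unfolding w'_def B_lin w(2) om pp using \<sigma>p \<sigma>2 by simp
  have fin: "\<exists>n. \<forall>k\<ge>n. B (w j) (w k) = 0" for j
    unfolding w(2) om by (intro exI[of _ "Suc (partner j)"]) auto
  obtain r where r: "flinear r" "\<forall>x y. r (x * y) = r x * r y" "inj r" "surj r"
    "\<And>T i j. ent (r T) i j = B (w' i) (T * w j)"
    "\<And>T. st T = - T \<longleftrightarrow> (\<forall>i j. B (w i) (T * w j) = - \<kappa> * B (w j) (T * w i))"
    using form_rep[OF w(1) w' bi fin w(3)] by blast
  have iff: "st T = - T \<longleftrightarrow> (\<forall>i j. ent (r T) (partner j) i * omega (partner j) j
      + omega i (partner i) * ent (r T) (partner i) j = 0)" for T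
  proof -
    have "ent (r T) (partner j) i * omega (partner j) j + omega i (partner i) * ent (r T) (partner i) j
        = - (\<sigma> j * \<sigma> j) * B (w j) (T * w i) + (\<sigma> i * \<sigma> i) * B (w i) (T * w j)" for i j
      unfolding r(5) w'_def B_lin om pp \<sigma>p by simp
    thus ?thesis unfolding r(6) \<sigma>2 using k by (simp add: add_eq_0_iff)
  qed
  have "(\<lambda>T. ent (r T)) ` {T. st T = - T} = lcarrier sp_inf"
  proof (intro equalityI subsetI)
    fix A assume A: "A \<in> lcarrier sp_inf"
    then obtain X where "A = ent X" unfolding mem_sp_inf by blast
    moreover obtain T where "r T = X" using r(4) by (metis surjD)
    ultimately have T: "A = ent (r T)" by simp
    hence "st T = - T" using A unfolding mem_sp_inf iff by blast
    thus "A \<in> (\<lambda>T. ent (r T)) ` {T. st T = - T}" using T by blast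
  next
    fix A assume "A \<in> (\<lambda>T. ent (r T)) ` {T. st T = - T}"
    then obtain T where "A = ent (r T)" "st T = - T" by blast
    thus "A \<in> lcarrier sp_inf" unfolding iff mem_sp_inf by blast
  qed
  thus ?thesis using r(1-3) by blast
qed

end

section \<open>Coordinates of vectors and functionals in dual bases\<close>

context dbasis
begin

definition crd :: "fmat \<Rightarrow> fmat" where
  "crd v = Fmat (\<lambda>i j. if j = 0 then bp (f i) v else 0)"

definition rcrd :: "fmat \<Rightarrow> fmat" where
  "rcrd h = Fmat (\<lambda>i j. if i = 0 then bp h (w j) else 0)"

lemma ent_crd: assumes "v \<in> M" shows "ent (crd v) i j = (if j = 0 then bp (f i) v else 0)"
proof -
  obtain n where n: "\<forall>k\<ge>n. bp (f k) v = 0" using f_van[OF assms] by blast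
  have "finite {(i :: nat, j :: nat). (if j = 0 then bp (f i) v else 0) \<noteq> 0}"
    by (rule finite_supp_bound[of _ n 1]) (use n in \<open>simp split: if_splits, meson not_le\<close>)
  thus ?thesis unfolding crd_def by (subst ent_Fmat) auto
qed

lemma ent_rcrd: assumes "h \<in> F" shows "ent (rcrd h) i j = (if i = 0 then bp h (w j) else 0)"
proof -
  obtain n where n: "\<forall>k\<ge>n. bp h (w k) = 0" using w_van[OF assms] by blast
  have "finite {(i :: nat, j :: nat). (if i = 0 then bp h (w j) else 0) \<noteq> 0}"
    by (rule finite_supp_bound[of _ 1 n]) (use n in \<open>simp split: if_splits, meson not_le\<close>)
  thus ?thesis unfolding rcrd_def by (subst ent_Fmat) auto
qed

lemma rcrd_Vr: "h \<in> F \<Longrightarrow> rcrd h \<in> Vr"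
  unfolding Vr_def by (auto intro!: fmat_eqI simp: ent_rcrd)

lemma crd_lin: "u \<in> M \<Longrightarrow> v \<in> M \<Longrightarrow> crd (u + v) = crd u + crd v" "v \<in> M \<Longrightarrow> crd (c *\<^sub>m v) = c *\<^sub>m crd v"
  by (rule fmat_eqI, simp add: ent_crd fm.subspace_add[OF sM] fm.subspace_scale[OF sM] bp_lin)+

lemma rcrd_lin: "u \<in> F \<Longrightarrow> v \<in> F \<Longrightarrow> rcrd (u + v) = rcrd u + rcrd v" "v \<in> F \<Longrightarrow> rcrd (c *\<^sub>m v) = c *\<^sub>m rcrd v"
  by (rule fmat_eqI, simp add: ent_rcrd fm.subspace_add[OF sF] fm.subspace_scale[OF sF] bp_lin)+

lemma crd_act: assumes "pres T" "v \<in> M" shows "crd (T * v) = rep T * crd v"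
proof (rule fmat_eqI)
  fix i j
  have Tv: "T * v \<in> M" using assms unfolding pres_def by blast
  obtain n where n: "bnd n (rep T)" using bnd_ex by blast
  have "bp (f i * T) (w k) = 0" if "k \<ge> n" for k
  proof -
    have "ent (rep T) i k = 0" using n that unfolding bnd_def by (meson leD)
    thus ?thesis unfolding ent_rep[OF assms(1)] bp_move .
  qed
  hence "bp (f i * T) v = (\<Sum>k<n. bp (f i * T) (w k) * bp (f k) v)"
    using assms fF unfolding pres_def by (intro expand) auto
  thus "ent (crd (T * v)) i j = ent (rep T * crd v) i j"
    by (simp add: ent_crd[OF Tv] ent_crd[OF assms(2)] ent_times_bound[OF n] ent_rep[OF assms(1)] bp_move)
qed

lemma rcrd_act: assumes "pres T" "h \<in> F" shows "rcrd (h * T) = rcrd h * rep T"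
proof (rule fmat_eqI)
  fix i j
  have hT: "h * T \<in> F" using assms unfolding pres_def by blast
  obtain n where n: "bnd n (rep T)" using bnd_ex by blast
  have "bp (f k) (T * w j) = 0" if "k \<ge> n" for k
  proof -
    have "ent (rep T) k j = 0" using n that unfolding bnd_def by (meson leD)
    thus ?thesis unfolding ent_rep[OF assms(1)] .
  qed
  hence "bp h (T * w j) = (\<Sum>k<n. bp h (w k) * bp (f k) (T * w j))"
    using assms wM unfolding pres_def by (intro expand) auto
  thus "ent (rcrd (h * T)) i j = ent (rcrd h * rep T) i j"
    by (simp add: ent_rcrd[OF hT] ent_rcrd[OF assms(2)] ent_times_bound2[OF n] ent_rep[OF assms(1)] bp_move)
qed

lemma crd_surj: assumes "u \<in> Vc" shows "\<exists>v\<in>M. crd v = u"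
proof -
  obtain n where n: "bnd n u" using bnd_ex by blast
  define v where "v = (\<Sum>i<n. ent u i 0 *\<^sub>m w i)"
  have v: "v \<in> M" unfolding v_def using wM by (intro fm.subspace_sum[OF sM] fm.subspace_scale[OF sM])
  have "bp (f i) v = ent u i 0" for i
  proof -
    have "bp (f i) v = (\<Sum>k<n. ent u k 0 * (if i = k then 1 else 0))"
      unfolding v_def by (simp only: bp_sum bp_lin bi)
    also have "\<dots> = (\<Sum>k<n. if k = i then ent u i 0 else 0)" by (rule sum.cong) auto
    finally have "bp (f i) v = (\<Sum>k<n. if k = i then ent u i 0 else 0)" .
    thus ?thesis using n by (auto simp: bnd_def)
  qed
  hence "crd v = u" using Vc_ent[OF assms] by (intro fmat_eqI) (simp add: ent_crd[OF v])
  thus ?thesis using v by blast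
qed

lemma rcrd_f: "rcrd (f k) = E 0 k"
  by (rule fmat_eqI) (auto simp: ent_rcrd[OF fF] bi)

end

section \<open>Irreducible sections of a simple ideal\<close>

lemma kernel_not_fd:
  assumes S: "fm.subspace S" "\<not> fd S" and f: "flinear f" "fd (f ` S)"
  shows "\<not> fd {s \<in> S. f s = 0}"
proof
  assume "fd {s \<in> S. f s = 0}"
  then obtain C where C: "finite C" "{s \<in> S. f s = 0} \<subseteq> fm.span C" unfolding fd_def by blast
  obtain B where B: "finite B" "f ` S \<subseteq> fm.span B" using f(2) unfolding fd_def by blast
  obtain F where F: "finite F" "F \<subseteq> S" "\<forall>s\<in>S. \<exists>t\<in>fm.span F. f (s - t) = 0"
    using preimage_finite[OF f(1) S(1) B] by blast
  have "S \<subseteq> fm.span (C \<union> F)"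
  proof
    fix s assume s: "s \<in> S"
    obtain t where t: "t \<in> fm.span F" "f (s - t) = 0" using F(3) s by blast
    have "t \<in> S" using t(1) fm.span_minimal[OF F(2) S(1)] by blast
    hence "s - t \<in> {s \<in> S. f s = 0}" using s t(2) fm.subspace_diff[OF S(1)] by simp
    hence "s - t \<in> fm.span (C \<union> F)" using C(2) fm.span_mono[of C "C \<union> F"] by blast
    moreover have "t \<in> fm.span (C \<union> F)" using t(1) fm.span_mono[of F "C \<union> F"] by blast
    ultimately have "(s - t) + t \<in> fm.span (C \<union> F)" by (rule fm.span_add)
    thus "s \<in> fm.span (C \<union> F)" by simp
  qed
  thus False using S(2) C(1) F(1) unfolding fd_def by (meson finite_UnI)
qed

text \<open>Each map of finite rank costs only finitely many dimensions.\<close>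

lemma common_kernel_not_fd:
  assumes S: "fm.subspace S" "\<not> fd S" and C: "finite C"
    and f: "\<And>c. c \<in> C \<Longrightarrow> flinear (f c) \<and> fd (f c ` S)"
  shows "\<not> fd {s \<in> S. \<forall>c\<in>C. f c s = 0} \<and> fm.subspace {s \<in> S. \<forall>c\<in>C. f c s = 0}"
  using C f
proof (induction C rule: finite_induct)
  case empty
  thus ?case using S by simp
next
  case (insert c C)
  define K where "K = {s \<in> S. \<forall>c\<in>C. f c s = 0}"
  have K: "\<not> fd K" "fm.subspace K" using insert unfolding K_def by auto
  have fc: "flinear (f c)" "fd (f c ` K)"
    using insert.prems[of c] fd_subset[of "f c ` S" "f c ` K"] unfolding K_def by auto
  have eq: "{s \<in> S. \<forall>c\<in>insert c C. f c s = 0} = {s \<in> K. f c s = 0}" unfolding K_def by auto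
  have "fm.subspace {s \<in> K. f c s = 0}"
    by (rule fm.subspaceI)
      (use K(2) fmm.linear_0[OF fc(1)] fmm.linear_add[OF fc(1)] fmm.linear_scale[OF fc(1)] in
        \<open>auto intro: fm.subspace_0 fm.subspace_add fm.subspace_scale\<close>)
  thus ?case using kernel_not_fd[OF K(2,1) fc] unfolding eq by blast
qed

text \<open>\<open>t\<close> is an auxiliary finite-dimensional perfect part of \<open>S\<close>.
  The space \<open>Y\<close> spanned by its values on columns has finite dimension, which the
  application of Zorn's lemma uses, and satisfies \<open>t Y = Y\<close>, which lets
  \<open>Y\<close> be pulled down through filtrations.\<close>

locale simple_ideal =
  fixes L S t :: "fmat set"
  assumes L: "lie_sub L" and S: "lie_sub S" and SL: "S \<subseteq> L"
    and ideal: "\<And>x s. x \<in> L \<Longrightarrow> s \<in> S \<Longrightarrow> lb x s \<in> S"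
    and simple: "\<And>J. fm.subspace J \<Longrightarrow> J \<subseteq> S \<Longrightarrow> (\<And>s j. s \<in> S \<Longrightarrow> j \<in> J \<Longrightarrow> lb s j \<in> J) \<Longrightarrow> J = {0} \<or> J = S"
    and perfect: "S \<subseteq> fm.span {lb a b |a b. a \<in> S \<and> b \<in> S}"
    and not_fd: "\<not> fd S"
    and t: "fd t" "t \<subseteq> S" "t \<subseteq> fm.span {lb a b |a b. a \<in> t \<and> b \<in> t}" "\<exists>x\<in>t. x \<noteq> 0"
begin

lemma sS: "fm.subspace S"
  using S unfolding lie_sub_def by blast

lemma S_lb: "s \<in> S \<Longrightarrow> x \<in> L \<Longrightarrow> lb s x \<in> S"
  using ideal[of x s] lb_minus_commute[of s x] fm.subspace_neg[OF sS] by simp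

definition Y :: "fmat set" where "Y = fm.span {a * E j 0 |a j. a \<in> t}"

definition Lsub :: "fmat set \<Rightarrow> bool" where
  "Lsub N \<longleftrightarrow> fm.subspace N \<and> N \<subseteq> Vc \<and> (\<forall>x\<in>L. \<forall>v\<in>N. x * v \<in> N)"

lemma Y_fd: "fd Y"
proof -
  obtain n where n: "\<forall>x\<in>t. bnd n x" using fd_imp_bnd[OF t(1)] by blast
  show ?thesis unfolding Y_def
    by (rule fd_span, rule fd_bnd[of _ "Suc n"]) (use n bnd_mult_Vc in auto)
qed

lemma Y_Vc: "Y \<subseteq> Vc"
  unfolding Y_def by (rule fm.span_minimal[OF _ subspace_Vc]) (auto intro!: Vc_mult)

lemma Y_nonzero: "\<exists>y\<in>Y. y \<noteq> 0"
proof -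
  obtain a where a: "a \<in> t" "a \<noteq> 0" using t(4) by blast
  then obtain j where "a * E j 0 \<noteq> 0" using col_eqI[of a 0] by auto
  moreover have "a * E j 0 \<in> Y" unfolding Y_def by (rule fm.span_base) (use a in blast)
  ultimately show ?thesis by blast
qed

text \<open>\<open>t\<close> is perfect, hence \<open>t Y = Y\<close>.\<close>

lemma Y_perfect:
  assumes X: "fm.subspace X" and tY: "\<And>a y. a \<in> t \<Longrightarrow> y \<in> Y \<Longrightarrow> a * y \<in> X"
  shows "Y \<subseteq> X"
  unfolding Y_def
proof (rule fm.span_minimal[OF _ X], safe)
  fix a j assume "a \<in> t"
  hence "a \<in> fm.span {lb a b |a b. a \<in> t \<and> b \<in> t}" using t(3) by blast
  thus "a * E j 0 \<in> X"
  proof (induction rule: fm.span_induct_alt)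
    case base
    show ?case using fm.subspace_0[OF X] by simp
  next
    case (step c x y)
    then obtain a b where ab: "x = lb a b" "a \<in> t" "b \<in> t" by blast
    have "b * E j 0 \<in> Y" "a * E j 0 \<in> Y" unfolding Y_def by (rule fm.span_base, use ab in blast)+
    hence "a * (b * E j 0) - b * (a * E j 0) \<in> X" using tY ab by (intro fm.subspace_diff[OF X]) auto
    hence "x * E j 0 \<in> X" unfolding ab(1) lb_def by (simp add: left_diff_distrib mult.assoc)
    thus ?case using step fm.subspace_add[OF X] fm.subspace_scale[OF X] by (simp add: distrib_right)
  qed
qed

text \<open>Zorn's lemma applies because \<open>Y\<close> is finitely spanned: if the union of a
  chain contained it, one member would.\<close>

lemma maximal_ex: "\<exists>N. Lsub N \<and> \<not> Y \<subseteq> N \<and> (\<forall>N'. Lsub N' \<longrightarrow> N \<subseteq> N' \<longrightarrow> N' \<noteq> N \<longrightarrow> Y \<subseteq> N')"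
proof -
  define A where "A = {N. Lsub N \<and> \<not> Y \<subseteq> N}"
  have "Lsub {0}" unfolding Lsub_def using fm.subspace_0[OF subspace_Vc] by simp
  hence A0: "A \<noteq> {}" unfolding A_def using Y_nonzero by auto
  have "\<exists>N\<in>A. \<forall>X\<in>A. N \<subseteq> X \<longrightarrow> X = N"
  proof (rule subset_Zorn_nonempty[OF A0])
    fix C assume C: "C \<noteq> {}" "subset.chain A C"
    have CA: "C \<subseteq> A" and lin: "\<And>X Y. X \<in> C \<Longrightarrow> Y \<in> C \<Longrightarrow> X \<subseteq> Y \<or> Y \<subseteq> X"
      using C(2) unfolding subset.chain_def by auto
    have sub: "fm.subspace (\<Union>C)"
    proof (rule fm.subspaceI)
      show "0 \<in> \<Union>C" using C(1) CA unfolding A_def Lsub_def by (auto intro: fm.subspace_0)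
    next
      fix x y assume "x \<in> \<Union>C" "y \<in> \<Union>C"
      then obtain X Z where XZ: "X \<in> C" "Z \<in> C" "x \<in> X" "y \<in> Z" by blast
      then obtain W where "W \<in> C" "x \<in> W" "y \<in> W" using lin by blast
      moreover from this have "fm.subspace W" using CA unfolding A_def Lsub_def by blast
      ultimately show "x + y \<in> \<Union>C" using fm.subspace_add by blast
    next
      fix c x assume "x \<in> \<Union>C"
      then obtain X where "X \<in> C" "x \<in> X" by blast
      moreover from this have "fm.subspace X" using CA unfolding A_def Lsub_def by blast
      ultimately show "c *\<^sub>m x \<in> \<Union>C" using fm.subspace_scale by blast
    qed
    have "\<not> Y \<subseteq> \<Union>C"
    proof
      assume YC: "Y \<subseteq> \<Union>C"
      obtain B where B: "finite B" "Y \<subseteq> fm.span B" using Y_fd unfolding fd_def by blast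
      obtain D where D: "finite D" "D \<subseteq> Y" "Y \<subseteq> fm.span D" using finite_basis_of_subset[OF B] by blast
      have "D \<subseteq> \<Union>C" using D(2) YC by blast
      with D(1) have "\<exists>X\<in>C. D \<subseteq> X"
      proof (induction D rule: finite_induct)
        case empty
        thus ?case using C(1) by blast
      next
        case (insert x F)
        then obtain X Z where "X \<in> C" "F \<subseteq> X" "Z \<in> C" "x \<in> Z" by auto
        thus ?case using lin[of X Z] by blast
      qed
      then obtain X where X: "X \<in> C" "D \<subseteq> X" by blast
      hence "X \<in> A" using CA by blast
      hence "fm.span D \<subseteq> X" using fm.span_minimal[OF X(2)] unfolding A_def Lsub_def by blast
      thus False using D(3) \<open>X \<in> A\<close> unfolding A_def by blast
    qed
    moreover have "Lsub (\<Union>C)" using sub CA unfolding Lsub_def A_def by blast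
    ultimately show "\<Union>C \<in> A" unfolding A_def by blast
  qed
  then obtain N where "N \<in> A" "\<forall>X\<in>A. N \<subseteq> X \<longrightarrow> X = N" by blast
  thus ?thesis unfolding A_def by blast
qed

definition N :: "fmat set" where
  "N = (SOME N. Lsub N \<and> \<not> Y \<subseteq> N \<and> (\<forall>N'. Lsub N' \<longrightarrow> N \<subseteq> N' \<longrightarrow> N' \<noteq> N \<longrightarrow> Y \<subseteq> N'))"

lemma N: "Lsub N" "\<not> Y \<subseteq> N" "\<And>N'. Lsub N' \<Longrightarrow> N \<subseteq> N' \<Longrightarrow> N' \<noteq> N \<Longrightarrow> Y \<subseteq> N'"
  using someI_ex[OF maximal_ex] unfolding N_def by blast+

text \<open>An \<open>L\<close>-submodule properly containing \<open>N\<close> contains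
  \<open>Y\<close> by maximality of \<open>N\<close>, hence \<open>M\<close>. So
  \<open>M / N\<close> is the smallest nonzero submodule of \<open>Vc / N\<close> and irreducible
  over \<open>L\<close>.\<close>

definition M :: "fmat set" where "M = \<Inter>{N'. Lsub N' \<and> N \<subseteq> N' \<and> Y \<subseteq> N'}"

lemma M_min: "Lsub N' \<Longrightarrow> N \<subseteq> N' \<Longrightarrow> Y \<subseteq> N' \<Longrightarrow> M \<subseteq> N'"
  unfolding M_def by blast

lemma M: "Lsub M" "N \<subseteq> M" "Y \<subseteq> M"
proof -
  have "Lsub Vc" unfolding Lsub_def using subspace_Vc Vc_mult by blast
  moreover have "N \<subseteq> Vc" using N(1) unfolding Lsub_def by blast
  ultimately have "M \<subseteq> Vc" using Y_Vc by (rule M_min)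
  moreover have "fm.subspace M" unfolding M_def by (rule fm.subspace_Inter) (auto simp: Lsub_def)
  ultimately show "Lsub M" unfolding Lsub_def unfolding M_def by (auto simp: Lsub_def)
qed (auto simp: M_def)

lemma sN: "fm.subspace N" and sM: "fm.subspace M" and MVc: "M \<subseteq> Vc"
  and LN: "x \<in> L \<Longrightarrow> v \<in> N \<Longrightarrow> x * v \<in> N" and LM: "x \<in> L \<Longrightarrow> v \<in> M \<Longrightarrow> x * v \<in> M"
  using N(1) M(1) unfolding Lsub_def by auto

lemma comm_act: "s * (y * u) = y * (s * u) + lb s y * u"
  by (simp add: lb_def left_diff_distrib mult.assoc)

section \<open>Irreducibility of the section over the ideal \<open>S\<close> alone\<close>

definition Ssub :: "fmat set \<Rightarrow> bool" where
  "Ssub U \<longleftrightarrow> fm.subspace U \<and> N \<subseteq> U \<and> U \<subseteq> M \<and> (\<forall>s\<in>S. \<forall>u\<in>U. s * u \<in> U)"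

text \<open>An infinite-dimensional simple algebra acts trivially on finite-dimensional modules;
  this is applied to \<open>(U + y U) / U\<close>.\<close>

lemma S_yU:
  assumes U: "Ssub U" and y: "y \<in> L" and s: "s \<in> S" and u: "u \<in> U"
  shows "s * (y * u) \<in> U"
proof -
  have sU: "fm.subspace U" and SU: "\<And>s u. s \<in> S \<Longrightarrow> u \<in> U \<Longrightarrow> s * u \<in> U"
    using U unfolding Ssub_def by auto
  \<comment> \<open>An ideal of \<open>S\<close>. It is nonzero since, modulo \<open>U\<close>, the
    infinite-dimensional \<open>S\<close> acts on the finite-dimensional image of
    \<open>y U\<close>; simplicity then gives \<open>K = S\<close>.\<close>
  define K where "K = {s \<in> S. \<forall>u\<in>U. s * (y * u) \<in> U}"
  obtain p where p: "flinear p" "\<And>x. p x = 0 \<longleftrightarrow> x \<in> U" using kernel_ex[OF sU] by blast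
  obtain n where n: "bnd n y" using bnd_ex by blast
  have UVc: "U \<subseteq> Vc" using U MVc unfolding Ssub_def by blast
  have yU: "bnd (Suc n) x" if "x \<in> (\<lambda>u. y * u) ` U" for x
    using that bnd_mult_Vc[OF n] UVc by blast
  obtain C where C: "finite C" "C \<subseteq> (\<lambda>u. y * u) ` U" "(\<lambda>u. y * u) ` U \<subseteq> fm.span C"
    using finite_basis_bnd[OF yU] by blast
  have lf: "flinear (\<lambda>s. p (s * c)) \<and> fd ((\<lambda>s. p (s * c)) ` S)" if c: "c \<in> C" for c
  proof
    show "flinear (\<lambda>s. p (s * c))"
      by (rule flinearI) (simp_all add: distrib_right fmm.linear_add[OF p(1)] fmm.linear_scale[OF p(1)])
    obtain u where u: "u \<in> U" "c = y * u" using C(2) c by blast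
    have pc: "p (s * c) \<in> p ` ((\<lambda>u. y * u) ` U)" if s: "s \<in> S" for s
    proof -
      \<comment> \<open>Modulo \<open>U\<close> the factors \<open>s\<close> and \<open>y\<close>
        commute on \<open>U\<close>, since \<open>lb s y\<close> lies in \<open>S\<close>; this
        makes the image of \<open>y U\<close> stable under \<open>S\<close>.\<close>
      have "p (lb s y * u) = 0" using p(2) SU[OF S_lb[OF s y] u(1)] by blast
      hence "p (s * c) = p (y * (s * u))"
        unfolding u(2) by (subst comm_act) (simp add: fmm.linear_add[OF p(1)])
      thus ?thesis using SU[OF s u(1)] by blast
    qed
    have "fd (p ` ((\<lambda>u. y * u) ` U))" by (rule fd_image[OF fd_bnd[OF yU] p(1)])
    thus "fd ((\<lambda>s. p (s * c)) ` S)" by (rule fd_subset) (use pc in blast)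
  qed
  have nK: "\<not> fd {s \<in> S. \<forall>c\<in>C. p (s * c) = 0}"
    by (rule conjunct1[OF common_kernel_not_fd[OF sS not_fd C(1), of "\<lambda>c s. p (s * c)"]]) (rule lf)
  have "{s \<in> S. \<forall>c\<in>C. p (s * c) = 0} \<subseteq> K"
  proof
    fix s assume s: "s \<in> {s \<in> S. \<forall>c\<in>C. p (s * c) = 0}"
    have "s * x \<in> U" if "x \<in> fm.span C" for x
      using that
    proof (induction rule: fm.span_induct_alt)
      case (step c x z)
      hence "s * x \<in> U" using s p(2) by blast
      thus ?case using step fm.subspace_add[OF sU] fm.subspace_scale[OF sU] by (simp add: distrib_left)
    qed (simp add: fm.subspace_0[OF sU])
    thus "s \<in> K" using s C(3) unfolding K_def by blast
  qed
  hence "\<not> fd K" using nK fd_subset by blast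
  moreover have "fd {0}" unfolding fd_def by (intro exI[of _ "{}"]) simp
  ultimately have "K \<noteq> {0}" by blast
  moreover have "fm.subspace K" unfolding K_def
    by (rule fm.subspaceI)
      (auto simp: distrib_right fm.subspace_0[OF sS] fm.subspace_0[OF sU]
        intro: fm.subspace_add[OF sS] fm.subspace_add[OF sU] fm.subspace_scale[OF sS] fm.subspace_scale[OF sU])
  moreover have "lb s k \<in> K" if s: "s \<in> S" and k: "k \<in> K" for s k
  proof -
    have kS: "k \<in> S" and kU: "\<And>u. u \<in> U \<Longrightarrow> k * (y * u) \<in> U" using k unfolding K_def by auto
    have "lb s k * (y * u) \<in> U" if u: "u \<in> U" for u
    proof -
      have "lb s k * (y * u) = s * (k * (y * u)) - k * (s * (y * u))"
        by (simp add: lb_def left_diff_distrib mult.assoc)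
      also have "k * (s * (y * u)) = k * (y * (s * u)) + k * (lb s y * u)"
        by (subst comm_act) (simp add: distrib_left)
      finally have "lb s k * (y * u) = s * (k * (y * u)) - (k * (y * (s * u)) + k * (lb s y * u))" .
      moreover have "s * (k * (y * u)) \<in> U" using SU s kU u by blast
      moreover have "k * (y * (s * u)) \<in> U" using kU SU s u by blast
      moreover have "k * (lb s y * u) \<in> U" using SU kS S_lb[OF s y] u by blast
      ultimately show ?thesis using fm.subspace_diff[OF sU] fm.subspace_add[OF sU] by simp
    qed
    thus ?thesis using lie_sub_lb[OF S s kS] unfolding K_def by blast
  qed
  moreover have "K \<subseteq> S" unfolding K_def by blast
  ultimately have "K = S" using simple[of K] by blast
  thus ?thesis using s u unfolding K_def by blast
qed

text \<open>\<open>G U k\<close> consists of the vectors of \<open>M\<close> that all products of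
  \<open>k\<close> elements of \<open>S\<close> carry into \<open>U\<close>. \<open>U\<close> itself
  need not be stable under \<open>L\<close>, but an element of \<open>L\<close> raises the index by
  at most one, so the union is.\<close>

primrec G :: "fmat set \<Rightarrow> nat \<Rightarrow> fmat set" where
  "G U 0 = U"
| "G U (Suc k) = {v \<in> M. \<forall>s\<in>S. s * v \<in> G U k}"

text \<open>The union of the \<open>G U k\<close> is an \<open>L\<close>-submodule larger than
  \<open>N\<close>, so it contains \<open>Y\<close>; by finite dimension a single
  \<open>G U k\<close> does. As \<open>t Y = Y\<close> and \<open>t\<close> lowers the index,
  \<open>Y\<close> descends to \<open>G U 0 = U\<close>.\<close>

lemma Y_sub:
  assumes U: "Ssub U" and ne: "U \<noteq> N"
  shows "Y \<subseteq> U"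
proof -
  have sU: "fm.subspace U" and NU: "N \<subseteq> U" and UM: "U \<subseteq> M"
    and SU: "\<And>s u. s \<in> S \<Longrightarrow> u \<in> U \<Longrightarrow> s * u \<in> U"
    using U unfolding Ssub_def by auto
  have GM: "G U k \<subseteq> M" for k by (cases k) (use UM in auto)
  have sG: "fm.subspace (G U k)" for k
  proof (induction k)
    case 0
    thus ?case using sU by simp
  next
    case (Suc k)
    show ?case
      by (rule fm.subspaceI)
        (auto simp: distrib_left fm.subspace_0[OF sM] fm.subspace_0[OF Suc]
          intro: fm.subspace_add[OF sM] fm.subspace_add[OF Suc] fm.subspace_scale[OF sM] fm.subspace_scale[OF Suc])
  qed
  have up: "G U k \<subseteq> G U (Suc k)" for k
  proof (induction k)
    case 0
    show ?case using SU UM by auto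
  next
    case (Suc k)
    thus ?case using GM by auto
  qed
  have yG: "y * v \<in> G U (Suc k)" if y: "y \<in> L" and "v \<in> G U k" for y v k
    using that(2)
  proof (induction k arbitrary: v)
    case 0
    thus ?case using S_yU[OF U y] LM[OF y] UM by auto
  next
    case (Suc k)
    have v: "v \<in> M" "\<And>s. s \<in> S \<Longrightarrow> s * v \<in> G U k" using Suc.prems by auto
    have "s * (y * v) \<in> G U (Suc k)" if s: "s \<in> S" for s
    proof -
      have "y * (s * v) \<in> G U (Suc k)" using Suc.IH v(2) s by blast
      moreover have "lb s y * v \<in> G U (Suc k)" using v(2)[OF S_lb[OF s y]] up by blast
      ultimately have "y * (s * v) + lb s y * v \<in> G U (Suc k)" by (rule fm.subspace_add[OF sG])
      thus ?thesis by (subst comm_act)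
    qed
    thus ?case using LM[OF y v(1)] by auto
  qed
  have mono: "G U k \<subseteq> G U (k + d)" for k d
    by (induction d) (use up in auto)
  define W where "W = (\<Union>k. G U k)"
  have common: "\<exists>k. x \<in> G U k \<and> z \<in> G U k" if xz: "x \<in> W" "z \<in> W" for x z
  proof -
    obtain k l where "x \<in> G U k" "z \<in> G U l" using xz unfolding W_def by blast
    hence "x \<in> G U (k + l)" "z \<in> G U (k + l)"
      using mono[of k l] mono[of l k] by (auto simp: add.commute)
    thus ?thesis by blast
  qed
  have sW: "fm.subspace W"
  proof (rule fm.subspaceI)
    show "0 \<in> W" unfolding W_def using fm.subspace_0[OF sG[of 0]] by blast
    show "x + z \<in> W" if "x \<in> W" "z \<in> W" for x z
      using common[OF that] fm.subspace_add[OF sG] unfolding W_def by blast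
    show "c *\<^sub>m x \<in> W" if "x \<in> W" for c x
      using that fm.subspace_scale[OF sG] unfolding W_def by blast
  qed
  have WVc: "W \<subseteq> Vc" unfolding W_def using GM MVc by blast
  have LW: "x * v \<in> W" if x: "x \<in> L" and v: "v \<in> W" for x v
  proof -
    obtain k where "v \<in> G U k" using v unfolding W_def by blast
    hence "x * v \<in> G U (Suc k)" by (rule yG[OF x])
    thus ?thesis unfolding W_def by (rule UN_I[OF UNIV_I])
  qed
  have "Lsub W" unfolding Lsub_def using sW WVc LW by simp
  moreover have UW: "U \<subseteq> W" unfolding W_def using UN_upper[of 0 UNIV "G U"] by simp
  ultimately have "Y \<subseteq> W" using N(3)[of W] NU ne by auto
  obtain B where B: "finite B" "Y \<subseteq> fm.span B" using Y_fd unfolding fd_def by blast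
  obtain D where D: "finite D" "D \<subseteq> Y" "Y \<subseteq> fm.span D" using finite_basis_of_subset[OF B] by blast
  have "D \<subseteq> W" using D(2) \<open>Y \<subseteq> W\<close> by blast
  with D(1) have "\<exists>k. D \<subseteq> G U k"
  proof (induction D rule: finite_induct)
    case (insert x F)
    then obtain k where k: "F \<subseteq> G U k" by auto
    obtain l where l: "x \<in> G U l" using insert.prems unfolding W_def by auto
    have "insert x F \<subseteq> G U (k + l)" using k l mono[of k l] mono[of l k] by (auto simp: add.commute)
    thus ?case by (rule exI)
  qed simp
  then obtain k where "D \<subseteq> G U k" by blast
  hence "Y \<subseteq> G U k" using D(3) fm.span_minimal[OF _ sG] by blast
  moreover have "Y \<subseteq> G U k \<Longrightarrow> Y \<subseteq> U" for k
  proof (induction k)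
    case (Suc k)
    have "Y \<subseteq> G U k"
      by (rule Y_perfect[OF sG]) (use Suc.prems t(2) in auto)
    thus ?case by (rule Suc.IH)
  qed simp
  ultimately show ?thesis by blast
qed

text \<open>The smallest \<open>S\<close>-submodule \<open>U0\<close> containing \<open>N\<close>
  and \<open>Y\<close> is stable under \<open>L\<close>: for \<open>y\<close> in \<open>L\<close>
  the vectors of \<open>U0\<close> that \<open>y\<close> keeps in \<open>U0\<close> form an
  \<open>S\<close>-submodule containing \<open>N\<close> and \<open>S U0\<close>, hence
  \<open>Y = t Y\<close>. So \<open>U0 = M\<close>, and every \<open>U \<noteq> N\<close> contains
  it.\<close>

lemma S_irreducible:
  assumes U: "Ssub U"
  shows "U = N \<or> U = M"
proof (rule disjCI)
  assume nM: "U \<noteq> M"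
  show "U = N"
  proof (rule ccontr)
    assume nN: "U \<noteq> N"
    define U0 where "U0 = \<Inter>{U. Ssub U \<and> Y \<subseteq> U}"
    have SM: "Ssub M" unfolding Ssub_def using sM M LM SL by blast
    have U0M: "U0 \<subseteq> M" unfolding U0_def using SM M(3) by blast
    have YU0: "Y \<subseteq> U0" unfolding U0_def by blast
    have "fm.subspace U0" unfolding U0_def by (rule fm.subspace_Inter) (auto simp: Ssub_def)
    moreover have "N \<subseteq> U0" unfolding U0_def by (auto simp: Ssub_def)
    moreover have "s * u \<in> U0" if "s \<in> S" "u \<in> U0" for s u
      using that unfolding U0_def by (auto simp: Ssub_def)
    ultimately have U0: "Ssub U0" unfolding Ssub_def using U0M by blast
    hence sU0: "fm.subspace U0" and SU0: "\<And>s u. s \<in> S \<Longrightarrow> u \<in> U0 \<Longrightarrow> s * u \<in> U0" and NU0: "N \<subseteq> U0"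
      unfolding Ssub_def by auto
    have "y * u \<in> U0" if y: "y \<in> L" and u: "u \<in> U0" for y u
    proof -
      define U1 where "U1 = {u \<in> U0. y * u \<in> U0}"
      have SU: "s * u \<in> U1" if s: "s \<in> S" and u: "u \<in> U0" for s u
      proof -
        have "y * (s * u) = s * (y * u) - lb s y * u" using comm_act[of s y u] by simp
        also have "\<dots> \<in> U0" using S_yU[OF U0 y s u] SU0[OF S_lb[OF s y] u] by (rule fm.subspace_diff[OF sU0])
        finally show ?thesis using SU0[OF s u] unfolding U1_def by blast
      qed
      have sU1: "fm.subspace U1" unfolding U1_def
        by (rule fm.subspaceI)
          (auto simp: distrib_left fm.subspace_0[OF sU0] intro: fm.subspace_add[OF sU0] fm.subspace_scale[OF sU0])
      have "Ssub U1" unfolding Ssub_def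
      proof (intro conjI ballI)
        show "N \<subseteq> U1" unfolding U1_def using NU0 LN[OF y] by auto
        show "U1 \<subseteq> M" unfolding U1_def using U0M by auto
        show "s * u \<in> U1" if "s \<in> S" "u \<in> U1" for s u
          using that SU[of s u] unfolding U1_def by auto
      qed (rule sU1)
      moreover have "Y \<subseteq> U1"
        by (rule Y_perfect[OF sU1]) (use SU t(2) YU0 in blast)
      ultimately have "U0 \<subseteq> U1" unfolding U0_def by blast
      thus ?thesis using u unfolding U1_def by blast
    qed
    hence "Lsub U0" unfolding Lsub_def using sU0 U0M MVc by simp
    hence "M \<subseteq> U0" using NU0 YU0 by (rule M_min)
    moreover have "U0 \<subseteq> U" unfolding U0_def using U Y_sub[OF U nN] by (intro Inter_lower) simp
    ultimately have "M \<subseteq> U" by (rule subset_trans)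
    moreover have "U \<subseteq> M" using U unfolding Ssub_def by simp
    ultimately show False using nM by blast
  qed
qed

end

lemma linear_extend:
  assumes L: "fm.subspace L" and add: "\<And>x y. x \<in> L \<Longrightarrow> y \<in> L \<Longrightarrow> r (x + y) = r x + r y"
    and scale: "\<And>c x. x \<in> L \<Longrightarrow> r (c *\<^sub>m x) = c *\<^sub>m r x"
  shows "\<exists>g. flinear g \<and> (\<forall>x\<in>L. g x = r x)"
proof -
  obtain B where B: "B \<subseteq> L" "fm.independent B" "L \<subseteq> fm.span B"
    using fm.maximal_independent_subset[of L] by blast
  obtain g where g: "flinear g" "\<forall>x\<in>B. g x = r x" using fmm.linear_independent_extend[OF B(2)] by blast
  have "x \<in> L \<and> g x = r x" if "x \<in> fm.span B" for x
    using that
  proof (induction rule: fm.span_induct_alt)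
    case base
    have "r 0 = 0" using scale[of 0 0] fm.subspace_0[OF L] by simp
    thus ?case using fmm.linear_0[OF g(1)] fm.subspace_0[OF L] by simp
  next
    case (step c x y)
    have "x \<in> L" "g x = r x" using step B(1) g(2) by auto
    thus ?case using step fm.subspace_add[OF L] fm.subspace_scale[OF L]
      by (simp add: add scale fmm.linear_add[OF g(1)] fmm.linear_scale[OF g(1)])
  qed
  thus ?thesis using g(1) B(3) by blast
qed

text \<open>An arbitrary functional on columns need not be a finitely supported row. After
  composition with \<open>s\<close> it is, because \<open>s\<close> sees only finitely many
  coordinates.\<close>

lemma functional_ex:
  assumes p: "flinear p"
  shows "\<exists>h\<in>Vr. \<forall>v\<in>Vc. bp h v = ent (p (s * v)) a b"
proof -
  obtain k where k: "bnd k s" using bnd_ex by blast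
  define h where "h = (\<Sum>j<k. ent (p (s * E j 0)) a b *\<^sub>m E 0 j)"
  have "h \<in> Vr" unfolding h_def by (intro fm.subspace_sum[OF subspace_Vr] fm.subspace_scale[OF subspace_Vr] E_Vr)
  moreover have "bp h v = ent (p (s * v)) a b" if v: "v \<in> Vc" for v
  proof -
    have "s * v = (\<Sum>j<k. ent v j 0 *\<^sub>m (s * E j 0))"
    proof (rule fmat_eqI)
      fix i j
      show "ent (s * v) i j = ent (\<Sum>j<k. ent v j 0 *\<^sub>m (s * E j 0)) i j"
        by (cases "j = 0") (simp_all add: ent_times_bound[OF k] Vc_ent[OF v] mult.commute)
    qed
    hence "p (s * v) = (\<Sum>j<k. ent v j 0 *\<^sub>m p (s * E j 0))"
      by (simp add: fmm.linear_sum[OF p] fmm.linear_scale[OF p])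
    moreover have "bp h v = (\<Sum>j<k. ent (p (s * E j 0)) a b * ent v j 0)"
      unfolding h_def by (simp add: bp_sum bp_lin) (simp add: bp_def)
    ultimately show ?thesis by (simp add: mult.commute)
  qed
  ultimately show ?thesis by blast
qed

definition hom_on :: "fmat set \<Rightarrow> (fmat \<Rightarrow> fmat) \<Rightarrow> bool" where
  "hom_on L r \<longleftrightarrow> flinear r \<and> (\<forall>x\<in>L. \<forall>y\<in>L. r (lb x y) = lb (r x) (r y))"

context simple_ideal
begin

text \<open>The elements of \<open>S\<close> mapping \<open>M\<close> into \<open>N\<close> form an
  ideal; if it were all of \<open>S\<close>, then \<open>Y = t Y\<close> would lie in
  \<open>N\<close>.\<close>

lemma faithful:
  assumes s: "s \<in> S" "\<And>m. m \<in> M \<Longrightarrow> s * m \<in> N"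
  shows "s = 0"
proof -
  define K where "K = {s \<in> S. \<forall>m\<in>M. s * m \<in> N}"
  have "fm.subspace K" unfolding K_def
    by (rule fm.subspaceI)
      (auto simp: distrib_right fm.subspace_0[OF sS] fm.subspace_0[OF sN]
        intro: fm.subspace_add[OF sS] fm.subspace_add[OF sN] fm.subspace_scale[OF sS] fm.subspace_scale[OF sN])
  moreover have "K \<subseteq> S" unfolding K_def by blast
  moreover have "lb x k \<in> K" if x: "x \<in> S" and k: "k \<in> K" for x k
  proof -
    have kS: "k \<in> S" and kM: "\<And>m. m \<in> M \<Longrightarrow> k * m \<in> N" using k unfolding K_def by auto
    have xL: "x \<in> L" using x SL by blast
    have "lb x k * m \<in> N" if m: "m \<in> M" for m
    proof -
      have "x * (k * m) - k * (x * m) \<in> N"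
        by (rule fm.subspace_diff[OF sN LN[OF xL kM[OF m]] kM[OF LM[OF xL m]]])
      thus ?thesis by (simp add: lb_def left_diff_distrib mult.assoc)
    qed
    thus ?thesis using lie_sub_lb[OF S x kS] unfolding K_def by auto
  qed
  ultimately have "K = {0} \<or> K = S" by (rule simple)
  moreover have "K \<noteq> S"
  proof
    assume KS: "K = S"
    have "Y \<subseteq> N"
    proof (rule Y_perfect[OF sN])
      fix a y assume "a \<in> t" "y \<in> Y"
      hence "a \<in> K" "y \<in> M" using t(2) KS M(3) by auto
      thus "a * y \<in> N" unfolding K_def by blast
    qed
    thus False using N(2) by blast
  qed
  moreover have "s \<in> K" using s unfolding K_def by blast
  ultimately show ?thesis by blast
qed

section \<open>Functionals on the section \<open>M / N\<close>\<close>

definition Np :: "fmat set" where "Np = {h \<in> Vr. \<forall>n\<in>N. h * n = 0}"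

lemma sNp: "fm.subspace Np"
  unfolding Np_def by (rule fm.subspaceI)
    (auto simp: distrib_right fm.subspace_0[OF subspace_Vr] intro: fm.subspace_add[OF subspace_Vr] fm.subspace_scale[OF subspace_Vr])

lemma Np_act: "h \<in> Np \<Longrightarrow> x \<in> L \<Longrightarrow> h * x \<in> Np"
  unfolding Np_def using Vr_mult LN by (simp add: mult.assoc)

text \<open>Passing from \<open>Np\<close> to the span of \<open>Np S\<close> makes
  \<open>Q S\<close> span \<open>Q\<close>, which becomes \<open>rowfull\<close> in coordinates,
  while \<open>Q\<close> still separates the points of \<open>M / N\<close>.\<close>

definition Q :: "fmat set" where "Q = fm.span {h * s |h s. h \<in> Np \<and> s \<in> S}"

lemma sQ: "fm.subspace Q"
  unfolding Q_def by (rule fm.subspace_span)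

lemma Q_base: "h \<in> Np \<Longrightarrow> s \<in> S \<Longrightarrow> h * s \<in> Q"
  unfolding Q_def by (rule fm.span_base) blast

lemma Q_Np: "Q \<subseteq> Np"
  unfolding Q_def by (rule fm.span_minimal[OF _ sNp]) (use Np_act SL in blast)

lemma Q_Vr: "Q \<subseteq> Vr"
  using Q_Np unfolding Np_def by blast

lemma Q_act: assumes g: "g \<in> Q" and y: "y \<in> L" shows "g * y \<in> Q"
  using g unfolding Q_def
proof (induction rule: fm.span_induct_alt)
  case base
  show ?case using fm.span_zero by simp
next
  case (step c x z)
  then obtain h s where hs: "x = h * s" "h \<in> Np" "s \<in> S" by blast
  have "x * y = h * lb s y + (h * y) * s" unfolding hs(1) lb_def by (simp add: right_diff_distrib mult.assoc)
  moreover have "h * lb s y \<in> Q" "(h * y) * s \<in> Q"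
    by (rule Q_base[OF hs(2) S_lb[OF hs(3) y]], rule Q_base[OF Np_act[OF hs(2) y] hs(3)])
  ultimately have "x * y \<in> Q" using fm.subspace_add[OF sQ] by simp
  thus ?case using step fm.subspace_add[OF sQ] fm.subspace_scale[OF sQ]
    unfolding Q_def by (simp add: distrib_right)
qed

lemma Q_perfect: "Q \<subseteq> fm.span {g * s |g s. g \<in> Q \<and> s \<in> S}" (is "_ \<subseteq> fm.span ?X")
proof -
  have "h * s \<in> fm.span ?X" if h: "h \<in> Np" and s: "s \<in> S" for h s
  proof -
    have "s \<in> fm.span {lb a b |a b. a \<in> S \<and> b \<in> S}" using s perfect by blast
    thus ?thesis
    proof (induction rule: fm.span_induct_alt)
      case base
      show ?case using fm.span_zero by simp
    next
      case (step c x z)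
      then obtain a b where ab: "x = lb a b" "a \<in> S" "b \<in> S" by blast
      have "h * a * b \<in> fm.span ?X" "h * b * a \<in> fm.span ?X"
        by (rule fm.span_base, use Q_base[OF h] ab in blast)+
      hence "h * a * b - h * b * a \<in> fm.span ?X" by (rule fm.span_diff)
      moreover have "h * x = h * a * b - h * b * a" unfolding ab(1) lb_def by (simp add: right_diff_distrib mult.assoc)
      ultimately have "h * x \<in> fm.span ?X" by simp
      thus ?case using step fm.span_add fm.span_scale by (simp add: distrib_left)
    qed
  qed
  thus ?thesis unfolding Q_def by (intro fm.span_minimal fm.subspace_span) (auto simp: Q_def)
qed

lemma Q_N: "g \<in> Q \<Longrightarrow> n \<in> N \<Longrightarrow> bp g n = 0"
  using Q_Np unfolding Np_def bp_def by auto

text \<open>The vectors of \<open>M\<close> that \<open>S\<close> sends into \<open>N\<close> form a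
  submodule, so they are \<open>N\<close> or all of \<open>M\<close>; the latter would put
  \<open>Y = t Y\<close> into \<open>N\<close>.\<close>

lemma not_killed: assumes m: "m \<in> M" "m \<notin> N" shows "\<exists>s\<in>S. s * m \<notin> N"
proof (rule ccontr)
  assume c: "\<not> (\<exists>s\<in>S. s * m \<notin> N)"
  define U where "U = {m \<in> M. \<forall>s\<in>S. s * m \<in> N}"
  have "fm.subspace U" unfolding U_def
    by (rule fm.subspaceI)
      (auto simp: distrib_left fm.subspace_0[OF sM] fm.subspace_0[OF sN]
        intro: fm.subspace_add[OF sM] fm.subspace_add[OF sN] fm.subspace_scale[OF sM] fm.subspace_scale[OF sN])
  moreover have NU: "N \<subseteq> U" unfolding U_def using M(2) LN SL by auto
  moreover have "s * u \<in> U" if "s \<in> S" "u \<in> U" for s u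
    using that NU unfolding U_def by auto
  ultimately have "Ssub U" unfolding Ssub_def by (auto simp: U_def)
  hence "U = N \<or> U = M" by (rule S_irreducible)
  moreover have "m \<in> U" using c m unfolding U_def by blast
  ultimately have UM: "U = M" using m by blast
  have "Y \<subseteq> N"
  proof (rule Y_perfect[OF sN])
    fix a y assume "a \<in> t" "y \<in> Y"
    hence "a \<in> S" "y \<in> U" using t(2) UM M(3) by auto
    thus "a * y \<in> N" unfolding U_def by blast
  qed
  thus False using N(2) by blast
qed

text \<open>Two elements of \<open>S\<close> are spent: \<open>s'\<close> turns a functional
  vanishing on \<open>N\<close> into a finitely supported row in \<open>Np\<close>, and
  \<open>s\<close> moves this row into \<open>Q\<close>.\<close>

lemma separation: assumes m: "m \<in> M" "m \<notin> N" shows "\<exists>g\<in>Q. bp g m \<noteq> 0"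
proof -
  obtain s where s: "s \<in> S" "s * m \<notin> N" using not_killed[OF m] by blast
  have sm: "s * m \<in> M" using LM s(1) SL m(1) by blast
  obtain s' where s': "s' \<in> S" "s' * (s * m) \<notin> N" using not_killed[OF sm s(2)] by blast
  obtain p where p: "flinear p" "\<And>x. p x = 0 \<longleftrightarrow> x \<in> N" using kernel_ex[OF sN] by blast
  obtain a b where ab: "ent (p (s' * (s * m))) a b \<noteq> 0" using fmat_nonzero_ex[of "p (s' * (s * m))"] p(2) s'(2) by auto
  obtain h where h: "h \<in> Vr" "\<forall>v\<in>Vc. bp h v = ent (p (s' * v)) a b" using functional_ex[OF p(1)] by blast
  have "h * n = 0" if n: "n \<in> N" for n
  proof -
    have nV: "n \<in> Vc" using n M(2) MVc by blast
    have "s' * n \<in> N" using LN[OF _ n] s'(1) SL by auto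
    hence "p (s' * n) = 0" using p(2) by blast
    hence "bp h n = 0" using h(2) nV by simp
    thus ?thesis using Vr_Vc[OF h(1) nV] unfolding bp_def by simp
  qed
  hence "h \<in> Np" unfolding Np_def using h(1) by blast
  hence "h * s \<in> Q" using s(1) by (rule Q_base)
  moreover have "bp (h * s) m \<noteq> 0" unfolding bp_move using h(2) sm MVc ab by auto
  ultimately show ?thesis by blast
qed

text \<open>If a finite system gave the whole pairing, \<open>M\<close> would be spanned modulo
  \<open>N\<close> by finitely many vectors. An infinite-dimensional part of \<open>S\<close> would
  send them into \<open>N\<close>, against faithfulness.\<close>

lemma infinite_rank:
  assumes xs: "biorth M Q xs"
  shows "\<exists>v\<in>M. \<exists>h\<in>Q. bp h v \<noteq> bexp xs h v"
proof (rule ccontr)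
  assume c: "\<not> ?thesis"
  define C where "C = fst ` set xs"
  have C: "finite C" "C \<subseteq> M" unfolding C_def using xs unfolding biorth_def by auto
  have ex: "\<exists>u\<in>fm.span C. v - u \<in> N" if v: "v \<in> M" for v
  proof -
    define u where "u = (\<Sum>x\<leftarrow>xs. bp (snd x) v *\<^sub>m fst x)"
    have u: "u \<in> fm.span C" unfolding u_def
      by (rule subspace_sum_list[OF fm.subspace_span]) (auto simp: C_def intro: fm.span_scale fm.span_base)
    have "u \<in> M" using u fm.span_minimal[OF C(2) sM] by blast
    hence vu: "v - u \<in> M" using v fm.subspace_diff[OF sM] by blast
    have "bp h (v - u) = 0" if h: "h \<in> Q" for h
    proof -
      have "bp h u = bexp xs h v" unfolding u_def bexp_def bp_sum_list
        by (simp add: o_def bp_lin mult.commute)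
      thus ?thesis using c v h by (simp add: bp_lin)
    qed
    hence "v - u \<in> N" using separation[OF vu] by blast
    thus ?thesis using u by blast
  qed
  obtain q where q: "flinear q" "\<And>x. q x = 0 \<longleftrightarrow> x \<in> N" using kernel_ex[OF sN] by blast
  have qM: "q ` M \<subseteq> fm.span (q ` C)"
  proof
    fix y assume "y \<in> q ` M"
    then obtain v where v: "v \<in> M" "y = q v" by blast
    obtain u where u: "u \<in> fm.span C" "v - u \<in> N" using ex[OF v(1)] by blast
    have "q v = q u" using q(2)[of "v - u"] u(2) fmm.linear_diff[OF q(1)] by simp
    thus "y \<in> fm.span (q ` C)" using u(1) v(2) fmm.linear_span_image[OF q(1), of C] by auto
  qed
  have fdq: "fd (q ` M)" unfolding fd_def using qM C(1) by (intro exI[of _ "q ` C"]) simp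
  have "\<not> fd {s \<in> S. \<forall>c\<in>C. q (s * c) = 0}"
  proof (rule conjunct1[OF common_kernel_not_fd[OF sS not_fd C(1), of "\<lambda>c s. q (s * c)"]])
    fix c assume c: "c \<in> C"
    have "flinear (\<lambda>s. q (s * c))"
      by (rule flinearI) (simp_all add: distrib_right fmm.linear_add[OF q(1)] fmm.linear_scale[OF q(1)])
    moreover have "s * c \<in> M" if "s \<in> S" for s using LM[of s c] that SL C(2) c by auto
    hence "(\<lambda>s. q (s * c)) ` S \<subseteq> q ` M" by auto
    hence "fd ((\<lambda>s. q (s * c)) ` S)" by (rule fd_subset[OF fdq])
    ultimately show "flinear (\<lambda>s. q (s * c)) \<and> fd ((\<lambda>s. q (s * c)) ` S)" by blast
  qed
  moreover have "{s \<in> S. \<forall>c\<in>C. q (s * c) = 0} \<subseteq> {0}"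
  proof
    fix s assume s: "s \<in> {s \<in> S. \<forall>c\<in>C. q (s * c) = 0}"
    hence sSS: "s \<in> S" and sC: "\<And>c. c \<in> C \<Longrightarrow> s * c \<in> N" using q(2) by auto
    have sub: "fm.subspace {u. s * u \<in> N}"
      by (rule fm.subspaceI)
        (auto simp: distrib_left fm.subspace_0[OF sN] intro: fm.subspace_add[OF sN] fm.subspace_scale[OF sN])
    have sp: "s * u \<in> N" if "u \<in> fm.span C" for u
      using that fm.span_minimal[OF _ sub, of C] sC by blast
    have "s * v \<in> N" if v: "v \<in> M" for v
    proof -
      obtain u where u: "u \<in> fm.span C" "v - u \<in> N" using ex[OF v] by blast
      have "s * (v - u) + s * u \<in> N" using LN[OF _ u(2)] sSS SL sp[OF u(1)] fm.subspace_add[OF sN] by blast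
      thus ?thesis by (simp add: right_diff_distrib)
    qed
    hence "s = 0" by (rule faithful[OF sSS])
    thus "s \<in> {0}" by simp
  qed
  moreover have "fd {0}" unfolding fd_def by (intro exI[of _ "{}"]) simp
  ultimately show False using fd_subset by blast
qed

theorem irreducible_rep:
  "\<exists>r. hom_on L r \<and> irr (r ` S) \<and> rowfull (r ` S) \<and> (\<forall>s\<in>S. r s = 0 \<longrightarrow> s = 0)"
proof -
  obtain u where u: "\<And>k :: nat. u k \<in> M" "M \<subseteq> fm.span (range u)" using countable_spanning[OF sM] by auto
  obtain g where g: "\<And>k :: nat. g k \<in> Q" "Q \<subseteq> fm.span (range g)" using countable_spanning[OF sQ] by auto
  define P where "P w f \<longleftrightarrow> (\<forall>i :: nat. w i \<in> M \<and> f i \<in> Q) \<and> (\<forall>i j. bp (f i) (w j) = (if i = j then 1 else 0))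
    \<and> (\<forall>v\<in>M. \<exists>n. \<forall>h\<in>Q. bp h v = (\<Sum>k<n. bp h (w k) * bp (f k) v))
    \<and> (\<forall>h\<in>Q. \<exists>n. \<forall>v\<in>M. bp h v = (\<Sum>k<n. bp h (w k) * bp (f k) v))" for w f
  have "\<exists>w f. P w f" unfolding P_def by (rule dual_bases[OF sM sQ u g infinite_rank])
  then obtain w f where "P w f" by auto
  note wf = this[unfolded P_def]
  have fQ: "f i \<in> Q" for i using wf by simp
  interpret D: dbasis M Q w f
    by unfold_locales (use sM sQ MVc Q_Vr wf in simp_all)
  have pres: "D.pres x" if "x \<in> L" for x unfolding D.pres_def using LM[OF that] Q_act[OF _ that] by auto
  have sL: "fm.subspace L" using L unfolding lie_sub_def by blast
  \<comment> \<open>\<open>D.rep\<close> is known to be linear only on matrices preserving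
    \<open>M\<close> and \<open>Q\<close>; its restriction to \<open>L\<close> is extended, since
    \<open>hom_on\<close> asks for a globally linear map.\<close>
  obtain r where r: "flinear r" "\<And>x. x \<in> L \<Longrightarrow> r x = D.rep x"
    using linear_extend[OF sL, of D.rep] by (auto simp: D.rep_add D.rep_scale pres)
  have hom: "hom_on L r" unfolding hom_on_def
    using r(1) lie_sub_lb[OF L] by (simp add: r(2) D.rep_lb pres)
  have inj: "s = 0" if s: "s \<in> S" "r s = 0" for s
  proof (rule faithful[OF s(1)])
    fix m assume m: "m \<in> M"
    have sL: "s \<in> L" using s(1) SL by blast
    have "bp h (s * m) = 0" if "h \<in> Q" for h
      using D.rep_eq_0[OF pres[OF sL] _ that m] s(2) r(2)[OF sL] by simp
    thus "s * m \<in> N" using separation[OF LM[OF sL m]] by blast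
  qed
  have crdN: "D.crd v = 0" if v: "v \<in> N" for v
  proof (rule fmat_eqI)
    fix i j
    have "v \<in> M" using v M(2) by blast
    thus "ent (D.crd v) i j = ent 0 i j" using Q_N[OF fQ v] by (simp add: D.ent_crd)
  qed
  have irr: "X = {0} \<or> X = Vc" if X: "fm.subspace X" "X \<subseteq> Vc" "\<And>s x. s \<in> S \<Longrightarrow> x \<in> X \<Longrightarrow> r s * x \<in> X" for X
  proof -
    \<comment> \<open>The preimage of \<open>X\<close> under taking coordinates, to which
      irreducibility of \<open>M / N\<close> applies.\<close>
    define U where "U = {v \<in> M. D.crd v \<in> X}"
    have c0: "D.crd 0 = 0" using crdN fm.subspace_0[OF sN] by blast
    have "fm.subspace U" unfolding U_def
      by (rule fm.subspaceI)
        (auto simp: D.crd_lin c0 fm.subspace_0[OF sM] fm.subspace_0[OF X(1)]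
          intro: fm.subspace_add[OF sM] fm.subspace_add[OF X(1)] fm.subspace_scale[OF sM] fm.subspace_scale[OF X(1)])
    moreover have "N \<subseteq> U" unfolding U_def using M(2) crdN fm.subspace_0[OF X(1)] by auto
    moreover have "s * v \<in> U" if s: "s \<in> S" and v: "v \<in> U" for s v
    proof -
      have sL: "s \<in> L" using s SL by blast
      have vM: "v \<in> M" "D.crd v \<in> X" using v unfolding U_def by auto
      have "D.crd (s * v) = r s * D.crd v" unfolding r(2)[OF sL] by (rule D.crd_act[OF pres[OF sL] vM(1)])
      thus ?thesis unfolding U_def using X(3)[OF s vM(2)] LM[OF sL vM(1)] by simp
    qed
    ultimately have "Ssub U" unfolding Ssub_def by (auto simp: U_def)
    hence "U = N \<or> U = M" by (rule S_irreducible)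
    thus ?thesis
    proof
      assume UN: "U = N"
      have "x = 0" if x: "x \<in> X" for x
      proof -
        have "x \<in> Vc" using x X(2) by blast
        then obtain v where v: "v \<in> M" "D.crd v = x" using D.crd_surj by blast
        hence "v \<in> N" using x UN unfolding U_def by blast
        thus ?thesis using crdN v(2) by simp
      qed
      thus ?thesis using fm.subspace_0[OF X(1)] by blast
    next
      assume UM: "U = M"
      have "x \<in> X" if x: "x \<in> Vc" for x
      proof -
        obtain v where v: "v \<in> M" "D.crd v = x" using D.crd_surj[OF x] by blast
        thus ?thesis using UM unfolding U_def by blast
      qed
      thus ?thesis using X(2) by blast
    qed
  qed
  have "irr (r ` S)" unfolding irr_def using irr by auto
  moreover have "rowfull (r ` S)" unfolding rowfull_def
  proof
    let ?X = "{f * s |f s. f \<in> Vr \<and> s \<in> r ` S}"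
    have sp: "h \<in> Q \<and> D.rcrd h \<in> fm.span ?X" if "h \<in> fm.span {g * s |g s. g \<in> Q \<and> s \<in> S}" for h
      using that
    proof (induction rule: fm.span_induct_alt)
      case base
      have "D.rcrd 0 = 0" using D.rcrd_lin(2)[of 0 0] fm.subspace_0[OF sQ] by simp
      thus ?case using fm.subspace_0[OF sQ] fm.span_zero by simp
    next
      case (step c x y)
      then obtain h s where hs: "x = h * s" "h \<in> Q" "s \<in> S" by blast
      have sL: "s \<in> L" using hs(3) SL by blast
      have "D.rcrd x = D.rcrd h * r s" unfolding hs(1) r(2)[OF sL] by (rule D.rcrd_act[OF pres[OF sL] hs(2)])
      hence "D.rcrd x \<in> fm.span ?X"
        using D.rcrd_Vr[OF hs(2)] hs(3) by (intro fm.span_base) auto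
      moreover have xQ: "x \<in> Q" unfolding hs(1) by (rule Q_act[OF hs(2) sL])
      ultimately show ?case
        using step fm.subspace_add[OF sQ] fm.subspace_scale[OF sQ, of x c] fm.span_add fm.span_scale
        by (simp add: D.rcrd_lin)
    qed
    have E: "E 0 k \<in> fm.span ?X" for k
    proof -
      have "f k \<in> fm.span {g * s |g s. g \<in> Q \<and> s \<in> S}" using Q_perfect fQ by blast
      from sp[OF this] show ?thesis unfolding D.rcrd_f by simp
    qed
    fix v assume v: "v \<in> Vr"
    obtain n where n: "bnd n v" using bnd_ex by blast
    show "v \<in> fm.span ?X"
      by (subst Vr_sum[OF v n]) (intro fm.span_sum fm.span_scale E)
  qed
  ultimately show ?thesis using hom inj by blast
qed

end

section \<open>Homomorphic images, commutators and the model of a simple ideal\<close>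

lemma hom_on_lie_sub:
  assumes r: "hom_on L r" and S: "lie_sub S" "S \<subseteq> L"
  shows "lie_sub (r ` S)"
proof -
  have f: "flinear r" and h: "\<And>x y. x \<in> L \<Longrightarrow> y \<in> L \<Longrightarrow> r (lb x y) = lb (r x) (r y)"
    using r unfolding hom_on_def by auto
  have "fm.subspace (r ` S)"
    by (rule fmm.linear_subspace_image[OF f]) (use S(1) in \<open>simp add: lie_sub_def\<close>)
  moreover have "lb (r x) (r y) \<in> r ` S" if x: "x \<in> S" and y: "y \<in> S" for x y
  proof -
    have "lb (r x) (r y) = r (lb x y)" using h[of x y] subsetD[OF S(2)] x y by simp
    thus ?thesis using lie_sub_lb[OF S(1) x y] by simp
  qed
  ultimately show ?thesis unfolding lie_sub_def by auto
qed

lemma hom_on_locally_fd: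
  assumes r: "hom_on L r" and S: "S \<subseteq> L" "locally_fd S"
  shows "locally_fd (r ` S)"
  unfolding locally_fd_def
proof (intro allI impI)
  fix F assume F: "finite F" "F \<subseteq> r ` S"
  obtain C where C: "C \<subseteq> S" "finite C" "F = r ` C" using finite_subset_image[OF F] by blast
  obtain K where K: "lie_sub K" "K \<subseteq> S" "C \<subseteq> K" "fd K"
    using S(2) C(1,2) unfolding locally_fd_def by meson
  have "lie_sub (r ` K)" by (rule hom_on_lie_sub[OF r K(1)]) (use K(2) S(1) in auto)
  moreover have "fd (r ` K)" by (rule fd_image[OF K(4)]) (use r in \<open>simp add: hom_on_def\<close>)
  ultimately show "\<exists>K. lie_sub K \<and> K \<subseteq> r ` S \<and> F \<subseteq> K \<and> fd K"
    using K(2,3) C(3) by (intro exI[of _ "r ` K"]) auto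
qed

lemma commute_alg:
  assumes "\<And>s. s \<in> S \<Longrightarrow> lb z s = 0" "T \<in> alg S"
  shows "lb z T = 0"
  using assms(2)
proof (induction rule: alg.induct)
  case (mult x y)
  have "lb z (x * y) = lb z x * y + x * lb z y"
    unfolding lb_def by (simp add: left_diff_distrib right_diff_distrib mult.assoc)
  thus ?case using mult by simp
qed (simp_all add: assms(1) lb_simps)

text \<open>No nonzero scalar matrix is finitely supported: bracketing with \<open>E k i\<close> for
  \<open>k\<close> outside the support of \<open>z\<close> exhibits entry \<open>(i, j)\<close> of
  \<open>z\<close>.\<close>

lemma commute_UNIV:
  assumes "\<And>T. lb z T = 0"
  shows "z = 0"
proof (rule fmat_eqI)
  fix i j
  obtain n where n: "bnd n z" using bnd_ex by blast
  define k where "k = Suc (n + j)"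
  have "ent (lb z (E k i)) k j = 0" using assms by simp
  moreover have "ent z k k = 0" using n unfolding bnd_def k_def by (metis less_Suc_eq not_add_less1 not_less_eq)
  ultimately show "ent z i j = ent 0 i j" unfolding lb_def by (simp split: if_splits)
qed

definition comm :: "fmat set \<Rightarrow> fmat set" where
  "comm T = fm.span {lb a b |a b. a \<in> T \<and> b \<in> T}"

lemma comm_base: "a \<in> T \<Longrightarrow> b \<in> T \<Longrightarrow> lb a b \<in> comm T"
  unfolding comm_def by (rule fm.span_base) blast

lemma comm_mono: "S \<subseteq> T \<Longrightarrow> comm S \<subseteq> comm T"
  unfolding comm_def by (rule fm.span_mono) blast

lemma comm_sub: "lie_sub T \<Longrightarrow> comm T \<subseteq> T"
  unfolding comm_def by (rule fm.span_minimal) (auto simp: lie_sub_def)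

lemma hom_on_comm:
  assumes r: "hom_on L r" and S: "S \<subseteq> L"
  shows "r ` comm S = comm (r ` S)"
proof -
  have f: "flinear r" and h: "\<And>x y. x \<in> L \<Longrightarrow> y \<in> L \<Longrightarrow> r (lb x y) = lb (r x) (r y)"
    using r unfolding hom_on_def by auto
  have "r ` {lb a b |a b. a \<in> S \<and> b \<in> S} = {lb a b |a b. a \<in> r ` S \<and> b \<in> r ` S}"
  proof (intro equalityI subsetI)
    fix x assume "x \<in> r ` {lb a b |a b. a \<in> S \<and> b \<in> S}"
    then obtain a b where ab: "x = r (lb a b)" "a \<in> S" "b \<in> S" by auto
    hence "x = lb (r a) (r b)" using h[of a b] subsetD[OF S] by simp
    thus "x \<in> {lb a b |a b. a \<in> r ` S \<and> b \<in> r ` S}" using ab by auto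
  next
    fix x assume "x \<in> {lb a b |a b. a \<in> r ` S \<and> b \<in> r ` S}"
    then obtain a b where ab: "x = lb (r a) (r b)" "a \<in> S" "b \<in> S" by auto
    hence "x = r (lb a b)" using h[of a b] subsetD[OF S] by simp
    thus "x \<in> r ` {lb a b |a b. a \<in> S \<and> b \<in> S}" using ab by auto
  qed
  thus ?thesis unfolding comm_def using fmm.linear_span_image[OF f, of "{lb a b |a b. a \<in> S \<and> b \<in> S}"] by simp
qed

text \<open>The off-diagonal units generate the differences \<open>E i i - E j j\<close>, hence all
  brackets of matrix units.\<close>

lemma comm_UNIV_sub:
  assumes S: "lie_sub S" and E: "\<And>i j. i \<noteq> j \<Longrightarrow> E i j \<in> S"
  shows "comm UNIV \<subseteq> S"
proof -
  have sS: "fm.subspace S" using S unfolding lie_sub_def by blast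
  have D: "E i i - E j j \<in> S" for i j
  proof (cases "i = j")
    case True
    thus ?thesis using fm.subspace_0[OF sS] by simp
  next
    case False
    hence "lb (E i j) (E j i) \<in> S" using E[of i j] E[of j i] lie_sub_lb[OF S] by simp
    thus ?thesis by (simp add: lb_def)
  qed
  have EE: "lb (E i j) (E k l) \<in> S" for i j k l
  proof -
    have eq: "lb (E i j) (E k l) = (if j = k then E i l else 0) - (if l = i then E k j else 0)"
      by (simp add: lb_def E_mult_E)
    have "E i l \<in> S" if "i \<noteq> l" using E that .
    moreover have "E k j \<in> S" if "k \<noteq> j" using E that .
    ultimately show ?thesis unfolding eq
      using D[of i k] fm.subspace_0[OF sS] fm.subspace_neg[OF sS] fm.subspace_diff[OF sS]
      by (cases "j = k"; cases "l = i") auto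
  qed
  have EX: "lb (E i j) x \<in> S" for i j x
  proof -
    have "fm.subspace {x. lb (E i j) x \<in> S}"
      by (rule fm.subspaceI)
        (simp_all add: lb_simps fm.subspace_0[OF sS] fm.subspace_add[OF sS] fm.subspace_scale[OF sS])
    moreover have "range (\<lambda>(i, j). E i j) \<subseteq> {x. lb (E i j) x \<in> S}" using EE by auto
    ultimately have "fm.span (range (\<lambda>(i, j). E i j)) \<subseteq> {x. lb (E i j) x \<in> S}" by (intro fm.span_minimal)
    thus ?thesis using span_E by blast
  qed
  have "lb a x \<in> S" for a x
  proof -
    have "fm.subspace {a. lb a x \<in> S}"
      by (rule fm.subspaceI)
        (simp_all add: lb_simps fm.subspace_0[OF sS] fm.subspace_add[OF sS] fm.subspace_scale[OF sS])
    moreover have "range (\<lambda>(i, j). E i j) \<subseteq> {a. lb a x \<in> S}" using EX by auto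
    ultimately have "fm.span (range (\<lambda>(i, j). E i j)) \<subseteq> {a. lb a x \<in> S}" by (intro fm.span_minimal)
    thus ?thesis using span_E by blast
  qed
  thus ?thesis unfolding comm_def by (intro fm.span_minimal[OF _ sS]) auto
qed

definition mlie :: "fmat set \<Rightarrow> (nat \<Rightarrow> nat \<Rightarrow> complex) lie_alg" where
  "mlie T = gl_inf\<lparr>lcarrier := ent ` T\<rparr>"

text \<open>\<open>r\<close> need not map \<open>L\<close> onto \<open>T\<close>; only
  \<open>S\<close> has a prescribed image, the derived algebra. The last clause makes the kernels
  for all simple ideals meet in the centre.\<close>

definition has_model :: "fmat set \<Rightarrow> fmat set \<Rightarrow> bool" where
  "has_model L S \<longleftrightarrow> (\<exists>T r. lie_sub T \<and>
     (mlie T = gl_inf \<or> mlie T = so_inf \<or> mlie T = sp_inf \<or> fin_dim (mlie T) \<and> simple_lie (mlie T)) \<and>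
     hom_on L r \<and> r ` L \<subseteq> T \<and> r ` S = comm T \<and> (\<forall>x\<in>L. r x = 0 \<longleftrightarrow> (\<forall>s\<in>S. lb x s = 0)))"

context simple_ideal
begin

theorem model:
  assumes loc: "locally_fd S"
  shows "has_model L S"
proof -
  obtain r where r: "hom_on L r" "irr (r ` S)" "rowfull (r ` S)" and inj: "\<And>s. s \<in> S \<Longrightarrow> r s = 0 \<Longrightarrow> s = 0"
    using irreducible_rep by blast
  have f: "flinear r" and h: "\<And>x y. x \<in> L \<Longrightarrow> y \<in> L \<Longrightarrow> r (lb x y) = lb (r x) (r y)"
    using r(1) unfolding hom_on_def by auto
  have lS: "lie_sub (r ` S)" by (rule hom_on_lie_sub[OF r(1) S SL])
  have A: "alg (r ` S) = UNIV" by (rule alg_UNIV[OF _ r(2,3)]) (use lS in \<open>simp add: lie_sub_def\<close>)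
  have centre: "z = 0" if "\<And>s. s \<in> S \<Longrightarrow> lb z (r s) = 0" for z
  proof (rule commute_UNIV)
    fix T
    have "T \<in> alg (r ` S)" unfolding A by simp
    thus "lb z T = 0" by (rule commute_alg[rotated]) (use that in auto)
  qed
  have kernel: "r x = 0 \<longleftrightarrow> (\<forall>s\<in>S. lb x s = 0)" if x: "x \<in> L" for x
  proof
    assume r0: "r x = 0"
    have "lb x s = 0" if s: "s \<in> S" for s
    proof (rule inj[OF ideal[OF x s]])
      have "s \<in> L" using s SL by blast
      thus "r (lb x s) = 0" using h[OF x, of s] r0 by (simp add: lb_simps)
    qed
    thus "\<forall>s\<in>S. lb x s = 0" by blast
  next
    assume c: "\<forall>s\<in>S. lb x s = 0"
    show "r x = 0"
    proof (rule centre)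
      fix s assume s: "s \<in> S"
      have "s \<in> L" using s SL by blast
      hence "lb (r x) (r s) = r (lb x s)" using h[OF x, of s] by simp
      also have "\<dots> = 0" using c s fmm.linear_0[OF f] by simp
      finally show "lb (r x) (r s) = 0" .
    qed
  qed
  have perf: "comm (r ` S) = r ` S"
    using hom_on_comm[OF r(1) SL] perfect comm_sub[OF S] unfolding comm_def by auto
  have "(\<forall>i j. i \<noteq> j \<longrightarrow> E i j \<in> r ` S) \<or> (\<exists>st. star st \<and> r ` S = {T. st T = - T})"
    by (rule irreducible_locally_fd_cases[OF lS r(2,3) hom_on_locally_fd[OF r(1) SL loc]])
  thus ?thesis
  proof
    assume E: "\<forall>i j. i \<noteq> j \<longrightarrow> E i j \<in> r ` S"
    have "comm UNIV = r ` S"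
      using comm_UNIV_sub[OF lS] E perf comm_mono[of "r ` S" UNIV] by auto
    moreover have "mlie UNIV = gl_inf" unfolding mlie_def using lcarrier_gl_inf by (metis lie_alg.surjective lie_alg.update_convs(1))
    moreover have "lie_sub UNIV" unfolding lie_sub_def by simp
    ultimately show ?thesis unfolding has_model_def using r(1) kernel
      by (intro exI[of _ UNIV] exI[of _ r]) simp
  next
    assume "\<exists>st. star st \<and> r ` S = {T. st T = - T}"
    then obtain st where st: "star st" and eq: "r ` S = {T. st T = - T}" by blast
    interpret star st by (rule st)
    \<comment> \<open>The part \<open>y + st y\<close> of an image \<open>y\<close> that is
      symmetric under \<open>st\<close> commutes with \<open>r S\<close> and therefore vanishes; so
      all of \<open>L\<close> acts by skew matrices.\<close>
    have rL: "r ` L \<subseteq> r ` S"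
    proof
      fix y assume "y \<in> r ` L"
      then obtain x where x: "x \<in> L" "y = r x" by blast
      have "y + st y = 0"
      proof (rule centre)
        fix s assume s: "s \<in> S"
        have sS: "st (r s) = - r s" using eq s by blast
        have "s \<in> L" using s SL by blast
        hence "lb y (r s) = r (lb x s)" using h[OF x(1), of s] x(2) by simp
        moreover have "r (lb x s) \<in> r ` S" using ideal[OF x(1) s] by blast
        ultimately have "st (lb y (r s)) = - lb y (r s)" using eq by auto
        moreover have "st (lb y (r s)) = lb (st y) (r s)"
          by (simp add: lb_def st_diff st_mult sS)
        ultimately show "lb (y + st y) (r s) = 0" by (simp add: lb_simps)
      qed
      hence "st y = - y" by (simp add: eq_neg_iff_add_eq_0 add.commute)
      thus "y \<in> r ` S" unfolding eq by blast
    qed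
    obtain q where q: "flinear q" "\<And>x y. q (x * y) = q x * q y" "inj q"
      and car: "(\<lambda>T. ent (q T)) ` {T. st T = - T} = lcarrier so_inf
        \<or> (\<lambda>T. ent (q T)) ` {T. st T = - T} = lcarrier sp_inf"
      using star_model by auto
    define T where "T = q ` r ` S"
    have eT: "ent ` T = lcarrier so_inf \<or> ent ` T = lcarrier sp_inf"
      using car unfolding T_def eq[symmetric] by (simp add: image_image)
    have m: "mlie T = so_inf \<or> mlie T = sp_inf"
      using eT unfolding mlie_def so_inf_def sp_inf_def by auto
    have hq: "hom_on UNIV q" unfolding hom_on_def lb_def using q(1,2) by (simp add: fmm.linear_diff[OF q(1)])
    have lT: "lie_sub T" unfolding T_def by (rule hom_on_lie_sub[OF hq lS]) simp
    have "comm T = T" unfolding T_def using hom_on_comm[OF hq, of "r ` S"] perf by simp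
    moreover have "hom_on L (q \<circ> r)"
      unfolding hom_on_def
      using h hq Vector_Spaces.linear_compose[OF f q(1)] unfolding hom_on_def by simp
    moreover have "(q \<circ> r) x = 0 \<longleftrightarrow> r x = 0" for x
      using q(3) fmm.linear_0[OF q(1)] by (auto dest: injD[of q "r x" 0])
    ultimately show ?thesis unfolding has_model_def using m lT kernel rL
      by (intro exI[of _ T] exI[of _ "q \<circ> r"]) (auto simp: T_def)
  qed
qed

end

section \<open>Commuting simple subalgebras\<close>

definition simp_alg :: "fmat set \<Rightarrow> bool" where
  "simp_alg t \<longleftrightarrow> lie_sub t \<and> (\<exists>x\<in>t. \<exists>y\<in>t. lb x y \<noteq> 0) \<and>
    (\<forall>K. fm.subspace K \<longrightarrow> K \<subseteq> t \<longrightarrow> (\<forall>x\<in>t. \<forall>k\<in>K. lb x k \<in> K) \<longrightarrow> K = {0} \<or> K = t)"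

lemma simp_alg_lie: "simp_alg t \<Longrightarrow> lie_sub t"
  unfolding simp_alg_def by blast

lemma simp_alg_sub: "simp_alg t \<Longrightarrow> fm.subspace t"
  unfolding simp_alg_def lie_sub_def by blast

lemma simp_alg_ideal:
  assumes t: "simp_alg t" and K: "fm.subspace K" "K \<subseteq> t" "\<And>x k. x \<in> t \<Longrightarrow> k \<in> K \<Longrightarrow> lb x k \<in> K" "k \<in> K" "k \<noteq> 0"
  shows "K = t"
proof -
  have "K = {0} \<or> K = t" using t K(1-3) unfolding simp_alg_def by simp
  thus ?thesis using K(4,5) by blast
qed

text \<open>The elements satisfying \<open>P\<close> form an ideal, so one nonzero element
  suffices.\<close>

lemma simp_alg_induct [consumes 4, case_names zero add scale lb]:
  assumes t: "simp_alg t" and u: "u \<in> t" "u \<noteq> 0" "P u" and a: "a \<in> t"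
    and P0: "P 0" and Padd: "\<And>x y. x \<in> t \<Longrightarrow> y \<in> t \<Longrightarrow> P x \<Longrightarrow> P y \<Longrightarrow> P (x + y)"
    and Psc: "\<And>c x. x \<in> t \<Longrightarrow> P x \<Longrightarrow> P (c *\<^sub>m x)"
    and Plb: "\<And>x y. x \<in> t \<Longrightarrow> y \<in> t \<Longrightarrow> P y \<Longrightarrow> P (lb x y)"
  shows "P a"
proof -
  have st: "fm.subspace t" by (rule simp_alg_sub[OF t])
  have "{a \<in> t. P a} = t"
  proof (rule simp_alg_ideal[OF t, of _ u])
    show "fm.subspace {a \<in> t. P a}"
      by (rule fm.subspaceI)
        (auto simp: fm.subspace_0[OF st] P0 intro: fm.subspace_add[OF st] fm.subspace_scale[OF st] Padd Psc)
  qed (use u Plb lie_sub_lb[OF simp_alg_lie[OF t]] in auto)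
  thus ?thesis using a by blast
qed

lemma simp_alg_nonabelian: "simp_alg t \<Longrightarrow> \<exists>x\<in>t. \<exists>y\<in>t. lb x y \<noteq> 0"
  unfolding simp_alg_def by blast

lemma simp_alg_centre:
  assumes t: "simp_alg t" and x: "x \<in> t" "x \<noteq> 0"
  shows "\<exists>y\<in>t. lb y x \<noteq> 0"
proof (rule ccontr)
  assume c: "\<not> ?thesis"
  obtain a b where ab: "a \<in> t" "b \<in> t" "lb a b \<noteq> 0" using simp_alg_nonabelian[OF t] by blast
  have x0: "\<forall>y\<in>t. lb y x = 0" using c by blast
  have "\<forall>y\<in>t. lb y b = 0"
    by (rule simp_alg_induct[where P = "\<lambda>b. \<forall>y\<in>t. lb y b = 0", OF t x x0 ab(2)]) (auto simp: lb_simps)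
  thus False using ab by blast
qed

lemma simp_alg_perfect: "simp_alg t \<Longrightarrow> comm t = t"
proof -
  assume t: "simp_alg t"
  obtain a b where ab: "a \<in> t" "b \<in> t" "lb a b \<noteq> 0" using simp_alg_nonabelian[OF t] by blast
  have sub: "comm t \<subseteq> t" by (rule comm_sub[OF simp_alg_lie[OF t]])
  show ?thesis
  proof (rule simp_alg_ideal[OF t _ sub _ comm_base[OF ab(1,2)] ab(3)])
    show "fm.subspace (comm t)" unfolding comm_def by (rule fm.subspace_span)
    show "lb x k \<in> comm t" if "x \<in> t" "k \<in> comm t" for x k
      using that sub by (intro comm_base) auto
  qed
qed

lemma card_le_family:
  assumes T: "finite T" and B: "finite B" and z: "\<And>s. s \<in> T \<Longrightarrow> z s \<in> fm.span B"
    and ind: "\<And>c s. (\<Sum>s\<in>T. c s *\<^sub>m z s) = 0 \<Longrightarrow> s \<in> T \<Longrightarrow> c s = 0"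
  shows "card T \<le> card B"
proof -
  have inj: "inj_on z T"
  proof (rule inj_onI, rule ccontr)
    fix s s' assume s: "s \<in> T" "s' \<in> T" "z s = z s'" "s \<noteq> s'"
    define c where "c x = (if x = s then 1 else if x = s' then - 1 else (0::complex))" for x
    have "(\<Sum>x\<in>T. c x *\<^sub>m z x) = (\<Sum>x\<in>{s, s'}. c x *\<^sub>m z x)"
      by (rule sum.mono_neutral_right[OF T]) (use s in \<open>auto simp: c_def\<close>)
    also have "\<dots> = 0" using s by (simp add: c_def scaleM_uminus[symmetric])
    finally have "c s = 0" using ind s(1) by blast
    thus False unfolding c_def by simp
  qed
  have "fm.independent (z ` T)"
  proof
    assume "fm.dependent (z ` T)"
    then obtain u v where uv: "v \<in> z ` T" "u v \<noteq> 0" "(\<Sum>v\<in>z ` T. u v *\<^sub>m v) = 0"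
      unfolding fm.dependent_finite[OF finite_imageI[OF T]] by blast
    have "(\<Sum>s\<in>T. u (z s) *\<^sub>m z s) = 0" using uv(3) by (simp add: sum.reindex[OF inj])
    hence "u (z s) = 0" if "s \<in> T" for s using ind[of "\<lambda>s. u (z s)"] that by blast
    thus False using uv by auto
  qed
  moreover have "z ` T \<subseteq> fm.span B" using z by blast
  ultimately have "card (z ` T) \<le> card B" using fm.independent_span_bound[OF B] by blast
  thus ?thesis using card_image[OF inj] by simp
qed

text \<open>The image of \<open>x * y - y * x\<close> lies in the span of the first \<open>n\<close>
  unit columns and of their images under \<open>y\<close>, so the rank is at most
  \<open>2 * n\<close> whatever the size of \<open>y\<close>.\<close>

lemma lb_image_span:
  assumes x: "bnd n x"
  shows "\<exists>W. finite W \<and> card W \<le> 2 * n \<and> (\<forall>v\<in>Vc. lb x y * v \<in> fm.span W)"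
proof -
  define W1 where "W1 = (\<lambda>i. E i 0) ` {..<n}"
  define W2 where "W2 = (\<lambda>i. y * E i 0) ` {..<n}"
  have W: "finite (W1 \<union> W2)" unfolding W1_def W2_def by simp
  have "card W1 \<le> n" "card W2 \<le> n"
    unfolding W1_def W2_def using card_image_le[of "{..<n}"] by auto
  hence c: "card (W1 \<union> W2) \<le> 2 * n" using card_Un_le[of W1 W2] by linarith
  have eq: "x * v = (\<Sum>i<n. ent (x * v) i 0 *\<^sub>m E i 0)" if v: "v \<in> Vc" for v
  proof (rule fmat_eqI)
    fix a b :: nat
    have xv: "x * v \<in> Vc" by (rule Vc_mult[OF v])
    have z: "ent (x * v) a b = 0" if "a \<ge> n"
    proof -
      have "ent x a k = 0" for k using x that unfolding bnd_def by (meson leD)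
      thus ?thesis by (simp add: ent_times_bound[OF x])
    qed
    have "(\<Sum>i<n. ent (x * v) i 0 * (if a = i \<and> b = 0 then 1 else 0))
        = (\<Sum>i<n. if i = a then (if b = 0 then ent (x * v) a 0 else 0) else 0)"
      by (rule sum.cong) auto
    also have "\<dots> = ent (x * v) a b" using z Vc_ent[OF xv, of b a] by auto
    finally show "ent (x * v) a b = ent (\<Sum>i<n. ent (x * v) i 0 *\<^sub>m E i 0) a b" by simp
  qed
  have "lb x y * v \<in> fm.span (W1 \<union> W2)" if v: "v \<in> Vc" for v
  proof -
    have "x * (y * v) \<in> fm.span W1"
      by (subst eq[OF Vc_mult[OF v]]) (intro fm.span_sum fm.span_scale fm.span_base, simp add: W1_def)
    hence 1: "x * (y * v) \<in> fm.span (W1 \<union> W2)" using fm.span_mono[of W1 "W1 \<union> W2"] by blast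
    have "y * (x * v) = (\<Sum>i<n. ent (x * v) i 0 *\<^sub>m (y * E i 0))"
      by (subst eq[OF v]) (simp add: sum_distrib_left)
    also have "\<dots> \<in> fm.span W2"
      by (intro fm.span_sum fm.span_scale fm.span_base) (simp add: W2_def)
    finally have 2: "y * (x * v) \<in> fm.span (W1 \<union> W2)" using fm.span_mono[of W2 "W1 \<union> W2"] by blast
    have "x * (y * v) - y * (x * v) \<in> fm.span (W1 \<union> W2)" by (rule fm.span_diff[OF 1 2])
    thus ?thesis by (simp add: lb_def left_diff_distrib mult.assoc)
  qed
  thus ?thesis using W c by blast
qed

lemma comm_eq: "lb a b = 0 \<Longrightarrow> a * b = b * a"
  by (simp add: lb_def)

definition commuting :: "fmat set \<Rightarrow> fmat set \<Rightarrow> bool" where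
  "commuting s t \<longleftrightarrow> (\<forall>x\<in>s. \<forall>y\<in>t. lb x y = 0)"

text \<open>The algebras in \<open>T\<close> commute with \<open>t\<close>, so they act on the image
  of \<open>u = lb x y\<close>, whose dimension is at most \<open>2 * n\<close>. An algebra killing
  this image would kill all of \<open>t\<close>, contrary to adjacency. Nonzero operators from
  pairwise commuting simple algebras are linearly independent there, and the operators form a space
  of dimension at most \<open>(2 * n) ^ 2\<close>.\<close>

lemma count_adjacent:
  assumes t: "simp_alg t" and x: "bnd n x" and u: "lb x y \<in> t" "lb x y \<noteq> 0"
    and T: "finite T" "\<And>s. s \<in> T \<Longrightarrow> simp_alg s" "\<And>s. s \<in> T \<Longrightarrow> commuting s t"
    and TT: "\<And>s s'. s \<in> T \<Longrightarrow> s' \<in> T \<Longrightarrow> s \<noteq> s' \<Longrightarrow> commuting s s'"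
    and adj: "\<And>s. s \<in> T \<Longrightarrow> \<exists>a\<in>t. \<exists>b\<in>s. b * a \<noteq> 0"
  shows "card T \<le> (2 * n) ^ 2"
proof -
  define u where "u = lb x y"
  note u' = u[folded u_def]
  have cu: "b * a = a * b" if "s \<in> T" "b \<in> s" "a \<in> t" for s a b
    using T(3)[OF that(1)] that(2,3) unfolding commuting_def by (intro comm_eq) blast
  have "\<exists>a\<in>s. a * u \<noteq> 0" if s: "s \<in> T" for s
  proof (rule ccontr)
    assume "\<not> (\<exists>a\<in>s. a * u \<noteq> 0)"
    hence c: "\<forall>b\<in>s. b * u = 0" by blast
    obtain a b where ab: "a \<in> t" "b \<in> s" "b * a \<noteq> 0" using adj[OF s] by blast
    have "\<forall>b\<in>s. b * a = 0"
    proof (rule simp_alg_induct[where P = "\<lambda>a. \<forall>b\<in>s. b * a = 0", OF t u' c ab(1)])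
      fix d a assume d: "d \<in> t" and a: "a \<in> t" "\<forall>b\<in>s. b * a = 0"
      show "\<forall>b\<in>s. b * lb d a = 0"
      proof
        fix b assume b: "b \<in> s"
        have "b * lb d a = (b * d) * a - (b * a) * d" unfolding lb_def by (simp add: right_diff_distrib mult.assoc)
        also have "\<dots> = d * (b * a) - (b * a) * d" using cu[OF s b d] by (simp add: mult.assoc)
        finally show "b * lb d a = 0" using a(2) b by simp
      qed
    qed (simp_all add: distrib_left)
    thus False using ab by blast
  qed
  then obtain A where A: "\<And>s. s \<in> T \<Longrightarrow> A s \<in> s" "\<And>s. s \<in> T \<Longrightarrow> A s * u \<noteq> 0" by metis
  have Au: "A s * u = u * A s" if "s \<in> T" for s using cu[OF that A(1)[OF that] u'(1)] .
  define I where "I = (\<lambda>v. u * v) ` Vc"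
  obtain W where W: "finite W" "card W \<le> 2 * n" "\<forall>v\<in>Vc. lb x y * v \<in> fm.span W"
    using lb_image_span[OF x] by blast
  have IW: "I \<subseteq> fm.span W" using W(3) unfolding I_def u_def by blast
  then obtain C where C: "finite C" "C \<subseteq> I" "I \<subseteq> fm.span C" "fm.independent C"
    using finite_basis_of_subset[OF W(1) IW] by blast
  have "C \<subseteq> fm.span W" using C(2) IW by (rule subset_trans)
  hence "card C \<le> card W" using fm.independent_span_bound[OF W(1) C(4)] by blast
  hence cC: "card C \<le> 2 * n" using W(2) by simp
  obtain e where e: "bij_betw e {0..<card C} C" using ex_bij_betw_nat_finite[OF C(1)] by blast
  have eC: "e l \<in> C" if "l < card C" for l using e that unfolding bij_betw_def by auto
  \<comment> \<open>The operator of \<open>A s\<close> on the image, encoded as one matrix: column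
    \<open>l\<close> is its value on the basis vector \<open>e l\<close>. Correspondingly
    \<open>B\<close> spans all such operators.\<close>
  define z where "z s = (\<Sum>l<card C. A s * e l * E 0 l)" for s
  define B where "B = (\<lambda>(c, l). c * E 0 l) ` (C \<times> {..<card C})"
  have "card B \<le> card C * card C"
    unfolding B_def using card_image_le[of "C \<times> {..<card C}"] C(1) by (simp add: card_cartesian_product)
  also have "\<dots> \<le> (2 * n) ^ 2" using mult_le_mono[OF cC cC] by (simp add: power2_eq_square)
  finally have cB: "card B \<le> (2 * n) ^ 2" .
  have "card T \<le> card B"
  proof (rule card_le_family[OF T(1)])
    show "finite B" unfolding B_def using C(1) by simp
  next
    fix s assume s: "s \<in> T"
    have "A s * e l * E 0 l \<in> fm.span B" if l: "l < card C" for l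
    proof -
      obtain v where v: "v \<in> Vc" "e l = u * v" using eC[OF l] C(2) unfolding I_def by auto
      have "A s * e l = (A s * u) * v" unfolding v(2) by (simp add: mult.assoc)
      also have "\<dots> = u * (A s * v)" unfolding Au[OF s] by (simp add: mult.assoc)
      finally have "A s * e l \<in> I" unfolding I_def using Vc_mult[OF v(1), of "A s"] by simp
      hence "A s * e l \<in> fm.span C" using C(3) by auto
      thus ?thesis
      proof (induction rule: fm.span_induct_alt)
        case base
        show ?case using fm.span_zero by simp
      next
        case (step k c r)
        have "c * E 0 l \<in> B" unfolding B_def using step(1) l by auto
        hence "c * E 0 l \<in> fm.span B" by (rule fm.span_base)
        thus ?case using step(2) by (simp add: distrib_right fm.span_add fm.span_scale)
      qed
    qed
    thus "z s \<in> fm.span B" unfolding z_def by (intro fm.span_sum) simp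
  next
    fix k s0 assume k: "(\<Sum>s\<in>T. k s *\<^sub>m z s) = 0" and s0: "s0 \<in> T"
    define a where "a = (\<Sum>s\<in>T. k s *\<^sub>m A s)"
    have sz: "(\<Sum>s\<in>T. k s *\<^sub>m z s) = (\<Sum>l<card C. a * e l * E 0 l)"
      unfolding z_def a_def
      by (simp add: fm.scale_sum_right sum_distrib_right) (rule sum.swap)
    have ae: "a * e l = 0" if l: "l < card C" for l
    proof -
      have ev: "a * e l \<in> Vc" using eC[OF l] C(2) unfolding I_def by (auto intro!: Vc_mult)
      have "0 = (\<Sum>l<card C. a * e l * E 0 l) * E l 0" using k sz by simp
      also have "\<dots> = (\<Sum>m<card C. if m = l then a * e l * E 0 0 else 0)"
        unfolding sum_distrib_right by (rule sum.cong) (auto simp: mult.assoc E_mult_E)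
      also have "\<dots> = a * e l * E 0 0" using l by simp
      also have "\<dots> = a * e l" using ev unfolding Vc_def by simp
      finally show ?thesis by simp
    qed
    have aC: "a * c = 0" if "c \<in> C" for c
      using e ae that unfolding bij_betw_def by force
    have aI: "a * v = 0" if "v \<in> I" for v
    proof -
      have "v \<in> fm.span C" using that C(3) by auto
      thus ?thesis by (induction rule: fm.span_induct_alt) (simp_all add: aC distrib_left)
    qed
    have au: "a * u = 0"
    proof (rule col_eqI)
      fix j
      have "u * E j 0 \<in> I" unfolding I_def by simp
      thus "a * u * E j 0 = 0 * E j 0" using aI by (simp add: mult.assoc)
    qed
    \<comment> \<open>Bracketing with an element of \<open>s0\<close> removes every other summand of
      \<open>a\<close>, since distinct members of \<open>T\<close> commute; a nonzero
      \<open>k s0\<close> would then make \<open>s0\<close> kill \<open>u\<close>.\<close>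
    show "k s0 = 0"
    proof (rule ccontr)
      assume k0: "k s0 \<noteq> 0"
      have "A s0 \<noteq> 0" using A(2)[OF s0] by auto
      then obtain b where b: "b \<in> s0" "lb b (A s0) \<noteq> 0" using simp_alg_centre[OF T(2)[OF s0] A(1)[OF s0]] by blast
      have "lb b a = (\<Sum>s\<in>T. k s *\<^sub>m lb b (A s))" unfolding a_def by (simp add: lb_sum_right lb_simps)
      also have "\<dots> = (\<Sum>s\<in>T. if s = s0 then k s0 *\<^sub>m lb b (A s0) else 0)"
      proof (rule sum.cong)
        fix s assume s: "s \<in> T"
        have "lb b (A s) = 0" if "s \<noteq> s0"
          using TT[OF s0 s that[symmetric]] b(1) A(1)[OF s] unfolding commuting_def by blast
        thus "k s *\<^sub>m lb b (A s) = (if s = s0 then k s0 *\<^sub>m lb b (A s0) else 0)" by simp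
      qed simp
      also have "\<dots> = k s0 *\<^sub>m lb b (A s0)" using T(1) s0 by simp
      finally have e1: "lb b a = k s0 *\<^sub>m lb b (A s0)" .
      have "lb b a * u = b * (a * u) - a * (b * u)" unfolding lb_def by (simp add: left_diff_distrib mult.assoc)
      also have "\<dots> = b * (a * u) - (a * u) * b" using cu[OF s0 b(1) u'(1)] by (simp add: mult.assoc)
      finally have "k s0 *\<^sub>m (lb b (A s0) * u) = 0" using au e1 by simp
      hence d: "lb b (A s0) * u = 0" using k0 by simp
      have ds: "lb b (A s0) \<in> s0" by (rule lie_sub_lb[OF simp_alg_lie[OF T(2)[OF s0]] b(1) A(1)[OF s0]])
      have "A s0 * u = 0"
      proof (rule simp_alg_induct[where P = "\<lambda>a. a * u = 0", OF T(2)[OF s0] ds b(2) d A(1)[OF s0]])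
        fix c a assume c: "c \<in> s0" and a: "a \<in> s0" "a * u = 0"
        have "lb c a * u = c * (a * u) - a * (c * u)" unfolding lb_def by (simp add: left_diff_distrib mult.assoc)
        also have "\<dots> = c * (a * u) - (a * u) * c" using cu[OF s0 c u'(1)] by (simp add: mult.assoc)
        finally show "lb c a * u = 0" using a(2) by simp
      qed (simp_all add: distrib_right)
      thus False using A(2)[OF s0] by blast
    qed
  qed
  thus ?thesis using cB by linarith
qed

text \<open>If \<open>t u t = 0\<close>, the vanishing spreads from \<open>u\<close> to all of
  \<open>t\<close>, so triple products vanish. Then a nonzero bracket kills \<open>t\<close> by left
  multiplication, and a second spreading makes all products vanish, although \<open>t\<close> is not
  abelian.\<close>

lemma simp_alg_cube:
  assumes t: "simp_alg t" and u: "u \<in> t" "u \<noteq> 0"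
  shows "\<exists>b\<in>t. \<exists>c\<in>t. b * u * c \<noteq> 0"
proof (rule ccontr)
  assume c: "\<not> ?thesis"
  hence u0: "\<forall>b\<in>t. \<forall>c\<in>t. b * u * c = 0" by blast
  have cube: "\<forall>b\<in>t. \<forall>c\<in>t. b * a * c = 0" if a: "a \<in> t" for a
  proof (rule simp_alg_induct[where P = "\<lambda>a. \<forall>b\<in>t. \<forall>c\<in>t. b * a * c = 0", OF t u u0 a])
    fix d a assume d: "d \<in> t" and a: "a \<in> t" "\<forall>b\<in>t. \<forall>c\<in>t. b * a * c = 0"
    show "\<forall>b\<in>t. \<forall>c\<in>t. b * lb d a * c = 0"
    proof (intro ballI)
      fix b c assume bc: "b \<in> t" "c \<in> t"
      have "b * lb d a * c = b * (d * a * c) - (b * a * d) * c"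
        unfolding lb_def by (simp add: left_diff_distrib right_diff_distrib mult.assoc)
      thus "b * lb d a * c = 0" using a(2) bc d by simp
    qed
  qed (auto simp: distrib_left distrib_right)
  obtain x y where xy: "x \<in> t" "y \<in> t" "lb x y \<noteq> 0" using simp_alg_nonabelian[OF t] by blast
  have l: "lb x y \<in> t" by (rule lie_sub_lb[OF simp_alg_lie[OF t] xy(1,2)])
  have l0: "\<forall>b\<in>t. lb x y * b = 0"
    using cube xy(1,2) unfolding lb_def by (simp add: left_diff_distrib)
  have sq: "\<forall>b\<in>t. a * b = 0" if a: "a \<in> t" for a
  proof (rule simp_alg_induct[where P = "\<lambda>a. \<forall>b\<in>t. a * b = 0", OF t l xy(3) l0 a])
    fix d a assume d: "d \<in> t" and a: "a \<in> t" "\<forall>b\<in>t. a * b = 0"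
    have "lb d a * b = d * (a * b) - (a * d) * b" for b
      unfolding lb_def by (simp add: left_diff_distrib mult.assoc)
    thus "\<forall>b\<in>t. lb d a * b = 0" using a(2) d by simp
  qed (auto simp: distrib_right)
  have "lb x y = 0" unfolding lb_def using sq xy(1,2) by simp
  thus False using xy(3) by blast
qed

text \<open>When all cross products vanish, the vectors \<open>w s\<close> taken from the images of
  the brackets \<open>lb x (y s)\<close> are independent, yet all lie in the image of the single
  bracket of \<open>x\<close> with the sum of the \<open>y s\<close>, whose rank is at most
  \<open>2 * n\<close>.\<close>

lemma count_orthogonal:
  assumes x: "bnd n x" and T: "finite T" "\<And>s. s \<in> T \<Longrightarrow> simp_alg s"
    and TT: "\<And>s s' a b. s \<in> T \<Longrightarrow> s' \<in> T \<Longrightarrow> s \<noteq> s' \<Longrightarrow> a \<in> s \<Longrightarrow> b \<in> s' \<Longrightarrow> a * b = 0"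
    and act: "\<And>s y. s \<in> T \<Longrightarrow> y \<in> s \<Longrightarrow> lb x y \<in> s" "\<And>s. s \<in> T \<Longrightarrow> \<exists>y\<in>s. lb x y \<noteq> 0"
  shows "card T \<le> 2 * n"
proof -
  obtain y where y: "\<And>s. s \<in> T \<Longrightarrow> y s \<in> s" "\<And>s. s \<in> T \<Longrightarrow> lb x (y s) \<noteq> 0" using act(2) by metis
  define u where "u s = lb x (y s)" for s
  have u: "u s \<in> s" "u s \<noteq> 0" if "s \<in> T" for s using act(1) y that unfolding u_def by auto
  have "\<exists>b\<in>s. \<exists>w. (\<exists>c\<in>s. \<exists>j. w = u s * c * E j 0) \<and> b * w \<noteq> 0" if s: "s \<in> T" for s
  proof -
    obtain b c where bc: "b \<in> s" "c \<in> s" "b * u s * c \<noteq> 0" using simp_alg_cube[OF T(2)[OF s] u[OF s]] by blast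
    then obtain j where "b * u s * c * E j 0 \<noteq> 0" using col_eqI[of "b * u s * c" 0] by auto
    thus ?thesis using bc by (intro bexI[of _ b] exI[of _ "u s * c * E j 0"]) (auto simp: mult.assoc)
  qed
  then obtain b w where bw: "\<And>s. s \<in> T \<Longrightarrow> b s \<in> s" "\<And>s. s \<in> T \<Longrightarrow> \<exists>c\<in>s. \<exists>j. w s = u s * c * E j 0"
    "\<And>s. s \<in> T \<Longrightarrow> b s * w s \<noteq> 0" by metis
  obtain W where W: "finite W" "card W \<le> 2 * n" "\<forall>v\<in>Vc. lb x (\<Sum>s\<in>T. y s) * v \<in> fm.span W"
    using lb_image_span[OF x] by blast
  have "card T \<le> card W"
  proof (rule card_le_family[OF T(1) W(1)])
    fix s assume s: "s \<in> T"
    obtain c j where cj: "c \<in> s" "w s = u s * c * E j 0" using bw(2)[OF s] by blast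
    have "lb x (\<Sum>s\<in>T. y s) * c = (\<Sum>s'\<in>T. u s' * c)" unfolding u_def by (simp add: lb_sum_right sum_distrib_right)
    also have "\<dots> = (\<Sum>s'\<in>T. if s' = s then u s * c else 0)"
      by (rule sum.cong) (use TT[OF _ s] u(1) cj(1) in auto)
    also have "\<dots> = u s * c" using T(1) s by simp
    finally have "w s = lb x (\<Sum>s\<in>T. y s) * (c * E j 0)" unfolding cj(2) by (simp add: mult.assoc[symmetric])
    thus "w s \<in> fm.span W" using W(3) Vc_mult[of "E j 0" c] by simp
  next
    fix k s0 assume k: "(\<Sum>s\<in>T. k s *\<^sub>m w s) = 0" and s0: "s0 \<in> T"
    have "0 = b s0 * (\<Sum>s\<in>T. k s *\<^sub>m w s)" using k by simp
    also have "\<dots> = (\<Sum>s\<in>T. if s = s0 then k s0 *\<^sub>m (b s0 * w s0) else 0)"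
      unfolding sum_distrib_left
    proof (rule sum.cong)
      fix s assume s: "s \<in> T"
      obtain c j where cj: "c \<in> s" "w s = u s * c * E j 0" using bw(2)[OF s] by blast
      have "b s0 * w s = 0" if "s \<noteq> s0"
      proof -
        have "b s0 * u s = 0" using TT[OF s0 s _ bw(1)[OF s0] u(1)[OF s]] that by blast
        thus ?thesis unfolding cj(2) by (simp add: mult.assoc[symmetric])
      qed
      thus "b s0 * k s *\<^sub>m w s = (if s = s0 then k s0 *\<^sub>m (b s0 * w s0) else 0)" by auto
    qed simp
    also have "\<dots> = k s0 *\<^sub>m (b s0 * w s0)" using T(1) s0 by simp
    finally show "k s0 = 0" using bw(3)[OF s0] by simp
  qed
  thus ?thesis using W(2) by linarith
qed

text \<open>A maximal subfamily \<open>J\<close> with vanishing cross products has at most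
  \<open>2 * n\<close> members. By maximality every other algebra has a nonzero product with some
  member of \<open>J\<close>, and each member has at most \<open>(2 * n) ^ 2\<close> such
  neighbours.\<close>

theorem count_simple:
  assumes x: "bnd n x" and T: "finite T" "\<And>s. s \<in> T \<Longrightarrow> simp_alg s"
    and TT: "\<And>s s'. s \<in> T \<Longrightarrow> s' \<in> T \<Longrightarrow> s \<noteq> s' \<Longrightarrow> commuting s s'"
    and act: "\<And>s y. s \<in> T \<Longrightarrow> y \<in> s \<Longrightarrow> lb x y \<in> s" "\<And>s. s \<in> T \<Longrightarrow> \<exists>y\<in>s. lb x y \<noteq> 0"
  shows "card T \<le> 2 * n + 2 * n * (2 * n) ^ 2"
proof -
  define orth where "orth J \<longleftrightarrow> (\<forall>s\<in>J. \<forall>s'\<in>J. s \<noteq> s' \<longrightarrow> (\<forall>a\<in>s. \<forall>b\<in>s'. a * b = 0))" for J :: "fmat set set"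
  define \<J> where "\<J> = {J. J \<subseteq> T \<and> orth J}"
  have fin: "finite \<J>" unfolding \<J>_def using T(1) by simp
  have "{} \<in> \<J>" unfolding \<J>_def orth_def by simp
  then obtain J where J: "J \<in> \<J>" "\<And>J'. J' \<in> \<J> \<Longrightarrow> J \<subseteq> J' \<Longrightarrow> J = J'"
    using finite_has_maximal[OF fin] by (metis empty_iff)
  have JT: "J \<subseteq> T" and oJ: "orth J" using J(1) unfolding \<J>_def by auto
  have fJ: "finite J" using JT T(1) finite_subset by blast
  have cJ: "card J \<le> 2 * n"
    by (rule count_orthogonal[OF x fJ]) (use JT T(2) oJ act in \<open>auto simp: orth_def\<close>)
  define N where "N j = {s \<in> T. s \<noteq> j \<and> (\<exists>a\<in>j. \<exists>b\<in>s. b * a \<noteq> 0)}" for j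
  have cN: "card (N j) \<le> (2 * n) ^ 2" if j: "j \<in> J" for j
  proof -
    have jT: "j \<in> T" using j JT by blast
    obtain y where y: "y \<in> j" "lb x y \<noteq> 0" using act(2)[OF jT] by blast
    show ?thesis
    proof (rule count_adjacent[OF T(2)[OF jT] x act(1)[OF jT y(1)] y(2)])
      show "finite (N j)" unfolding N_def using T(1) by simp
    qed (use T(2) TT jT in \<open>auto simp: N_def\<close>)
  qed
  have "T \<subseteq> J \<union> (\<Union>j\<in>J. N j)"
  proof
    fix s assume s: "s \<in> T"
    show "s \<in> J \<union> (\<Union>j\<in>J. N j)"
    proof (rule ccontr)
      assume n: "s \<notin> J \<union> (\<Union>j\<in>J. N j)"
      have z: "b * a = 0 \<and> a * b = 0" if "j \<in> J" "a \<in> j" "b \<in> s" for j a b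
      proof
        have sj: "s \<noteq> j" using n that(1) by blast
        have "s \<notin> N j" using n that(1) by blast
        thus ba: "b * a = 0" using s sj that(2,3) unfolding N_def by blast
        have "lb b a = 0" using TT[OF s _ sj] JT that unfolding commuting_def by blast
        thus "a * b = 0" using ba comm_eq[of b a] by simp
      qed
      have "orth (insert s J)" using oJ z unfolding orth_def by blast
      hence "insert s J \<in> \<J>" unfolding \<J>_def using JT s by simp
      hence "J = insert s J" using J(2) by blast
      thus False using n by blast
    qed
  qed
  moreover have fN: "finite (N j)" for j unfolding N_def using T(1) by simp
  ultimately have "card T \<le> card (J \<union> (\<Union>j\<in>J. N j))" using fJ by (intro card_mono) auto
  also have "\<dots> \<le> card J + card (\<Union>j\<in>J. N j)" by (rule card_Un_le)
  also have "card (\<Union>j\<in>J. N j) \<le> (\<Sum>j\<in>J. card (N j))" by (rule card_UN_le[OF fJ])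
  also have "\<dots> \<le> card J * (2 * n) ^ 2" using sum_bounded_above[of J "\<lambda>j. card (N j)" "(2 * n) ^ 2"] cN by simp
  also have "card J + card J * (2 * n) ^ 2 \<le> 2 * n + 2 * n * (2 * n) ^ 2"
    by (intro add_mono mult_le_mono1 cJ)
  finally show ?thesis by simp
qed

section \<open>Reductive algebras and their unions\<close>

definition idl :: "fmat set \<Rightarrow> fmat set \<Rightarrow> bool" where
  "idl A I \<longleftrightarrow> fm.subspace I \<and> I \<subseteq> A \<and> (\<forall>x\<in>A. \<forall>i\<in>I. lb x i \<in> I)"

definition red :: "fmat set \<Rightarrow> bool" where
  "red A \<longleftrightarrow> lie_sub A \<and> fd A \<and>
    (\<forall>I. idl A I \<longrightarrow> (\<exists>J. idl A J \<and> I \<inter> J = {0} \<and> (\<forall>x\<in>A. \<exists>a\<in>I. \<exists>b\<in>J. x = a + b)))"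

definition ctr :: "fmat set \<Rightarrow> fmat set" where
  "ctr A = {z \<in> A. \<forall>x\<in>A. lb z x = 0}"

definition simples :: "fmat set \<Rightarrow> fmat set set" where
  "simples A = {t. idl A t \<and> simp_alg t}"

lemma idl_lb: "idl A I \<Longrightarrow> x \<in> A \<Longrightarrow> i \<in> I \<Longrightarrow> lb x i \<in> I"
  and idl_sub: "idl A I \<Longrightarrow> fm.subspace I" and idl_subset: "idl A I \<Longrightarrow> I \<subseteq> A"
  unfolding idl_def by auto

lemma idl_lb': "idl A I \<Longrightarrow> x \<in> A \<Longrightarrow> i \<in> I \<Longrightarrow> lb i x \<in> I"
  using idl_lb[of A I x i] fm.subspace_neg[OF idl_sub] lb_minus_commute[of i x] by simp

lemma idl_lie_sub: "idl A I \<Longrightarrow> lie_sub I"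
  unfolding lie_sub_def using idl_sub idl_lb idl_subset by blast

lemma idl_commute:
  assumes "idl A I" "idl A J" "I \<inter> J = {0}" "i \<in> I" "j \<in> J"
  shows "lb i j = 0"
proof -
  have "lb i j \<in> J" using idl_lb[OF assms(2) _ assms(5)] idl_subset[OF assms(1)] assms(4) by blast
  moreover have "lb i j \<in> I" using idl_lb'[OF assms(1) _ assms(4)] idl_subset[OF assms(2)] assms(5) by blast
  ultimately show ?thesis using assms(3) by blast
qed

lemma simples_idl: "t \<in> simples A \<Longrightarrow> idl A t" and simples_simp: "t \<in> simples A \<Longrightarrow> simp_alg t"
  unfolding simples_def by auto

lemma simp_alg_meet:
  assumes t: "simp_alg t" and K: "fm.subspace K" "\<And>x k. x \<in> t \<Longrightarrow> k \<in> K \<Longrightarrow> k \<in> t \<Longrightarrow> lb x k \<in> K"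
    and k: "k \<in> K" "k \<in> t" "k \<noteq> 0"
  shows "t \<subseteq> K"
proof -
  have "K \<inter> t = t"
    by (rule simp_alg_ideal[OF t fm.subspace_inter[OF K(1) simp_alg_sub[OF t]] _ _ _ k(3)])
      (use K(2) k lie_sub_lb[OF simp_alg_lie[OF t]] in auto)
  thus ?thesis by blast
qed

text \<open>A nonzero bracket would lie in both ideals, and by simplicity each would contain the
  other.\<close>

lemma simples_commuting:
  assumes "s \<in> simples A" "t \<in> simples A" "s \<noteq> t"
  shows "commuting s t"
proof (rule ccontr)
  assume "\<not> commuting s t"
  then obtain x y where xy: "x \<in> s" "y \<in> t" "lb x y \<noteq> 0" unfolding commuting_def by blast
  have s: "idl A s" "simp_alg s" and t: "idl A t" "simp_alg t" using assms unfolding simples_def by auto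
  have xA: "x \<in> A" "y \<in> A" using xy idl_subset s(1) t(1) by auto
  have l: "lb x y \<in> s" "lb x y \<in> t" using idl_lb'[OF s(1) xA(2) xy(1)] idl_lb[OF t(1) xA(1) xy(2)] by auto
  have "s \<subseteq> t"
    by (rule simp_alg_meet[OF s(2) idl_sub[OF t(1)] _ l(2,1) xy(3)]) (use idl_lb[OF t(1)] idl_subset[OF s(1)] in blast)
  moreover have "t \<subseteq> s"
    by (rule simp_alg_meet[OF t(2) idl_sub[OF s(1)] _ l xy(3)]) (use idl_lb[OF s(1)] idl_subset[OF t(1)] in blast)
  ultimately show False using assms(3) by blast
qed

lemma simples_commute: "s \<in> simples A \<Longrightarrow> t \<in> simples A \<Longrightarrow> s \<noteq> t \<Longrightarrow> x \<in> s \<Longrightarrow> y \<in> t \<Longrightarrow> lb x y = 0"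
  using simples_commuting[of s A t] unfolding commuting_def by blast

text \<open>A complementary ideal of \<open>I\<close> commutes with \<open>I\<close>, so it acts
  trivially on \<open>K\<close>.\<close>

lemma red_idl_idl:
  assumes A: "red A" and I: "idl A I" and K: "idl I K"
  shows "idl A K"
proof -
  obtain J where J: "idl A J" "I \<inter> J = {0}" "\<forall>x\<in>A. \<exists>a\<in>I. \<exists>b\<in>J. x = a + b"
    using A I unfolding red_def by blast
  have "lb x k \<in> K" if x: "x \<in> A" and k: "k \<in> K" for x k
  proof -
    obtain a b where ab: "a \<in> I" "b \<in> J" "x = a + b" using J(3) x by blast
    have kI: "k \<in> I" using k idl_subset[OF K] by blast
    have "lb k b = 0" by (rule idl_commute[OF I J(1,2) kI ab(2)])
    hence "lb b k = 0" using lb_minus_commute[of b k] by simp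
    hence "lb x k = lb a k" unfolding ab(3) by (simp add: lb_simps)
    thus ?thesis using idl_lb[OF K ab(1) k] by simp
  qed
  thus ?thesis using idl_sub[OF K] idl_subset[OF K] idl_subset[OF I] unfolding idl_def by auto
qed

lemma dim_less:
  assumes "fm.subspace K" "fm.subspace J" "K \<subseteq> J" "K \<noteq> J" "fd J"
  shows "fm.dim K < fm.dim J"
proof -
  obtain B where B: "B \<subseteq> K" "fm.independent B" "K \<subseteq> fm.span B" "card B = fm.dim K"
    using fm.basis_exists[of K] by blast
  obtain C where C: "B \<subseteq> C" "C \<subseteq> J" "fm.independent C" "J \<subseteq> fm.span C"
    using fm.maximal_independent_subset_extend[of B J] B(1,2) assms(3) by blast
  obtain G where G: "finite G" "J \<subseteq> fm.span G" using assms(5) unfolding fd_def by blast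
  have "finite C" using fm.independent_span_bound[OF G(1) C(3)] C(2) G(2) by blast
  moreover have "B \<noteq> C"
  proof
    assume "B = C"
    hence "J \<subseteq> K" using C(4) fm.span_minimal[OF B(1) assms(1)] by blast
    thus False using assms(3,4) by blast
  qed
  ultimately have "card B < card C" using C(1) psubset_card_mono by blast
  moreover have "card C = fm.dim J" by (rule fm.basis_card_eq_dim[OF C(2,4,3)])
  ultimately show ?thesis using B(4) by simp
qed

lemma minimal_idl:
  assumes J: "idl A J" "J \<noteq> {0}" "fd J"
  shows "\<exists>K. idl A K \<and> K \<subseteq> J \<and> K \<noteq> {0} \<and> (\<forall>K'. idl A K' \<longrightarrow> K' \<subseteq> K \<longrightarrow> K' = {0} \<or> K' = K)"
proof -
  obtain K where K: "idl A K \<and> K \<subseteq> J \<and> K \<noteq> {0}"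
    and min: "\<And>K'. idl A K' \<and> K' \<subseteq> J \<and> K' \<noteq> {0} \<Longrightarrow> fm.dim K \<le> fm.dim K'"
    using ex_has_least_nat[of "\<lambda>K. idl A K \<and> K \<subseteq> J \<and> K \<noteq> {0}" J fm.dim] J by auto
  have "K' = {0} \<or> K' = K" if K': "idl A K'" "K' \<subseteq> K" for K'
  proof (rule ccontr)
    assume n: "\<not> ?thesis"
    have "fm.dim K' < fm.dim K"
      by (rule dim_less[OF idl_sub[OF K'(1)] _ K'(2)]) (use n K idl_sub fd_subset[OF J(3), of K] in auto)
    moreover have "fm.dim K \<le> fm.dim K'" using min[of K'] K' K n by auto
    ultimately show False by simp
  qed
  thus ?thesis using K by blast
qed

text \<open>Take a complement \<open>J\<close> of the ideal spanned by the centre and the simple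
  ideals, and a minimal ideal \<open>K\<close> in it. If \<open>K\<close> is abelian it is central,
  as a complement of \<open>K\<close> commutes with it; otherwise it is simple. Both are excluded,
  so \<open>J = {0}\<close>.\<close>

lemma red_span: assumes A: "red A" shows "A \<subseteq> fm.span (ctr A \<union> \<Union>(simples A))"
proof -
  define I where "I = fm.span (ctr A \<union> \<Union>(simples A))"
  have lA: "lie_sub A" and fdA: "fd A" using A unfolding red_def by auto
  have sA: "fm.subspace A" using lA unfolding lie_sub_def by blast
  have sI: "fm.subspace I" unfolding I_def by (rule fm.subspace_span)
  have IA: "I \<subseteq> A" unfolding I_def
    by (rule fm.span_minimal[OF _ sA]) (use idl_subset simples_idl in \<open>auto simp: ctr_def\<close>)
  have "lb x i \<in> I" if x: "x \<in> A" and i: "i \<in> I" for x i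
    using i unfolding I_def
  proof (induction rule: fm.span_induct_alt)
    case base
    show ?case using fm.span_zero by (simp add: lb_simps)
  next
    case (step c v y)
    have "lb x v \<in> I"
    proof (cases "v \<in> ctr A")
      case True
      hence "lb v x = 0" using x unfolding ctr_def by blast
      hence "lb x v = 0" using lb_minus_commute[of x v] by simp
      thus ?thesis using fm.subspace_0[OF sI] by simp
    next
      case False
      then obtain t where t: "t \<in> simples A" "v \<in> t" using step(1) by blast
      have "lb x v \<in> t" by (rule idl_lb[OF simples_idl[OF t(1)] x t(2)])
      thus ?thesis unfolding I_def using t(1) by (intro fm.span_base) blast
    qed
    thus ?case using step(2) fm.subspace_add[OF sI] fm.subspace_scale[OF sI]
      unfolding I_def by (simp add: lb_simps)
  qed
  hence "idl A I" using sI IA unfolding idl_def by blast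
  then obtain J where J: "idl A J" "I \<inter> J = {0}" "\<forall>x\<in>A. \<exists>a\<in>I. \<exists>b\<in>J. x = a + b"
    using A unfolding red_def by blast
  have "J = {0}"
  proof (rule ccontr)
    assume "J \<noteq> {0}"
    then obtain K where K: "idl A K" "K \<subseteq> J" "K \<noteq> {0}"
      and min: "\<And>K'. idl A K' \<Longrightarrow> K' \<subseteq> K \<Longrightarrow> K' = {0} \<or> K' = K"
      using minimal_idl[OF J(1) _ fd_subset[OF fdA idl_subset[OF J(1)]]] by blast
    have lK: "lie_sub K" by (rule idl_lie_sub[OF K(1)])
    have KI: "K \<subseteq> I"
    proof (cases "\<exists>x\<in>K. \<exists>y\<in>K. lb x y \<noteq> 0")
      case True
      have "simp_alg K" unfolding simp_alg_def
      proof (intro conjI allI impI)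
        fix K' assume "fm.subspace K'" "K' \<subseteq> K" "\<forall>x\<in>K. \<forall>k\<in>K'. lb x k \<in> K'"
        hence "idl K K'" unfolding idl_def by blast
        hence "idl A K'" by (rule red_idl_idl[OF A K(1)])
        thus "K' = {0} \<or> K' = K" using \<open>K' \<subseteq> K\<close> by (rule min)
      qed (use lK True in auto)
      hence "K \<in> simples A" using K(1) unfolding simples_def by blast
      thus ?thesis unfolding I_def using fm.span_superset[of "ctr A \<union> \<Union>(simples A)"] by blast
    next
      case False
      obtain J' where J': "idl A J'" "K \<inter> J' = {0}" "\<forall>x\<in>A. \<exists>a\<in>K. \<exists>b\<in>J'. x = a + b"
        using A K(1) unfolding red_def by blast
      have "lb k x = 0" if k: "k \<in> K" and x: "x \<in> A" for k x
      proof -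
        obtain a b where ab: "a \<in> K" "b \<in> J'" "x = a + b" using J'(3) x by blast
        have "lb k a = 0" using False k ab(1) by blast
        moreover have "lb k b = 0" by (rule idl_commute[OF K(1) J'(1,2) k ab(2)])
        ultimately show ?thesis unfolding ab(3) by (simp add: lb_simps)
      qed
      hence "K \<subseteq> ctr A" using idl_subset[OF K(1)] unfolding ctr_def by blast
      thus ?thesis unfolding I_def using fm.span_superset[of "ctr A \<union> \<Union>(simples A)"] by blast
    qed
    hence "K \<subseteq> {0}" using K(2) J(2) by blast
    thus False using K(3) fm.subspace_0[OF idl_sub[OF K(1)]] by blast
  qed
  thus ?thesis using J(3) unfolding I_def by auto
qed

lemma span_Union_ex:
  assumes sub: "\<And>s. s \<in> \<S> \<Longrightarrow> fm.subspace s" and x: "x \<in> fm.span (\<Union>\<S>)"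
  shows "\<exists>F f. finite F \<and> F \<subseteq> \<S> \<and> (\<forall>s\<in>F. f s \<in> s) \<and> x = sum f F"
  using x
proof (induction rule: fm.span_induct_alt)
  case base
  show ?case by (rule exI[of _ "{}"]) simp
next
  case (step c v y)
  then obtain F f where F: "finite F" "F \<subseteq> \<S>" "\<forall>s\<in>F. f s \<in> s" "y = sum f F" by auto
  obtain s where s: "s \<in> \<S>" "v \<in> s" using step(1) by blast
  have cv: "c *\<^sub>m v \<in> s" by (rule fm.subspace_scale[OF sub[OF s(1)] s(2)])
  show ?case
  proof (cases "s \<in> F")
    case True
    have "sum (f(s := c *\<^sub>m v + f s)) F = (c *\<^sub>m v + f s) + sum f (F - {s})"
      using F(1) True by (subst sum.remove[of F s]) auto
    also have "\<dots> = c *\<^sub>m v + y" unfolding F(4) using F(1) True by (simp add: sum.remove[of F s] add.assoc)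
    finally have "c *\<^sub>m v + y = sum (f(s := c *\<^sub>m v + f s)) F" by simp
    moreover have "\<forall>r\<in>F. (f(s := c *\<^sub>m v + f s)) r \<in> r"
      using F(3) cv True fm.subspace_add[OF sub[OF s(1)]] by auto
    ultimately show ?thesis using F(1,2) by blast
  next
    case False
    have "sum (f(s := c *\<^sub>m v)) (insert s F) = c *\<^sub>m v + sum f F"
      using F(1) False by (simp add: sum.insert cong: sum.cong) (rule sum.cong, auto)
    hence "c *\<^sub>m v + y = sum (f(s := c *\<^sub>m v)) (insert s F)" using F(4) by simp
    moreover have "\<forall>r\<in>insert s F. (f(s := c *\<^sub>m v)) r \<in> r" using F(3) cv by auto
    moreover have "finite (insert s F)" "insert s F \<subseteq> \<S>" using F(1,2) s(1) by auto
    ultimately show ?thesis by blast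
  qed
qed

lemma simples_component:
  assumes F: "finite F" "F \<subseteq> simples A" "\<forall>s\<in>F. f s \<in> s" and t: "t \<in> F" "y \<in> t"
  shows "lb y (sum f F) = lb y (f t)"
proof -
  have "lb y (sum f F) = (\<Sum>s\<in>F. lb y (f s))" by (rule lb_sum_right)
  also have "\<dots> = (\<Sum>s\<in>F. if s = t then lb y (f t) else 0)"
  proof (rule sum.cong)
    fix s assume s: "s \<in> F"
    have "lb y (f s) = 0" if "s \<noteq> t"
      by (rule simples_commute[of t A s]) (use F t s that in auto)
    thus "lb y (f s) = (if s = t then lb y (f t) else 0)" by simp
  qed simp
  finally show ?thesis using F(1) t(1) by simp
qed

text \<open>A nonzero element of an ideal meets, by bracketing with one component, a simple summand.\<close>

lemma simples_below:
  assumes x: "x \<in> fm.span (\<Union>\<S>)" "x \<noteq> 0" "x \<in> K" and S: "\<S> \<subseteq> simples A"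
    and K: "fm.subspace K" "\<And>y k. y \<in> \<Union>\<S> \<Longrightarrow> k \<in> K \<Longrightarrow> lb y k \<in> K"
  shows "\<exists>t\<in>\<S>. t \<subseteq> K"
proof -
  have sub: "fm.subspace s" if "s \<in> \<S>" for s using idl_sub[OF simples_idl] that S by blast
  obtain F f where F: "finite F" "F \<subseteq> \<S>" "\<forall>s\<in>F. f s \<in> s" "x = sum f F"
    using span_Union_ex[OF sub x(1)] by blast
  have FS: "F \<subseteq> simples A" using F(2) S by blast
  obtain t where t: "t \<in> F" "f t \<noteq> 0" using x(2) F(4) sum.neutral[of F f] by blast
  have tS: "t \<in> \<S>" using t(1) F(2) by blast
  have tA: "t \<in> simples A" using t(1) FS by blast
  have ft: "f t \<in> t" using F(3) t(1) by blast
  obtain y where y: "y \<in> t" "lb y (f t) \<noteq> 0" using simp_alg_centre[OF simples_simp[OF tA] ft t(2)] by blast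
  have eq: "lb y x = lb y (f t)" unfolding F(4) by (rule simples_component[OF F(1) FS F(3) t(1) y(1)])
  have "lb y x \<in> K" using K(2)[OF _ x(3)] y(1) tS by blast
  moreover have "lb y x \<in> t" unfolding eq by (rule lie_sub_lb[OF simp_alg_lie[OF simples_simp[OF tA]] y(1) ft])
  moreover have "lb y x \<noteq> 0" using eq y(2) by simp
  ultimately have "t \<subseteq> K"
    by (intro simp_alg_meet[OF simples_simp[OF tA] K(1) K(2)]) (use tS in auto)
  thus ?thesis using tS by blast
qed

definition acted :: "fmat set \<Rightarrow> fmat \<Rightarrow> fmat set set" where
  "acted A x = {s \<in> simples A. \<exists>y\<in>s. lb x y \<noteq> 0}"

text \<open>The count applies to finite families, hence to all finite subsets. This matters when
  \<open>A\<close> is the infinite-dimensional union, where finiteness is not clear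
  beforehand.\<close>

lemma acted_bound:
  assumes x: "x \<in> A" "bnd n x"
  shows "finite (acted A x) \<and> card (acted A x) \<le> 2 * n + 2 * n * (2 * n) ^ 2"
proof (rule finite_if_finite_subsets_card_bdd)
  fix F assume F: "F \<subseteq> acted A x" "finite F"
  hence FS: "F \<subseteq> simples A" unfolding acted_def by blast
  show "card F \<le> 2 * n + 2 * n * (2 * n) ^ 2"
  proof (rule count_simple[OF x(2) F(2)])
    show "simp_alg s" if "s \<in> F" for s using that FS simples_simp by blast
    show "commuting s s'" if "s \<in> F" "s' \<in> F" "s \<noteq> s'" for s s' using that FS simples_commuting by blast
    show "lb x y \<in> s" if "s \<in> F" "y \<in> s" for s y using that FS idl_lb[OF simples_idl x(1)] by blast
    show "\<exists>y\<in>s. lb x y \<noteq> 0" if "s \<in> F" for s using that F(1) unfolding acted_def by blast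
  qed
qed

lemma comm_red: assumes A: "red A" shows "comm A \<subseteq> fm.span (\<Union>(simples A))"
  unfolding comm_def
proof (rule fm.span_minimal[OF _ fm.subspace_span], safe)
  fix a b assume a: "a \<in> A" and "b \<in> A"
  hence "b \<in> fm.span (ctr A \<union> \<Union>(simples A))" using red_span[OF A] by blast
  thus "lb a b \<in> fm.span (\<Union>(simples A))"
  proof (induction rule: fm.span_induct_alt)
    case base
    show ?case using fm.span_zero by (simp add: lb_simps)
  next
    case (step c v y)
    have "lb a v \<in> fm.span (\<Union>(simples A))"
    proof (cases "v \<in> ctr A")
      case True
      hence "lb v a = 0" using a unfolding ctr_def by blast
      hence "lb a v = 0" using lb_minus_commute[of a v] by simp
      thus ?thesis using fm.span_zero by simp
    next
      case False
      then obtain t where t: "t \<in> simples A" "v \<in> t" using step(1) by blast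
      have "lb a v \<in> t" by (rule idl_lb[OF simples_idl[OF t(1)] a t(2)])
      thus ?thesis using t(1) by (intro fm.span_base) blast
    qed
    thus ?case using step(2) by (simp add: lb_simps fm.span_add fm.span_scale)
  qed
qed

section \<open>Increasing unions of reductive algebras\<close>

locale red_union =
  fixes A :: "nat \<Rightarrow> fmat set"
  assumes red: "red (A n)" and mono: "A n \<subseteq> A (Suc n)"
begin

definition L :: "fmat set" where "L = (\<Union>n. A n)"

lemma A_mono: "n \<le> m \<Longrightarrow> A n \<subseteq> A m"
  using lift_Suc_mono_le[of A, OF mono] by blast

lemma A_lie: "lie_sub (A n)" and A_fd: "fd (A n)"
  using red unfolding red_def by auto

lemma A_L: "A n \<subseteq> L"
  unfolding L_def by blast

lemma L_ex2: "x \<in> L \<Longrightarrow> y \<in> L \<Longrightarrow> \<exists>n. x \<in> A n \<and> y \<in> A n"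
proof -
  assume "x \<in> L" "y \<in> L"
  then obtain k l where "x \<in> A k" "y \<in> A l" unfolding L_def by blast
  hence "x \<in> A (max k l)" "y \<in> A (max k l)" using A_mono[of k "max k l"] A_mono[of l "max k l"] by auto
  thus ?thesis by blast
qed

lemma L_lie: "lie_sub L"
  unfolding lie_sub_def
proof (intro conjI fm.subspaceI ballI)
  show "0 \<in> L" using lie_sub_0[OF A_lie] A_L by blast
next
  fix x y assume "x \<in> L" "y \<in> L"
  then obtain n where n: "x \<in> A n" "y \<in> A n" using L_ex2 by blast
  show "x + y \<in> L" using lie_sub_add[OF A_lie n] A_L by blast
next
  fix c x assume "x \<in> L"
  then obtain n where "x \<in> A n" unfolding L_def by blast
  hence "c *\<^sub>m x \<in> A n" by (rule lie_sub_scale[OF A_lie])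
  thus "c *\<^sub>m x \<in> L" using A_L by blast
next
  fix x y assume "x \<in> L" "y \<in> L"
  then obtain n where n: "x \<in> A n" "y \<in> A n" using L_ex2 by blast
  show "lb x y \<in> L" using lie_sub_lb[OF A_lie n] A_L by blast
qed

lemma fin_subset: assumes F: "finite F" "F \<subseteq> L" shows "\<exists>n. F \<subseteq> A n"
  using F
proof (induction F rule: finite_induct)
  case (insert x F)
  then obtain k where k: "F \<subseteq> A k" by auto
  obtain l where l: "x \<in> A l" using insert.prems unfolding L_def by auto
  have "insert x F \<subseteq> A (max k l)" using k l A_mono[of k "max k l"] A_mono[of l "max k l"] by auto
  thus ?case by (rule exI)
qed simp

text \<open>For a simple ideal \<open>t\<close> of an earlier stage, these are the simple ideals of
  \<open>A m\<close> in which \<open>t\<close> has a nonzero component, and \<open>gen m t\<close>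
  is the ideal of \<open>A m\<close> generated by \<open>t\<close>.\<close>

definition dsc :: "nat \<Rightarrow> fmat set \<Rightarrow> fmat set set" where
  "dsc m t = {s \<in> simples (A m). \<exists>x\<in>t. \<exists>y\<in>s. lb x y \<noteq> 0}"

definition gen :: "nat \<Rightarrow> fmat set \<Rightarrow> fmat set" where
  "gen m t = fm.span (\<Union>(dsc m t))"

lemma simples_sub: "s \<in> simples (A m) \<Longrightarrow> m \<le> k \<Longrightarrow> s \<subseteq> A k"
  using idl_subset[OF simples_idl] A_mono by blast

lemma dsc_gen: "s \<in> dsc m t \<Longrightarrow> s \<subseteq> gen m t"
  unfolding gen_def using fm.span_superset[of "\<Union>(dsc m t)"] by blast

text \<open>As \<open>t\<close> is perfect, it suffices to split one factor of a bracket into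
  central and simple parts: only simple ideals on which \<open>t\<close> acts contribute.\<close>

lemma sub_gen: assumes t: "t \<in> simples (A m)" "m \<le> k" shows "t \<subseteq> gen k t"
proof -
  have tA: "t \<subseteq> A k" by (rule simples_sub[OF t])
  have "lb x y \<in> gen k t" if x: "x \<in> t" and y: "y \<in> t" for x y
  proof -
    have xA: "x \<in> A k" using x tA by blast
    have "y \<in> fm.span (ctr (A k) \<union> \<Union>(simples (A k)))" using red_span[OF red] y tA by blast
    thus ?thesis unfolding gen_def
    proof (induction rule: fm.span_induct_alt)
      case base
      show ?case using fm.span_zero by (simp add: lb_simps)
    next
      case (step c v y)
      have "lb x v \<in> fm.span (\<Union>(dsc k t))"
      proof (cases "lb x v = 0")
        case False
        have "v \<notin> ctr (A k)"
        proof
          assume "v \<in> ctr (A k)"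
          hence "lb v x = 0" using xA unfolding ctr_def by blast
          thus False using False lb_minus_commute[of x v] by simp
        qed
        then obtain s where s: "s \<in> simples (A k)" "v \<in> s" using step(1) by blast
        have "s \<in> dsc k t" unfolding dsc_def using s x False by blast
        moreover have "lb x v \<in> s" by (rule idl_lb[OF simples_idl[OF s(1)] xA s(2)])
        ultimately show ?thesis by (intro fm.span_base) blast
      qed (simp add: fm.span_zero)
      thus ?case using step(2) by (simp add: lb_simps fm.span_add fm.span_scale)
    qed
  qed
  hence "comm t \<subseteq> gen k t" unfolding comm_def
    by (intro fm.span_minimal) (auto simp: gen_def fm.subspace_span)
  thus ?thesis using simp_alg_perfect[OF simples_simp[OF t(1)]] by simp
qed

lemma lb_lb_zero:
  assumes "\<forall>y\<in>s. lb a y = 0" "\<forall>y\<in>s. lb b y \<in> s"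
  shows "\<forall>y\<in>s. lb (lb b a) y = 0"
  using assms by (simp add: lb_jacobi lb_simps)

text \<open>By simplicity one nonzero \<open>x\<close> in \<open>t\<close> detects every ideal that
  \<open>t\<close> acts on. Its size does not depend on \<open>k\<close>, so neither does the bound
  on the number of these ideals.\<close>

lemma dsc_acted:
  assumes t: "t \<in> simples (A m)" "m \<le> k" and x: "x \<in> t" "x \<noteq> 0"
  shows "dsc k t \<subseteq> acted (A k) x"
proof
  fix s assume "s \<in> dsc k t"
  then obtain x' y' where s: "s \<in> simples (A k)" and xy: "x' \<in> t" "y' \<in> s" "lb x' y' \<noteq> 0"
    unfolding dsc_def by blast
  have tA: "t \<subseteq> A k" by (rule simples_sub[OF t])
  have "\<exists>y\<in>s. lb x y \<noteq> 0"
  proof (rule ccontr)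
    assume "\<not> ?thesis"
    hence c: "\<forall>y\<in>s. lb x y = 0" by blast
    have "\<forall>y\<in>s. lb x' y = 0"
    proof (rule simp_alg_induct[where P = "\<lambda>x. \<forall>y\<in>s. lb x y = 0", OF simples_simp[OF t(1)] x c xy(1)])
      fix b a assume "b \<in> t" "\<forall>y\<in>s. lb a y = 0"
      thus "\<forall>y\<in>s. lb (lb b a) y = 0" using idl_lb[OF simples_idl[OF s]] tA by (intro lb_lb_zero) auto
    qed (simp_all add: lb_simps)
    thus False using xy by blast
  qed
  thus "s \<in> acted (A k) x" unfolding acted_def using s by blast
qed

lemma dsc_finite: "t \<in> simples (A m) \<Longrightarrow> m \<le> k \<Longrightarrow> finite (dsc k t)"
  and dsc_card: "t \<in> simples (A m) \<Longrightarrow> \<exists>d. \<forall>k\<ge>m. card (dsc k t) \<le> d"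
proof -
  assume t: "t \<in> simples (A m)"
  obtain a b where "a \<in> t" "b \<in> t" "lb a b \<noteq> 0" using simp_alg_nonabelian[OF simples_simp[OF t]] by blast
  hence x: "a \<in> t" "a \<noteq> 0" by (auto simp: lb_simps)
  obtain n where n: "bnd n a" using bnd_ex by blast
  have aA: "a \<in> A k" if "m \<le> k" for k using x(1) simples_sub[OF t that] by blast
  show "finite (dsc k t)" if "m \<le> k"
    using acted_bound[OF aA[OF that] n] dsc_acted[OF t that x] finite_subset by blast
  have "card (dsc k t) \<le> 2 * n + 2 * n * (2 * n) ^ 2" if "m \<le> k" for k
    using acted_bound[OF aA[OF that] n] card_mono[OF _ dsc_acted[OF t that x]] by (meson le_trans)
  thus "\<exists>d. \<forall>k\<ge>m. card (dsc k t) \<le> d" by blast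
qed

text \<open>The number of simple ideals \<open>t\<close> acts on need not be monotone in \<open>k\<close>; \<open>D t\<close> is its upper limit.\<close>

definition D :: "fmat set \<Rightarrow> nat" where
  "D t = (LEAST d. \<exists>K. \<forall>k\<ge>K. card (dsc k t) \<le> d)"

lemma D_ex: "t \<in> simples (A m) \<Longrightarrow> \<exists>K. \<forall>k\<ge>K. card (dsc k t) \<le> D t"
  unfolding D_def by (rule LeastI_ex) (use dsc_card in blast)

lemma D_le: "\<forall>k\<ge>K. card (dsc k t) \<le> d \<Longrightarrow> D t \<le> d"
  unfolding D_def by (rule Least_le) blast

text \<open>If \<open>t\<close> centralized \<open>r\<close>, so would a nonzero bracket of
  \<open>t\<close> with \<open>s\<close>, and by simplicity all of \<open>s\<close>.\<close>

lemma dsc_dsc: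
  assumes t: "t \<in> simples (A m)" "m \<le> k" and s: "s \<in> dsc k t" and l: "k \<le> l"
  shows "dsc l s \<subseteq> dsc l t"
proof
  fix r assume r: "r \<in> dsc l s"
  hence rA: "r \<in> simples (A l)" unfolding dsc_def by blast
  obtain x y where xy: "x \<in> s" "y \<in> r" "lb x y \<noteq> 0" using r unfolding dsc_def by blast
  obtain x0 y0 where sA: "s \<in> simples (A k)" and xy0: "x0 \<in> t" "y0 \<in> s" "lb x0 y0 \<noteq> 0"
    using s unfolding dsc_def by blast
  have sl: "s \<subseteq> A l" by (rule simples_sub[OF sA l])
  have rs: "\<forall>y\<in>r. lb b y \<in> r" if "b \<in> s" for b using idl_lb[OF simples_idl[OF rA]] that sl by blast
  show "r \<in> dsc l t"
  proof (rule ccontr)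
    assume "r \<notin> dsc l t"
    hence c: "\<And>a z. a \<in> t \<Longrightarrow> z \<in> r \<Longrightarrow> lb a z = 0" using rA unfolding dsc_def by blast
    have xk: "x0 \<in> A k" using xy0(1) simples_sub[OF t] by blast
    have u: "lb x0 y0 \<in> s" by (rule idl_lb[OF simples_idl[OF sA] xk xy0(2)])
    have u0: "\<forall>z\<in>r. lb (lb x0 y0) z = 0"
      using c[OF xy0(1)] rs[OF xy0(2)] by (simp add: lb_jacobi lb_simps)
    have "\<forall>z\<in>r. lb x z = 0"
    proof (rule simp_alg_induct[where P = "\<lambda>x. \<forall>z\<in>r. lb x z = 0", OF simples_simp[OF sA] u xy0(3) u0 xy(1)])
      fix b a assume "b \<in> s" "\<forall>z\<in>r. lb a z = 0"
      thus "\<forall>z\<in>r. lb (lb b a) z = 0" using rs by (intro lb_lb_zero) auto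
    qed (simp_all add: lb_simps)
    thus False using xy by blast
  qed
qed

lemma gen_mono:
  assumes t: "t \<in> simples (A m)" "m \<le> k" and l: "k \<le> l"
  shows "gen k t \<subseteq> gen l t"
proof -
  have "s \<subseteq> gen l t" if s: "s \<in> dsc k t" for s
  proof -
    have sA: "s \<in> simples (A k)" using s unfolding dsc_def by blast
    have "gen l s \<subseteq> gen l t" unfolding gen_def using dsc_dsc[OF t s l] by (intro fm.span_mono) blast
    thus ?thesis using sub_gen[OF sA l] by blast
  qed
  thus ?thesis unfolding gen_def[of k] by (intro fm.span_minimal) (auto simp: gen_def fm.subspace_span)
qed

lemma gen_lb: assumes "x \<in> A k" "i \<in> gen k t" shows "lb x i \<in> gen k t"
  using assms(2) unfolding gen_def
proof (induction rule: fm.span_induct_alt)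
  case base
  show ?case using fm.span_zero by (simp add: lb_simps)
next
  case (step c v y)
  then obtain s where s: "s \<in> dsc k t" "v \<in> s" by blast
  have "s \<in> simples (A k)" using s(1) unfolding dsc_def by blast
  hence "lb x v \<in> s" using idl_lb[OF simples_idl assms(1) s(2)] by blast
  hence "lb x v \<in> fm.span (\<Union>(dsc k t))" using s(1) by (intro fm.span_base) blast
  thus ?case using step(2) by (simp add: lb_simps fm.span_add fm.span_scale)
qed

text \<open>The ideal of \<open>L\<close> generated by \<open>t\<close>, an increasing union by
  \<open>gen_mono\<close>.\<close>

definition lim :: "nat \<Rightarrow> fmat set \<Rightarrow> fmat set" where
  "lim m t = (\<Union>k\<in>{m..}. gen k t)"

lemma gen_lim: "m \<le> k \<Longrightarrow> gen k t \<subseteq> lim m t"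
  unfolding lim_def by auto

lemma lim_ex: "x \<in> lim m t \<Longrightarrow> \<exists>k\<ge>m. x \<in> gen k t"
  unfolding lim_def by auto

lemma lim_idl: assumes t: "t \<in> simples (A m)" shows "idl L (lim m t)"
proof -
  have two: "\<exists>l\<ge>m. x \<in> gen l t \<and> y \<in> gen l t" if xy: "x \<in> lim m t" "y \<in> lim m t" for x y
  proof -
    obtain k l where k: "m \<le> k" "x \<in> gen k t" "m \<le> l" "y \<in> gen l t" using lim_ex xy by meson
    thus ?thesis using gen_mono[OF t k(1), of "max k l"] gen_mono[OF t k(3), of "max k l"]
      by (intro exI[of _ "max k l"]) auto
  qed
  have sg: "fm.subspace (gen k t)" for k unfolding gen_def by (rule fm.subspace_span)
  have "fm.subspace (lim m t)"
  proof (rule fm.subspaceI)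
    show "0 \<in> lim m t" using fm.subspace_0[OF sg[of m]] gen_lim[of m m t] by blast
  next
    fix x y assume "x \<in> lim m t" "y \<in> lim m t"
    then obtain l where l: "m \<le> l" "x \<in> gen l t" "y \<in> gen l t" using two by blast
    show "x + y \<in> lim m t" using fm.subspace_add[OF sg l(2,3)] gen_lim[OF l(1)] by blast
  next
    fix c x assume "x \<in> lim m t"
    then obtain l where l: "m \<le> l" "x \<in> gen l t" using lim_ex by blast
    show "c *\<^sub>m x \<in> lim m t" using fm.subspace_scale[OF sg l(2)] gen_lim[OF l(1)] by blast
  qed
  moreover have "gen k t \<subseteq> L" for k
  proof -
    have "gen k t \<subseteq> A k" unfolding gen_def
    proof (rule fm.span_minimal)
      show "\<Union>(dsc k t) \<subseteq> A k" unfolding dsc_def using simples_sub[of _ k k] by blast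
      show "fm.subspace (A k)" using A_lie unfolding lie_sub_def by blast
    qed
    thus ?thesis using A_L by blast
  qed
  hence "lim m t \<subseteq> L" unfolding lim_def by blast
  moreover have "lb x i \<in> lim m t" if x: "x \<in> L" and i: "i \<in> lim m t" for x i
  proof -
    obtain k where k: "m \<le> k" "i \<in> gen k t" using lim_ex[OF i] by blast
    obtain l where l: "x \<in> A l" using x unfolding L_def by blast
    have "x \<in> A (max k l)" using l A_mono[of l "max k l"] by auto
    moreover have "i \<in> gen (max k l) t" using k gen_mono[OF t k(1), of "max k l"] by auto
    ultimately have "lb x i \<in> gen (max k l) t" by (rule gen_lb)
    moreover have "m \<le> max k l" using k(1) by simp
    ultimately show ?thesis using gen_lim by blast
  qed
  ultimately show ?thesis unfolding idl_def by blast
qed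

text \<open>A nonzero ideal \<open>K\<close> contains some \<open>s\<close> in
  \<open>dsc k t\<close>. Since \<open>D s\<close> is not smaller than \<open>D t\<close>,
  arbitrarily late stages have \<open>dsc l s = dsc l t\<close>; there \<open>s\<close> reaches
  every simple ideal that makes up \<open>gen l t\<close>, which therefore lies in
  \<open>K\<close>.\<close>

lemma lim_simple:
  assumes t: "t \<in> simples (A m)"
    and min: "\<And>k s. s \<in> simples (A k) \<Longrightarrow> s \<subseteq> lim m t \<Longrightarrow> D t \<le> D s"
  shows "lim m t \<in> simples L"
proof -
  let ?S = "lim m t"
  have tS: "t \<subseteq> ?S" using sub_gen[OF t order_refl] gen_lim[of m m t] by blast
  have "K = {0} \<or> K = ?S" if K: "fm.subspace K" "K \<subseteq> ?S" "\<forall>x\<in>?S. \<forall>k\<in>K. lb x k \<in> K" for K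
  proof (rule disjCI)
    assume n0: "K \<noteq> ?S"
    show "K = {0}"
    proof (rule ccontr)
      assume "K \<noteq> {0}"
      then obtain x where x: "x \<in> K" "x \<noteq> 0" using fm.subspace_0[OF K(1)] by blast
      obtain k where k: "m \<le> k" "x \<in> gen k t" using lim_ex x(1) K(2) by blast
      have S: "\<And>l y j. m \<le> l \<Longrightarrow> y \<in> \<Union>(dsc l t) \<Longrightarrow> j \<in> K \<Longrightarrow> lb y j \<in> K"
        using K(3) dsc_gen gen_lim by blast
      have "\<exists>s\<in>dsc k t. s \<subseteq> K"
        by (rule simples_below[OF _ x(2,1) _ K(1), of _ "A k"])
          (use k S[OF k(1)] in \<open>auto simp: gen_def dsc_def\<close>)
      then obtain s where s: "s \<in> dsc k t" "s \<subseteq> K" by blast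
      have sA: "s \<in> simples (A k)" using s(1) unfolding dsc_def by blast
      have Ds: "D t \<le> D s" by (rule min[OF sA]) (use s(2) K(2) in blast)
      have inf: "\<exists>l\<ge>l0. dsc l s = dsc l t" if l0: "k \<le> l0" for l0
      proof (rule ccontr)
        assume c: "\<not> ?thesis"
        obtain K0 where K0: "\<forall>k\<ge>K0. card (dsc k t) \<le> D t" using D_ex[OF t] by blast
        have lt: "card (dsc l s) < D t" if l: "l \<ge> max K0 l0" for l
        proof -
          have "dsc l s \<subset> dsc l t" using c l dsc_dsc[OF t k(1) s(1), of l] l0 by auto
          moreover have "finite (dsc l t)" by (rule dsc_finite[OF t]) (use l l0 k(1) in auto)
          ultimately have "card (dsc l s) < card (dsc l t)" by (rule psubset_card_mono[rotated])
          thus ?thesis using K0 l by (meson le_trans less_le_trans max.cobounded1)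
        qed
        \<comment> \<open>If the inclusion were proper at every late stage, the count for
          \<open>s\<close> would stay below \<open>D t\<close>; positivity of \<open>D t\<close>
          makes the truncated subtraction harmless.\<close>
        have "D s \<le> D t - 1"
        proof (rule D_le[of "max K0 l0"], intro allI impI)
          fix l assume "max K0 l0 \<le> l"
          thus "card (dsc l s) \<le> D t - 1" using lt[of l] by simp
        qed
        moreover have "D t > 0" using lt[of "max K0 l0"] by simp
        ultimately show False using Ds by simp
      qed
      have "?S \<subseteq> K"
      proof
        fix z assume "z \<in> ?S"
        then obtain l0 where l0: "m \<le> l0" "z \<in> gen l0 t" using lim_ex by blast
        obtain l where l: "l \<ge> max k l0" "dsc l s = dsc l t" using inf[of "max k l0"] by auto
        have "r \<subseteq> K" if r: "r \<in> dsc l t" for r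
        proof -
          have rs: "r \<in> dsc l s" using r l(2) by simp
          have rA: "r \<in> simples (A l)" using r unfolding dsc_def by blast
          obtain a b where ab: "a \<in> s" "b \<in> r" "lb a b \<noteq> 0" using rs unfolding dsc_def by blast
          have lm: "m \<le> l" using l(1) k(1) by simp
          have bK: "lb b a \<in> K" using S[OF lm _, of b a] r ab(1,2) s(2) by blast
          have aA: "a \<in> A l" using ab(1) simples_sub[OF sA, of l] l(1) by auto
          have br: "lb b a \<in> r" by (rule idl_lb'[OF simples_idl[OF rA] aA ab(2)])
          have b0: "lb b a \<noteq> 0" using ab(3) lb_minus_commute[of b a] by simp
          show ?thesis
            by (rule simp_alg_meet[OF simples_simp[OF rA] K(1) _ bK br b0]) (use S[OF lm] r in blast)
        qed
        hence "gen l t \<subseteq> K" unfolding gen_def using K(1) by (intro fm.span_minimal) auto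
        moreover have "z \<in> gen l t" using gen_mono[OF t l0(1), of l] l(1) l0(2) by auto
        ultimately show "z \<in> K" by blast
      qed
      thus False using n0 K(2) by blast
    qed
  qed
  moreover have "\<exists>x\<in>?S. \<exists>y\<in>?S. lb x y \<noteq> 0"
    using simp_alg_nonabelian[OF simples_simp[OF t]] tS by blast
  moreover note lim_idl[OF t]
  ultimately show ?thesis unfolding simples_def simp_alg_def using idl_lie_sub by blast
qed

lemma comm_L: assumes "x \<in> comm L" shows "\<exists>m. x \<in> comm (A m)"
  using assms unfolding comm_def[of L]
proof (induction rule: fm.span_induct_alt)
  case base
  show ?case unfolding comm_def using fm.span_zero by blast
next
  case (step c v y)
  then obtain a b where ab: "v = lb a b" "a \<in> L" "b \<in> L" by blast
  obtain k where k: "a \<in> A k" "b \<in> A k" using L_ex2[OF ab(2,3)] by blast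
  obtain l where l: "y \<in> comm (A l)" using step(2) by blast
  have "v \<in> comm (A (max k l))" unfolding ab(1) using k A_mono[of k "max k l"] by (intro comm_base) auto
  moreover have "y \<in> comm (A (max k l))" using l comm_mono[OF A_mono, of l "max k l"] by auto
  ultimately have "c *\<^sub>m v + y \<in> comm (A (max k l))"
    unfolding comm_def by (intro fm.span_add fm.span_scale)
  thus ?case by blast
qed

lemma simple_below:
  assumes J: "idl L J" and x: "x \<in> comm L" "x \<in> J" "x \<noteq> 0"
  shows "\<exists>m. \<exists>t\<in>simples (A m). t \<subseteq> J"
proof -
  obtain m where m: "x \<in> comm (A m)" using comm_L[OF x(1)] by blast
  have "\<exists>t\<in>simples (A m). t \<subseteq> J"
  proof (rule simples_below[OF _ x(3,2) order_refl idl_sub[OF J]])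
    show "x \<in> fm.span (\<Union>(simples (A m)))" using comm_red[OF red] m by blast
    show "lb y k \<in> J" if y: "y \<in> \<Union>(simples (A m))" and k: "k \<in> J" for y k
    proof (rule idl_lb[OF J _ k])
      show "y \<in> L" using y simples_sub[of _ m m] A_L by blast
    qed
  qed
  thus ?thesis by blast
qed

text \<open>Among all simple ideals of all \<open>A m\<close> inside \<open>J\<close>, take
  \<open>t\<close> with least \<open>D t\<close>. The ideal of \<open>L\<close> it generates stays
  in \<open>J\<close>, so the minimality covers every simple ideal below it.\<close>

theorem simple_ideal_below:
  assumes J: "idl L J" and x: "x \<in> comm L" "x \<in> J" "x \<noteq> 0"
  shows "\<exists>S\<in>simples L. S \<subseteq> J"
proof -
  define P where "P t \<longleftrightarrow> (\<exists>m. t \<in> simples (A m)) \<and> t \<subseteq> J" for t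
  obtain t0 where "P t0" using simple_below[OF J x] unfolding P_def by blast
  then obtain t where t: "P t" "\<And>s. P s \<Longrightarrow> D t \<le> D s" using ex_has_least_nat[of P t0 D] by blast
  obtain m where m: "t \<in> simples (A m)" "t \<subseteq> J" using t(1) unfolding P_def by blast
  have gJ: "gen k t \<subseteq> J" if k: "m \<le> k" for k
  proof -
    have "s \<subseteq> J" if s: "s \<in> dsc k t" for s
    proof -
      obtain a b where sA: "s \<in> simples (A k)" and ab: "a \<in> t" "b \<in> s" "lb a b \<noteq> 0"
        using s unfolding dsc_def by blast
      have sL: "s \<subseteq> L" using simples_sub[OF sA order_refl] A_L by blast
      have "lb a b \<in> J" using idl_lb'[OF J] m(2) ab sL by blast
      moreover have "lb a b \<in> s" using idl_lb[OF simples_idl[OF sA]] simples_sub[OF m(1) k] ab by blast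
      ultimately show ?thesis
        by (intro simp_alg_meet[OF simples_simp[OF sA] idl_sub[OF J] _ _ _ ab(3)]) (use idl_lb[OF J] sL in auto)
    qed
    thus ?thesis unfolding gen_def using idl_sub[OF J] by (intro fm.span_minimal) auto
  qed
  hence lJ: "lim m t \<subseteq> J" unfolding lim_def by auto
  have "lim m t \<in> simples L"
  proof (rule lim_simple[OF m(1)])
    fix k s assume "s \<in> simples (A k)" "s \<subseteq> lim m t"
    hence "P s" unfolding P_def using lJ by blast
    thus "D t \<le> D s" by (rule t(2))
  qed
  thus ?thesis using lJ by blast
qed

end

section \<open>Matrix Lie algebras as records\<close>

lemma mlie_simps:
  "lcarrier (mlie T) = ent ` T" "lzero (mlie T) = ent 0"
  "ladd (mlie T) (ent a) (ent b) = ent (a + b)"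
  "lsmult (mlie T) c (ent a) = ent (c *\<^sub>m a)"
  "lbr (mlie T) (ent a) (ent b) = ent (lb a b)"
  unfolding mlie_def gl_inf_def lb_def by (simp_all add: fun_eq_iff ent_times)

lemma ent_mem [simp]: "ent a \<in> ent ` T \<longleftrightarrow> a \<in> T"
  using ent_inject by auto

lemma mlie_lie_algebra:
  assumes "lie_sub T" shows "lie_algebra (mlie T)"
proof -
  have "\<exists>y\<in>T. x + y = 0" if "x \<in> T" for x
    using lie_sub_scale[OF assms that, of "-1"] by (intro bexI[of _ "(-1) *\<^sub>m x"]) simp_all
  moreover have "lb x (lb y z) + (lb y (lb z x) + lb z (lb x y)) = 0" for x y z
    by (simp add: lb_def algebra_simps)
  ultimately show ?thesis
    unfolding lie_algebra_def Let_def mlie_simps(1,2)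
    by (simp add: mlie_simps(3-5) ent_inject lie_sub_0[OF assms] lie_sub_add[OF assms] lie_sub_scale[OF assms]
        lie_sub_lb[OF assms] lb_simps add_ac fm.scale_right_distrib fm.scale_left_distrib)
qed

lemma lsum_mlie: "(\<And>i. i < n \<Longrightarrow> v i = ent (f i)) \<Longrightarrow> lsum (mlie T) v n = ent (\<Sum>i<n. f i)"
  by (induction n) (simp_all add: mlie_simps)

lemma span_sum_ex:
  assumes "x \<in> fm.span X"
  shows "\<exists>c w n. (\<forall>i<n. w i \<in> X) \<and> x = (\<Sum>i<(n::nat). c i *\<^sub>m w i)"
  using assms
proof (induction rule: fm.span_induct_alt)
  case base
  show ?case by (intro exI[of _ "\<lambda>_. 0"] exI[of _ "0::nat"]) simp
next
  case (step k v z)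
  then obtain c w and n :: nat where w: "\<forall>i<n. w i \<in> X" "z = (\<Sum>i<n. c i *\<^sub>m w i)" by blast
  have "k *\<^sub>m v + z = (\<Sum>i<Suc n. (c(n := k)) i *\<^sub>m (w(n := v)) i)"
    unfolding w(2) by (simp add: add.commute)
  moreover have "\<forall>i<Suc n. (w(n := v)) i \<in> X" using w(1) step(1) by (simp add: less_Suc_eq)
  ultimately show ?case by blast
qed

lemma lspan_mlie: "lspan (mlie T) (ent ` X) = ent ` fm.span X"
proof (intro equalityI subsetI)
  fix y assume "y \<in> lspan (mlie T) (ent ` X)"
  then obtain c v n where y: "y = lsum (mlie T) (\<lambda>i. lsmult (mlie T) (c i) (v i)) n" and v: "\<forall>i<n. v i \<in> ent ` X"
    unfolding lspan_def by blast
  have "\<forall>i. \<exists>w. i < n \<longrightarrow> w \<in> X \<and> v i = ent w" using v by blast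
  then obtain w where w: "\<And>i. i < n \<Longrightarrow> w i \<in> X" "\<And>i. i < n \<Longrightarrow> v i = ent (w i)" by metis
  have "y = ent (\<Sum>i<n. c i *\<^sub>m w i)" unfolding y by (rule lsum_mlie) (simp add: w(2) mlie_simps)
  moreover have "(\<Sum>i<n. c i *\<^sub>m w i) \<in> fm.span X"
    by (intro fm.span_sum fm.span_scale fm.span_base) (use w(1) in auto)
  ultimately show "y \<in> ent ` fm.span X" by blast
next
  fix y assume "y \<in> ent ` fm.span X"
  then obtain x where x: "y = ent x" "x \<in> fm.span X" by blast
  obtain c w and n :: nat where w: "\<forall>i<n. w i \<in> X" "x = (\<Sum>i<n. c i *\<^sub>m w i)"
    using span_sum_ex[OF x(2)] by auto
  have "lsum (mlie T) (\<lambda>i. lsmult (mlie T) (c i) (ent (w i))) n = y"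
    unfolding x(1) w(2) by (rule lsum_mlie) (simp add: mlie_simps)
  thus "y \<in> lspan (mlie T) (ent ` X)" unfolding lspan_def using w(1)
    by (intro CollectI exI[of _ c] exI[of _ "\<lambda>i. ent (w i)"] exI[of _ n]) auto
qed

lemma derived_mlie: "derived (mlie T) = ent ` comm T"
proof -
  have "{lbr (mlie T) x y |x y. x \<in> ent ` T \<and> y \<in> ent ` T} = ent ` {lb a b |a b. a \<in> T \<and> b \<in> T}"
    (is "?X = _")
  proof (intro equalityI subsetI)
    fix z assume "z \<in> ?X"
    then obtain a b where ab: "z = lbr (mlie T) (ent a) (ent b)" "a \<in> T" "b \<in> T" by blast
    have "z = ent (lb a b)" unfolding ab(1) mlie_simps ..
    thus "z \<in> ent ` {lb a b |a b. a \<in> T \<and> b \<in> T}" using ab(2,3) by blast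
  next
    fix z assume "z \<in> ent ` {lb a b |a b. a \<in> T \<and> b \<in> T}"
    then obtain a b where ab: "z = ent (lb a b)" "a \<in> T" "b \<in> T" by blast
    have "z = lbr (mlie T) (ent a) (ent b)" unfolding ab(1) mlie_simps ..
    thus "z \<in> ?X" using ab(2,3) by blast
  qed
  thus ?thesis unfolding derived_def comm_def mlie_simps(1) by (simp only: lspan_mlie)
qed

lemma fin_dim_mlie:
  assumes "fm.subspace T" "fd T" shows "fin_dim (mlie T)"
proof -
  obtain B where B: "finite B" "T \<subseteq> fm.span B" using assms(2) unfolding fd_def by blast
  obtain C where C: "finite C" "C \<subseteq> T" "T \<subseteq> fm.span C" using finite_basis_of_subset[OF B] by blast
  have "fm.span C = T" using C(3) fm.span_minimal[OF C(2) assms(1)] by blast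
  thus ?thesis unfolding fin_dim_def mlie_simps(1) using C(1,2)
    by (intro exI[of _ "ent ` C"]) (auto simp: lspan_mlie)
qed

lemma simple_mlie:
  assumes T: "simp_alg T" shows "simple_lie (mlie T)"
  unfolding simple_lie_def
proof (intro conjI allI impI)
  show "lie_algebra (mlie T)" by (rule mlie_lie_algebra[OF simp_alg_lie[OF T]])
  obtain a b where ab: "a \<in> T" "b \<in> T" "lb a b \<noteq> 0" using simp_alg_nonabelian[OF T] by blast
  show "\<exists>x\<in>lcarrier (mlie T). \<exists>y\<in>lcarrier (mlie T). lbr (mlie T) x y \<noteq> lzero (mlie T)"
    unfolding mlie_simps(1,2)
    by (rule bexI[of _ "ent a"], rule bexI[of _ "ent b"]) (use ab in \<open>simp_all add: mlie_simps ent_inject\<close>)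
next
  fix I assume I: "lideal (mlie T) I"
  define K where "K = {a. ent a \<in> I}"
  have IT: "I \<subseteq> ent ` T" using I unfolding lideal_def lsubspace_def mlie_simps by blast
  have IK: "I = ent ` K" using IT unfolding K_def by blast
  have i: "ent 0 \<in> I" "\<And>x y. x \<in> I \<Longrightarrow> y \<in> I \<Longrightarrow> ladd (mlie T) x y \<in> I"
    "\<And>c x. x \<in> I \<Longrightarrow> lsmult (mlie T) c x \<in> I" "\<And>x y. x \<in> ent ` T \<Longrightarrow> y \<in> I \<Longrightarrow> lbr (mlie T) x y \<in> I"
    using I unfolding lideal_def lsubspace_def mlie_simps(1,2) by auto
  have "fm.subspace K"
  proof (rule fm.subspaceI)
    show "0 \<in> K" using i(1) unfolding K_def by (rule CollectI)
  next
    fix x y assume "x \<in> K" "y \<in> K"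
    hence "ladd (mlie T) (ent x) (ent y) \<in> I" unfolding K_def by (intro i(2)) simp_all
    thus "x + y \<in> K" unfolding K_def mlie_simps by (rule CollectI)
  next
    fix c x assume "x \<in> K"
    hence "lsmult (mlie T) c (ent x) \<in> I" unfolding K_def by (intro i(3)) simp_all
    thus "c *\<^sub>m x \<in> K" unfolding K_def mlie_simps by (rule CollectI)
  qed
  moreover have "K \<subseteq> T"
  proof
    fix x assume "x \<in> K"
    hence "ent x \<in> ent ` T" using IT unfolding K_def by blast
    thus "x \<in> T" unfolding ent_mem .
  qed
  moreover have "lb x k \<in> K" if "x \<in> T" "k \<in> K" for x k
  proof -
    have "lbr (mlie T) (ent x) (ent k) \<in> I" using that unfolding K_def by (intro i(4)) simp_all
    thus ?thesis unfolding K_def mlie_simps by (rule CollectI)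
  qed
  ultimately have "K = {0} \<or> K = T" using T unfolding simp_alg_def by simp
  thus "I = {lzero (mlie T)} \<or> I = lcarrier (mlie T)" unfolding IK mlie_simps by auto
qed

section \<open>The simple ideals of a union of reductive algebras\<close>

context red_union
begin

lemma L_sub: "fm.subspace L"
  using L_lie unfolding lie_sub_def by blast

lemma simples_L: "S \<in> simples L \<Longrightarrow> S \<subseteq> L"
  using idl_subset simples_idl by blast

lemma simples_comm: assumes "S \<in> simples L" shows "S \<subseteq> comm L"
  using comm_mono[OF simples_L[OF assms]] simp_alg_perfect[OF simples_simp[OF assms]] by simp

lemma simples_locally_fd: assumes S: "S \<in> simples L" shows "locally_fd S"
  unfolding locally_fd_def
proof (intro allI impI)
  fix F assume F: "finite F" "F \<subseteq> S"
  obtain n where n: "F \<subseteq> A n" using fin_subset[OF F(1)] F(2) simples_L[OF S] by blast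
  have lS: "lie_sub S" by (rule simp_alg_lie[OF simples_simp[OF S]])
  have "lie_sub (S \<inter> A n)"
    unfolding lie_sub_def
    using fm.subspace_inter[of S "A n"] lie_sub_lb[OF lS] lie_sub_lb[OF A_lie] lS A_lie[of n]
    by (auto simp: lie_sub_def)
  moreover have "fd (S \<inter> A n)" by (rule fd_subset[OF A_fd]) blast
  ultimately show "\<exists>K. lie_sub K \<and> K \<subseteq> S \<and> F \<subseteq> K \<and> fd K"
    using F(2) n by (intro exI[of _ "S \<inter> A n"]) auto
qed

lemma simples_nonzero: assumes "S \<in> simples L" shows "\<exists>x\<in>S. x \<noteq> 0"
proof -
  obtain a b where "a \<in> S" "b \<in> S" "lb a b \<noteq> 0" using simp_alg_nonabelian[OF simples_simp[OF assms]] by blast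
  thus ?thesis by (intro bexI[of _ a]) (auto simp: lb_simps)
qed

lemma model_infinite:
  assumes S: "S \<in> simples L" and inf: "\<not> fd S"
  shows "has_model L S"
proof -
  have iS: "idl L S" and pS: "simp_alg S" using S unfolding simples_def by auto
  obtain x where x: "x \<in> S" "x \<noteq> 0" using simples_nonzero[OF S] by blast
  have "x \<in> comm L" using x(1) simples_comm[OF S] by blast
  then obtain m t where t: "t \<in> simples (A m)" "t \<subseteq> S" using simple_below[OF iS _ x] by blast
  obtain a b where ab: "a \<in> t" "b \<in> t" "lb a b \<noteq> 0" using simp_alg_nonabelian[OF simples_simp[OF t(1)]] by blast
  have loc: "locally_fd S" by (rule simples_locally_fd[OF S])
  interpret simple_ideal L S t
  proof unfold_locales
    show "lie_sub L" by (rule L_lie)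
    show "lie_sub S" by (rule simp_alg_lie[OF pS])
    show "S \<subseteq> L" by (rule simples_L[OF S])
    show "lb x s \<in> S" if "x \<in> L" "s \<in> S" for x s by (rule idl_lb[OF iS that])
    show "J = {0} \<or> J = S" if "fm.subspace J" "J \<subseteq> S" "\<And>s j. s \<in> S \<Longrightarrow> j \<in> J \<Longrightarrow> lb s j \<in> J" for J
      using pS that unfolding simp_alg_def by simp
    show "S \<subseteq> fm.span {lb a b |a b. a \<in> S \<and> b \<in> S}" using simp_alg_perfect[OF pS] unfolding comm_def by simp
    show "\<not> fd S" by (rule inf)
    show "fd t" by (rule fd_subset[OF A_fd simples_sub[OF t(1) order_refl]])
    show "t \<subseteq> S" by (rule t(2))
    show "t \<subseteq> fm.span {lb a b |a b. a \<in> t \<and> b \<in> t}"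
      using simp_alg_perfect[OF simples_simp[OF t(1)]] unfolding comm_def by simp
    show "\<exists>x\<in>t. x \<noteq> 0" using ab by (intro bexI[of _ a]) (auto simp: lb_simps)
  qed
  show ?thesis by (rule model[OF loc])
qed

text \<open>A finite-dimensional simple ideal has its centralizer as complement.\<close>

lemma model_finite:
  assumes S: "S \<in> simples L" and fin: "fd S"
  shows "has_model L S"
proof -
  have iS: "idl L S" and pS: "simp_alg S" using S unfolding simples_def by auto
  have sS: "fm.subspace S" by (rule idl_sub[OF iS])
  define C where "C = {x \<in> L. \<forall>s\<in>S. lb x s = 0}"
  have sC: "fm.subspace C" unfolding C_def
    by (rule fm.subspaceI)
      (auto simp: lb_simps fm.subspace_0[OF L_sub] intro: fm.subspace_add[OF L_sub] fm.subspace_scale[OF L_sub])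
  have SC: "s = 0" if sSC: "s \<in> S" "s \<in> C" for s
  proof (rule ccontr)
    assume "s \<noteq> 0"
    then obtain y where "y \<in> S" "lb y s \<noteq> 0" using simp_alg_centre[OF pS sSC(1)] by blast
    thus False using sSC(2) lb_minus_commute[of y s] unfolding C_def by simp
  qed
  obtain B where "finite B" "S \<subseteq> fm.span B" using fin unfolding fd_def by blast
  then obtain B' where B': "finite B'" "B' \<subseteq> S" "S \<subseteq> fm.span B'" using finite_basis_of_subset[of B S] by blast
  obtain n where n: "B' \<subseteq> A n" using fin_subset[OF B'(1)] B'(2) simples_L[OF S] by blast
  have "fm.span B' \<subseteq> A n" using A_lie[of n] unfolding lie_sub_def by (intro fm.span_minimal[OF n]) blast
  hence Sn: "S \<subseteq> A n" using B'(3) by blast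
  have ex: "\<exists>s. s \<in> S \<and> x - s \<in> C" if x: "x \<in> L" for x
  proof -
    obtain l where l: "x \<in> A l" using x unfolding L_def by blast
    define k where "k = max n l"
    have xk: "x \<in> A k" using l A_mono[of l k] unfolding k_def by auto
    have Sk: "S \<subseteq> A k" using Sn A_mono[of n k] unfolding k_def by auto
    \<comment> \<open>Once a stage contains both \<open>x\<close> and all of \<open>S\<close>,
      reductivity splits off \<open>S\<close>, and the complement centralizes it.\<close>
    have iSk: "idl (A k) S" unfolding idl_def using sS Sk idl_lb[OF iS] A_L by blast
    obtain J where J: "idl (A k) J" "S \<inter> J = {0}" "\<forall>x\<in>A k. \<exists>a\<in>S. \<exists>b\<in>J. x = a + b"
      using red[of k] iSk unfolding red_def by blast
    obtain a b where ab: "a \<in> S" "b \<in> J" "x = a + b" using J(3) xk by blast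
    have "lb b s = 0" if s: "s \<in> S" for s
    proof -
      have "lb s b = 0" by (rule idl_commute[OF iSk J(1,2) s ab(2)])
      thus ?thesis using lb_minus_commute[of b s] by simp
    qed
    moreover have "b \<in> L" using ab(2) idl_subset[OF J(1)] A_L by blast
    ultimately have "b \<in> C" unfolding C_def by blast
    thus ?thesis using ab by (intro exI[of _ a]) simp
  qed
  have uniq: "s = s'" if "s \<in> S" "x - s \<in> C" "s' \<in> S" "x - s' \<in> C" for x s s'
  proof -
    have "(x - s') - (x - s) \<in> C" by (rule fm.subspace_diff[OF sC that(4,2)])
    moreover have "(x - s') - (x - s) = s - s'" by simp
    ultimately have "s - s' = 0" using SC[OF fm.subspace_diff[OF sS that(1,3)]] by metis
    thus ?thesis by simp
  qed
  define p where "p x = (SOME s. s \<in> S \<and> x - s \<in> C)" for x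
  have p: "p x \<in> S" "x - p x \<in> C" if "x \<in> L" for x
    using someI_ex[OF ex[OF that]] unfolding p_def by auto
  have peq: "p x = s" if "x \<in> L" "s \<in> S" "x - s \<in> C" for x s
    by (rule uniq[OF p[OF that(1)] that(2,3)])
  have padd: "p (x + y) = p x + p y" if xy: "x \<in> L" "y \<in> L" for x y
  proof (rule peq[OF fm.subspace_add[OF L_sub xy] fm.subspace_add[OF sS p(1)[OF xy(1)] p(1)[OF xy(2)]]])
    have "(x - p x) + (y - p y) \<in> C" by (rule fm.subspace_add[OF sC p(2)[OF xy(1)] p(2)[OF xy(2)]])
    thus "x + y - (p x + p y) \<in> C" by (simp add: algebra_simps)
  qed
  have pscale: "p (c *\<^sub>m x) = c *\<^sub>m p x" if x: "x \<in> L" for c x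
  proof (rule peq[OF fm.subspace_scale[OF L_sub x] fm.subspace_scale[OF sS p(1)[OF x]]])
    have "c *\<^sub>m (x - p x) \<in> C" by (rule fm.subspace_scale[OF sC p(2)[OF x]])
    thus "c *\<^sub>m x - c *\<^sub>m p x \<in> C" by (simp add: fm.scale_right_diff_distrib)
  qed
  have plb: "p (lb x y) = lb (p x) (p y)" if xy: "x \<in> L" "y \<in> L" for x y
  proof (rule peq[OF lie_sub_lb[OF L_lie xy] lie_sub_lb[OF simp_alg_lie[OF pS] p(1)[OF xy(1)] p(1)[OF xy(2)]]])
    define c d where "c = x - p x" and "d = y - p y"
    have cd: "c \<in> C" "d \<in> C" unfolding c_def d_def using p(2) xy by auto
    have cL: "c \<in> L" "d \<in> L" using cd unfolding C_def by auto
    have "lb c (p y) = 0" using cd(1) p(1)[OF xy(2)] unfolding C_def by blast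
    moreover have "lb d (p x) = 0" using cd(2) p(1)[OF xy(1)] unfolding C_def by blast
    hence "lb (p x) d = 0" using lb_minus_commute[of "p x" d] by simp
    moreover have "lb x y = lb (p x + c) (p y + d)" unfolding c_def d_def by simp
    ultimately have eq: "lb x y - lb (p x) (p y) = lb c d" by (simp add: lb_simps)
    have "lb (lb c d) s = 0" if s: "s \<in> S" for s
      using cd s by (simp add: lb_jacobi C_def lb_simps)
    thus "lb x y - lb (p x) (p y) \<in> C" unfolding eq C_def using lie_sub_lb[OF L_lie cL] by blast
  qed
  obtain r where r: "flinear r" "\<forall>x\<in>L. r x = p x" using linear_extend[OF L_sub padd pscale] by blast
  have "hom_on L r" unfolding hom_on_def using r lie_sub_lb[OF L_lie] plb by simp
  moreover have "r ` L \<subseteq> S" using r(2) p(1) by auto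
  moreover have "r s = s" if s: "s \<in> S" for s
  proof -
    have sL: "s \<in> L" using s simples_L[OF S] by blast
    show ?thesis using r(2) sL peq[OF sL s] fm.subspace_0[OF sC] by simp
  qed
  hence "r ` S = comm S" using simp_alg_perfect[OF pS] by simp
  moreover have "r x = 0 \<longleftrightarrow> (\<forall>s\<in>S. lb x s = 0)" if x: "x \<in> L" for x
  proof
    assume "r x = 0"
    hence "p x = 0" using r(2) x by simp
    thus "\<forall>s\<in>S. lb x s = 0" using p(2)[OF x] unfolding C_def by simp
  next
    assume "\<forall>s\<in>S. lb x s = 0"
    hence "p x = 0" by (intro peq[OF x fm.subspace_0[OF sS]]) (use x in \<open>simp add: C_def\<close>)
    thus "r x = 0" using r(2) x by simp
  qed
  ultimately show ?thesis
    unfolding has_model_def using fin_dim_mlie[OF sS fin] simple_mlie[OF pS] simp_alg_lie[OF pS] by blast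
qed

lemma model: "S \<in> simples L \<Longrightarrow> has_model L S"
  using model_finite model_infinite by blast

text \<open>The elements of \<open>comm L\<close> centralizing all simple ideals form an ideal. Were
  it nonzero, it would contain a simple ideal, which would then be abelian.\<close>

lemma comm_zero:
  assumes x: "x \<in> comm L" and c: "\<And>S s. S \<in> simples L \<Longrightarrow> s \<in> S \<Longrightarrow> lb x s = 0"
  shows "x = 0"
proof (rule ccontr)
  assume x0: "x \<noteq> 0"
  define J where "J = {x \<in> comm L. \<forall>S\<in>simples L. \<forall>s\<in>S. lb x s = 0}"
  have sc: "fm.subspace (comm L)" unfolding comm_def by (rule fm.subspace_span)
  have cL: "comm L \<subseteq> L" by (rule comm_sub[OF L_lie])
  have "fm.subspace J" unfolding J_def
    by (rule fm.subspaceI)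
      (auto simp: lb_simps fm.subspace_0[OF sc] intro: fm.subspace_add[OF sc] fm.subspace_scale[OF sc])
  moreover have "lb y j \<in> J" if y: "y \<in> L" and j: "j \<in> J" for y j
  proof -
    have jL: "j \<in> L" using j cL unfolding J_def by blast
    have "lb (lb y j) s = 0" if S: "S \<in> simples L" "s \<in> S" for S s
    proof -
      have "lb y s \<in> S" by (rule idl_lb[OF simples_idl[OF S(1)] y S(2)])
      thus ?thesis using j S unfolding J_def by (simp add: lb_jacobi lb_simps)
    qed
    thus ?thesis unfolding J_def using comm_base[OF y jL] by blast
  qed
  ultimately have "idl L J" unfolding idl_def using cL by (auto simp: J_def)
  moreover have xJ: "x \<in> J" unfolding J_def using x c by blast
  ultimately obtain S where S: "S \<in> simples L" "S \<subseteq> J" using simple_ideal_below[OF _ x _ x0] by blast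
  obtain a b where "a \<in> S" "b \<in> S" "lb a b \<noteq> 0" using simp_alg_nonabelian[OF simples_simp[OF S(1)]] by blast
  thus False using S unfolding J_def by blast
qed

text \<open>If \<open>x\<close> centralizes all simple ideals, so does every \<open>lb x y\<close>,
  which lies in \<open>comm L\<close> and hence vanishes.\<close>

lemma ctr_iff:
  assumes x: "x \<in> L"
  shows "x \<in> ctr L \<longleftrightarrow> (\<forall>S\<in>simples L. \<forall>s\<in>S. lb x s = 0)"
proof
  assume "x \<in> ctr L"
  thus "\<forall>S\<in>simples L. \<forall>s\<in>S. lb x s = 0" using simples_L unfolding ctr_def by blast
next
  assume c: "\<forall>S\<in>simples L. \<forall>s\<in>S. lb x s = 0"
  have "lb x y = 0" if y: "y \<in> L" for y
  proof (rule comm_zero[OF comm_base[OF x y]])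
    fix S s assume S: "S \<in> simples L" "s \<in> S"
    have "lb y s \<in> S" by (rule idl_lb[OF simples_idl[OF S(1)] y S(2)])
    thus "lb (lb x y) s = 0" using c S by (simp add: lb_jacobi lb_simps)
  qed
  thus "x \<in> ctr L" unfolding ctr_def using x by blast
qed

lemma ctr_comm: assumes "x \<in> ctr L" "x \<in> comm L" shows "x = 0"
proof -
  have "x \<in> L" using assms(1) unfolding ctr_def by blast
  thus ?thesis using comm_zero[OF assms(2)] ctr_iff assms(1) by blast
qed

lemma finite_acted: "x \<in> L \<Longrightarrow> finite (acted L x)"
  using bnd_ex[of x] acted_bound by blast

text \<open>Every simple ideal is acted on by some member of a countable spanning set, and each
  member acts on finitely many. This permits indexing the summands by natural numbers.\<close>

lemma countable_simples: "countable (simples L)"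
proof -
  obtain u where u: "\<forall>k::nat. u k \<in> L" "L \<subseteq> fm.span (range u)" using countable_spanning[OF L_sub] by blast
  have "simples L \<subseteq> (\<Union>k. acted L (u k))"
  proof
    fix S assume S: "S \<in> simples L"
    show "S \<in> (\<Union>k. acted L (u k))"
    proof (rule ccontr)
      assume "S \<notin> (\<Union>k. acted L (u k))"
      hence c: "lb (u k) y = 0" if "y \<in> S" for k y using S that unfolding acted_def by blast
      obtain a b where ab: "a \<in> S" "b \<in> S" "lb a b \<noteq> 0" using simp_alg_nonabelian[OF simples_simp[OF S]] by blast
      have "a \<in> fm.span (range u)" using ab(1) simples_L[OF S] u(2) by blast
      hence "lb a b = 0"
        by (induction rule: fm.span_induct_alt) (auto simp: lb_simps c[OF ab(2)])
      thus False using ab(3) by blast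
    qed
  qed
  moreover have "countable (\<Union>k. acted L (u k))"
    using finite_acted u(1) by (intro countable_UN) (auto intro: countable_finite)
  ultimately show ?thesis by (rule countable_subset)
qed

text \<open>The centre and \<open>comm L\<close> meet in \<open>0\<close> but need not span
  \<open>L\<close>, as \<open>gl_inf\<close> shows. So the projection involves a choice: the
  quotient by \<open>comm L\<close> is injective on the centre and has a left inverse there.\<close>

lemma centre_projection:
  "\<exists>p. flinear p \<and> (\<forall>z\<in>ctr L. p z = z) \<and> (\<forall>x\<in>comm L. p x = 0) \<and> range p \<subseteq> ctr L"
proof -
  have sZ: "fm.subspace (ctr L)" unfolding ctr_def
    by (rule fm.subspaceI)
      (auto simp: lb_simps fm.subspace_0[OF L_sub] intro: fm.subspace_add[OF L_sub] fm.subspace_scale[OF L_sub])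
  obtain q where q: "flinear q" "\<forall>x. q x = 0 \<longleftrightarrow> x \<in> comm L"
    using kernel_ex[of "comm L"] fm.subspace_span unfolding comm_def by blast
  have inj: "x = y" if xy: "x \<in> ctr L" "y \<in> ctr L" "q x = q y" for x y
  proof -
    have "x - y \<in> comm L" using q xy(3) by (simp add: fmm.linear_diff[OF q(1)] flip: q(2))
    hence "x - y = 0" using ctr_comm fm.subspace_diff[OF sZ xy(1,2)] by blast
    thus ?thesis by simp
  qed
  have "inj_on q (ctr L)" by (rule inj_onI) (rule inj)
  hence "\<exists>g. range g \<subseteq> ctr L \<and> flinear g \<and> (\<forall>v\<in>ctr L. g (q v) = v)"
    by (rule fmm.linear_exists_left_inverse_on[OF q(1) sZ])
  then obtain g where g: "range g \<subseteq> ctr L \<and> flinear g \<and> (\<forall>v\<in>ctr L. g (q v) = v)" ..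
  hence lg: "flinear g" by simp
  have "flinear (g \<circ> q)" by (rule Vector_Spaces.linear_compose[OF q(1) lg])
  moreover have "(g \<circ> q) x = 0" if "x \<in> comm L" for x
  proof -
    have "q x = 0" using q(2) that by blast
    thus ?thesis using fmm.linear_0[OF lg] by simp
  qed
  moreover have "range (g \<circ> q) \<subseteq> ctr L" using g by auto
  moreover have "(g \<circ> q) z = z" if "z \<in> ctr L" for z using g that by simp
  ultimately show ?thesis by (intro exI[of _ "g \<circ> q"]) simp
qed

end

section \<open>Transport to abstract Lie algebras\<close>

lemma mlie_UNIV: "mlie UNIV = gl_inf"
proof -
  have "gl_inf\<lparr>lcarrier := lcarrier gl_inf\<rparr> = gl_inf" by simp
  thus ?thesis unfolding mlie_def lcarrier_gl_inf .
qed

lemma lie_iso_refl: "lie_iso X X"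
  unfolding lie_iso_def lie_hom_def by (intro exI[of _ "\<lambda>x. x"]) (simp add: bij_betw_def)

lemma lrestrict_simps:
  "lcarrier (lrestrict X U) = U" "lzero (lrestrict X U) = lzero X" "ladd (lrestrict X U) = ladd X"
  "lsmult (lrestrict X U) = lsmult X" "lbr (lrestrict X U) = lbr X"
  unfolding lrestrict_def by simp_all

lemma lspan_lrestrict: "lspan (lrestrict X U) B = lspan X B"
proof -
  have "lsum (lrestrict X U) v n = lsum X v n" for v n
    by (induction n) (simp_all add: lrestrict_simps)
  thus ?thesis unfolding lspan_def lrestrict_simps by simp
qed

lemma lie_algebraD:
  assumes "lie_algebra g"
  shows "lzero g \<in> lcarrier g" "\<forall>x\<in>lcarrier g. \<forall>y\<in>lcarrier g. ladd g x y \<in> lcarrier g"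
    "\<forall>c. \<forall>x\<in>lcarrier g. lsmult g c x \<in> lcarrier g"
    "\<forall>x\<in>lcarrier g. \<forall>y\<in>lcarrier g. lbr g x y \<in> lcarrier g"
    "\<forall>x\<in>lcarrier g. ladd g (lzero g) x = x"
  using assms unfolding lie_algebra_def Let_def by - (elim conjE, assumption)+

text \<open>The dictionary between records with a carrier and sets of matrices, through a faithful
  representation.\<close>

locale lie_rep =
  fixes g :: "'a lie_alg" and \<rho> :: "'a \<Rightarrow> fmat"
  assumes lie: "lie_algebra g"
    and add: "x \<in> lcarrier g \<Longrightarrow> y \<in> lcarrier g \<Longrightarrow> \<rho> (ladd g x y) = \<rho> x + \<rho> y"
    and scale: "x \<in> lcarrier g \<Longrightarrow> \<rho> (lsmult g c x) = c *\<^sub>m \<rho> x"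
    and br: "x \<in> lcarrier g \<Longrightarrow> y \<in> lcarrier g \<Longrightarrow> \<rho> (lbr g x y) = lb (\<rho> x) (\<rho> y)"
    and inj: "inj_on \<rho> (lcarrier g)"
begin

abbreviation C where "C \<equiv> lcarrier g"

lemma closed:
  "lzero g \<in> C" "x \<in> C \<Longrightarrow> y \<in> C \<Longrightarrow> ladd g x y \<in> C" "x \<in> C \<Longrightarrow> lsmult g c x \<in> C"
  "x \<in> C \<Longrightarrow> y \<in> C \<Longrightarrow> lbr g x y \<in> C" "x \<in> C \<Longrightarrow> ladd g (lzero g) x = x"
  using lie_algebraD[OF lie] by simp_all

lemma zero: "\<rho> (lzero g) = 0"
  using add[OF closed(1,1)] closed(5)[OF closed(1)] by simp

lemma eqI: "x \<in> C \<Longrightarrow> y \<in> C \<Longrightarrow> \<rho> x = \<rho> y \<Longrightarrow> x = y"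
  using inj by (rule inj_onD)

lemma lsum_rep:
  "(\<And>i. i < n \<Longrightarrow> v i \<in> C) \<Longrightarrow> lsum g v n \<in> C \<and> \<rho> (lsum g v n) = (\<Sum>i<n. \<rho> (v i))"
  by (induction n) (simp_all add: closed zero add)

lemma lspan_rep:
  assumes X: "X \<subseteq> C"
  shows "lspan g X \<subseteq> C" "\<rho> ` lspan g X = fm.span (\<rho> ` X)"
proof -
  have 1: "lsum g (\<lambda>i. lsmult g (c i) (v i)) n \<in> C
      \<and> \<rho> (lsum g (\<lambda>i. lsmult g (c i) (v i)) n) = (\<Sum>i<n. c i *\<^sub>m \<rho> (v i))"
    if v: "\<forall>i<n. v i \<in> X" for c v and n :: nat
  proof -
    have vC: "v i \<in> C" if "i < n" for i using v that X by blast
    have "lsum g (\<lambda>i. lsmult g (c i) (v i)) n \<in> C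
      \<and> \<rho> (lsum g (\<lambda>i. lsmult g (c i) (v i)) n) = (\<Sum>i<n. \<rho> (lsmult g (c i) (v i)))"
      by (rule lsum_rep) (simp add: closed vC)
    thus ?thesis by (simp add: scale vC)
  qed
  show "lspan g X \<subseteq> C" unfolding lspan_def using 1 by blast
  show "\<rho> ` lspan g X = fm.span (\<rho> ` X)"
  proof (intro equalityI subsetI)
    fix y assume "y \<in> \<rho> ` lspan g X"
    then obtain c v and n :: nat where v: "\<forall>i<n. v i \<in> X" "y = \<rho> (lsum g (\<lambda>i. lsmult g (c i) (v i)) n)"
      unfolding lspan_def by blast
    hence "y = (\<Sum>i<n. c i *\<^sub>m \<rho> (v i))" using 1 by simp
    also have "\<dots> \<in> fm.span (\<rho> ` X)" using v(1) by (intro fm.span_sum fm.span_scale fm.span_base) auto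
    finally show "y \<in> fm.span (\<rho> ` X)" .
  next
    fix y assume "y \<in> fm.span (\<rho> ` X)"
    then obtain c w and n :: nat where w: "\<forall>i<n. w i \<in> \<rho> ` X" "y = (\<Sum>i<n. c i *\<^sub>m w i)"
      using span_sum_ex by blast
    have "\<forall>i. \<exists>v. i < n \<longrightarrow> v \<in> X \<and> w i = \<rho> v" using w(1) by blast
    then obtain v where v: "\<forall>i. i < n \<longrightarrow> v i \<in> X \<and> w i = \<rho> (v i)" by metis
    have "y = \<rho> (lsum g (\<lambda>i. lsmult g (c i) (v i)) n)"
      using 1[of n v c] v w(2) by simp
    moreover have "lsum g (\<lambda>i. lsmult g (c i) (v i)) n \<in> lspan g X" unfolding lspan_def using v by blast
    ultimately show "y \<in> \<rho> ` lspan g X" by blast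
  qed
qed

lemma derived_rep: "derived g \<subseteq> C" "\<rho> ` derived g = comm (\<rho> ` C)"
proof -
  let ?X = "{lbr g x y |x y. x \<in> C \<and> y \<in> C}"
  have X: "?X \<subseteq> C" using closed(4) by blast
  show "derived g \<subseteq> C" unfolding derived_def by (rule lspan_rep(1)[OF X])
  have "\<rho> ` ?X = {lb a b |a b. a \<in> \<rho> ` C \<and> b \<in> \<rho> ` C}"
  proof (intro equalityI subsetI)
    fix z assume "z \<in> \<rho> ` ?X"
    then obtain x y where xy: "z = \<rho> (lbr g x y)" "x \<in> C" "y \<in> C" by blast
    hence "z = lb (\<rho> x) (\<rho> y)" using br by simp
    thus "z \<in> {lb a b |a b. a \<in> \<rho> ` C \<and> b \<in> \<rho> ` C}" using xy(2,3) by blast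
  next
    fix z assume "z \<in> {lb a b |a b. a \<in> \<rho> ` C \<and> b \<in> \<rho> ` C}"
    then obtain x y where xy: "z = lb (\<rho> x) (\<rho> y)" "x \<in> C" "y \<in> C" by blast
    hence "z = \<rho> (lbr g x y)" using br by simp
    thus "z \<in> \<rho> ` ?X" using xy(2,3) by blast
  qed
  thus "\<rho> ` derived g = comm (\<rho> ` C)" unfolding derived_def comm_def using lspan_rep(2)[OF X] by simp
qed

lemma centre_rep: "center g \<subseteq> C" "\<rho> ` center g = ctr (\<rho> ` C)"
proof -
  show cC: "center g \<subseteq> C" unfolding center_def by blast
  have iff: "lbr g z x = lzero g \<longleftrightarrow> lb (\<rho> z) (\<rho> x) = 0" if "z \<in> C" "x \<in> C" for z x
    using eqI[OF closed(4)[OF that] closed(1)] br[OF that] zero by auto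
  show "\<rho> ` center g = ctr (\<rho> ` C)"
  proof (intro equalityI subsetI)
    fix y assume "y \<in> \<rho> ` center g"
    then obtain z where z: "y = \<rho> z" "z \<in> C" "\<forall>x\<in>C. lbr g z x = lzero g" unfolding center_def by blast
    thus "y \<in> ctr (\<rho> ` C)" unfolding ctr_def using iff by auto
  next
    fix y assume y: "y \<in> ctr (\<rho> ` C)"
    then obtain z where z: "y = \<rho> z" "z \<in> C" unfolding ctr_def by blast
    hence "\<forall>x\<in>C. lbr g z x = lzero g" using y iff unfolding ctr_def by auto
    thus "y \<in> \<rho> ` center g" unfolding center_def using z by blast
  qed
qed

lemma reductive_rep:
  assumes U: "subalgebra g U" and R: "reductive (lrestrict g U)"
  shows "red (\<rho> ` U)"
proof -
  have u: "U \<subseteq> C" "lzero g \<in> U" "\<And>x y. x \<in> U \<Longrightarrow> y \<in> U \<Longrightarrow> ladd g x y \<in> U"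
    "\<And>c x. x \<in> U \<Longrightarrow> lsmult g c x \<in> U" "\<And>x y. x \<in> U \<Longrightarrow> y \<in> U \<Longrightarrow> lbr g x y \<in> U"
    using U unfolding subalgebra_def lsubspace_def by auto
  have uC: "x \<in> C" if "x \<in> U" for x using that u(1) by blast
  have sub: "fm.subspace (\<rho> ` V)"
    if V: "V \<subseteq> C" "lzero g \<in> V" "\<And>x y. x \<in> V \<Longrightarrow> y \<in> V \<Longrightarrow> ladd g x y \<in> V"
      "\<And>c x. x \<in> V \<Longrightarrow> lsmult g c x \<in> V" for V
  proof (rule fm.subspaceI)
    show "0 \<in> \<rho> ` V" using zero V(2) by (metis imageI)
  next
    fix x y assume "x \<in> \<rho> ` V" "y \<in> \<rho> ` V"
    then obtain a b where ab: "x = \<rho> a" "y = \<rho> b" "a \<in> V" "b \<in> V" by blast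
    have "x + y = \<rho> (ladd g a b)" using ab subsetD[OF V(1)] add by simp
    thus "x + y \<in> \<rho> ` V" using V(3)[OF ab(3,4)] by blast
  next
    fix c x assume "x \<in> \<rho> ` V"
    then obtain a where a: "x = \<rho> a" "a \<in> V" by blast
    have "c *\<^sub>m x = \<rho> (lsmult g c a)" using a subsetD[OF V(1)] scale by simp
    thus "c *\<^sub>m x \<in> \<rho> ` V" using V(4)[OF a(2)] by blast
  qed
  have lbU: "lb (\<rho> a) (\<rho> b) = \<rho> (lbr g a b)" if "a \<in> U" "b \<in> U" for a b
    using br[OF uC[OF that(1)] uC[OF that(2)]] by simp
  have "lie_sub (\<rho> ` U)" unfolding lie_sub_def using sub[OF u(1-4)] lbU u(5) by auto
  moreover have "fd (\<rho> ` U)"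
  proof -
    obtain B where B: "finite B" "B \<subseteq> U" "lspan g B = U"
      using R unfolding reductive_def fin_dim_def lspan_lrestrict lrestrict_simps by blast
    have "B \<subseteq> C" using B(2) u(1) by blast
    hence "\<rho> ` U = fm.span (\<rho> ` B)" using lspan_rep(2)[of B] B(3) by simp
    thus ?thesis unfolding fd_def using B(1) by (intro exI[of _ "\<rho> ` B"]) simp
  qed
  moreover have "\<exists>J. idl (\<rho> ` U) J \<and> I \<inter> J = {0} \<and> (\<forall>x\<in>\<rho> ` U. \<exists>a\<in>I. \<exists>b\<in>J. x = a + b)"
    if I: "idl (\<rho> ` U) I" for I
  proof -
    define I' where "I' = {x \<in> U. \<rho> x \<in> I}"
    have sI: "fm.subspace I" by (rule idl_sub[OF I])
    have "lideal (lrestrict g U) I'"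
      unfolding lideal_def lsubspace_def lrestrict_simps
    proof (intro conjI ballI allI)
      show "I' \<subseteq> U" unfolding I'_def by blast
      show "lzero g \<in> I'" unfolding I'_def using u(2) zero fm.subspace_0[OF sI] by simp
      show "ladd g x y \<in> I'" if "x \<in> I'" "y \<in> I'" for x y
        using that u(3) add[OF uC uC] fm.subspace_add[OF sI] unfolding I'_def by simp
      show "lsmult g c x \<in> I'" if "x \<in> I'" for c x
        using that u(4) scale[OF uC] fm.subspace_scale[OF sI] unfolding I'_def by simp
      show "lbr g x y \<in> I'" if "x \<in> U" "y \<in> I'" for x y
        using that u(5) lbU[of x y] idl_lb[OF I, of "\<rho> x" "\<rho> y"] unfolding I'_def by simp
    qed
    then obtain J' where J': "lideal (lrestrict g U) J'" "I' \<inter> J' = {lzero g}"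
      "\<forall>x\<in>U. \<exists>a\<in>I'. \<exists>b\<in>J'. x = ladd g a b"
      using R unfolding reductive_def lrestrict_simps by blast
    have j: "J' \<subseteq> U" "lzero g \<in> J'" "\<And>x y. x \<in> J' \<Longrightarrow> y \<in> J' \<Longrightarrow> ladd g x y \<in> J'"
      "\<And>c x. x \<in> J' \<Longrightarrow> lsmult g c x \<in> J'" "\<And>x y. x \<in> U \<Longrightarrow> y \<in> J' \<Longrightarrow> lbr g x y \<in> J'"
      using J'(1) unfolding lideal_def lsubspace_def lrestrict_simps by auto
    have jC: "J' \<subseteq> C" using j(1) u(1) by blast
    have "idl (\<rho> ` U) (\<rho> ` J')"
      unfolding idl_def
    proof (intro conjI ballI)
      show "fm.subspace (\<rho> ` J')" by (rule sub[OF jC j(2-4)])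
      show "\<rho> ` J' \<subseteq> \<rho> ` U" using j(1) by blast
      fix x y assume "x \<in> \<rho> ` U" "y \<in> \<rho> ` J'"
      then obtain a b where ab: "x = \<rho> a" "y = \<rho> b" "a \<in> U" "b \<in> J'" by blast
      have "lb x y = \<rho> (lbr g a b)" unfolding ab(1,2) by (rule lbU) (use ab j(1) in auto)
      thus "lb x y \<in> \<rho> ` J'" using j(5)[OF ab(3,4)] by blast
    qed
    moreover have "I \<inter> \<rho> ` J' = {0}"
    proof (intro equalityI subsetI)
      fix y assume y: "y \<in> I \<inter> \<rho> ` J'"
      then obtain b where b: "y = \<rho> b" "b \<in> J'" by blast
      hence "b \<in> I' \<inter> J'" using y j(1) unfolding I'_def by blast
      thus "y \<in> {0}" using J'(2) b(1) zero by simp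
    next
      fix y :: fmat assume "y \<in> {0}"
      hence y0: "y = 0" by simp
      have "\<rho> (lzero g) \<in> \<rho> ` J'" using j(2) by (rule imageI)
      thus "y \<in> I \<inter> \<rho> ` J'" using y0 zero fm.subspace_0[OF sI] by simp
    qed
    moreover have "\<exists>a\<in>I. \<exists>b\<in>\<rho> ` J'. x = a + b" if x: "x \<in> \<rho> ` U" for x
    proof -
      obtain z where z: "x = \<rho> z" "z \<in> U" using x by blast
      obtain a b where ab: "a \<in> I'" "b \<in> J'" "z = ladd g a b" using J'(3) z(2) by blast
      have "x = \<rho> a + \<rho> b"
        unfolding z(1) ab(3) by (rule add) (use ab(1,2) jC uC in \<open>auto simp: I'_def\<close>)
      moreover have "\<rho> a \<in> I" using ab(1) unfolding I'_def by blast
      ultimately show ?thesis using ab(2) by blast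
    qed
    ultimately show ?thesis by blast
  qed
  ultimately show ?thesis unfolding red_def by blast
qed

end

lemma dsum_simps:
  "lcarrier (dsum Z I G) = {(z, f). z \<in> lcarrier Z \<and> (\<forall>i\<in>I. f i \<in> lcarrier (G i)) \<and>
     (\<forall>i. i \<notin> I \<longrightarrow> f i = lzero (G i)) \<and> finite {i. f i \<noteq> lzero (G i)}}"
  "ladd (dsum Z I G) (z, f) (z', f') = (ladd Z z z', \<lambda>i. ladd (G i) (f i) (f' i))"
  "lsmult (dsum Z I G) c (z, f) = (lsmult Z c z, \<lambda>i. lsmult (G i) c (f i))"
  "lbr (dsum Z I G) (z, f) (z', f') = (lbr Z z z', \<lambda>i. lbr (G i) (f i) (f' i))"
  unfolding dsum_def by simp_all

theorem theorem4p5: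
  fixes g :: "'a lie_alg"
  assumes "lie_algebra g"
    and "countable_dim g"
    and "finitary g"
    and "union_of_reductive g"
  shows "\<exists>(I :: nat set) (G :: nat \<Rightarrow> (nat \<Rightarrow> nat \<Rightarrow> complex) lie_alg) \<phi>.
     (\<forall>i\<in>I. lie_algebra (G i) \<and>
        (lie_iso (G i) gl_inf \<or> lie_iso (G i) so_inf \<or> lie_iso (G i) sp_inf \<or>
         (fin_dim (G i) \<and> simple_lie (G i)))) \<and>
     lie_hom g (dsum (lrestrict g (center g)) I G) \<phi> \<and>
     inj_on \<phi> (lcarrier g) \<and>
     (\<forall>z\<in>center g. \<phi> z = (z, \<lambda>i. lzero (G i))) \<and>
     \<phi> ` derived g =
       lcarrier (dsum (lrestrict g {lzero g}) I (\<lambda>i. lrestrict (G i) (derived (G i))))"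
proof -
  obtain f where f: "lie_hom g gl_inf f" "inj_on f (lcarrier g)"
    using assms(3) unfolding finitary_def by blast
  define \<rho> where "\<rho> x = Fmat (f x)" for x
  have ent\<rho>: "f x = ent (\<rho> x)" if "x \<in> lcarrier g" for x
  proof -
    have "f x \<in> range ent" using f(1) that unfolding lie_hom_def lcarrier_gl_inf by blast
    thus ?thesis unfolding \<rho>_def by (auto simp: ent_inverse)
  qed
  have clo: "ladd g x y \<in> lcarrier g" "lsmult g c x \<in> lcarrier g" "lbr g x y \<in> lcarrier g"
    if "x \<in> lcarrier g" "y \<in> lcarrier g" for x y c
    using lie_algebraD[OF assms(1)] that by simp_all
  note gl = mlie_simps(3-5)[of UNIV, unfolded mlie_UNIV]
  interpret lie_rep g \<rho>
  proof
    show "lie_algebra g" by (rule assms(1))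
    show "inj_on \<rho> (lcarrier g)"
      using f(2) ent\<rho> by (auto simp: inj_on_def)
    fix x y c assume x: "x \<in> lcarrier g"
    have "ent (\<rho> (lsmult g c x)) = lsmult gl_inf c (f x)"
      using f(1) x ent\<rho>[OF clo(2)[OF x x]] unfolding lie_hom_def by simp
    thus "\<rho> (lsmult g c x) = c *\<^sub>m \<rho> x" unfolding ent\<rho>[OF x] gl ent_inject .
    assume y: "y \<in> lcarrier g"
    have "ent (\<rho> (ladd g x y)) = ladd gl_inf (f x) (f y)"
      using f(1) x y ent\<rho>[OF clo(1)[OF x y]] unfolding lie_hom_def by simp
    thus "\<rho> (ladd g x y) = \<rho> x + \<rho> y" unfolding ent\<rho>[OF x] ent\<rho>[OF y] gl ent_inject .
    have "ent (\<rho> (lbr g x y)) = lbr gl_inf (f x) (f y)"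
      using f(1) x y ent\<rho>[OF clo(3)[OF x y]] unfolding lie_hom_def by simp
    thus "\<rho> (lbr g x y) = lb (\<rho> x) (\<rho> y)" unfolding ent\<rho>[OF x] ent\<rho>[OF y] gl ent_inject .
  qed
  obtain U :: "nat \<Rightarrow> 'a set" where U: "\<And>n. subalgebra g (U n)" "\<And>n. reductive (lrestrict g (U n))"
    "\<And>n. U n \<subseteq> U (Suc n)" "(\<Union>n. U n) = C"
    using assms(4) unfolding union_of_reductive_def by blast
  interpret R: red_union "\<lambda>n. \<rho> ` U n"
    by unfold_locales (use reductive_rep[OF U(1,2)] U(3) in \<open>auto intro: image_mono\<close>)
  define L where "L = R.L"
  have L: "\<rho> ` C = L" unfolding L_def R.L_def U(4)[symmetric] by blast
  have \<rho>L: "\<rho> x \<in> L" if "x \<in> C" for x using that L by blast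
  define unrep where "unrep = inv_into C \<rho>"
  have unrep: "unrep a \<in> C" "\<rho> (unrep a) = a" if "a \<in> L" for a
    using that unfolding unrep_def L[symmetric] by (rule inv_into_into, rule f_inv_into_f)
  have unrep_\<rho>: "unrep (\<rho> x) = x" if "x \<in> C" for x unfolding unrep_def by (rule inv_into_f_f[OF inj that])
  obtain p where p: "flinear p" "\<And>z. z \<in> ctr L \<Longrightarrow> p z = z" "\<And>x. x \<in> comm L \<Longrightarrow> p x = 0" "\<And>x. p x \<in> ctr L"
    using R.centre_projection unfolding L_def by blast
  have pL: "p x \<in> L" for x using p(4)[of x] unfolding ctr_def by blast
  have unrep_ctr: "unrep a \<in> center g" if "a \<in> ctr L" for a
  proof -
    have "a \<in> \<rho> ` center g" using that unfolding centre_rep(2) L .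
    then obtain z where z: "z \<in> center g" "a = \<rho> z" by blast
    have "unrep a = z" unfolding z(2) by (rule unrep_\<rho>) (use z(1) centre_rep(1) in blast)
    thus ?thesis using z(1) by simp
  qed
  define \<S> where "\<S> = simples L"
  have "\<forall>S\<in>\<S>. has_model L S" unfolding \<S>_def L_def using R.model by blast
  then obtain T r where Tr: "\<And>S. S \<in> \<S> \<Longrightarrow> lie_sub (T S) \<and>
     (mlie (T S) = gl_inf \<or> mlie (T S) = so_inf \<or> mlie (T S) = sp_inf \<or> fin_dim (mlie (T S)) \<and> simple_lie (mlie (T S))) \<and>
     hom_on L (r S) \<and> r S ` L \<subseteq> T S \<and> r S ` S = comm (T S) \<and> (\<forall>x\<in>L. r S x = 0 \<longleftrightarrow> (\<forall>s\<in>S. lb x s = 0))"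
    unfolding has_model_def by metis
  define e where "e = to_nat_on \<S>"
  have e: "inj_on e \<S>" unfolding e_def \<S>_def L_def by (rule inj_on_to_nat_on[OF R.countable_simples])
  define I where "I = e ` \<S>"
  define Si where "Si = inv_into \<S> e"
  have Si: "Si i \<in> \<S>" "e (Si i) = i" if "i \<in> I" for i
    using that unfolding Si_def I_def by (rule inv_into_into, rule f_inv_into_f)
  have Si_e: "Si (e S) = S" if "S \<in> \<S>" for S unfolding Si_def by (rule inv_into_f_f[OF e that])
  \<comment> \<open>Outside \<open>I\<close> the summand is a dummy: \<open>gl_inf\<close> with the
    zero map, so that its component equals \<open>lzero\<close> as \<open>dsum\<close>
    requires.\<close>
  define TT where "TT i = (if i \<in> I then T (Si i) else UNIV)" for i
  define rr where "rr i = (if i \<in> I then r (Si i) else (\<lambda>x. 0))" for i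
  define G where "G i = mlie (TT i)" for i
  \<comment> \<open>The first component is the projection to the centre, carried back to
    \<open>g\<close>; it kills brackets, which is consistent because the centre is abelian.\<close>
  define \<phi> where "\<phi> x = (unrep (p (\<rho> x)), \<lambda>i. ent (rr i (\<rho> x)))" for x
  have rr_lin: "rr i (a + b) = rr i a + rr i b" "rr i (c *\<^sub>m a) = c *\<^sub>m rr i a" for i a b c
    unfolding rr_def using Tr Si(1) fmm.linear_add fmm.linear_scale unfolding hom_on_def by auto
  have rr_lb: "rr i (lb a b) = lb (rr i a) (rr i b)" if "a \<in> L" "b \<in> L" for i a b
    unfolding rr_def using Tr[OF Si(1)] that unfolding hom_on_def by (auto simp: lb_simps)
  have rr_T: "rr i a \<in> T (Si i)" if "i \<in> I" "a \<in> L" for i a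
    unfolding rr_def using Tr[OF Si(1)[OF that(1)]] that by auto
  have rr_0: "rr i a = 0 \<longleftrightarrow> (\<forall>s\<in>Si i. lb a s = 0)" if "i \<in> I" "a \<in> L" for i a
    unfolding rr_def using Tr[OF Si(1)[OF that(1)]] that by auto
  \<comment> \<open>Only the finitely many simple ideals on which \<open>a\<close> acts give nonzero
    components.\<close>
  have rr_fin: "finite {i. ent (rr i a) \<noteq> ent 0}" if a: "a \<in> L" for a
  proof (rule finite_subset)
    show "finite (e ` acted L a)" using R.finite_acted a unfolding L_def by blast
    show "{i. ent (rr i a) \<noteq> ent 0} \<subseteq> e ` acted L a"
    proof safe
      fix i assume i: "ent (rr i a) \<noteq> ent 0"
      have iI: "i \<in> I" using i unfolding rr_def by (auto split: if_splits)
      have "rr i a \<noteq> 0" using i by auto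
      hence "\<exists>s\<in>Si i. lb a s \<noteq> 0" using rr_0[OF iI a] by blast
      hence "Si i \<in> acted L a" unfolding acted_def using Si(1)[OF iI] unfolding \<S>_def by blast
      thus "i \<in> e ` acted L a" using Si(2)[OF iI] by force
    qed
  qed
  have rr_S: "rr i ` Si i = comm (TT i)" if "i \<in> I" for i
    unfolding rr_def TT_def using Tr[OF Si(1)[OF that]] that by simp
  have rr_comm: "rr i a \<in> comm (TT i)" if i: "i \<in> I" and a: "a \<in> comm L" for i a
  proof -
    have h: "hom_on L (rr i)" unfolding rr_def using Tr[OF Si(1)[OF i]] i by simp
    have "rr i a \<in> rr i ` comm L" using a by (rule imageI)
    also have "rr i ` comm L = comm (rr i ` L)" by (rule hom_on_comm[OF h order_refl])
    also have "\<dots> \<subseteq> comm (TT i)" by (rule comm_mono) (use rr_T i in \<open>auto simp: TT_def\<close>)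
    finally show ?thesis .
  qed
  have lz: "lzero (G i) = ent 0" for i unfolding G_def mlie_simps ..
  have models: "\<forall>i\<in>I. lie_algebra (G i) \<and>
        (lie_iso (G i) gl_inf \<or> lie_iso (G i) so_inf \<or> lie_iso (G i) sp_inf \<or> (fin_dim (G i) \<and> simple_lie (G i)))"
  proof
    fix i assume i: "i \<in> I"
    have Gi: "G i = mlie (T (Si i))" unfolding G_def TT_def using i by simp
    have "lie_algebra (G i)" unfolding Gi using Tr[OF Si(1)[OF i]] by (intro mlie_lie_algebra) blast
    moreover have "G i = gl_inf \<or> G i = so_inf \<or> G i = sp_inf \<or> fin_dim (G i) \<and> simple_lie (G i)"
      unfolding Gi using Tr[OF Si(1)[OF i]] by blast
    ultimately show "lie_algebra (G i) \<and>
        (lie_iso (G i) gl_inf \<or> lie_iso (G i) so_inf \<or> lie_iso (G i) sp_inf \<or> (fin_dim (G i) \<and> simple_lie (G i)))"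
      using lie_iso_refl by metis
  qed
  have hom: "lie_hom g (dsum (lrestrict g (center g)) I G) \<phi>"
    unfolding lie_hom_def
  proof (intro conjI ballI allI)
    fix x assume x: "x \<in> C"
    show "\<phi> x \<in> lcarrier (dsum (lrestrict g (center g)) I G)"
      unfolding \<phi>_def dsum_simps lrestrict_simps lz
      using unrep_ctr[OF p(4)] rr_T[OF _ \<rho>L[OF x]] rr_fin[OF \<rho>L[OF x]]
      by (auto simp: G_def mlie_simps TT_def) (simp add: rr_def)
    fix c
    have "unrep (p (\<rho> (lsmult g c x))) = lsmult g c (unrep (p (\<rho> x)))"
    proof (rule eqI)
      show "unrep (p (\<rho> (lsmult g c x))) \<in> C" "lsmult g c (unrep (p (\<rho> x))) \<in> C"
        using unrep(1)[OF pL] closed(3) by auto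
      show "\<rho> (unrep (p (\<rho> (lsmult g c x)))) = \<rho> (lsmult g c (unrep (p (\<rho> x))))"
        by (simp only: scale[OF unrep(1)[OF pL]] unrep(2)[OF pL]) (simp add: scale[OF x] fmm.linear_scale[OF p(1)])
    qed
    thus "\<phi> (lsmult g c x) = lsmult (dsum (lrestrict g (center g)) I G) c (\<phi> x)"
      unfolding \<phi>_def dsum_simps lrestrict_simps G_def mlie_simps by (simp add: scale[OF x] rr_lin)
    fix y assume y: "y \<in> C"
    have "unrep (p (\<rho> (ladd g x y))) = ladd g (unrep (p (\<rho> x))) (unrep (p (\<rho> y)))"
    proof (rule eqI)
      show "unrep (p (\<rho> (ladd g x y))) \<in> C" "ladd g (unrep (p (\<rho> x))) (unrep (p (\<rho> y))) \<in> C"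
        using unrep(1)[OF pL] closed(2) by auto
      show "\<rho> (unrep (p (\<rho> (ladd g x y)))) = \<rho> (ladd g (unrep (p (\<rho> x))) (unrep (p (\<rho> y))))"
        by (simp only: add[OF unrep(1)[OF pL] unrep(1)[OF pL]] unrep(2)[OF pL])
          (simp add: add[OF x y] fmm.linear_add[OF p(1)])
    qed
    thus "\<phi> (ladd g x y) = ladd (dsum (lrestrict g (center g)) I G) (\<phi> x) (\<phi> y)"
      unfolding \<phi>_def dsum_simps lrestrict_simps G_def mlie_simps by (simp add: add[OF x y] rr_lin)
    have "unrep (p (\<rho> (lbr g x y))) = lbr g (unrep (p (\<rho> x))) (unrep (p (\<rho> y)))"
    proof (rule eqI)
      show "unrep (p (\<rho> (lbr g x y))) \<in> C" "lbr g (unrep (p (\<rho> x))) (unrep (p (\<rho> y))) \<in> C"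
        using unrep(1)[OF pL] closed(4) by auto
      have "p (\<rho> (lbr g x y)) = 0" unfolding br[OF x y] by (intro p(3) comm_base \<rho>L x y)
      moreover have "lb (p (\<rho> x)) (p (\<rho> y)) = 0" using p(4)[of "\<rho> x"] pL unfolding ctr_def by blast
      ultimately show "\<rho> (unrep (p (\<rho> (lbr g x y)))) = \<rho> (lbr g (unrep (p (\<rho> x))) (unrep (p (\<rho> y))))"
        unfolding br[OF unrep(1)[OF pL] unrep(1)[OF pL]] unrep(2)[OF pL] by simp
    qed
    thus "\<phi> (lbr g x y) = lbr (dsum (lrestrict g (center g)) I G) (\<phi> x) (\<phi> y)"
      unfolding \<phi>_def dsum_simps lrestrict_simps G_def mlie_simps
      by (simp add: br[OF x y] rr_lb \<rho>L x y)
  qed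
  have ctrI: "a \<in> ctr L" if a: "a \<in> L" and z: "\<And>i. i \<in> I \<Longrightarrow> rr i a = 0" for a
  proof -
    have "lb a s = 0" if S: "S \<in> simples L" "s \<in> S" for S s
    proof -
      have "S \<in> \<S>" using S(1) unfolding \<S>_def .
      hence i: "e S \<in> I" "Si (e S) = S" unfolding I_def using Si_e by auto
      show ?thesis using rr_0[OF i(1) a] z[OF i(1)] i(2) S(2) by blast
    qed
    thus ?thesis using R.ctr_iff a unfolding L_def by blast
  qed
  have inj: "inj_on \<phi> C"
  proof (rule inj_onI)
    fix x y assume x: "x \<in> C" and y: "y \<in> C" and eq: "\<phi> x = \<phi> y"
    have "ent (rr i (\<rho> x)) = ent (rr i (\<rho> y))" for i using eq unfolding \<phi>_def by (auto dest: fun_cong)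
    hence rxy: "rr i (\<rho> x) = rr i (\<rho> y)" for i using ent_inject by blast
    have d: "\<rho> x - \<rho> y \<in> L" using fm.subspace_diff[OF R.L_sub] \<rho>L x y unfolding L_def by blast
    \<comment> \<open>The difference is killed by all components, hence central and fixed by
      \<open>p\<close>; but \<open>p\<close> also annihilates it.\<close>
    have "rr i (\<rho> x - \<rho> y) = 0" for i
      using rr_lin(1)[of i "\<rho> x - \<rho> y" "\<rho> y"] rxy[of i] by simp
    hence "p (\<rho> x - \<rho> y) = \<rho> x - \<rho> y" by (intro p(2) ctrI d) 
    moreover have "unrep (p (\<rho> x)) = unrep (p (\<rho> y))" using eq unfolding \<phi>_def by simp
    hence "p (\<rho> x) = p (\<rho> y)" using unrep(2)[OF pL] by metis
    hence "p (\<rho> x - \<rho> y) = 0" by (simp add: fmm.linear_diff[OF p(1)])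
    ultimately have "\<rho> x = \<rho> y" by simp
    thus "x = y" by (rule eqI[OF x y])
  qed
  have centre: "\<forall>z\<in>center g. \<phi> z = (z, \<lambda>i. lzero (G i))"
  proof
    fix z assume z: "z \<in> center g"
    have zC: "z \<in> C" using z centre_rep(1) by blast
    have zc: "\<rho> z \<in> ctr L" using imageI[OF z, of \<rho>] unfolding centre_rep(2) L .
    have "rr i (\<rho> z) = 0" for i
    proof (cases "i \<in> I")
      case True
      have "Si i \<subseteq> L" using R.simples_L Si(1)[OF True] unfolding \<S>_def L_def by blast
      thus ?thesis using rr_0[OF True \<rho>L[OF zC]] zc unfolding ctr_def by blast
    qed (simp add: rr_def)
    thus "\<phi> z = (z, \<lambda>i. lzero (G i))" unfolding \<phi>_def lz using p(2)[OF zc] unrep_\<rho>[OF zC] by simp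
  qed
  have image: "\<phi> ` derived g =
       lcarrier (dsum (lrestrict g {lzero g}) I (\<lambda>i. lrestrict (G i) (derived (G i))))"
    unfolding dsum_simps lrestrict_simps lz
  proof (intro equalityI subsetI)
    fix z assume "z \<in> \<phi> ` derived g"
    then obtain x where x: "x \<in> derived g" "z = \<phi> x" by blast
    have xC: "x \<in> C" using x(1) derived_rep(1) by blast
    have xc: "\<rho> x \<in> comm L" using imageI[OF x(1), of \<rho>] unfolding derived_rep(2) L .
    have "unrep (p (\<rho> x)) = lzero g"
      using p(3)[OF xc] unrep_\<rho>[OF closed(1)] zero by simp
    moreover have "ent (rr i (\<rho> x)) \<in> derived (G i)" if "i \<in> I" for i
      unfolding G_def derived_mlie using rr_comm[OF that xc] by (rule imageI)
    moreover have "ent (rr i (\<rho> x)) = ent 0" if "i \<notin> I" for i using that unfolding rr_def by simp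
    ultimately show "z \<in> {(z, f). z \<in> {lzero g} \<and> (\<forall>i\<in>I. f i \<in> derived (G i)) \<and>
        (\<forall>i. i \<notin> I \<longrightarrow> f i = ent 0) \<and> finite {i. f i \<noteq> ent 0}}"
      unfolding x(2) \<phi>_def using rr_fin[OF \<rho>L[OF xC]] by simp
  next
    fix z assume "z \<in> {(z, f). z \<in> {lzero g} \<and> (\<forall>i\<in>I. f i \<in> derived (G i)) \<and>
        (\<forall>i. i \<notin> I \<longrightarrow> f i = ent 0) \<and> finite {i. f i \<noteq> ent 0}}"
    then obtain h where h: "z = (lzero g, h)" "\<And>i. i \<in> I \<Longrightarrow> h i \<in> derived (G i)"
      "\<And>i. i \<notin> I \<Longrightarrow> h i = ent 0" "finite {i. h i \<noteq> ent 0}" by blast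
    have "\<forall>i\<in>I. \<exists>s. s \<in> Si i \<and> h i = ent (rr i s)"
    proof
      fix i assume i: "i \<in> I"
      have "h i \<in> ent ` rr i ` Si i" using h(2)[OF i] unfolding G_def derived_mlie rr_S[OF i] .
      thus "\<exists>s. s \<in> Si i \<and> h i = ent (rr i s)" by blast
    qed
    then obtain s where s: "\<And>i. i \<in> I \<Longrightarrow> s i \<in> Si i" "\<And>i. i \<in> I \<Longrightarrow> h i = ent (rr i (s i))" by metis
    define J where "J = {i. h i \<noteq> ent 0}"
    have J: "finite J" "J \<subseteq> I" unfolding J_def using h(3,4) by auto
    \<comment> \<open>Representatives in the simple ideals are summed over the finite support; the
      components do not interfere because distinct simple ideals commute.\<close>
    define y where "y = sum s J"
    have sc: "s i \<in> comm L" if "i \<in> I" for i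
      using s(1)[OF that] R.simples_comm Si(1)[OF that] unfolding \<S>_def L_def by blast
    have yc: "y \<in> comm L" unfolding y_def comm_def
      by (intro fm.span_sum) (use sc J(2) in \<open>auto simp: comm_def\<close>)
    hence "y \<in> \<rho> ` derived g" unfolding derived_rep(2) L .
    then obtain x where x: "x \<in> derived g" "\<rho> x = y" by blast
    have ry: "ent (rr i y) = h i" for i
    proof (cases "i \<in> I")
      case True
      have z: "rr i (s j) = 0" if j: "j \<in> J" "j \<noteq> i" for j
      proof -
        have jI: "j \<in> I" using j(1) J(2) by blast
        have "Si j \<noteq> Si i" using Si(2)[OF True] Si(2)[OF jI] j(2) by metis
        hence "lb (s j) t = 0" if "t \<in> Si i" for t
          using simples_commute[of "Si j" L "Si i"] Si(1)[OF True] Si(1)[OF jI] s(1)[OF jI] that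
          unfolding \<S>_def by blast
        moreover have "s j \<in> L" using sc[OF jI] comm_sub[OF R.L_lie] unfolding L_def by blast
        ultimately show ?thesis using rr_0[OF True] by blast
      qed
      have r0: "rr i 0 = 0" using rr_lin(2)[of i 0 0] by simp
      have "rr i y = (\<Sum>j\<in>J. rr i (s j))"
        unfolding y_def using J(1) by (induction J rule: finite_induct) (simp_all add: r0 rr_lin)
      also have "\<dots> = (\<Sum>j\<in>J. if j = i then rr i (s i) else 0)" by (rule sum.cong) (use z in auto)
      also have "\<dots> = (if i \<in> J then rr i (s i) else 0)" using J(1) by simp
      finally show ?thesis using s(2)[OF True] unfolding J_def by auto
    next
      case False
      thus ?thesis using h(3) unfolding rr_def by simp
    qed
    have "\<phi> x = z"
      unfolding \<phi>_def h(1) x(2) using p(3)[OF yc] unrep_\<rho>[OF closed(1)] zero ry by simp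
    thus "z \<in> \<phi> ` derived g" using x(1) by blast
  qed
  show ?thesis using models hom inj centre image by blast
qed

end
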